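(* Suppose $\Gamma$ is a union of closed edges of elements of $\mathcal{T}_H$, $\Gamma=\bigcup\mathcal{E}_H^\Gamma$, and let $\mathcal{I}_H$ be the interpolation operator defined by $$\mathcal{I}_H v = \sum_{N \in \mathcal{N}^{\Gamma}} \frac{1}{\operatorname{card}(\mathcal{T}^{\Gamma}(N))} \sum_{T \in \mathcal{T}^{\Gamma}(N)} \left(\int_{\Gamma_T} \psi_{N,\Gamma_T}v \right) \lambda_N + \sum_{N \in \mathcal{N}^{\Omega}} \frac{1}{\operatorname{card}(\mathcal{T}(N))} \sum_{T \in \mathcal{T}(N)} \left(\int_{T} \psi_{N,T}v \right) \lambda_N$$ with $$\mathcal{T}^{\Gamma}(N) = \{T \in \mathcal{T}(N) : N \in E \text{ and } E \subset T \text{ for some } E \in \mathcal{E}^{\Gamma}_H \}.$$ Then there is a constant $C$ independent of $H$ such that for all $v\in V$ and all $T\in\mathcal{T}_H$, $$\| v-\mathcal{I}_H v \|_{T} + \| v-\mathcal{I}_H v \|_{\Gamma_T} \leq C H \bigl(\| \nabla v \|_{U(T)}+\| \nabla_{\boldsymbol\tau} v \|_{U_{\Gamma}(T)}\bigr)$$ and $$\| \nabla \mathcal{I}_H v \|_{T} + \| \nabla_{\boldsymbol\tau} \mathcal{I}_H v \|_{\Gamma_T} \leq C\bigl(\| \nabla v \|_{U(T)}+\| \nabla_{\boldsymbol\tau} v \|_{U_{\Gamma}(T)}\bigr).$$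
   Context: $\Omega\subset\mathbb{R}^2$ is a polygonal domain. $\mathcal{T}_H$ is a quasi-uniform conforming triangulation of $\Omega$ into closed shape-regular triangles with mesh size parameter $H$, and $\gamma$ is a constant (independent of $H$) with $\max_{T\in\mathcal{T}_H}H/d_T\le\gamma$ and $\max_{T,T'\in\mathcal{T}_H}d_{T'}/d_T\le\gamma$, where $d_T$ is the diameter of the inscribed circle of $T$. $\Gamma$ is the interface, and $\mathcal{E}_H^\Gamma$ is the set of all closed element edges comprising $\Gamma$. $\nabla_{\boldsymbol\tau}$ is the tangential gradient along $\Gamma$. $\|\cdot\|_\omega$ is the $L^2(\omega)$ norm; on subsets of $\Gamma$ it is taken with respect to arc length. $V=H^1_0(\Omega)\cap H^1(\Gamma)$ is the space of functions in $H^1_0(\Omega)$ whose trace on $\Gamma$ is in $H^1(\Gamma)$ (i.e. in $H^1$ of each edge of $\Gamma$ and continuous on $\Gamma$). $V_H$ is the space of continuous piecewise linear functions on $\mathcal{T}_H$ vanishing on $\partial\Omega$. For $T\in\mathcal{T}_H$: $\Gamma_T=\Gamma\cap T$, $U(T)=\bigcup\{T'\in\mathcal{T}_H:T'\cap T\ne\emptyset\}$, $U_\Gamma(T)=U(T)\cap\Gamma$. Nodes are the vertices of $\mathcal{T}_H$; fixed nodes are those on $\partial\Omega$ and free nodes the others. $\mathcal{N}$ is the set of free nodes, and $\lambda_N$ is the continuous piecewise linear nodal basis function of node $N$ ($\lambda_N(N')=\delta_{NN'}$). $\mathcal{T}(N)=\{T\in\mathcal{T}_H:N\in T\}$. Given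 the sets $\mathcal{T}^\Gamma(N)\subset\mathcal{T}(N)$, put $\mathcal{N}^\Gamma=\{N\in\mathcal{N}:\mathcal{T}^\Gamma(N)\neq\emptyset\}$ and $\mathcal{N}^\Omega=\{N\in\mathcal{N}:\mathcal{T}^\Gamma(N)=\emptyset\}$. For a free node $N$ and an integration domain $\sigma\subset T$, $T\in\mathcal{T}_H$ (here $\sigma=T$, or $\sigma=\Gamma_T$, in which case it is a union of edges of $T$ up to a null set), the $L^2(\sigma)$-dual basis function $\psi_{N,\sigma}$ is the function in the span of the restrictions $\lambda_{N'}|_\sigma$ ($N'$ ranging over all fixed and free nodes) satisfying $\int_\sigma\psi_{N,\sigma}\lambda_{N'}=\delta_{NN'}$ for all fixed and free nodes $N'$; integrals over subsets of $\Gamma$ are with respect to arc length. *)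

theory Defs
  imports "HOL-Analysis.Analysis"
begin

type_synonym pt = "real ^ 2"

subsection \<open>Sobolev spaces\<close>

definition L2 :: "'a measure \<Rightarrow> 'a set \<Rightarrow> ('a \<Rightarrow> 'b::euclidean_space) set" where
  "L2 M \<omega> = {f. set_borel_measurable M \<omega> f \<and> set_integrable M \<omega> (\<lambda>x. (norm (f x))\<^sup>2)}"

definition L2_norm :: "'a measure \<Rightarrow> 'a set \<Rightarrow> ('a \<Rightarrow> 'b::euclidean_space) \<Rightarrow> real" where
  "L2_norm M \<omega> f = sqrt (LINT x:\<omega>|M. (norm (f x))\<^sup>2)"

primrec k_times_cont_diff :: "nat \<Rightarrow> ('a::euclidean_space \<Rightarrow> real) \<Rightarrow> bool" where
  "k_times_cont_diff 0 f \<longleftrightarrow> continuous_on UNIV f"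
| "k_times_cont_diff (Suc k) f \<longleftrightarrow>
     (\<exists>f'. (\<forall>x. GDERIV f x :> f' x) \<and> (\<forall>b\<in>Basis. k_times_cont_diff k (\<lambda>x. f' x \<bullet> b)))"

definition test_functions :: "'a::euclidean_space set \<Rightarrow> ('a \<Rightarrow> real) set" where
  "test_functions S = {\<phi>. (\<forall>k. k_times_cont_diff k \<phi>) \<and>
     compact (closure {x. \<phi> x \<noteq> 0}) \<and> closure {x. \<phi> x \<noteq> 0} \<subseteq> S}"

definition weak_gradient ::
    "'a::euclidean_space set \<Rightarrow> ('a \<Rightarrow> real) \<Rightarrow> ('a \<Rightarrow> 'a) \<Rightarrow> bool" where
  "weak_gradient S u g \<longleftrightarrow> (\<forall>\<phi>\<in>test_functions S. \<forall>\<phi>'. (\<forall>x. GDERIV \<phi> x :> \<phi>' x) \<longrightarrow>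
     (LINT x:S|lebesgue. u x *\<^sub>R \<phi>' x) = - (LINT x:S|lebesgue. \<phi> x *\<^sub>R g x))"

definition H1 :: "'a::euclidean_space set \<Rightarrow> ('a \<Rightarrow> real) set" where
  "H1 S = {u \<in> L2 lebesgue S. \<exists>g\<in>L2 lebesgue S. weak_gradient S u g}"

text \<open>Elements of \<open>L2\<close> are functions, not classes, so the weak gradient, and likewise the trace,
  the tangential gradient and the dual basis function below, are determined only up to null sets.
  All of them enter only through integrals.\<close>

definition grad :: "'a::euclidean_space set \<Rightarrow> ('a \<Rightarrow> real) \<Rightarrow> 'a \<Rightarrow> 'a" where
  "grad S u = (SOME g. g \<in> L2 lebesgue S \<and> weak_gradient S u g)"

definition H1_norm :: "'a::euclidean_space set \<Rightarrow> ('a \<Rightarrow> real) \<Rightarrow> real" where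
  "H1_norm S u = sqrt ((L2_norm lebesgue S u)\<^sup>2 + (L2_norm lebesgue S (grad S u))\<^sup>2)"

definition H1_0 :: "'a::euclidean_space set \<Rightarrow> ('a \<Rightarrow> real) set" where
  "H1_0 S = {u \<in> H1 S. \<exists>\<phi>. (\<forall>n::nat. \<phi> n \<in> test_functions S) \<and>
     (\<lambda>n. H1_norm S (\<lambda>x. \<phi> n x - u x)) \<longlonglongrightarrow> 0}"

subsection \<open>Triangulations\<close>

text \<open>Slit domains are admitted; isolated boundary points are not.\<close>

definition polygonal_domain :: "pt set \<Rightarrow> bool" where
  "polygonal_domain \<Omega> \<longleftrightarrow> open \<Omega> \<and> connected \<Omega> \<and> bounded \<Omega> \<and> \<Omega> \<noteq> {} \<and>
     (\<exists>S. finite S \<and> (\<forall>(a, b)\<in>S. a \<noteq> b) \<and> frontier \<Omega> = (\<Union>(a, b)\<in>S. closed_segment a b))"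

definition nodes :: "pt set set \<Rightarrow> pt set" where
  "nodes \<T> = {N. \<exists>T\<in>\<T>. N extreme_point_of T}"

definition free_nodes :: "pt set \<Rightarrow> pt set set \<Rightarrow> pt set" where
  "free_nodes \<Omega> \<T> = nodes \<T> - frontier \<Omega>"

definition edges :: "pt set set \<Rightarrow> pt set set" where
  "edges \<T> = {E. \<exists>T\<in>\<T>. E edge_of T}"

text \<open>The circle about \<open>c\<close> of radius \<open>r\<close> lies in \<open>T\<close> and touches all sides of \<open>T\<close>.\<close>

definition inscribed_circle :: "pt set \<Rightarrow> pt \<Rightarrow> real \<Rightarrow> bool" where
  "inscribed_circle T c r \<longleftrightarrow> 0 < r \<and> cball c r \<subseteq> T \<and> (\<forall>E. E edge_of T \<longrightarrow> sphere c r \<inter> E \<noteq> {})"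

definition incircle_diameter :: "pt set \<Rightarrow> real" where
  "incircle_diameter T = (THE d. \<exists>c. inscribed_circle T c (d / 2))"

text \<open>The library's \<^const>\<open>triangulation\<close> is the conformity condition.
  That the frontier consists of edges matters only if \<open>\<Omega>\<close> has slits.\<close>

definition conforming_triangulation :: "pt set \<Rightarrow> pt set set \<Rightarrow> bool" where
  "conforming_triangulation \<Omega> \<T> \<longleftrightarrow> triangulation \<T> \<and> (\<forall>T\<in>\<T>. 2 simplex T) \<and>
     \<Union>\<T> = closure \<Omega> \<and> (\<exists>B\<subseteq>edges \<T>. frontier \<Omega> = \<Union>B)"

definition quasi_uniform :: "real \<Rightarrow> real \<Rightarrow> pt set set \<Rightarrow> bool" where
  "quasi_uniform \<gamma> H \<T> \<longleftrightarrow> (\<forall>T\<in>\<T>. diameter T \<le> H) \<and>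
     (\<forall>T\<in>\<T>. H / incircle_diameter T \<le> \<gamma>) \<and>
     (\<forall>T\<in>\<T>. \<forall>T'\<in>\<T>. incircle_diameter T' / incircle_diameter T \<le> \<gamma>)"

definition nodal_basis :: "pt set set \<Rightarrow> pt \<Rightarrow> pt \<Rightarrow> real" where
  "nodal_basis \<T> N = (THE f. continuous_on (\<Union>\<T>) f \<and>
     (\<forall>T\<in>\<T>. \<exists>a b. \<forall>x\<in>T. f x = a \<bullet> x + b) \<and>
     (\<forall>N'\<in>nodes \<T>. f N' = (if N' = N then 1 else 0)) \<and> (\<forall>x. x \<notin> \<Union>\<T> \<longrightarrow> f x = 0))"

definition patch :: "pt set set \<Rightarrow> pt set \<Rightarrow> pt set" where
  "patch \<T> T = \<Union>{T'\<in>\<T>. T' \<inter> T \<noteq> {}}"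

subsection \<open>The interface\<close>

definition interface_edges :: "pt set set \<Rightarrow> pt set \<Rightarrow> pt set set" where
  "interface_edges \<T> \<Gamma> = {E \<in> edges \<T>. E \<subseteq> \<Gamma>}"

definition endpoints :: "pt set \<Rightarrow> pt \<times> pt" where
  "endpoints E = (SOME (a, b). E = closed_segment a b)"

definition tangent :: "pt set \<Rightarrow> pt" where
  "tangent E = sgn (snd (endpoints E) - fst (endpoints E))"

text \<open>Arc length parametrization on \<open>{0..diameter E}\<close>; the diameter of a segment is its length.\<close>

definition arc_param :: "pt set \<Rightarrow> real \<Rightarrow> pt" where
  "arc_param E t = fst (endpoints E) + t *\<^sub>R tangent E"

text \<open>Arc length on \<open>\<Union>\<E>\<close>: the sum over \<open>E \<in> \<E>\<close> of the images of Lebesgue measure under the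
  parametrizations. Distinct edges of a conforming triangulation share at most an endpoint, so no
  set of positive length is counted twice.\<close>

definition arc_length :: "pt set set \<Rightarrow> pt measure" where
  "arc_length \<E> =
     distr (restrict_space (count_space \<E> \<Otimes>\<^sub>M lborel) (SIGMA E:\<E>. {0..diameter E})) borel
       (\<lambda>(E, t). arc_param E t)"

definition H1_interface :: "pt set set \<Rightarrow> (pt \<Rightarrow> real) set" where
  "H1_interface \<E> = {g. continuous_on (\<Union>\<E>) g \<and>
     (\<forall>E\<in>\<E>. (\<lambda>t. g (arc_param E t)) \<in> H1 {0<..<diameter E})}"

text \<open>The derivative with respect to arc length times the unit tangent; this does not depend on
  the orientation of the edges.\<close>

definition tangential_grad :: "pt set set \<Rightarrow> (pt \<Rightarrow> real) \<Rightarrow> pt \<Rightarrow> pt" where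
  "tangential_grad \<E> g = (SOME G. G \<in> L2 (arc_length \<E>) (\<Union>\<E>) \<and>
     (\<forall>E\<in>\<E>. weak_gradient {0<..<diameter E} (\<lambda>t. g (arc_param E t))
                (\<lambda>t. G (arc_param E t) \<bullet> tangent E) \<and>
             (\<forall>t\<in>{0<..<diameter E}.
                G (arc_param E t) = (G (arc_param E t) \<bullet> tangent E) *\<^sub>R tangent E)))"

text \<open>The trace on \<open>\<Union>\<E>\<close> of functions in \<^term>\<open>H1_0 \<Omega>\<close> is the continuous extension, as a map
  into \<open>L2\<close>, of the restriction of test functions.\<close>

definition is_trace :: "pt set \<Rightarrow> pt set set \<Rightarrow> (pt \<Rightarrow> real) \<Rightarrow> (pt \<Rightarrow> real) \<Rightarrow> bool" where
  "is_trace \<Omega> \<E> u g \<longleftrightarrow> g \<in> L2 (arc_length \<E>) (\<Union>\<E>) \<and>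
     (\<exists>\<phi>. (\<forall>n::nat. \<phi> n \<in> test_functions \<Omega>) \<and>
        (\<lambda>n. H1_norm \<Omega> (\<lambda>x. \<phi> n x - u x)) \<longlonglongrightarrow> 0 \<and>
        (\<lambda>n. L2_norm (arc_length \<E>) (\<Union>\<E>) (\<lambda>x. \<phi> n x - g x)) \<longlonglongrightarrow> 0)"

definition trace_on :: "pt set \<Rightarrow> pt set set \<Rightarrow> (pt \<Rightarrow> real) \<Rightarrow> pt \<Rightarrow> real" where
  "trace_on \<Omega> \<E> u = (SOME g. is_trace \<Omega> \<E> u g)"

definition V_space :: "pt set \<Rightarrow> pt set set \<Rightarrow> (pt \<Rightarrow> real) set" where
  "V_space \<Omega> \<E> = {v \<in> H1_0 \<Omega>. \<exists>g\<in>H1_interface \<E>. is_trace \<Omega> \<E> v g}"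

subsection \<open>The interpolation operator\<close>

definition dual_basis :: "pt measure \<Rightarrow> pt set set \<Rightarrow> pt \<Rightarrow> pt set \<Rightarrow> pt \<Rightarrow> real" where
  "dual_basis M \<T> N \<sigma> = (SOME \<psi>.
     (\<exists>c. \<forall>x\<in>\<sigma>. \<psi> x = (\<Sum>N'\<in>nodes \<T>. c N' * nodal_basis \<T> N' x)) \<and>
     (\<forall>N'\<in>nodes \<T>. (LINT x:\<sigma>|M. \<psi> x * nodal_basis \<T> N' x) = (if N' = N then 1 else 0)))"

definition elements_at :: "pt set set \<Rightarrow> pt \<Rightarrow> pt set set" where
  "elements_at \<T> N = {T\<in>\<T>. N \<in> T}"

definition interface_elements_at :: "pt set set \<Rightarrow> pt set \<Rightarrow> pt \<Rightarrow> pt set set" where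
  "interface_elements_at \<T> \<Gamma> N =
     {T \<in> elements_at \<T> N. \<exists>E\<in>interface_edges \<T> \<Gamma>. N \<in> E \<and> E \<subseteq> T}"

definition interpolation ::
    "pt set \<Rightarrow> pt set set \<Rightarrow> pt set \<Rightarrow> (pt \<Rightarrow> real) \<Rightarrow> pt \<Rightarrow> real" where
  "interpolation \<Omega> \<T> \<Gamma> v x =
     (\<Sum>N\<in>{N \<in> free_nodes \<Omega> \<T>. interface_elements_at \<T> \<Gamma> N \<noteq> {}}.
        1 / real (card (interface_elements_at \<T> \<Gamma> N)) *
        (\<Sum>T\<in>interface_elements_at \<T> \<Gamma> N.
           LINT y:\<Gamma> \<inter> T|arc_length (interface_edges \<T> \<Gamma>).
             dual_basis (arc_length (interface_edges \<T> \<Gamma>)) \<T> N (\<Gamma> \<inter> T) y *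
             trace_on \<Omega> (interface_edges \<T> \<Gamma>) v y) * nodal_basis \<T> N x) +
     (\<Sum>N\<in>{N \<in> free_nodes \<Omega> \<T>. interface_elements_at \<T> \<Gamma> N = {}}.
        1 / real (card (elements_at \<T> N)) *
        (\<Sum>T\<in>elements_at \<T> N. LINT y:T|lebesgue. dual_basis lebesgue \<T> N T y * v y) *
        nodal_basis \<T> N x)"

end

theory Submission
  imports Defs "HOL-Analysis.Radon_Nikodym"
begin

text \<open>Let \<open>\<phi>\<close> be a test function and \<open>N\<close> a node. Cut off to the star of \<open>N\<close>, \<open>\<phi>\<close> is continuously differentiable
  in a ball \<open>B\<close> about \<open>N\<close> whose radius is comparable to \<open>H\<close>. Passing from \<open>T'\<close> to \<open>T' \<inter> B\<close>, to \<open>T \<inter> B\<close>, and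
  to \<open>T\<close>, and using the Poincare inequality on these convex sets, one bounds the integral of
  \<open>(\<phi> x - \<phi> y)\<^sup>2\<close> over \<open>T' \<times> T\<close> by \<open>H ^ 4\<close> times the Dirichlet integral of \<open>\<phi>\<close> on the star, for any two
  elements \<open>T\<close>, \<open>T'\<close> at \<open>N\<close>; with a trace inequality the same works for an interface edge at \<open>N\<close> in place of
  \<open>T'\<close>. At a fixed node \<open>\<phi>\<close> vanishes on a boundary edge, so that \<open>\<phi>\<close> itself is controlled. All of this passes
  to the limit \<open>v\<close>; applied at small scales about a fixed node on the interface it shows that
  the continuous trace vanishes there.

  The dual functions have integral 1 and \<open>L\<^sup>2\<close> norm at most a multiple of the inverse square root of
  the measure of their domain. Hence every coefficient of the interpolant at a node of \<open>T\<close> differs from the mean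
  of \<open>v\<close> over \<open>T\<close>, and at interface nodes from the value of the continuous trace, by the gradients on the patch;
  along the interface, traces are compared by the fundamental theorem of calculus, and \<open>H\<close> is bounded
  in terms of the diameter of \<open>\<Omega>\<close>. On each element and edge the interpolant is a convex combination of
  coefficients, which gives the first estimate; its gradients are differences of coefficients
  divided by lengths comparable to \<open>H\<close>, which gives the second.\<close>

text \<open>The comparison goes through a ball rather than from neighbour to neighbour because
  elements at a node need not be linked by common edges: at a pinched boundary node they fall into
  groups that share only the node. Test functions extend by zero across the gaps, so the ball joins
  all elements at once, with constants that depend neither on their number nor on the shape of the
  domain. Oscillations are kept as double integrals without mean values, since these can be handed
  from one set to the next, and as \<open>ennreal\<close> integrals, so that integrability need not
  be carried along before the limit. A fixed node on the interface demands more than an estimate: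
  its coefficient is zero by definition, and an inequality at scale H would leave a bulk term of the
  wrong order in H along the interface; hence the trace has to vanish there exactly. The diameter of
  \<Omega> enters for a reason of scaling: the squared increment of the trace along an edge carries
  a factor H that the target does not have.\<close>

abbreviation (input) sq_int :: "'a measure \<Rightarrow> 'a set \<Rightarrow> ('a \<Rightarrow> real) \<Rightarrow> ennreal" where
  "sq_int M A f \<equiv> \<integral>\<^sup>+x\<in>A. ennreal ((f x)\<^sup>2) \<partial>M"

subsection \<open>Smooth bump functions and uniqueness of weak gradients\<close>

lemma GDERIV_isCont: "GDERIV f x :> D \<Longrightarrow> isCont f x"
  by (auto simp: gderiv_def intro: has_derivative_continuous)

lemma GDERIV_unique:
  assumes "GDERIV f x :> D" "GDERIV f x :> D'"
  shows "D = D'"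
proof -
  have "(\<lambda>h. inner h D) = (\<lambda>h. inner h D')"
    using assms unfolding gderiv_def by (rule has_derivative_unique)
  then have "inner (D - D') D = inner (D - D') D'"
    by (rule fun_cong)
  then have "inner (D - D') (D - D') = 0"
    by (simp only: inner_diff_right)
  then show ?thesis by simp
qed

lemma k_times_cont_diff_Suc_imp: "k_times_cont_diff (Suc k) f \<Longrightarrow> k_times_cont_diff k f"
proof (induction k arbitrary: f)
  case 0
  then obtain f' where "\<forall>x. GDERIV f x :> f' x" by auto
  then show ?case
    by (auto intro!: continuous_at_imp_continuous_on dest: spec GDERIV_isCont)
next
  case (Suc k)
  then obtain f' where "\<forall>x. GDERIV f x :> f' x" "\<forall>b\<in>Basis. k_times_cont_diff (Suc k) (\<lambda>x. f' x \<bullet> b)"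
    by (subst (asm) k_times_cont_diff.simps(2)) blast
  then show ?case
    unfolding k_times_cont_diff.simps(2)[of k f] using Suc.IH by blast
qed

lemma k_times_cont_diff_const: "k_times_cont_diff k (\<lambda>x. c)"
proof (induction k arbitrary: c)
  case (Suc k)
  show ?case
    by (auto intro!: exI[of _ "\<lambda>x. 0"] GDERIV_const Suc)
qed auto

lemma k_times_cont_diff_inner: "k_times_cont_diff k (\<lambda>x. x \<bullet> a)"
proof (cases k)
  case (Suc k)
  have "GDERIV (\<lambda>x. x \<bullet> a) x :> a" for x
    unfolding gderiv_def by (auto intro!: derivative_eq_intros)
  then show ?thesis
    unfolding Suc by (auto intro!: exI[of _ "\<lambda>x. a"] k_times_cont_diff_const)
qed (auto intro!: continuous_intros)

lemma k_times_cont_diff_add: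
  "k_times_cont_diff k f \<Longrightarrow> k_times_cont_diff k g \<Longrightarrow> k_times_cont_diff k (\<lambda>x. f x + g x)"
proof (induction k arbitrary: f g)
  case (Suc k)
  then obtain f' g' where f': "\<forall>x. GDERIV f x :> f' x" "\<forall>b\<in>Basis. k_times_cont_diff k (\<lambda>x. f' x \<bullet> b)"
    and g': "\<forall>x. GDERIV g x :> g' x" "\<forall>b\<in>Basis. k_times_cont_diff k (\<lambda>x. g' x \<bullet> b)" by auto
  show ?case
    unfolding k_times_cont_diff.simps(2)
    by (rule exI[of _ "\<lambda>x. f' x + g' x"]) (use f' g' Suc.IH in \<open>auto simp: inner_add_left intro!: GDERIV_add\<close>)
qed (auto intro!: continuous_intros)

lemma k_times_cont_diff_mult:
  "k_times_cont_diff k f \<Longrightarrow> k_times_cont_diff k g \<Longrightarrow> k_times_cont_diff k (\<lambda>x. f x * g x)"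
proof (induction k arbitrary: f g)
  case (Suc k)
  then obtain f' g' where f': "\<forall>x. GDERIV f x :> f' x" "\<forall>b\<in>Basis. k_times_cont_diff k (\<lambda>x. f' x \<bullet> b)"
    and g': "\<forall>x. GDERIV g x :> g' x" "\<forall>b\<in>Basis. k_times_cont_diff k (\<lambda>x. g' x \<bullet> b)" by auto
  have "k_times_cont_diff k f" "k_times_cont_diff k g"
    using Suc.prems k_times_cont_diff_Suc_imp by blast+
  then show ?case
    unfolding k_times_cont_diff.simps(2)
    by (intro exI[of _ "\<lambda>x. f x *\<^sub>R g' x + g x *\<^sub>R f' x"])
       (use f' g' Suc.IH in \<open>auto simp: inner_add_left intro!: GDERIV_mult k_times_cont_diff_add\<close>)
qed (auto intro!: continuous_intros)

lemma k_times_cont_diff_prod: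
  assumes "finite I" "\<And>i. i \<in> I \<Longrightarrow> k_times_cont_diff k (f i)"
  shows "k_times_cont_diff k (\<lambda>x. \<Prod>i\<in>I. f i x)"
  using assms by (induction I) (auto intro: k_times_cont_diff_const k_times_cont_diff_mult)

text \<open>The outer function is given as the sequence of its successive derivatives, and
  \<open>j\<close> stays arbitrary in the induction on \<open>k\<close>: the chain rule replaces
  \<open>h j\<close> by \<open>h (Suc j)\<close>, to which the induction hypothesis applies.\<close>

lemma k_times_cont_diff_compose:
  fixes h :: "nat \<Rightarrow> real \<Rightarrow> real"
  assumes h: "\<And>j x. (h j has_real_derivative h (Suc j) x) (at x)"
    and f: "\<And>k. k_times_cont_diff k f"
  shows "k_times_cont_diff k (\<lambda>x. h j (f x))"
proof (induction k arbitrary: j)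
  case 0
  have "continuous_on UNIV (h j)"
    by (meson DERIV_isCont continuous_at_imp_continuous_on h)
  then show ?case
    using f[of 0] continuous_on_compose2 by fastforce
next
  case (Suc k)
  obtain f' where f': "\<forall>x. GDERIV f x :> f' x" "\<forall>b\<in>Basis. k_times_cont_diff k (\<lambda>x. f' x \<bullet> b)"
    using f[of "Suc k"] by auto
  show ?case
    unfolding k_times_cont_diff.simps(2)
  proof (intro exI[of _ "\<lambda>x. h (Suc j) (f x) *\<^sub>R f' x"] conjI allI ballI)
    show "GDERIV (\<lambda>x. h j (f x)) x :> h (Suc j) (f x) *\<^sub>R f' x" for x
      using f' h by (intro GDERIV_DERIV_compose) auto
    show "k_times_cont_diff k (\<lambda>x. (h (Suc j) (f x) *\<^sub>R f' x) \<bullet> b)" if "b \<in> Basis" for b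
      using f' Suc that by (auto intro!: k_times_cont_diff_mult)
  qed
qed

section \<open>The flat function exp(-1/x) and smooth bumps on boxes\<close>

definition flat_fun :: "real poly \<Rightarrow> real \<Rightarrow> real" where
  "flat_fun p x = (if x > 0 then poly p (1 / x) * exp (- 1 / x) else 0)"

text \<open>The factor \<open>y ^ k\<close> serves twice: it carries the induction over the
  coefficients of \<open>p\<close>, and for \<open>k = 1\<close> and y = 1/h it is the denominator
  of the difference quotient of \<open>flat_fun\<close> at 0.\<close>

lemma poly_times_exp_tendsto_0: "((\<lambda>y::real. y ^ k * poly p y * exp (- y)) \<longlongrightarrow> 0) at_top"
proof (induction p arbitrary: k)
  case (pCons a p)
  have 1: "((\<lambda>y::real. a * (y ^ k / exp y)) \<longlongrightarrow> a * 0) at_top"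
    by (intro tendsto_mult tendsto_const tendsto_power_div_exp_0)
  have 2: "((\<lambda>y::real. y ^ Suc k * poly p y * exp (- y)) \<longlongrightarrow> 0) at_top"
    by (rule pCons.IH)
  have "(\<lambda>y. y ^ k * poly (pCons a p) y * exp (- y)) =
      (\<lambda>y::real. a * (y ^ k / exp y) + y ^ Suc k * poly p y * exp (- y))"
    by (auto simp: fun_eq_iff exp_minus field_simps)
  then show ?case
    using tendsto_add[OF 1 2] by simp
qed simp

text \<open>Polynomials in 1/x are carried along so that the family is closed under differentiation:
  p(1/x) exp(-1/x) has the derivative x^(-2) (p(1/x) - p'(1/x)) exp(-1/x), and the polynomial
  \<open>[:0, 0, 1:]\<close> stands for x^(-2). For \<open>p = 1\<close> the function is the usual
  exp(-1/x), extended by zero.\<close>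

lemma flat_fun_has_derivative:
  "(flat_fun p has_real_derivative flat_fun ([:0, 0, 1:] * (p - pderiv p)) x) (at x)"
proof -
  consider "x > 0" | "x < 0" | "x = 0" by linarith
  then show ?thesis
  proof cases
    case 1
    have "((\<lambda>x. poly p (1 / x) * exp (- 1 / x)) has_real_derivative
        flat_fun ([:0, 0, 1:] * (p - pderiv p)) x) (at x)"
      using 1 by (auto intro!: derivative_eq_intros poly_DERIV[THEN DERIV_chain2]
          simp: flat_fun_def field_simps power2_eq_square)
    then show ?thesis
      by (rule DERIV_cong_ev[THEN iffD1, rotated -1])
         (use 1 in \<open>auto simp: flat_fun_def intro: eventually_mono[OF eventually_nhds_in_open[of "{0<..}"]]\<close>)
  next
    case 2
    have "((\<lambda>x. 0) has_real_derivative flat_fun ([:0, 0, 1:] * (p - pderiv p)) x) (at x)"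
      using 2 by (auto simp: flat_fun_def)
    then show ?thesis
      by (rule DERIV_cong_ev[THEN iffD1, rotated -1])
         (use 2 in \<open>auto simp: flat_fun_def intro: eventually_mono[OF eventually_nhds_in_open[of "{..<0}"]]\<close>)
  next
    case 3
    have "((\<lambda>h. flat_fun p h / h) \<longlongrightarrow> 0) (at_right 0)"
    proof -
      have "((\<lambda>h. (1 / h) ^ 1 * poly p (1 / h) * exp (- (1 / h))) \<longlongrightarrow> 0) (at_right (0::real))"
        by (rule filterlim_compose[OF poly_times_exp_tendsto_0])
           (use filterlim_inverse_at_top_right in \<open>simp add: inverse_eq_divide\<close>)
      then show ?thesis
        by (rule Lim_transform_eventually)
           (auto simp: flat_fun_def eventually_at_right_less intro!: eventually_mono[OF eventually_at_right_less])
    qed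
    moreover have "((\<lambda>h. flat_fun p h / h) \<longlongrightarrow> 0) (at_left 0)"
      by (rule tendsto_eventually)
         (auto simp: flat_fun_def eventually_at_left_field intro!: exI[of _ "-1"])
    ultimately have "((\<lambda>h. flat_fun p h / h) \<longlongrightarrow> 0) (at 0)"
      by (simp add: filterlim_split_at)
    then show ?thesis
      unfolding 3 has_field_derivative_iff by (simp add: flat_fun_def)
  qed
qed

lemma k_times_cont_diff_flat:
  assumes "\<And>k. k_times_cont_diff k f"
  shows "k_times_cont_diff k (\<lambda>x. flat_fun 1 (f x))"
  using k_times_cont_diff_compose[where h = "\<lambda>j. flat_fun (((\<lambda>p. [:0, 0, 1:] * (p - pderiv p)) ^^ j) 1)"
      and j = 0 and f = f and k = k] flat_fun_has_derivative assms by simp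

definition box_bump :: "'a::euclidean_space \<Rightarrow> 'a \<Rightarrow> 'a \<Rightarrow> real" where
  "box_bump a b x = (\<Prod>i\<in>Basis. flat_fun 1 (x \<bullet> i - a \<bullet> i) * flat_fun 1 (b \<bullet> i - x \<bullet> i))"

lemma k_times_cont_diff_box_bump: "k_times_cont_diff k (box_bump a b)"
proof -
  have 1: "k_times_cont_diff k (\<lambda>x::'a. x \<bullet> i - c)" for i k c
    using k_times_cont_diff_add[OF k_times_cont_diff_inner k_times_cont_diff_const, of k i "- c"] by simp
  have 2: "k_times_cont_diff k (\<lambda>x::'a. c - x \<bullet> i)" for i k c
    using k_times_cont_diff_add[OF k_times_cont_diff_inner k_times_cont_diff_const, of k "- i" c]
    by (simp add: algebra_simps)
  show ?thesis
    unfolding box_bump_def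
    by (intro k_times_cont_diff_prod k_times_cont_diff_mult k_times_cont_diff_flat 1 2) auto
qed

lemma box_bump_nonneg: "box_bump a b x \<ge> 0"
  by (auto simp: box_bump_def flat_fun_def intro!: prod_nonneg)

lemma box_bump_pos: "box_bump a b x > 0 \<longleftrightarrow> x \<in> box a b"
proof
  assume "x \<in> box a b"
  then show "box_bump a b x > 0"
    by (auto simp: box_bump_def flat_fun_def mem_box intro!: prod_pos)
next
  assume *: "box_bump a b x > 0"
  show "x \<in> box a b"
    unfolding mem_box
  proof
    fix i :: 'a assume i: "i \<in> Basis"
    have "flat_fun 1 (x \<bullet> i - a \<bullet> i) * flat_fun 1 (b \<bullet> i - x \<bullet> i) \<noteq> 0"
      using * i unfolding box_bump_def by (metis (mono_tags, lifting) finite_Basis less_irrefl prod_zero)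
    then show "a \<bullet> i < x \<bullet> i \<and> x \<bullet> i < b \<bullet> i"
      by (auto simp: flat_fun_def split: if_splits)
  qed
qed

lemma test_functions_cboxI:
  assumes "\<And>k. k_times_cont_diff k \<phi>" "\<And>x. x \<notin> cbox a b \<Longrightarrow> \<phi> x = 0" "cbox a b \<subseteq> S"
  shows "\<phi> \<in> test_functions S"
proof -
  have sub: "closure {x. \<phi> x \<noteq> 0} \<subseteq> cbox a b"
    using assms(2) by (intro closure_minimal) auto
  then have "compact (closure {x. \<phi> x \<noteq> 0})"
    by (meson bounded_cbox bounded_subset closed_closure compact_eq_bounded_closed)
  then show ?thesis
    using assms sub by (auto simp: test_functions_def)
qed

text \<open>Where a bump b of the box is positive, 1 - exp(-n b) tends to 1; where b vanishes, it is
  0 for every n. Composition with an entire function keeps smoothness, so nothing has to be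
  glued.\<close>

lemma test_function_box_approx:
  assumes "cbox a b \<subseteq> S"
  obtains \<phi> :: "nat \<Rightarrow> 'a::euclidean_space \<Rightarrow> real" where "\<And>n. \<phi> n \<in> test_functions S"
    "\<And>n x. 0 \<le> \<phi> n x \<and> \<phi> n x \<le> 1" "\<And>x. (\<lambda>n. \<phi> n x) \<longlonglongrightarrow> indicator (box a b) x" "\<And>n x. x \<notin> box a b \<Longrightarrow> \<phi> n x = 0"
proof
  let ?\<phi> = "\<lambda>n x. 1 - exp (- real n * box_bump a b x)"
  have kc: "k_times_cont_diff k (?\<phi> n)" for k n
  proof -
    \<comment> \<open>The successive derivatives of 1 - exp(-n t); the constant 1 is present only at
      order 0.\<close>
    let ?h = "\<lambda>j t. (if j = 0 then 1 else 0) - (- real n) ^ j * exp (- real n * t)"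
    have "(?h j has_real_derivative ?h (Suc j) x) (at x)" for j x
      by (auto intro!: derivative_eq_intros)
    from k_times_cont_diff_compose[where h = ?h and j = 0, OF this k_times_cont_diff_box_bump]
    show ?thesis by simp
  qed
  have out: "?\<phi> n x = 0" if "x \<notin> box a b" for n x
    using box_bump_pos[of a b x] box_bump_nonneg[of a b x] that by auto
  then show "\<And>n x. x \<notin> box a b \<Longrightarrow> ?\<phi> n x = 0" .
  show "?\<phi> n \<in> test_functions S" for n
    by (rule test_functions_cboxI[OF kc _ assms]) (use out box_subset_cbox in blast)
  show "0 \<le> ?\<phi> n x \<and> ?\<phi> n x \<le> 1" for n x
    using box_bump_nonneg[of a b x] by auto
  show "(\<lambda>n. ?\<phi> n x) \<longlonglongrightarrow> indicator (box a b) x" for x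
  proof (cases "x \<in> box a b")
    case True
    then have pos: "box_bump a b x > 0" by (simp add: box_bump_pos)
    have "(\<lambda>n. exp (- box_bump a b x) ^ n) \<longlonglongrightarrow> 0"
      using pos by (intro LIMSEQ_power_zero) auto
    then have "(\<lambda>n. exp (- (real n * box_bump a b x))) \<longlonglongrightarrow> 0"
      by (simp add: exp_of_nat_mult[symmetric])
    then have "(\<lambda>n. 1 - exp (- (real n * box_bump a b x))) \<longlonglongrightarrow> 1 - 0"
      by (intro tendsto_intros)
    then show ?thesis using True by simp
  next
    case False
    then have "(\<lambda>n. ?\<phi> n x) = (\<lambda>n. 0)" using out by auto
    with False show ?thesis by simp
  qed
qed

section \<open>The fundamental lemma of the calculus of variations\<close>

lemma AE_zero_if_integral_boxes_zero:
  fixes f :: "'a::euclidean_space \<Rightarrow> real"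
  assumes f: "integrable lborel f"
    and box: "\<And>c d. (\<integral>x. indicator (box c d) x * f x \<partial>lborel) = 0"
  shows "AE x in lborel. f x = 0"
proof -
  have [measurable]: "f \<in> borel_measurable borel" using f by auto
  \<comment> \<open>\<open>ennreal\<close> cuts off at 0, so these densities are the positive and
    the negative part of \<open>f\<close>. The two finite measures agree on open boxes, an
    intersection-stable generator of the Borel sets; hence the two parts agree almost everywhere,
    and both are zero.\<close>
  let ?M = "density lborel (\<lambda>x. ennreal (f x))" and ?N = "density lborel (\<lambda>x. ennreal (- f x))"
  let ?E = "range (\<lambda>(a, b). box a b :: 'a set)"
  have fin: "(\<integral>\<^sup>+x. ennreal (g x) * indicator A x \<partial>lborel) < \<infinity>" if "g = f \<or> g = (\<lambda>x. - f x)" for g A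
  proof -
    have "(\<integral>\<^sup>+x. ennreal (g x) * indicator A x \<partial>lborel) \<le> (\<integral>\<^sup>+x. ennreal (norm (f x)) \<partial>lborel)"
      using that by (intro nn_integral_mono) (auto simp: indicator_def intro!: ennreal_leI)
    also have "\<dots> < \<infinity>"
      using f by (simp add: integrable_iff_bounded)
    finally show ?thesis .
  qed
  have eq: "emeasure ?M X = emeasure ?N X" if "X \<in> ?E" for X
  proof -
    from that obtain c d where X: "X = box c d" by (elim rangeE) (auto split: prod.splits)
    have *: "(\<integral>\<^sup>+x. ennreal (g x) * indicator X x \<partial>lborel) = (\<integral>\<^sup>+x. ennreal (indicator X x * g x) \<partial>lborel)" for g
      by (intro nn_integral_cong) (auto simp: indicator_def)
    have int: "integrable lborel (\<lambda>x. indicator X x * f x)"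
      using integrable_mult_indicator[OF _ f, of X] by (simp add: X)
    have "enn2real (\<integral>\<^sup>+x. ennreal (indicator X x * f x) \<partial>lborel) = enn2real (\<integral>\<^sup>+x. ennreal (- (indicator X x * f x)) \<partial>lborel)"
      using box[of c d] real_lebesgue_integral_def[OF int] by (simp add: X)
    then have "(\<integral>\<^sup>+x. ennreal (f x) * indicator X x \<partial>lborel) = (\<integral>\<^sup>+x. ennreal (- f x) * indicator X x \<partial>lborel)"
      using fin[of f X] fin[of "\<lambda>x. - f x" X] unfolding *
      by (metis (no_types, lifting) ennreal_enn2real infinity_ennreal_def mult_minus_right nn_integral_cong)
    then show ?thesis
      by (simp add: emeasure_density X)
  qed
  have "?M = ?N"
  proof (rule measure_eqI_generator_eq[where E = ?E and \<Omega> = UNIV and A = "\<lambda>i. box (- (real i *\<^sub>R One)) (real i *\<^sub>R One)"])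
    show "Int_stable ?E"
      by (auto simp: Int_stable_def box_Int_box)
    show "sets ?M = sigma_sets UNIV ?E" "sets ?N = sigma_sets UNIV ?E"
      by (simp_all add: borel_eq_box)
    show "emeasure ?M (box (- (real i *\<^sub>R One)) (real i *\<^sub>R One)) \<noteq> \<infinity>" for i
      using fin[of f] by (simp add: emeasure_density less_top)
  qed (use eq UN_box_eq_UNIV in auto)
  then have "AE x in lborel. ennreal (f x) = ennreal (- f x)"
    by (intro sigma_finite_measure.density_unique[OF sigma_finite_lborel]) auto
  then show ?thesis
  proof eventually_elim
    case (elim x)
    then show ?case
      by (cases "f x \<ge> 0") (auto simp: ennreal_neg ennreal_eq_0_iff dest: sym)
  qed
qed

text \<open>Dominated convergence along test functions tending to the indicator of an open box turns
  the hypothesis into vanishing integrals over boxes. These determine \<open>f\<close> on each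
  compact box, and countably many compact boxes exhaust \<open>S\<close>.\<close>

lemma AE_zero_if_test_integrals_zero:
  fixes f :: "'a::euclidean_space \<Rightarrow> real"
  assumes S: "open S"
    and f: "\<And>a b. cbox a b \<subseteq> S \<Longrightarrow> set_integrable lebesgue (cbox a b) f"
    and test: "\<And>\<phi>. \<phi> \<in> test_functions S \<Longrightarrow> (LINT x:S|lebesgue. \<phi> x * f x) = 0"
  shows "AE x in lebesgue. x \<in> S \<longrightarrow> f x = 0"
proof -
  have zero: "(LINT x:box a b|lebesgue. f x) = 0" if ab: "cbox a b \<subseteq> S" for a b
  proof -
    obtain \<phi> :: "nat \<Rightarrow> 'a \<Rightarrow> real" where \<phi>: "\<And>n. \<phi> n \<in> test_functions S"
      "\<And>n x. 0 \<le> \<phi> n x \<and> \<phi> n x \<le> 1" "\<And>x. (\<lambda>n. \<phi> n x) \<longlonglongrightarrow> indicator (box a b) x" "\<And>n x. x \<notin> box a b \<Longrightarrow> \<phi> n x = 0"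
      using test_function_box_approx[OF ab] by metis
    have cont: "continuous_on UNIV (\<phi> n)" for n
      using \<phi>(1)[of n] by (auto simp: test_functions_def dest: spec[of _ 0])
    let ?g = "\<lambda>x. indicator (cbox a b) x *\<^sub>R f x"
    have g: "integrable lebesgue ?g" using f[OF ab] by (simp add: set_integrable_def)
    have "(\<lambda>n. \<integral>x. \<phi> n x *\<^sub>R ?g x \<partial>lebesgue) \<longlonglongrightarrow> (\<integral>x. indicator (box a b) x *\<^sub>R ?g x \<partial>lebesgue)"
    proof (rule integral_dominated_convergence[where w = "\<lambda>x. norm (?g x)"])
      show "(\<lambda>x. \<phi> n x *\<^sub>R ?g x) \<in> borel_measurable lebesgue" for n
        using cont[of n]
        by (intro borel_measurable_scaleR borel_measurable_integrable[OF g] measurable_completion)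
           (simp add: borel_measurable_continuous_onI)
      show "(\<lambda>x. indicator (box a b) x *\<^sub>R ?g x) \<in> borel_measurable lebesgue"
        by (intro borel_measurable_scaleR borel_measurable_indicator borel_measurable_integrable[OF g]) auto
      show "AE x in lebesgue. (\<lambda>n. \<phi> n x *\<^sub>R ?g x) \<longlonglongrightarrow> indicator (box a b) x *\<^sub>R ?g x"
        by (intro AE_I2 tendsto_scaleR tendsto_const \<phi>)
      show "AE x in lebesgue. norm (\<phi> n x *\<^sub>R ?g x) \<le> norm (?g x)" for n
        using \<phi>(2)[of n] by (auto simp: abs_mult intro!: mult_left_le_one_le)
      show "integrable lebesgue (\<lambda>x. norm (?g x))" using g by simp
    qed
    moreover have "(\<integral>x. \<phi> n x *\<^sub>R ?g x \<partial>lebesgue) = (LINT x:S|lebesgue. \<phi> n x * f x)" for n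
      unfolding set_lebesgue_integral_def
      using \<phi>(4)[of _ n] ab box_subset_cbox[of a b]
      by (intro Bochner_Integration.integral_cong) (auto simp: indicator_def)
    moreover have "(\<integral>x. indicator (box a b) x *\<^sub>R ?g x \<partial>lebesgue) = (LINT x:box a b|lebesgue. f x)"
      unfolding set_lebesgue_integral_def
      using box_subset_cbox[of a b]
      by (intro Bochner_Integration.integral_cong) (auto simp: indicator_def)
    ultimately show ?thesis
      using test[OF \<phi>(1)] LIMSEQ_unique[OF _ tendsto_const] by simp
  qed
  have AE: "AE x in lebesgue. x \<in> box A B \<longrightarrow> f x = 0" if AB: "cbox A B \<subseteq> S" for A B
  proof -
    let ?F = "\<lambda>x. indicator (box A B) x * f x"
    have F: "integrable lebesgue ?F"
      using set_integrable_subset[OF f[OF AB], of "box A B"] box_subset_cbox[of A B]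
      by (simp add: set_integrable_def)
    then obtain f0 where f0[measurable]: "f0 \<in> borel_measurable lborel" and "AE x in lborel. ?F x = f0 x"
      using completion_ex_borel_measurable_real[of ?F lborel] by auto
    then have eq: "AE x in lebesgue. ?F x = f0 x" by (simp add: AE_completion)
    have int0: "integrable lebesgue f0"
      using F eq by (subst integrable_cong_AE[symmetric, of ?F]) (auto intro: measurable_completion)
    have "AE x in lborel. f0 x = 0"
    proof (rule AE_zero_if_integral_boxes_zero)
      show "integrable lborel f0"
        using int0 by (subst (asm) integrable_completion) auto
      fix c d
      obtain l u where lu: "box c d \<inter> box A B = box l u"
        by (auto simp: box_Int_box)
      have "(\<integral>x. indicator (box c d) x * f0 x \<partial>lborel) = (\<integral>x. indicator (box c d) x * f0 x \<partial>lebesgue)"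
        by (rule integral_completion[symmetric]) auto
      also have "\<dots> = (\<integral>x. indicator (box c d) x * ?F x \<partial>lebesgue)"
      proof (rule integral_cong_AE)
        show "(\<lambda>x. indicator (box c d) x * f0 x) \<in> borel_measurable lebesgue"
          by (intro measurable_completion) simp
        show "(\<lambda>x. indicator (box c d) x * ?F x) \<in> borel_measurable lebesgue"
          by (rule borel_measurable_times[OF borel_measurable_indicator borel_measurable_integrable[OF F]]) simp
        show "AE x in lebesgue. indicator (box c d) x * f0 x = indicator (box c d) x * ?F x"
          using eq by eventually_elim simp
      qed
      also have "\<dots> = (LINT x:box l u|lebesgue. f x)"
        unfolding set_lebesgue_integral_def lu[symmetric]
        by (intro Bochner_Integration.integral_cong) (auto simp: indicator_def)
      also have "\<dots> = 0"
      \<comment> \<open>\<open>zero\<close> needs the closed box inside \<open>S\<close>; for a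
        nonempty open box the closed one is its closure and so stays inside
        \<open>cbox A B\<close>.\<close>
      proof (cases "box l u = {}")
        case False
        then have "cbox l u = closure (box c d \<inter> box A B)" by (simp add: lu)
        also have "\<dots> \<subseteq> cbox A B" by (intro closure_minimal) (auto intro: subsetD[OF box_subset_cbox])
        finally show ?thesis using AB by (intro zero) auto
      qed (simp add: set_lebesgue_integral_def)
      finally show "(\<integral>x. indicator (box c d) x * f0 x \<partial>lborel) = 0" .
    qed
    then have "AE x in lebesgue. f0 x = 0" by (simp add: AE_completion)
    with eq show ?thesis by eventually_elim auto
  qed
  obtain D where D: "countable D" "D \<subseteq> Pow S" "\<And>X. X \<in> D \<Longrightarrow> \<exists>a b. X = cbox a b" "\<Union>D = S"
    using open_countable_Union_open_cbox[OF S] by metis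
  have "AE x in lebesgue. x \<in> X \<longrightarrow> f x = 0" if X: "X \<in> D" for X
  proof -
    obtain a b where ab: "X = cbox a b" using D(3)[OF X] by blast
    have "cbox a b - box a b \<in> null_sets lebesgue"
      by (metis negligible_frontier_interval negligible_iff_null_sets)
    then have "AE x in lebesgue. x \<notin> cbox a b - box a b"
      by (rule AE_not_in)
    moreover have "AE x in lebesgue. x \<in> box a b \<longrightarrow> f x = 0"
      using X D(2) ab by (intro AE) auto
    ultimately show ?thesis
      unfolding ab by eventually_elim blast
  qed
  then have "AE x in lebesgue. \<forall>X\<in>D. x \<in> X \<longrightarrow> f x = 0"
    using D(1) by (intro AE_ball_countable[THEN iffD2] ballI)
  then show ?thesis
    unfolding D(4)[symmetric] by eventually_elim auto
qed

section \<open>Square integrable functions paired with test functions\<close>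

lemma L2_measurable: "f \<in> L2 M S \<Longrightarrow> set_borel_measurable M S f"
  and L2_integrable: "f \<in> L2 M S \<Longrightarrow> set_integrable M S (\<lambda>x. (norm (f x))\<^sup>2)"
  by (auto simp: L2_def)

lemma le_one_plus_square: "(t::real) \<le> 1 + t\<^sup>2"
proof -
  have "0 \<le> (t - 1)\<^sup>2 + (1 + t\<^sup>2)" by simp
  then show ?thesis by (simp add: power2_eq_square algebra_simps)
qed

text \<open>The majorant is 1 + |f|^2, whose first summand is integrable because \<open>A\<close>
  has finite measure.\<close>

lemma set_integrable_L2_lmeasurable:
  fixes f :: "'a \<Rightarrow> 'b::euclidean_space"
  assumes f: "f \<in> L2 M S" and A: "A \<in> fmeasurable M" "A \<subseteq> S"
  shows "set_integrable M A f"
  unfolding set_integrable_def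
proof (rule Bochner_Integration.integrable_bound[where f = "\<lambda>x. indicator A x + indicator S x * (norm (f x))\<^sup>2"])
  show "integrable M (\<lambda>x. indicator A x + indicator S x * (norm (f x))\<^sup>2)"
    using L2_integrable[OF f] A unfolding set_integrable_def
    by (intro Bochner_Integration.integrable_add integrable_real_indicator) (auto simp: fmeasurable_def)
  have "(\<lambda>x. indicator A x *\<^sub>R indicator S x *\<^sub>R f x) \<in> borel_measurable M"
    using A by (intro borel_measurable_scaleR L2_measurable[OF f, unfolded set_borel_measurable_def])
      (auto simp: fmeasurableD)
  moreover have "(\<lambda>x. indicator A x *\<^sub>R indicator S x *\<^sub>R f x) = (\<lambda>x. indicator A x *\<^sub>R f x)"
    using A(2) by (auto simp: fun_eq_iff indicator_def)
  ultimately show "(\<lambda>x. indicator A x *\<^sub>R f x) \<in> borel_measurable M" by simp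
  show "AE x in M. norm (indicator A x *\<^sub>R f x) \<le> norm (indicator A x + indicator S x * (norm (f x))\<^sup>2)"
    using A(2) le_one_plus_square by (intro AE_I2) (auto simp: indicator_def)
qed

lemma set_integrable_L2_compact_support:
  fixes f :: "'a::euclidean_space \<Rightarrow> 'b::euclidean_space"
  assumes f: "f \<in> L2 lebesgue S" and \<phi>: "continuous_on UNIV \<phi>" "compact K" "\<And>x. x \<notin> K \<Longrightarrow> \<phi> x = 0"
  shows "set_integrable lebesgue S (\<lambda>x. \<phi> x *\<^sub>R f x)"
proof -
  obtain B where B: "\<And>x. \<bar>\<phi> x\<bar> \<le> B"
  proof -
    have "bounded (\<phi> ` K)"
      using \<phi> by (meson compact_continuous_image compact_imp_bounded continuous_on_subset subset_UNIV)
    then obtain B where "\<forall>x\<in>K. \<bar>\<phi> x\<bar> \<le> B" "B > 0"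
      unfolding bounded_pos by auto
    then have "\<bar>\<phi> x\<bar> \<le> B" for x
      using \<phi>(3)[of x] by (cases "x \<in> K") auto
    then show ?thesis using that by blast
  qed
  then have B0: "B \<ge> 0" using abs_ge_zero order_trans by blast
  have \<phi>m: "\<phi> \<in> borel_measurable lebesgue"
    using \<phi>(1) by (intro measurable_completion) (simp add: borel_measurable_continuous_onI)
  have fm: "(\<lambda>x. indicator S x *\<^sub>R f x) \<in> borel_measurable lebesgue"
    using L2_measurable[OF f] by (simp add: set_borel_measurable_def)
  show ?thesis
    unfolding set_integrable_def
  proof (rule Bochner_Integration.integrable_bound[where f = "\<lambda>x. B * (indicator K x + indicator S x * (norm (f x))\<^sup>2)"])
    have "emeasure lebesgue K < \<infinity>"
      using \<phi>(2) by (metis emeasure_compact_finite emeasure_lborel_cbox_finite fmeasurable_def lmeasurable_compact mem_Collect_eq infinity_ennreal_def)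
    then show "integrable lebesgue (\<lambda>x. B * (indicator K x + indicator S x * (norm (f x))\<^sup>2))"
      using L2_integrable[OF f] \<phi>(2) unfolding set_integrable_def
      by (intro integrable_mult_right Bochner_Integration.integrable_add integrable_real_indicator)
         (auto simp: lmeasurable_compact fmeasurableD)
    have "(\<lambda>x. \<phi> x *\<^sub>R (indicator S x *\<^sub>R f x)) \<in> borel_measurable lebesgue"
      by (intro borel_measurable_scaleR \<phi>m fm)
    then show "(\<lambda>x. indicator S x *\<^sub>R \<phi> x *\<^sub>R f x) \<in> borel_measurable lebesgue"
      by (simp add: mult.commute)
    show "AE x in lebesgue. norm (indicator S x *\<^sub>R \<phi> x *\<^sub>R f x) \<le> norm (B * (indicator K x + indicator S x * (norm (f x))\<^sup>2))"
    proof (rule AE_I2)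
      fix x
      have "\<bar>\<phi> x\<bar> * norm (f x) \<le> B * (1 + (norm (f x))\<^sup>2)"
        using B B0 le_one_plus_square by (intro mult_mono) auto
      then show "norm (indicator S x *\<^sub>R \<phi> x *\<^sub>R f x) \<le> norm (B * (indicator K x + indicator S x * (norm (f x))\<^sup>2))"
        using B0 \<phi>(3)[of x] by (cases "x \<in> K"; cases "x \<in> S") (auto simp: abs_mult)
    qed
  qed
qed

lemma test_functions_support:
  assumes "\<phi> \<in> test_functions S"
  obtains K where "compact K" "K \<subseteq> S" "\<And>x. x \<notin> K \<Longrightarrow> \<phi> x = 0"
  using assms closure_subset[of "{x. \<phi> x \<noteq> 0}"] unfolding test_functions_def by blast

lemma test_functions_continuous: "\<phi> \<in> test_functions S \<Longrightarrow> continuous_on UNIV \<phi>"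
  by (auto simp: test_functions_def dest: spec[of _ 0])

lemma set_integrable_test_L2:
  fixes f :: "'a::euclidean_space \<Rightarrow> 'b::euclidean_space"
  assumes "f \<in> L2 lebesgue S" "\<phi> \<in> test_functions T"
  shows "set_integrable lebesgue S (\<lambda>x. \<phi> x *\<^sub>R f x)"
  using assms test_functions_support[OF assms(2)] test_functions_continuous[OF assms(2)]
  by (metis set_integrable_L2_compact_support)

lemma test_functions_gradient:
  assumes "\<phi> \<in> test_functions S"
  obtains \<phi>' where "\<And>x. GDERIV \<phi> x :> \<phi>' x" "continuous_on UNIV \<phi>'"
    "\<And>x. x \<notin> closure {x. \<phi> x \<noteq> 0} \<Longrightarrow> \<phi>' x = 0"
proof -
  have "k_times_cont_diff (Suc 0) \<phi>" using assms by (auto simp: test_functions_def)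
  then obtain \<phi>' where \<phi>': "\<And>x. GDERIV \<phi> x :> \<phi>' x" "\<forall>b\<in>Basis. continuous_on UNIV (\<lambda>x. \<phi>' x \<bullet> b)"
    by auto
  moreover have "continuous_on UNIV \<phi>'"
    using \<phi>'(2) by (subst continuous_on_componentwise) auto
  moreover have "\<phi>' x = 0" if "x \<notin> closure {x. \<phi> x \<noteq> 0}" for x
  proof -
    have "GDERIV (\<lambda>x. 0) x :> \<phi>' x"
      unfolding gderiv_def
      by (rule has_derivative_transform_within_open[OF \<phi>'(1)[of x, unfolded gderiv_def], of "- closure {x. \<phi> x \<noteq> 0}"])
         (use that closure_subset[of "{x. \<phi> x \<noteq> 0}"] in auto)
    then show ?thesis using GDERIV_unique[OF _ GDERIV_const] by blast
  qed
  ultimately show ?thesis using that by blast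
qed

text \<open>Each component of the difference integrates to zero against all test functions, so the
  fundamental lemma applies component by component. Uniqueness is what makes the choices in
  \<open>grad\<close> and \<open>tangential_grad\<close> harmless.\<close>

lemma weak_gradient_unique:
  fixes u :: "'a::euclidean_space \<Rightarrow> real"
  assumes S: "open S" and g: "g1 \<in> L2 lebesgue S" "g2 \<in> L2 lebesgue S"
    and w: "weak_gradient S u g1" "weak_gradient S u g2"
  shows "AE x in lebesgue. x \<in> S \<longrightarrow> g1 x = g2 x"
proof -
  have int1: "set_integrable lebesgue (cbox a b) g" if "cbox a b \<subseteq> S" "g \<in> L2 lebesgue S" for a b and g :: "'a \<Rightarrow> 'a"
  proof -
    show ?thesis by (rule set_integrable_L2_lmeasurable[OF that(2) lmeasurable_cbox that(1)])
  qed
  have "AE x in lebesgue. x \<in> S \<longrightarrow> (g1 x - g2 x) \<bullet> b = 0" if b: "b \<in> Basis" for b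
  proof (rule AE_zero_if_test_integrals_zero[OF S])
    show "set_integrable lebesgue (cbox l u) (\<lambda>x. (g1 x - g2 x) \<bullet> b)" if "cbox l u \<subseteq> S" for l u
      using integrable_inner_left[OF set_integral_diff(1)[OF int1[OF that g(1)] int1[OF that g(2)], unfolded set_integrable_def], of b]
      by (simp add: set_integrable_def)
    fix \<phi> :: "'a \<Rightarrow> real" assume \<phi>: "\<phi> \<in> test_functions S"
    obtain \<phi>' where \<phi>': "\<And>x. GDERIV \<phi> x :> \<phi>' x"
      using test_functions_gradient[OF \<phi>] by metis
    note i = set_integrable_test_L2[OF g(1) \<phi>] set_integrable_test_L2[OF g(2) \<phi>]
    have "(LINT x:S|lebesgue. u x *\<^sub>R \<phi>' x) = - (LINT x:S|lebesgue. \<phi> x *\<^sub>R g1 x)"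
      "(LINT x:S|lebesgue. u x *\<^sub>R \<phi>' x) = - (LINT x:S|lebesgue. \<phi> x *\<^sub>R g2 x)"
      using w \<phi> \<phi>' unfolding weak_gradient_def by blast+
    then have "(LINT x:S|lebesgue. \<phi> x *\<^sub>R g1 x) - (LINT x:S|lebesgue. \<phi> x *\<^sub>R g2 x) = 0"
      by simp
    then have "0 = (LINT x:S|lebesgue. \<phi> x *\<^sub>R g1 x - \<phi> x *\<^sub>R g2 x)"
      unfolding set_integral_diff(2)[OF i] by simp
    then have "0 = (LINT x:S|lebesgue. \<phi> x *\<^sub>R g1 x - \<phi> x *\<^sub>R g2 x) \<bullet> b"
      using inner_zero_left[of b] by simp
    also have "\<dots> = (LINT x:S|lebesgue. (\<phi> x *\<^sub>R g1 x - \<phi> x *\<^sub>R g2 x) \<bullet> b)"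
      using integral_inner_left[of b lebesgue "\<lambda>x. indicator S x *\<^sub>R (\<phi> x *\<^sub>R g1 x - \<phi> x *\<^sub>R g2 x)"]
        set_integral_diff(1)[OF i]
      unfolding set_lebesgue_integral_def set_integrable_def by simp
    finally show "(LINT x:S|lebesgue. \<phi> x * ((g1 x - g2 x) \<bullet> b)) = 0"
      by (simp add: inner_diff_left right_diff_distrib)
  qed
  then have "AE x in lebesgue. \<forall>b\<in>Basis. x \<in> S \<longrightarrow> (g1 x - g2 x) \<bullet> b = 0"
    by (intro AE_ball_countable[THEN iffD2] ballI countable_finite finite_Basis)
  then show ?thesis
  proof eventually_elim
    case (elim x)
    show ?case
    proof
      assume "x \<in> S"
      with elim show "g1 x = g2 x"
        using euclidean_all_zero_iff[of "g1 x - g2 x"] by simp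
    qed
  qed
qed

subsection \<open>Weak gradients of piecewise affine functions\<close>

text \<open>Difference quotients in the direction \<open>b\<close> have integral zero because
  Lebesgue measure is translation invariant. They are bounded by \<open>L * norm b\<close>, and
  steps of length at most \<open>norm b\<close> keep their supports in one ball, so dominated
  convergence passes to the derivative.\<close>

lemma integral_gradient_eq_0:
  fixes F :: "'a::euclidean_space \<Rightarrow> real"
  assumes lip: "L-lipschitz_on UNIV F" and K: "bounded K" "\<And>x. x \<notin> K \<Longrightarrow> F x = 0"
    and der: "AE x in lebesgue. GDERIV F x :> F' x" and meas: "F' \<in> borel_measurable lebesgue"
  shows "(\<integral>x. F' x \<bullet> b \<partial>lebesgue) = 0"
proof -
  obtain R where R: "K \<subseteq> cball 0 R" "R > 0"
    using bounded_subset_ballD[OF K(1), of 0] ball_subset_cball by blast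
  have cF: "continuous_on UNIV F" using lip lipschitz_on_continuous_on by blast
  then have Fm[measurable]: "F \<in> borel_measurable borel" by (simp add: borel_measurable_continuous_onI)
  have L: "\<bar>F x - F y\<bar> \<le> L * norm (x - y)" for x y
    using lipschitz_onD[OF lip, of x y] by (simp add: dist_norm)
  have L0: "L \<ge> 0" using lip by (rule lipschitz_on_nonneg)
  have intF: "integrable lborel F"
  proof -
    have "continuous_on (cball 0 R) F" using cF continuous_on_subset by blast
    then have "integrable lborel (\<lambda>x. indicator (cball 0 R) x *\<^sub>R F x)"
      by (intro borel_integrable_compact) auto
    also have "(\<lambda>x. indicator (cball 0 R) x *\<^sub>R F x) = F"
      using K(2) R(1) by (intro ext) (metis indicator_simps scaleR_one scaleR_zero_left subsetD)
    finally show ?thesis .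
  qed
  let ?s = "\<lambda>n x. real (Suc n) * (F (x + (1 / real (Suc n)) *\<^sub>R b) - F x)"
  let ?K = "cball 0 (R + norm b) :: 'a set"
  have "(\<lambda>n. \<integral>x. ?s n x \<partial>lebesgue) \<longlonglongrightarrow> (\<integral>x. F' x \<bullet> b \<partial>lebesgue)"
  proof (rule integral_dominated_convergence[where w = "\<lambda>x. L * norm b * indicator ?K x"])
    show "(\<lambda>x. F' x \<bullet> b) \<in> borel_measurable lebesgue" using meas by simp
    show "?s n \<in> borel_measurable lebesgue" for n
      by (intro measurable_completion) simp
    show "integrable lebesgue (\<lambda>x. L * norm b * indicator ?K x)"
      by (intro integrable_mult_right integrable_real_indicator)
         (use emeasure_bounded_finite[OF bounded_cball] in auto)
    show "AE x in lebesgue. (\<lambda>n. ?s n x) \<longlonglongrightarrow> F' x \<bullet> b"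
      using der
    proof eventually_elim
      case (elim x)
      have "((\<lambda>t. x + t *\<^sub>R b) has_derivative (\<lambda>t. t *\<^sub>R b)) (at 0)"
        by (auto intro!: derivative_eq_intros)
      from diff_chain_at[OF this, of F "\<lambda>h. h \<bullet> F' x"] elim
      have "((\<lambda>t. F (x + t *\<^sub>R b)) has_derivative (\<lambda>t. (t *\<^sub>R b) \<bullet> F' x)) (at 0)"
        by (simp add: gderiv_def o_def)
      then have "((\<lambda>t. F (x + t *\<^sub>R b)) has_real_derivative (F' x \<bullet> b)) (at 0)"
        unfolding has_field_derivative_def
        by (rule has_derivative_eq_rhs) (auto simp: inner_commute mult.commute)
      then have *: "((\<lambda>t. (F (x + t *\<^sub>R b) - F x) / t) \<longlongrightarrow> F' x \<bullet> b) (at 0)"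
        by (simp add: has_field_derivative_iff)
      have "filterlim (\<lambda>n. 1 / real (Suc n)) (at 0) sequentially"
        unfolding filterlim_at using LIMSEQ_inverse_real_of_nat
        by (auto simp: inverse_eq_divide)
      from filterlim_compose[OF * this] show ?case
        by (simp add: field_simps)
    qed
    show "AE x in lebesgue. norm (?s n x) \<le> L * norm b * indicator ?K x" for n
    proof (rule AE_I2)
      fix x
      have le: "norm ((1 / real (Suc n)) *\<^sub>R b) \<le> norm b"
        by (simp add: divide_le_eq mult_le_cancel_left1 distrib_left)
      show "norm (?s n x) \<le> L * norm b * indicator ?K x"
      proof (cases "x \<in> ?K")
        case True
        have "real (Suc n) * \<bar>F (x + (1 / real (Suc n)) *\<^sub>R b) - F x\<bar> \<le> real (Suc n) * (L * norm ((1 / real (Suc n)) *\<^sub>R b))"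
          using L[of "x + (1 / real (Suc n)) *\<^sub>R b" x] by (intro mult_left_mono) auto
        then show ?thesis using True by (simp add: abs_mult)
      next
        case False
        then have "norm x > R + norm b" by simp
        moreover have "norm x \<le> norm (x + (1 / real (Suc n)) *\<^sub>R b) + norm b"
          using le norm_triangle_ineq4[of "x + (1 / real (Suc n)) *\<^sub>R b" "(1 / real (Suc n)) *\<^sub>R b"] by simp
        ultimately have "\<not> norm x \<le> R" "\<not> norm (x + (1 / real (Suc n)) *\<^sub>R b) \<le> R"
          using norm_ge_zero[of b] by linarith+
        then have "x \<notin> K" "x + (1 / real (Suc n)) *\<^sub>R b \<notin> K"
          using R(1) by (meson mem_cball_0 subsetD)+
        then show ?thesis using K(2) False by simp
      qed
    qed
  qed
  moreover have "(\<integral>x. ?s n x \<partial>lebesgue) = 0" for n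
  proof -
    let ?c = "(1 / real (Suc n)) *\<^sub>R b"
    have tr: "integrable lborel (\<lambda>x. F (x + ?c))" "(\<integral>x. F (x + ?c) \<partial>lborel) = (\<integral>x. F x \<partial>lborel)"
    proof -
      have "integrable (distr lborel borel ((+) ?c)) F"
        unfolding lborel_distr_plus by (rule intF)
      then show "integrable lborel (\<lambda>x. F (x + ?c))"
        by (subst (asm) integrable_distr_eq) (auto simp: add.commute)
      have "(\<integral>x. F x \<partial>lborel) = (\<integral>x. F x \<partial>distr lborel borel ((+) ?c))"
        unfolding lborel_distr_plus ..
      also have "\<dots> = (\<integral>x. F (x + ?c) \<partial>lborel)"
        by (subst integral_distr) (auto simp: add.commute)
      finally show "(\<integral>x. F (x + ?c) \<partial>lborel) = (\<integral>x. F x \<partial>lborel)" ..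
    qed
    have "(\<integral>x. ?s n x \<partial>lebesgue) = (\<integral>x. ?s n x \<partial>lborel)"
      by (rule integral_completion) simp
    also have "\<dots> = 0"
      using tr intF by (simp del: of_nat_Suc)
    finally show ?thesis .
  qed
  ultimately show ?thesis
    using LIMSEQ_unique[OF _ tendsto_const] by simp
qed

section \<open>Weak gradients obtained from gradients almost everywhere\<close>

lemma compact_continuous_bound:
  assumes "compact K" "continuous_on UNIV f"
  obtains B where "B > 0" "\<And>x. x \<in> K \<Longrightarrow> norm (f x) \<le> B"
proof -
  have "bounded (f ` K)"
    using assms by (meson compact_continuous_image compact_imp_bounded continuous_on_subset subset_UNIV)
  then show ?thesis using that unfolding bounded_pos by blast
qed

lemma test_functions_bounded_gradient:
  assumes "\<phi> \<in> test_functions S"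
  obtains \<phi>' B K where "\<And>x. GDERIV \<phi> x :> \<phi>' x" "continuous_on UNIV \<phi>'"
    "compact K" "K \<subseteq> S" "\<And>x. x \<notin> K \<Longrightarrow> \<phi> x = 0" "\<And>x. x \<notin> K \<Longrightarrow> \<phi>' x = 0"
    "\<And>x. \<bar>\<phi> x\<bar> \<le> B" "\<And>x. norm (\<phi>' x) \<le> B" "B-lipschitz_on UNIV \<phi>"
proof -
  obtain \<phi>' K where \<phi>': "\<And>x. GDERIV \<phi> x :> \<phi>' x" "continuous_on UNIV \<phi>'"
    and K: "compact K" "K \<subseteq> S" "\<And>x. x \<notin> K \<Longrightarrow> \<phi> x = 0" "\<And>x. x \<notin> K \<Longrightarrow> \<phi>' x = 0"
  proof (rule test_functions_gradient[OF assms])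
    fix \<phi>' assume *: "\<And>x. GDERIV \<phi> x :> \<phi>' x" "continuous_on UNIV \<phi>'"
      "\<And>x. x \<notin> closure {x. \<phi> x \<noteq> 0} \<Longrightarrow> \<phi>' x = 0"
    have 1: "compact (closure {x. \<phi> x \<noteq> 0})" "closure {x. \<phi> x \<noteq> 0} \<subseteq> S"
      using assms unfolding test_functions_def by blast+
    have 2: "\<phi> x = 0" if "x \<notin> closure {x. \<phi> x \<noteq> 0}" for x
      using that closure_subset[of "{x. \<phi> x \<noteq> 0}"] by blast
    show thesis by (rule that[OF *(1,2) 1 2 *(3)])
  qed
  obtain B1 where B1: "B1 > 0" "\<And>x. x \<in> K \<Longrightarrow> norm (\<phi> x) \<le> B1"
    using compact_continuous_bound[OF K(1) test_functions_continuous[OF assms]] by blast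
  obtain B2 where B2: "B2 > 0" "\<And>x. x \<in> K \<Longrightarrow> norm (\<phi>' x) \<le> B2"
    using compact_continuous_bound[OF K(1) \<phi>'(2)] by blast
  define B where "B = max B1 B2"
  have b1: "\<bar>\<phi> x\<bar> \<le> B" for x
    using B1 K(3)[of x] B1(2)[of x] unfolding B_def by (cases "x \<in> K") (simp_all add: max.coboundedI1)
  have b2: "norm (\<phi>' x) \<le> B" for x
    using B2 K(4)[of x] B2(2)[of x] unfolding B_def by (cases "x \<in> K") (simp_all add: max.coboundedI2)
  have "norm (\<phi> x - \<phi> y) \<le> B * norm (x - y)" for x y
  proof (rule differentiable_bound[OF convex_UNIV, of _ "\<lambda>x h. h \<bullet> \<phi>' x"])
    show "(\<phi> has_derivative (\<lambda>h. h \<bullet> \<phi>' x)) (at x within UNIV)" for x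
      using \<phi>'(1)[of x] by (simp add: gderiv_def)
    show "onorm (\<lambda>h. h \<bullet> \<phi>' x) \<le> B" for x
    proof (rule onorm_le)
      show "norm (h \<bullet> \<phi>' x) \<le> B * norm h" for h
        using Cauchy_Schwarz_ineq2[of h "\<phi>' x"] mult_left_mono[OF b2[of x], of "norm h"] by (simp add: mult.commute)
    qed
  qed auto
  then have lip: "B-lipschitz_on UNIV \<phi>"
    using B1(1) B2(1) by (intro lipschitz_onI) (auto simp: dist_norm B_def)
  show ?thesis using that[of \<phi>' K B] \<phi>' K b1 b2 lip by blast
qed

lemma set_integrable_L2_scaleR_compact_support:
  fixes u :: "'a::euclidean_space \<Rightarrow> real" and \<phi>' :: "'a \<Rightarrow> 'a"
  assumes u: "u \<in> L2 lebesgue S" and \<phi>'2: "continuous_on UNIV \<phi>'" and K: "compact K" "K \<subseteq> S" and \<phi>'0: "\<And>x. x \<notin> K \<Longrightarrow> \<phi>' x = 0"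
  shows "set_integrable lebesgue S (\<lambda>x. u x *\<^sub>R \<phi>' x)"
  proof -
    have Ks: "K \<in> sets lebesgue" using K(1) by (simp add: lmeasurable_compact fmeasurableD)
    have m: "\<phi>' \<in> borel_measurable (lebesgue_on K)"
      by (rule continuous_imp_measurable_on_sets_lebesgue[OF continuous_on_subset[OF \<phi>'2] Ks]) simp
    have bl: "bilinear (\<lambda>(a::'a) (b::real). b *\<^sub>R a)"
      by (simp add: bilinear_def linear_iff scaleR_add_left scaleR_add_right)
    have bd: "bounded (\<phi>' ` K)" using compact_continuous_bound[OF K(1) \<phi>'2] unfolding bounded_iff by (metis imageE)
    have "set_integrable lebesgue K u"
      by (rule set_integrable_L2_lmeasurable[OF u lmeasurable_compact[OF K(1)] K(2)])
    from absolutely_integrable_bounded_measurable_product[OF bl m Ks bd this]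
    have "(\<lambda>x. u x *\<^sub>R \<phi>' x) absolutely_integrable_on K" .
    moreover have "(\<lambda>x. indicator K x *\<^sub>R (u x *\<^sub>R \<phi>' x)) = (\<lambda>x. indicator S x *\<^sub>R (u x *\<^sub>R \<phi>' x))"
      using K(2) \<phi>'0 by (auto simp: fun_eq_iff indicator_def)
    ultimately show ?thesis by (simp add: set_integrable_def)
  qed

text \<open>The product of \<open>u\<close> with a test function is Lipschitz with compact support,
  and its gradient \<open>u \<phi>' + \<phi> g\<close> has integral zero; this is the defining
  identity. The Lipschitz condition excludes jumps of \<open>u\<close>, which a gradient almost
  everywhere does not see.\<close>

lemma weak_gradientI:
  fixes u :: "'a::euclidean_space \<Rightarrow> real"
  assumes S: "open S" and u: "u \<in> L2 lebesgue S" and g: "g \<in> L2 lebesgue S"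
    and lip: "\<And>\<phi>. \<phi> \<in> test_functions S \<Longrightarrow> \<exists>L. L-lipschitz_on UNIV (\<lambda>x. u x * \<phi> x)"
    and der: "AE x in lebesgue. x \<in> S \<longrightarrow> (GDERIV u x :> g x)"
  shows "weak_gradient S u g"
  unfolding weak_gradient_def
proof (intro ballI allI impI)
  fix \<phi> :: "'a \<Rightarrow> real" and \<phi>' assume \<phi>: "\<phi> \<in> test_functions S" and \<phi>': "\<forall>x. GDERIV \<phi> x :> \<phi>' x"
  obtain \<psi> B K where \<psi>: "\<And>x. GDERIV \<phi> x :> \<psi> x" "continuous_on UNIV \<psi>" "compact K" "K \<subseteq> S"
    "\<And>x. x \<notin> K \<Longrightarrow> \<phi> x = 0" "\<And>x. x \<notin> K \<Longrightarrow> \<psi> x = 0" "\<And>x. norm (\<psi> x) \<le> B"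
    using test_functions_bounded_gradient[OF \<phi>] by metis
  have "\<phi>' = \<psi>" using \<phi>' \<psi>(1) GDERIV_unique by blast
  with \<psi> have \<phi>'2: "continuous_on UNIV \<phi>'" "\<And>x. x \<notin> K \<Longrightarrow> \<phi>' x = 0" "\<And>x. norm (\<phi>' x) \<le> B"
    by auto
  note K = \<psi>(3,4,5)
  obtain L where L: "L-lipschitz_on UNIV (\<lambda>x. u x * \<phi> x)" using lip[OF \<phi>] by blast
  have i1: "set_integrable lebesgue S (\<lambda>x. u x *\<^sub>R \<phi>' x)"
    by (rule set_integrable_L2_scaleR_compact_support[OF u \<phi>'2(1) K(1,2) \<phi>'2(2)])
  have i2: "set_integrable lebesgue S (\<lambda>x. \<phi> x *\<^sub>R g x)"
    by (rule set_integrable_test_L2[OF g \<phi>])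
  note i = set_integral_add[OF i1 i2]
  let ?F' = "\<lambda>x. indicator S x *\<^sub>R (u x *\<^sub>R \<phi>' x + \<phi> x *\<^sub>R g x)"
  have "(\<integral>x. ?F' x \<bullet> b \<partial>lebesgue) = 0" for b
  proof (rule integral_gradient_eq_0[OF L])
    show "bounded K" using K by (simp add: compact_imp_bounded)
    show "AE x in lebesgue. GDERIV (\<lambda>x. u x * \<phi> x) x :> ?F' x"
      using der
    proof eventually_elim
      case (elim x)
      show ?case
      proof (cases "x \<in> S")
        case True
        then show ?thesis using elim GDERIV_mult[of u x "g x" \<phi> "\<phi>' x"] \<phi>' by simp
      next
        \<comment> \<open>Off \<open>S\<close> the compact support of the test function stays away
          from \<open>x\<close>, so the product vanishes near \<open>x\<close>.\<close>
        case False
        have "((\<lambda>x. 0) has_derivative (\<lambda>h. h \<bullet> 0)) (at x)" by simp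
        then have "GDERIV (\<lambda>x. u x * \<phi> x) x :> 0"
          unfolding gderiv_def
          by (rule has_derivative_transform_within_open[where s = "- K"])
             (use False K in \<open>auto simp: compact_imp_closed\<close>)
        then show ?thesis using False by simp
      qed
    qed
    show "?F' \<in> borel_measurable lebesgue"
      using i(1) by (simp add: set_integrable_def)
  qed (use K in auto)
  then have "(\<integral>x. ?F' x \<partial>lebesgue) \<bullet> b = 0" for b
    using i(1) unfolding set_integrable_def by (subst integral_inner_left[symmetric]) auto
  then have "(\<integral>x. ?F' x \<partial>lebesgue) = 0"
    using inner_eq_zero_iff by blast
  then show "(LINT x:S|lebesgue. u x *\<^sub>R \<phi>' x) = - (LINT x:S|lebesgue. \<phi> x *\<^sub>R g x)"
    using i(2) unfolding set_lebesgue_integral_def by (simp add: eq_neg_iff_add_eq_0)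
qed

lemma L2_bounded:
  assumes "S \<in> fmeasurable M" "set_borel_measurable M S f" "\<And>x. x \<in> S \<Longrightarrow> norm (f x) \<le> B"
  shows "f \<in> L2 M S"
proof -
  have "set_integrable M S (\<lambda>x. (norm (f x))\<^sup>2)"
    unfolding set_integrable_def
  proof (rule Bochner_Integration.integrable_bound[where f = "\<lambda>x. B\<^sup>2 * indicator S x"])
    show "integrable M (\<lambda>x. B\<^sup>2 * indicator S x)"
      using assms(1) by (intro integrable_mult_right integrable_real_indicator) (auto simp: fmeasurable_def)
    have "(\<lambda>x. (norm (indicator S x *\<^sub>R f x))\<^sup>2) \<in> borel_measurable M"
      using assms(2) unfolding set_borel_measurable_def by measurable
    then show "(\<lambda>x. indicator S x *\<^sub>R (norm (f x))\<^sup>2) \<in> borel_measurable M"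
      by (rule measurable_cong[THEN iffD1, rotated]) (auto simp: indicator_def)
    show "AE x in M. norm (indicator S x *\<^sub>R (norm (f x))\<^sup>2) \<le> norm (B\<^sup>2 * indicator S x)"
      using assms(3) by (intro AE_I2) (auto simp: indicator_def intro!: power_mono)
  qed
  with assms(2) show ?thesis by (simp add: L2_def)
qed

text \<open>Along a segment the cover becomes a cover of an interval by finitely many closed sets,
  where Lipschitz bounds can be glued; the constant stays \<open>L\<close> because only distances
  along the segment are used.\<close>

lemma lipschitz_on_closed_cover:
  fixes F :: "'a::euclidean_space \<Rightarrow> real"
  assumes "finite \<C>" "\<And>C. C \<in> \<C> \<Longrightarrow> closed C" "\<And>C. C \<in> \<C> \<Longrightarrow> L-lipschitz_on C F" "\<Union>\<C> = UNIV"
  shows "L-lipschitz_on UNIV F"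
proof (rule lipschitz_onI)
  show L0: "L \<ge> 0"
    using assms(3,4) lipschitz_on_nonneg by (metis UNIV_I UnionE)
  fix x y :: 'a
  let ?p = "\<lambda>t. x + t *\<^sub>R (y - x)"
  have "(L * dist x y)-lipschitz_on {0..1} (\<lambda>t. F (?p t))"
  proof (rule lipschitz_on_closed_Union[where I = \<C> and U = "\<lambda>C. {t. ?p t \<in> C}"])
    fix C assume C: "C \<in> \<C>"
    show "(L * dist x y)-lipschitz_on {t. ?p t \<in> C} (\<lambda>t. F (?p t))"
    proof (rule lipschitz_onI)
      fix s t assume "s \<in> {t. ?p t \<in> C}" "t \<in> {t. ?p t \<in> C}"
      then have "dist (F (?p s)) (F (?p t)) \<le> L * dist (?p s) (?p t)"
        using lipschitz_onD[OF assms(3)[OF C], of "?p s" "?p t"] by simp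
      also have "dist (?p s) (?p t) = dist s t * dist x y"
        by (simp add: dist_norm flip: scaleR_diff_left) (simp add: norm_minus_commute)
      finally show "dist (F (?p s)) (F (?p t)) \<le> L * dist x y * dist s t" by (simp add: ac_simps)
    qed (use L0 in auto)
    show "closed {t. ?p t \<in> C}"
      using continuous_closed_vimage[OF assms(2)[OF C], of ?p] by (auto simp: vimage_def intro: continuous_intros)
  qed (use assms L0 in auto)
  from lipschitz_onD[OF this, of 0 1] show "dist (F x) (F y) \<le> L * dist x y" by simp
qed

text \<open>Continuity across the pieces is contained in the hypothesis, since a single function
  \<open>u\<close> is affine on each closed piece. Its product with a test function is thus
  Lipschitz on each piece and on the complement of \<open>S\<close>, where it vanishes, and these
  closed sets cover the space.\<close>

lemma weak_gradient_piecewise_affine: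
  fixes u :: "'a::euclidean_space \<Rightarrow> real"
  assumes S: "open S" and u: "u \<in> L2 lebesgue S" and g: "g \<in> L2 lebesgue S"
    and T: "finite \<T>" "\<And>T. T \<in> \<T> \<Longrightarrow> compact T" "\<And>T. T \<in> \<T> \<Longrightarrow> negligible (frontier T)" "S \<subseteq> \<Union>\<T>"
    and aff: "\<And>T x. T \<in> \<T> \<Longrightarrow> x \<in> T \<Longrightarrow> u x = a T \<bullet> x + b T"
    and ga: "\<And>T x. T \<in> \<T> \<Longrightarrow> x \<in> interior T \<Longrightarrow> g x = a T"
  shows "weak_gradient S u g"
proof (rule weak_gradientI[OF S u g])
  fix \<phi> assume \<phi>: "\<phi> \<in> test_functions S"
  obtain \<phi>' B where B: "\<And>x. \<bar>\<phi> x\<bar> \<le> B" "B-lipschitz_on UNIV \<phi>"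
    using test_functions_bounded_gradient[OF \<phi>] by metis
  have B0: "B \<ge> 0" using B(2) by (rule lipschitz_on_nonneg)
  have "\<exists>M. \<forall>x\<in>T. \<bar>u x\<bar> \<le> M" if "T \<in> \<T>" for T
  proof -
    have "compact ((\<lambda>x. a T \<bullet> x + b T) ` T)"
      using T(2)[OF that] by (intro compact_continuous_image continuous_intros)
    then have "bounded ((\<lambda>x. a T \<bullet> x + b T) ` T)" by (rule compact_imp_bounded)
    then obtain M where "\<forall>y\<in>(\<lambda>x. a T \<bullet> x + b T) ` T. norm y \<le> M" unfolding bounded_iff by blast
    then show ?thesis
      using aff[OF that] by (intro exI[of _ M]) auto
  qed
  then obtain M where M: "\<And>T x. T \<in> \<T> \<Longrightarrow> x \<in> T \<Longrightarrow> \<bar>u x\<bar> \<le> M T" by metis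
  \<comment> \<open>On a piece the product rule gives sup |u| times the Lipschitz constant of the
    test function plus the slope of \<open>u\<close> times the sup of the test function;
    \<open>B\<close> bounds both of the latter. The sum over the pieces dominates each single
    constant.\<close>
  define L where "L = (\<Sum>T\<in>\<T>. \<bar>M T\<bar> * B + norm (a T) * B)"
  have L0: "L \<ge> 0" unfolding L_def using B0 by (intro sum_nonneg) auto
  have "L-lipschitz_on UNIV (\<lambda>x. u x * \<phi> x)"
  proof (rule lipschitz_on_closed_cover[where \<C> = "insert (- S) \<T>"])
    fix C assume "C \<in> insert (- S) \<T>"
    then consider "C = - S" | "C \<in> \<T>" by blast
    then show "L-lipschitz_on C (\<lambda>x. u x * \<phi> x)"
    proof cases
      case 1
      have "\<phi> x = 0" if "x \<notin> S" for x
        using \<phi> that closure_subset[of "{x. \<phi> x \<noteq> 0}"] by (auto simp: test_functions_def)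
      then show ?thesis using 1 L0 by (intro lipschitz_onI) auto
    next
      case 2
      have LC: "\<bar>M C\<bar> * B + norm (a C) * B \<le> L"
        unfolding L_def using B0 2 T(1) by (intro member_le_sum[where f = "\<lambda>T. \<bar>M T\<bar> * B + norm (a T) * B"]) auto
      show ?thesis
      proof (rule lipschitz_onI[OF _ L0])
        fix x y assume xy: "x \<in> C" "y \<in> C"
        have "u x * \<phi> x - u y * \<phi> y = u x * (\<phi> x - \<phi> y) + (u x - u y) * \<phi> y"
          by (simp add: algebra_simps)
        also have "\<bar>\<dots>\<bar> \<le> \<bar>u x\<bar> * \<bar>\<phi> x - \<phi> y\<bar> + \<bar>u x - u y\<bar> * \<bar>\<phi> y\<bar>"
          by (metis abs_mult abs_triangle_ineq)
        also have "\<dots> \<le> \<bar>M C\<bar> * (B * dist x y) + (norm (a C) * dist x y) * B"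
        proof (intro add_mono mult_mono)
          show "\<bar>u x\<bar> \<le> \<bar>M C\<bar>" using M[OF 2 xy(1)] by simp
          show "\<bar>\<phi> x - \<phi> y\<bar> \<le> B * dist x y" using lipschitz_onD[OF B(2), of x y] by (simp add: dist_real_def)
          have "u x - u y = a C \<bullet> (x - y)" using aff[OF 2 xy(1)] aff[OF 2 xy(2)] by (simp add: inner_diff_right)
          then show "\<bar>u x - u y\<bar> \<le> norm (a C) * dist x y" by (simp add: Cauchy_Schwarz_ineq2 dist_norm)
          show "\<bar>\<phi> y\<bar> \<le> B" using B by simp
        qed auto
        also have "\<dots> = (\<bar>M C\<bar> * B + norm (a C) * B) * dist x y" by (simp add: algebra_simps)
        also have "\<dots> \<le> L * dist x y" using LC by (intro mult_right_mono) auto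
        finally show "dist (u x * \<phi> x) (u y * \<phi> y) \<le> L * dist x y" by (simp add: dist_real_def)
      qed
    qed
  qed (use T S in \<open>auto intro: compact_imp_closed\<close>)
  then show "\<exists>L. L-lipschitz_on UNIV (\<lambda>x. u x * \<phi> x)" by blast
next
  have "AE x in lebesgue. \<forall>T\<in>\<T>. x \<notin> frontier T"
    using T(1,3) by (intro AE_ball_countable[THEN iffD2] ballI AE_not_in countable_finite)
      (auto simp: negligible_iff_null_sets)
  then show "AE x in lebesgue. x \<in> S \<longrightarrow> (GDERIV u x :> g x)"
  proof eventually_elim
    case (elim x)
    show ?case
    proof
      assume "x \<in> S"
      then obtain T where T': "T \<in> \<T>" "x \<in> T" using T(4) by blast
      with elim have x: "x \<in> interior T"
        unfolding frontier_def using closure_subset[of T] by blast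
      have "((\<lambda>x. a T \<bullet> x + b T) has_derivative (\<lambda>h. h \<bullet> a T)) (at x)"
        by (auto intro!: derivative_eq_intros simp: inner_commute)
      then have "(u has_derivative (\<lambda>h. h \<bullet> a T)) (at x)"
        by (rule has_derivative_transform_within_open[OF _ open_interior x])
           (use aff[OF T'(1)] interior_subset[of T] in auto)
      then show "GDERIV u x :> g x"
        using ga[OF T'(1) x] by (simp add: gderiv_def)
    qed
  qed
qed

lemma weak_gradient_test_function:
  assumes S: "open S" and \<phi>: "\<phi> \<in> test_functions T" and \<phi>': "\<And>x. GDERIV \<phi> x :> \<phi>' x"
  shows "\<phi> \<in> L2 lebesgue S" "\<phi>' \<in> L2 lebesgue S" "weak_gradient S \<phi> \<phi>'"
proof -
  obtain \<psi> B K where \<psi>: "\<And>x. GDERIV \<phi> x :> \<psi> x" "continuous_on UNIV \<psi>" "compact K"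
    "\<And>x. x \<notin> K \<Longrightarrow> \<phi> x = 0" "\<And>x. x \<notin> K \<Longrightarrow> \<psi> x = 0" "\<And>x. norm (\<psi> x) \<le> B" "\<And>x. \<bar>\<phi> x\<bar> \<le> B"
    "B-lipschitz_on UNIV \<phi>"
    using test_functions_bounded_gradient[OF \<phi>] by metis
  have "\<phi>' = \<psi>" using \<phi>' \<psi>(1) GDERIV_unique by blast
  note \<psi> = \<psi>[folded this]
  note K = \<psi>(3)
  have L2: "f \<in> L2 lebesgue S" if "continuous_on UNIV f" "\<And>x. x \<notin> K \<Longrightarrow> f x = 0" "\<And>x. norm (f x) \<le> B"
    for f :: "'a \<Rightarrow> 'b::euclidean_space"
  proof -
    have KS: "K \<inter> S \<in> fmeasurable lebesgue"
      using K S by (intro fmeasurable_Int_fmeasurable) (auto simp: lmeasurable_compact)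
    have fm: "f \<in> borel_measurable lebesgue"
      using that(1) by (intro measurable_completion) (simp add: borel_measurable_continuous_onI)
    have "f \<in> L2 lebesgue (K \<inter> S)"
      unfolding L2_def[symmetric] using that(3) fm KS by (intro L2_bounded[OF KS, of _ B])
        (auto simp: set_borel_measurable_def fmeasurableD intro!: borel_measurable_scaleR borel_measurable_indicator)
    moreover have "(\<lambda>x. indicator (K \<inter> S) x *\<^sub>R f x) = (\<lambda>x. indicator S x *\<^sub>R f x)"
      "(\<lambda>x. indicator (K \<inter> S) x *\<^sub>R (norm (f x))\<^sup>2) = (\<lambda>x. indicator S x *\<^sub>R (norm (f x))\<^sup>2)"
      using that(2) by (auto simp: fun_eq_iff indicator_def)
    ultimately show ?thesis
      by (simp add: L2_def set_borel_measurable_def set_integrable_def)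
  qed
  show u: "\<phi> \<in> L2 lebesgue S"
    using \<psi>(4,7) by (intro L2 test_functions_continuous[OF \<phi>]) auto
  show g: "\<phi>' \<in> L2 lebesgue S"
    using \<psi> by (intro L2) auto
  show "weak_gradient S \<phi> \<phi>'"
  proof (rule weak_gradientI[OF S u g])
    fix \<eta> assume \<eta>: "\<eta> \<in> test_functions S"
    obtain B2 where B2: "\<And>x. \<bar>\<eta> x\<bar> \<le> B2" "B2-lipschitz_on UNIV \<eta>"
      using test_functions_bounded_gradient[OF \<eta>] by metis
    have B0: "B \<ge> 0" "B2 \<ge> 0" using \<psi>(8) B2(2) lipschitz_on_nonneg by auto
    have "(2 * B * B2)-lipschitz_on UNIV (\<lambda>x. \<phi> x * \<eta> x)"
    proof (rule lipschitz_onI)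
      fix x y
      have "\<phi> x * \<eta> x - \<phi> y * \<eta> y = \<phi> x * (\<eta> x - \<eta> y) + (\<phi> x - \<phi> y) * \<eta> y"
        by (simp add: algebra_simps)
      also have "\<bar>\<dots>\<bar> \<le> \<bar>\<phi> x\<bar> * \<bar>\<eta> x - \<eta> y\<bar> + \<bar>\<phi> x - \<phi> y\<bar> * \<bar>\<eta> y\<bar>"
        by (metis abs_mult abs_triangle_ineq)
      also have "\<dots> \<le> B * (B2 * dist x y) + (B * dist x y) * B2"
        using lipschitz_onD[OF B2(2), of x y] lipschitz_onD[OF \<psi>(8), of x y]
        by (intro add_mono mult_mono) (use B0 \<psi>(7) B2(1) in \<open>auto simp: dist_real_def\<close>)
      finally show "dist (\<phi> x * \<eta> x) (\<phi> y * \<eta> y) \<le> 2 * B * B2 * dist x y" by (simp add: dist_real_def algebra_simps)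
    qed (use B0 in auto)
    then show "\<exists>L. L-lipschitz_on UNIV (\<lambda>x. \<phi> x * \<eta> x)" by blast
  qed (use \<phi>' in auto)
qed

subsection \<open>Barycentric coordinates of a simplex\<close>

definition vertices :: "'a::euclidean_space set \<Rightarrow> 'a set" where
  "vertices T = {p. p extreme_point_of T}"

text \<open>The gradient of the barycentric coordinate of \<open>p\<close>, which drops from 1 at
  \<open>p\<close> to 0 at every other vertex. On a full simplex these conditions determine
  it.\<close>

definition bgrad :: "'a::euclidean_space set \<Rightarrow> 'a \<Rightarrow> 'a" where
  "bgrad T p = (SOME a. \<forall>q\<in>vertices T. q \<noteq> p \<longrightarrow> a \<bullet> (q - p) = - 1)"

definition bary :: "'a::euclidean_space set \<Rightarrow> 'a \<Rightarrow> 'a \<Rightarrow> real" where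
  "bary T p x = 1 + bgrad T p \<bullet> (x - p)"

lemma bary_affine: "bary T p x = bgrad T p \<bullet> x + (1 - bgrad T p \<bullet> p)"
  by (simp add: bary_def inner_diff_right)

lemma bary_diff: "bary T p x - bary T p y = bgrad T p \<bullet> (x - y)"
  by (simp add: bary_def inner_diff_right)

lemma bary_sum_eq:
  assumes "(\<Sum>q\<in>Q. u q) = 1"
  shows "bary T p (\<Sum>q\<in>Q. u q *\<^sub>R q) = (\<Sum>q\<in>Q. u q * bary T p q)"
proof -
  have "(\<Sum>q\<in>Q. u q * bary T p q) = (\<Sum>q\<in>Q. u q * (bgrad T p \<bullet> q)) + (\<Sum>q\<in>Q. u q) * (1 - bgrad T p \<bullet> p)"
    by (simp add: bary_affine distrib_left sum.distrib sum_distrib_right)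
  then show ?thesis
    using assms by (simp add: bary_affine inner_sum_right)
qed

lemma simplex_vertices:
  assumes "n simplex T"
  shows "finite (vertices T)" "int (card (vertices T)) = n + 1" "\<not> affine_dependent (vertices T)"
    "T = convex hull vertices T"
proof -
  obtain C where C: "\<not> affine_dependent C" "int (card C) = n + 1" "T = convex hull C"
    using assms by (auto simp: simplex_def)
  then have "vertices T = C"
    by (auto simp: vertices_def extreme_point_of_convex_hull_affine_independent)
  with C show "finite (vertices T)" "int (card (vertices T)) = n + 1" "\<not> affine_dependent (vertices T)"
    "T = convex hull vertices T" by (auto simp: aff_independent_finite)
qed

locale full_simplex =
  fixes T :: "'a::euclidean_space set"
  assumes simplex: "int DIM('a) simplex T"
begin

lemmas vs = simplex_vertices[OF simplex]

lemma card_vertices: "card (vertices T) = Suc DIM('a)"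
  using vs(2) by simp

text \<open>The vectors \<open>q - p\<close> are linearly independent, so some linear functional
  takes the value -1 on all of them; its adjoint at 1 represents it as an inner product and
  witnesses the \<open>SOME\<close>.\<close>

lemma bary_vertex:
  assumes p: "p \<in> vertices T" and q: "q \<in> vertices T"
  shows "bary T p q = (if q = p then 1 else 0)"
proof -
  let ?B = "(\<lambda>x. - p + x) ` (vertices T - {p})"
  have "independent ?B"
    using vs(3) affine_dependent_iff_dependent2[OF p] by simp
  then obtain g :: "'a \<Rightarrow> real" where g: "linear g" "\<forall>x\<in>?B. g x = -1"
    using linear_independent_extend[of ?B "\<lambda>_. -1"] by blast
  have "adjoint g 1 \<bullet> (q - p) = -1" if "q \<in> vertices T" "q \<noteq> p" for q
  proof -
    have "adjoint g 1 \<bullet> (q - p) = g (q - p)"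
      using adjoint_works[OF g(1), of "q - p" 1] by (simp add: inner_commute)
    also have "\<dots> = -1" using g(2) that by auto
    finally show ?thesis .
  qed
  then have "\<forall>q\<in>vertices T. q \<noteq> p \<longrightarrow> bgrad T p \<bullet> (q - p) = - 1"
    unfolding bgrad_def by (intro someI[of "\<lambda>a. \<forall>q\<in>vertices T. q \<noteq> p \<longrightarrow> a \<bullet> (q - p) = - 1" "adjoint g 1"]) auto
  then show ?thesis using q by (auto simp: bary_def)
qed

lemma bary_combination:
  assumes "(\<Sum>q\<in>vertices T. u q) = 1" "p \<in> vertices T"
  shows "bary T p (\<Sum>q\<in>vertices T. u q *\<^sub>R q) = u p"
proof -
  have "bary T p (\<Sum>q\<in>vertices T. u q *\<^sub>R q) = (\<Sum>q\<in>vertices T. u q * bary T p q)"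
    by (rule bary_sum_eq[OF assms(1)])
  also have "\<dots> = (\<Sum>q\<in>vertices T. if q = p then u q else 0)"
    by (intro sum.cong) (auto simp: bary_vertex[OF assms(2)])
  finally show ?thesis using vs(1) assms(2) by simp
qed

lemma bary_sums: "(\<Sum>p\<in>vertices T. bary T p x) = 1" "(\<Sum>p\<in>vertices T. bary T p x *\<^sub>R p) = x"
proof -
  have "affine hull (vertices T) = UNIV"
    by (rule affine_independent_span_eq[OF vs(3) card_vertices])
  then have "x \<in> affine hull (vertices T)" by simp
  then obtain u where u: "sum u (vertices T) = 1" "x = (\<Sum>q\<in>vertices T. u q *\<^sub>R q)"
    unfolding affine_hull_finite[OF vs(1)] by auto
  have "bary T p x = u p" if "p \<in> vertices T" for p
    unfolding u(2) by (rule bary_combination[OF u(1) that])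
  then show "(\<Sum>p\<in>vertices T. bary T p x) = 1" "(\<Sum>p\<in>vertices T. bary T p x *\<^sub>R p) = x"
    using u by simp_all
qed

lemma mem_iff_bary: "x \<in> T \<longleftrightarrow> (\<forall>p\<in>vertices T. bary T p x \<ge> 0)"
proof
  assume "x \<in> T"
  then have "x \<in> convex hull (vertices T)" using vs(4) by simp
  then obtain u where u: "\<forall>q\<in>vertices T. 0 \<le> u q" "sum u (vertices T) = 1" "x = (\<Sum>q\<in>vertices T. u q *\<^sub>R q)"
    unfolding convex_hull_finite[OF vs(1)] by auto
  then show "\<forall>p\<in>vertices T. bary T p x \<ge> 0"
    using bary_combination[OF u(2)] by simp
next
  assume *: "\<forall>p\<in>vertices T. bary T p x \<ge> 0"
  then have "x \<in> convex hull (vertices T)"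
    unfolding convex_hull_finite[OF vs(1)] using bary_sums[of x] by (intro CollectI exI[of _ "\<lambda>p. bary T p x"]) auto
  then show "x \<in> T" using vs(4) by simp
qed

lemma bary_le_1: "x \<in> T \<Longrightarrow> p \<in> vertices T \<Longrightarrow> bary T p x \<le> 1"
  using bary_sums(1)[of x] mem_iff_bary[of x] vs(1)
    member_le_sum[of p "vertices T" "\<lambda>p. bary T p x"] by auto

lemma face_vertices:
  assumes "F face_of T"
  shows "vertices F \<subseteq> vertices T" "F = convex hull vertices F"
    and "x \<in> F \<Longrightarrow> p \<in> vertices T \<Longrightarrow> p \<notin> vertices F \<Longrightarrow> bary T p x = 0"
proof -
  obtain c where c: "c \<subseteq> vertices T" "F = convex hull c"
    using assms face_of_convex_hull_affine_independent[OF vs(3)] vs(4) by metis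
  have ind: "\<not> affine_dependent c" using c(1) vs(3) affine_dependent_subset by blast
  have vF: "vertices F = c"
    using ind c(2) by (auto simp: vertices_def extreme_point_of_convex_hull_affine_independent)
  then show "vertices F \<subseteq> vertices T" "F = convex hull vertices F" using c by auto
  assume x: "x \<in> F" "p \<in> vertices T" "p \<notin> vertices F"
  obtain u where u: "sum u c = 1" "x = (\<Sum>q\<in>c. u q *\<^sub>R q)"
    using x(1) c convex_hull_finite[OF finite_subset[OF c(1) vs(1)]] by auto
  have "bary T p x = (\<Sum>q\<in>c. u q * bary T p q)"
    unfolding u(2) by (rule bary_sum_eq[OF u(1)])
  also have "\<dots> = 0"
  proof (intro sum.neutral ballI)
    fix q assume "q \<in> c"
    then have "q \<in> vertices T" "q \<noteq> p" using c(1) vF x(3) by auto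
    then show "u q * bary T p q = 0" using bary_vertex[OF x(2)] by simp
  qed
  finally show "bary T p x = 0" .
qed

lemma vertices_subset: "vertices T \<subseteq> T"
  by (auto simp: vertices_def extreme_point_of_def)

lemma bgrad_nonzero:
  assumes "p \<in> vertices T" shows "bgrad T p \<noteq> 0"
proof
  assume 0: "bgrad T p = 0"
  have "vertices T \<noteq> {p}" using card_vertices by auto
  then obtain q where "q \<in> vertices T" "q \<noteq> p" using assms by blast
  then show False using bary_vertex[OF assms, of q] 0 by (simp add: bary_def)
qed

lemma sum_bgrad: "(\<Sum>p\<in>vertices T. bgrad T p) = 0"
proof -
  have "(\<Sum>p\<in>vertices T. bgrad T p) \<bullet> h = 0" for h
    using bary_sums(1)[of h] bary_sums(1)[of 0]
    by (simp add: bary_affine inner_sum_left sum.distrib)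
  then show ?thesis using inner_eq_zero_iff by blast
qed

lemma compact_simplex: "compact T"
  using vs(1,4) finite_imp_compact_convex_hull by metis

lemma convex_simplex: "convex T"
  using vs(4) convex_convex_hull by metis

text \<open>\<open>bary T p c / norm (bgrad T p)\<close> is the signed distance of \<open>c\<close>
  from the facet opposite \<open>p\<close>; a ball lies in \<open>T\<close> as soon as its radius is
  at most each of these distances.\<close>

lemma cball_subset:
  assumes "\<And>p. p \<in> vertices T \<Longrightarrow> r * norm (bgrad T p) \<le> bary T p c"
  shows "cball c r \<subseteq> T"
proof
  fix x assume "x \<in> cball c r"
  then have "norm (x - c) \<le> r" by (simp add: dist_norm norm_minus_commute)
  have "bary T p x \<ge> 0" if "p \<in> vertices T" for p
  proof -
    have "- (bgrad T p \<bullet> (x - c)) \<le> norm (bgrad T p) * norm (x - c)"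
      using Cauchy_Schwarz_ineq2[of "bgrad T p" "x - c"] by simp
    also have "\<dots> \<le> norm (bgrad T p) * r" using \<open>norm (x - c) \<le> r\<close> by (intro mult_left_mono) auto
    finally show ?thesis using assms[OF that] bary_diff[of T p x c] by (simp add: mult.commute)
  qed
  then show "x \<in> T" using mem_iff_bary by blast
qed

text \<open>The point of the ball that lies farthest towards the facet opposite \<open>p\<close>
  still has a nonnegative coordinate.\<close>

lemma bary_ge_of_cball_subset:
  assumes "cball c r \<subseteq> T" "r \<ge> 0" "p \<in> vertices T"
  shows "r * norm (bgrad T p) \<le> bary T p c"
proof -
  let ?x = "c - r *\<^sub>R sgn (bgrad T p)"
  have "?x \<in> cball c r" using assms(2) by (auto simp: dist_norm norm_sgn)
  then have "bary T p ?x \<ge> 0" using assms mem_iff_bary by blast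
  moreover have "bgrad T p \<bullet> sgn (bgrad T p) = norm (bgrad T p)"
    using bgrad_nonzero[OF assms(3)] by (simp add: sgn_div_norm flip: power2_norm_eq_inner) (simp add: power2_eq_square)
  ultimately show ?thesis using bary_diff[of T p ?x c] by simp
qed

text \<open>A point at the same distance r from all facets has the barycentric coordinates
  \<open>r * norm (bgrad T p)\<close>; that they add up to 1 determines r.\<close>

definition inradius :: real where "inradius = 1 / (\<Sum>p\<in>vertices T. norm (bgrad T p))"

lemma vertices_nonempty: "vertices T \<noteq> {}"
  using card_vertices by auto

lemma inradius_pos: "inradius > 0"
  unfolding inradius_def using bgrad_nonzero vs(1) vertices_nonempty by (auto intro!: divide_pos_pos sum_pos)

lemma inradius_sum: "inradius * (\<Sum>p\<in>vertices T. norm (bgrad T p)) = 1"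
  using inradius_pos unfolding inradius_def by auto

lemma norm_bgrad_le:
  assumes "p \<in> vertices T" shows "norm (bgrad T p) \<le> 1 / inradius"
  using assms vs(1) unfolding inradius_def by (auto intro: member_le_sum)

definition incenter :: 'a where "incenter = (\<Sum>p\<in>vertices T. (inradius * norm (bgrad T p)) *\<^sub>R p)"

lemma bary_incenter:
  assumes "p \<in> vertices T" shows "bary T p incenter = inradius * norm (bgrad T p)"
  unfolding incenter_def using inradius_sum by (intro bary_combination assms) (simp add: sum_distrib_left)

lemma cball_incenter: "cball incenter inradius \<subseteq> T"
  by (rule cball_subset) (simp add: bary_incenter)

lemma measure_lower: "unit_ball_vol (real DIM('a)) * inradius ^ DIM('a) \<le> measure lebesgue T"
proof -
  have "measure lebesgue (cball incenter inradius) \<le> measure lebesgue T"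
    using cball_incenter by (intro measure_mono_fmeasurable) (auto simp: lmeasurable_compact[OF compact_simplex])
  then show ?thesis
    using content_cball[of inradius incenter] inradius_pos by simp
qed

end

section \<open>Triangles: their edges and the inscribed circle\<close>

locale triangle = full_simplex T for T :: "pt set"
begin

lemma card3: "card (vertices T) = 3"
  using card_vertices by simp

lemma edge_iff: "E edge_of T \<longleftrightarrow> (\<exists>p\<in>vertices T. E = convex hull (vertices T - {p}))"
proof
  assume E: "E edge_of T"
  have F: "E face_of T" "aff_dim E = 1" using E by (auto simp: edge_of_def)
  let ?c = "vertices E"
  have c: "?c \<subseteq> vertices T" "E = convex hull ?c" using face_vertices[OF F(1)] by auto
  have ind: "\<not> affine_dependent ?c" using c(1) vs(3) affine_dependent_subset by blast
  have "aff_dim E = aff_dim ?c" by (subst c(2)) (rule aff_dim_convex_hull)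
  then have "card ?c = 2" using F(2) aff_dim_affine_independent[OF ind] by simp
  then have "card (vertices T - ?c) = 1" using c(1) card3 vs(1) by (simp add: card_Diff_subset finite_subset)
  then obtain p where "vertices T - ?c = {p}" using card_1_singletonE by blast
  then have "p \<in> vertices T" "?c = vertices T - {p}" using c(1) by blast+
  then show "\<exists>p\<in>vertices T. E = convex hull (vertices T - {p})" using c(2) by metis
next
  assume "\<exists>p\<in>vertices T. E = convex hull (vertices T - {p})"
  then obtain p where p: "p \<in> vertices T" "E = convex hull (vertices T - {p})" by blast
  have "E face_of T"
    using face_of_convex_hull_affine_independent[OF vs(3)] vs(4) p(2) by (metis Diff_subset)
  moreover have "aff_dim E = 1"
  proof -
    have ind: "\<not> affine_dependent (vertices T - {p})" using vs(3) affine_dependent_subset by blast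
    show ?thesis
      unfolding p(2) aff_dim_convex_hull using aff_dim_affine_independent[OF ind] p(1) card3 vs(1) by simp
  qed
  ultimately show "E edge_of T" by (simp add: edge_of_def)
qed

lemma edge_obtain:
  assumes "E edge_of T"
  obtains a b c where "vertices T = {a, b, c}" "a \<noteq> b" "a \<noteq> c" "b \<noteq> c" "E = closed_segment a b"
proof -
  obtain c where c: "c \<in> vertices T" "E = convex hull (vertices T - {c})" using assms edge_iff by blast
  have "card (vertices T - {c}) = 2" using c card3 by simp
  then obtain a b where "vertices T - {c} = {a, b}" "a \<noteq> b" by (meson card_2_iff)
  with c have "vertices T = {a, b, c}" "a \<noteq> c" "b \<noteq> c" by blast+
  then show ?thesis
    using that \<open>a \<noteq> b\<close> c(2) \<open>vertices T - {c} = {a, b}\<close> segment_convex_hull by metis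
qed

text \<open>Inclusion of the disk bounds its radius by the distance to each side, and touching a
  side gives the reverse inequality. Conversely, the foot of the perpendicular from \<open>c\<close>
  to a side lies in the disk, hence in \<open>T\<close>, and its vanishing coordinate puts it on
  that side.\<close>

lemma inscribed_circle_iff:
  assumes r: "r > 0"
  shows "inscribed_circle T c r \<longleftrightarrow> (\<forall>p\<in>vertices T. bary T p c = r * norm (bgrad T p))"
proof
  assume ins: "inscribed_circle T c r"
  show "\<forall>p\<in>vertices T. bary T p c = r * norm (bgrad T p)"
  proof
    fix p assume p: "p \<in> vertices T"
    have ge: "r * norm (bgrad T p) \<le> bary T p c"
      using ins r p by (intro bary_ge_of_cball_subset) (auto simp: inscribed_circle_def)
    let ?E = "convex hull (vertices T - {p})"
    have "?E edge_of T" using p edge_iff by blast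
    then have "sphere c r \<inter> ?E \<noteq> {}" using ins unfolding inscribed_circle_def by blast
    then obtain y where y: "y \<in> sphere c r" "y \<in> ?E" by blast
    have "?E face_of T" using \<open>?E edge_of T\<close> by (simp add: edge_of_def)
    moreover have "p \<notin> vertices ?E"
      using extreme_point_of_convex_hull[of p "vertices T - {p}"] by (auto simp: vertices_def)
    ultimately have "bary T p y = 0" using face_vertices(3) y(2) p by blast
    then have "bary T p c = bgrad T p \<bullet> (c - y)" using bary_diff[of T p c y] by simp
    also have "\<dots> \<le> norm (bgrad T p) * norm (c - y)" by (rule norm_cauchy_schwarz)
    also have "\<dots> = r * norm (bgrad T p)" using y(1) by (simp add: dist_norm)
    finally show "bary T p c = r * norm (bgrad T p)" using ge by simp
  qed
next
  assume *: "\<forall>p\<in>vertices T. bary T p c = r * norm (bgrad T p)"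
  have cb: "cball c r \<subseteq> T" using * by (intro cball_subset) auto
  have "sphere c r \<inter> E \<noteq> {}" if "E edge_of T" for E
  proof -
    from that have "\<exists>p\<in>vertices T. E = convex hull (vertices T - {p})" by (simp only: edge_iff)
    then obtain p where p: "p \<in> vertices T" "E = convex hull (vertices T - {p})" by (elim bexE)
    let ?y = "c - r *\<^sub>R sgn (bgrad T p)"
    have s: "?y \<in> sphere c r" using r bgrad_nonzero[OF p(1)] by (simp add: dist_norm norm_sgn)
    then have "?y \<in> T" using cb sphere_cball by blast
    have "bgrad T p \<bullet> sgn (bgrad T p) = norm (bgrad T p)"
      using bgrad_nonzero[OF p(1)] by (simp add: sgn_div_norm flip: power2_norm_eq_inner) (simp add: power2_eq_square)
    then have 0: "bary T p ?y = 0" using bary_diff[of T p ?y c] * p(1) by simp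
    have "(\<Sum>q\<in>vertices T - {p}. bary T q ?y) = 1" "(\<Sum>q\<in>vertices T - {p}. bary T q ?y *\<^sub>R q) = ?y"
      using bary_sums[of ?y] 0 sum.remove[OF vs(1) p(1), of "\<lambda>q. bary T q ?y"] sum.remove[OF vs(1) p(1), of "\<lambda>q. bary T q ?y *\<^sub>R q"]
      by simp_all
    then have "?y \<in> E"
      unfolding p(2) convex_hull_finite[OF finite_Diff[OF vs(1)]] using \<open>?y \<in> T\<close> mem_iff_bary
      by (intro CollectI exI[of _ "\<lambda>q. bary T q ?y"]) auto
    with s show ?thesis by blast
  qed
  with cb r show "inscribed_circle T c r" by (simp add: inscribed_circle_def)
qed

text \<open>Adding the equations of \<open>inscribed_circle_iff\<close> over the vertices fixes the
  radius, which is the uniqueness demanded by \<open>THE\<close>.\<close>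

lemma incircle_diameter_eq: "incircle_diameter T = 2 * inradius"
  unfolding incircle_diameter_def
proof (rule the_equality)
  show "\<exists>c. inscribed_circle T c (2 * inradius / 2)"
    using inscribed_circle_iff[OF inradius_pos] bary_incenter by auto
  fix d assume "\<exists>c. inscribed_circle T c (d / 2)"
  then obtain c where c: "inscribed_circle T c (d / 2)" by blast
  then have "d / 2 > 0" by (simp add: inscribed_circle_def)
  have "1 = (\<Sum>p\<in>vertices T. bary T p c)" by (simp add: bary_sums)
  also have "\<dots> = (\<Sum>p\<in>vertices T. d / 2 * norm (bgrad T p))"
    using c inscribed_circle_iff[OF \<open>d / 2 > 0\<close>] by (intro sum.cong) auto
  also have "\<dots> = d / 2 * (\<Sum>p\<in>vertices T. norm (bgrad T p))" by (simp add: sum_distrib_left)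
  finally have "d / 2 * (\<Sum>p\<in>vertices T. norm (bgrad T p)) = 1" by simp
  then have "d / 2 = inradius" using inradius_sum inradius_pos by (metis mult_cancel_right mult_zero_right zero_neq_one)
  then show "d = 2 * inradius" by simp
qed

end

subsection \<open>Conforming quasi-uniform meshes\<close>

locale mesh =
  fixes \<Omega> :: "pt set" and \<T> :: "pt set set" and \<gamma> H :: real
  assumes dom: "polygonal_domain \<Omega>"
    and conf: "conforming_triangulation \<Omega> \<T>"
    and quasi: "quasi_uniform \<gamma> H \<T>"
begin

lemma open_dom: "open \<Omega>" and bounded_dom: "bounded \<Omega>" and nonempty_dom: "\<Omega> \<noteq> {}"
  using dom by (auto simp: polygonal_domain_def)

lemma negligible_frontier_dom: "negligible (frontier \<Omega>)"
proof -
  obtain S where S: "finite S" "frontier \<Omega> = (\<Union>(a, b)\<in>S. closed_segment a b)"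
    using dom unfolding polygonal_domain_def by blast
  have "negligible (closed_segment a b)" for a b :: pt
    using negligible_convex_interior[of "closed_segment a b"] interior_closed_segment_ge2[of a b] by simp
  then show ?thesis using S by (auto intro!: negligible_Union)
qed

lemma finite_mesh: "finite \<T>"
  using conf by (auto simp: conforming_triangulation_def triangulation_def)

lemma Union_mesh: "\<Union>\<T> = closure \<Omega>"
  using conf by (simp add: conforming_triangulation_def)

lemma dom_subset: "\<Omega> \<subseteq> \<Union>\<T>"
  using Union_mesh closure_subset by auto

lemma mesh_nonempty: "\<T> \<noteq> {}"
  using dom_subset nonempty_dom by blast

lemma tri: "T \<in> \<T> \<Longrightarrow> triangle T"
  using conf by (auto simp: conforming_triangulation_def triangle_def full_simplex_def)

lemma compact_mem: "T \<in> \<T> \<Longrightarrow> compact T"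
  using full_simplex.compact_simplex[OF triangle.axioms[OF tri]] .

lemma convex_mem: "T \<in> \<T> \<Longrightarrow> convex T"
  using full_simplex.convex_simplex[OF triangle.axioms[OF tri]] .

lemma Int_face: "T \<in> \<T> \<Longrightarrow> T' \<in> \<T> \<Longrightarrow> (T \<inter> T') face_of T"
  using conf by (auto simp: conforming_triangulation_def triangulation_def)

lemma Int_face2: "T \<in> \<T> \<Longrightarrow> T' \<in> \<T> \<Longrightarrow> (T \<inter> T') face_of T'"
  using Int_face[of T' T] by (simp add: Int_commute)

text \<open>By quasi-uniformity a common lower bound for the inradii. All lower bounds for lengths,
  determinants and areas are expressed through it.\<close>

definition \<rho> :: real where "\<rho> = H / (2 * \<gamma>)"

lemma inradius_props:
  assumes T: "T \<in> \<T>"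
  shows "\<gamma> > 0" "H > 0" "\<rho> > 0" "\<rho> \<le> full_simplex.inradius T" "2 * full_simplex.inradius T \<le> diameter T" "diameter T \<le> H"
proof -
  interpret triangle T using tri[OF T] .
  have b: "bounded T" using compact_simplex by (rule compact_imp_bounded)
  have "diameter (cball incenter inradius) \<le> diameter T"
    using cball_incenter b by (rule diameter_subset)
  then show d: "2 * inradius \<le> diameter T" using inradius_pos by simp
  show dH: "diameter T \<le> H" using quasi T by (auto simp: quasi_uniform_def)
  then show H: "H > 0" using d inradius_pos by linarith
  have q: "H / (2 * inradius) \<le> \<gamma>"
    using quasi T incircle_diameter_eq by (auto simp: quasi_uniform_def)
  moreover have "H / (2 * inradius) > 0" using H inradius_pos by simp
  ultimately show g: "\<gamma> > 0" by linarith
  then show "\<rho> > 0" using H by (simp add: \<rho>_def)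
  show "\<rho> \<le> inradius" using q g inradius_pos unfolding \<rho>_def by (simp add: field_simps)
qed

lemma params: "\<gamma> > 0" "H > 0" "\<rho> > 0" "2 * \<rho> \<le> H" "H = 2 * \<gamma> * \<rho>" "\<gamma> \<ge> 1"
proof -
  obtain T where T: "T \<in> \<T>" using mesh_nonempty by blast
  note p = inradius_props[OF T]
  then show 1: "\<gamma> > 0" "H > 0" "\<rho> > 0" "2 * \<rho> \<le> H" by linarith+
  show "H = 2 * \<gamma> * \<rho>" using 1 by (simp add: \<rho>_def)
  then have "1 * \<rho> \<le> \<gamma> * \<rho>" using 1 by linarith
  then show "\<gamma> \<ge> 1" using 1 by (simp add: mult_le_cancel_right)
qed

text \<open>An element has diameter at least \<open>2 * \<rho>\<close>, which is H / \<gamma>. The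
  bound later absorbs a surplus factor H.\<close>

lemma H_le: "H \<le> \<gamma> * diameter (closure \<Omega>)"
proof -
  obtain T where T: "T \<in> \<T>" using mesh_nonempty by blast
  have "2 * \<rho> \<le> diameter T" using inradius_props[OF T] by linarith
  also have "\<dots> \<le> diameter (closure \<Omega>)"
    using T Union_mesh bounded_dom by (intro diameter_subset) auto
  finally have "\<gamma> * (2 * \<rho>) \<le> \<gamma> * diameter (closure \<Omega>)" using params by (intro mult_left_mono) auto
  moreover have "\<gamma> * (2 * \<rho>) = H" using params(5) by simp
  ultimately show ?thesis by simp
qed

lemma dist_le: "T \<in> \<T> \<Longrightarrow> x \<in> T \<Longrightarrow> y \<in> T \<Longrightarrow> dist x y \<le> H"
  using diameter_bounded_bound[OF compact_imp_bounded[OF compact_mem], of T x y] inradius_props(6) by force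

lemma norm_bgrad: "T \<in> \<T> \<Longrightarrow> p \<in> vertices T \<Longrightarrow> norm (bgrad T p) \<le> 1 / \<rho>"
proof -
  assume T: "T \<in> \<T>" and p: "p \<in> vertices T"
  interpret triangle T using tri[OF T] .
  have "norm (bgrad T p) \<le> 1 / inradius" using norm_bgrad_le[OF p] .
  also have "\<dots> \<le> 1 / \<rho>" using inradius_props[OF T] by (intro divide_left_mono) auto
  finally show ?thesis .
qed

text \<open>The incircle bounds the area from below and a disk of radius \<open>H\<close> about a
  point of \<open>T\<close> from above; 3 and 4 stand in for pi.\<close>

lemma measure_tri:
  assumes T: "T \<in> \<T>"
  shows "3 * \<rho>\<^sup>2 \<le> measure lebesgue T" "measure lebesgue T \<le> 4 * H\<^sup>2" "T \<in> lmeasurable"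
proof -
  interpret triangle T using tri[OF T] .
  show Tm: "T \<in> lmeasurable" using compact_simplex by (rule lmeasurable_compact)
  have "3 * \<rho>\<^sup>2 \<le> pi * inradius\<^sup>2"
    using inradius_props[OF T] pi_gt3 by (intro mult_mono power_mono) auto
  also have "\<dots> \<le> measure lebesgue T" using measure_lower by (simp add: unit_ball_vol_2 numeral_2_eq_2[symmetric])
  finally show "3 * \<rho>\<^sup>2 \<le> measure lebesgue T" .
  obtain p where p: "p \<in> T" using vertices_nonempty vertices_subset by blast
  have "T \<subseteq> cball p H" using dist_le[OF T p] by auto
  then have "measure lebesgue T \<le> measure lebesgue (cball p H)"
    using Tm by (intro measure_mono_fmeasurable) (auto simp: fmeasurableD)
  also have "\<dots> = pi * H\<^sup>2" using content_cball[of H p] params by (simp add: unit_ball_vol_2)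
  also have "\<dots> \<le> 4 * H\<^sup>2" using pi_less_4 by (intro mult_right_mono) auto
  finally show "measure lebesgue T \<le> 4 * H\<^sup>2" .
qed

section \<open>Nodes and nodal basis functions\<close>

lemma vertices_nodes: "T \<in> \<T> \<Longrightarrow> vertices T \<subseteq> nodes \<T>"
  by (auto simp: vertices_def nodes_def)

lemma node_vertex:
  assumes "N \<in> nodes \<T>" "T \<in> \<T>" "N \<in> T"
  shows "N \<in> vertices T"
proof -
  obtain T0 where T0: "T0 \<in> \<T>" "N extreme_point_of T0" using assms by (auto simp: nodes_def)
  then have "N \<in> T0 \<inter> T" using assms by (auto simp: extreme_point_of_def)
  then have "N extreme_point_of (T0 \<inter> T)"
    using extreme_point_of_face[OF Int_face[OF T0(1) assms(2)]] T0 by blast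
  then show ?thesis
    using extreme_point_of_face[OF Int_face2[OF T0(1) assms(2)]] by (simp add: vertices_def)
qed

lemma vertices_iff: "T \<in> \<T> \<Longrightarrow> vertices T = nodes \<T> \<inter> T"
  using node_vertex vertices_nodes full_simplex.vertices_subset[OF triangle.axioms[OF tri]] by blast

lemma finite_nodes: "finite (nodes \<T>)"
proof -
  have "nodes \<T> = (\<Union>T\<in>\<T>. vertices T)" by (auto simp: nodes_def vertices_def)
  then show ?thesis using finite_mesh full_simplex.vs(1)[OF triangle.axioms[OF tri]] by auto
qed

definition hat :: "pt \<Rightarrow> pt \<Rightarrow> real" where
  "hat N x = (if \<exists>T\<in>\<T>. x \<in> T \<and> N \<in> vertices T then bary (SOME T. T \<in> \<T> \<and> x \<in> T \<and> N \<in> vertices T) N x else 0)"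

text \<open>Two elements meet in a common face, on which a coordinate is determined by its values at
  the vertices of the face; if \<open>N\<close> is not among them, it vanishes there. Hence the
  choice of the element in \<open>hat\<close> does not matter.\<close>

lemma bary_agree:
  assumes T: "T \<in> \<T>" "T' \<in> \<T>" "x \<in> T" "x \<in> T'" and N: "N \<in> vertices T"
  shows "bary T N x = (if N \<in> vertices T' then bary T' N x else 0)"
proof -
  interpret t: triangle T using tri[OF T(1)] .
  interpret t': triangle T' using tri[OF T(2)] .
  have F: "(T \<inter> T') face_of T" "(T \<inter> T') face_of T'" using Int_face Int_face2 T by auto
  show ?thesis
  proof (cases "N \<in> vertices (T \<inter> T')")
    case False
    have "N \<notin> vertices T'"
    proof
      assume "N \<in> vertices T'"
      then have "N \<in> T \<inter> T'" using N t.vertices_subset t'.vertices_subset by blast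
      then have "N \<in> vertices (T \<inter> T')" using extreme_point_of_face[OF F(1)] N by (auto simp: vertices_def)
      with False show False by simp
    qed
    moreover have "bary T N x = 0" using t.face_vertices(3)[OF F(1) _ N False] T by blast
    ultimately show ?thesis by simp
  next
    case True
    let ?c = "vertices (T \<inter> T')"
    have c: "?c \<subseteq> vertices T" "?c \<subseteq> vertices T'" "T \<inter> T' = convex hull ?c"
      using t.face_vertices[OF F(1)] t'.face_vertices[OF F(2)] by auto
    have fc: "finite ?c" using c(1) t.vs(1) finite_subset by blast
    have "x \<in> convex hull ?c" using T c(3) by blast
    then obtain u where u: "sum u ?c = 1" "x = (\<Sum>q\<in>?c. u q *\<^sub>R q)"
      unfolding convex_hull_finite[OF fc] by auto
    have "bary T N x = (\<Sum>q\<in>?c. u q * bary T N q)" "bary T' N x = (\<Sum>q\<in>?c. u q * bary T' N q)"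
      unfolding u(2) using bary_sum_eq[OF u(1)] by auto
    moreover have "bary T N q = bary T' N q" if "q \<in> ?c" for q
      using that c True t.bary_vertex[of N q] t'.bary_vertex[of N q] by (metis subsetD)
    ultimately show ?thesis using True c(2) by (auto intro: sum.cong)
  qed
qed

lemma hat_eq:
  assumes "T \<in> \<T>" "x \<in> T"
  shows "hat N x = (if N \<in> vertices T then bary T N x else 0)"
proof (cases "\<exists>T\<in>\<T>. x \<in> T \<and> N \<in> vertices T")
  case True
  let ?T = "SOME T. T \<in> \<T> \<and> x \<in> T \<and> N \<in> vertices T"
  have "?T \<in> \<T> \<and> x \<in> ?T \<and> N \<in> vertices ?T" using someI_ex True by (metis (mono_tags, lifting))
  then have "bary ?T N x = (if N \<in> vertices T then bary T N x else 0)"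
    using assms by (intro bary_agree) auto
  then show ?thesis using True by (simp add: hat_def)
qed (use assms in \<open>auto simp: hat_def\<close>)

lemma hat_outside: "x \<notin> \<Union>\<T> \<Longrightarrow> hat N x = 0"
  by (auto simp: hat_def)

lemma hat_affine: "T \<in> \<T> \<Longrightarrow> x \<in> T \<Longrightarrow>
    hat N x = (if N \<in> vertices T then bgrad T N else 0) \<bullet> x + (if N \<in> vertices T then 1 - bgrad T N \<bullet> N else 0)"
  by (simp add: hat_eq bary_affine)

lemma continuous_hat: "continuous_on (\<Union>\<T>) (hat N)"
proof -
  have "continuous_on (\<Union>T\<in>\<T>. T) (hat N)"
  proof (rule continuous_on_closed_Union)
    fix T assume T: "T \<in> \<T>"
    show "closed T" using compact_mem[OF T] by (rule compact_imp_closed)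
    have "continuous_on T (\<lambda>x. (if N \<in> vertices T then bgrad T N else 0) \<bullet> x + (if N \<in> vertices T then 1 - bgrad T N \<bullet> N else 0))"
      by (intro continuous_intros)
    then show "continuous_on T (hat N)"
      by (rule continuous_on_eq) (simp add: hat_affine[OF T])
  qed (rule finite_mesh)
  then show ?thesis by simp
qed

lemma hat_node:
  assumes "N \<in> nodes \<T>" "N' \<in> nodes \<T>"
  shows "hat N N' = (if N' = N then 1 else 0)"
proof -
  obtain T where T: "T \<in> \<T>" "N' \<in> vertices T" using assms by (auto simp: nodes_def vertices_def)
  interpret triangle T using tri[OF T(1)] .
  have NT: "N' \<in> T" using T(2) vertices_subset by blast
  show ?thesis using hat_eq[OF T(1) NT, of N] bary_vertex[of N N'] T(2) by auto
qed

text \<open>Uniqueness, as \<open>THE\<close> requires it: on a triangle an affine function is the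
  combination of its vertex values with the barycentric coordinates as weights.\<close>

lemma nodal_basis_eq:
  assumes N: "N \<in> nodes \<T>"
  shows "nodal_basis \<T> N = hat N"
  unfolding nodal_basis_def
proof (rule the_equality)
  show "continuous_on (\<Union>\<T>) (hat N) \<and> (\<forall>T\<in>\<T>. \<exists>a b. \<forall>x\<in>T. hat N x = a \<bullet> x + b) \<and>
    (\<forall>N'\<in>nodes \<T>. hat N N' = (if N' = N then 1 else 0)) \<and> (\<forall>x. x \<notin> \<Union>\<T> \<longrightarrow> hat N x = 0)"
    using continuous_hat hat_affine hat_node[OF N] hat_outside by blast
  fix f assume f: "continuous_on (\<Union>\<T>) f \<and> (\<forall>T\<in>\<T>. \<exists>a b. \<forall>x\<in>T. f x = a \<bullet> x + b) \<and>
    (\<forall>N'\<in>nodes \<T>. f N' = (if N' = N then 1 else 0)) \<and> (\<forall>x. x \<notin> \<Union>\<T> \<longrightarrow> f x = 0)"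
  show "f = hat N"
  proof
    fix x
    show "f x = hat N x"
    proof (cases "x \<in> \<Union>\<T>")
      case True
      then obtain T where T: "T \<in> \<T>" "x \<in> T" by blast
      interpret triangle T using tri[OF T(1)] .
      obtain a b where ab: "\<forall>x\<in>T. f x = a \<bullet> x + b" using f T(1) by blast
      let ?a = "if N \<in> vertices T then bgrad T N else 0" and ?b = "if N \<in> vertices T then 1 - bgrad T N \<bullet> N else 0"
      have eq: "a \<bullet> q + b = ?a \<bullet> q + ?b" if "q \<in> vertices T" for q
      proof -
        have q: "q \<in> T" "q \<in> nodes \<T>" using that vertices_subset vertices_nodes[OF T(1)] by blast+
        then have "a \<bullet> q + b = f q" using ab by simp
        also have "\<dots> = hat N q" using f q(2) hat_node[OF N q(2)] by simp
        finally show ?thesis using hat_affine[OF T(1) q(1)] by simp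
      qed
      have x: "x = (\<Sum>q\<in>vertices T. bary T q x *\<^sub>R q)" "(\<Sum>q\<in>vertices T. bary T q x) = 1" using bary_sums by auto
      have "a \<bullet> x + b = (\<Sum>q\<in>vertices T. bary T q x * (a \<bullet> q + b))" for a b
      proof -
        have "(\<Sum>q\<in>vertices T. bary T q x * (a \<bullet> q + b)) = a \<bullet> (\<Sum>q\<in>vertices T. bary T q x *\<^sub>R q) + (\<Sum>q\<in>vertices T. bary T q x) * b"
          by (simp add: distrib_left sum.distrib inner_sum_right sum_distrib_right)
        then show ?thesis using x by simp
      qed
      from this[of a b] this[of ?a ?b] have "a \<bullet> x + b = ?a \<bullet> x + ?b"
        using eq by (metis (no_types, lifting) sum.cong)
      then show ?thesis using ab T hat_affine[OF T] by simp
    qed (use f hat_outside in auto)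
  qed
qed

section \<open>Edges of the mesh and their intersections\<close>

lemma edge_segment:
  assumes "E \<in> edges \<T>"
  obtains a b where "E = closed_segment a b" "a \<noteq> b" "a \<in> nodes \<T>" "b \<in> nodes \<T>" "\<rho> \<le> dist a b" "dist a b \<le> H"
proof -
  obtain T where T: "T \<in> \<T>" "E edge_of T" using assms by (auto simp: edges_def)
  interpret triangle T using tri[OF T(1)] .
  obtain a b c where abc: "vertices T = {a, b, c}" "a \<noteq> b" "E = closed_segment a b" using edge_obtain[OF T(2)] by metis
  have ab: "a \<in> vertices T" "b \<in> vertices T" using abc by auto
  \<comment> \<open>The coordinate of \<open>a\<close> falls from 1 to 0 along the edge with slope
    at most 1 / \<rho>, so the edge has length at least \<rho>.\<close>
  have "1 = bgrad T a \<bullet> (a - b)"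
    using bary_diff[of T a a b] bary_vertex[OF ab(1) ab(1)] bary_vertex[OF ab(1) ab(2)] abc(2) by simp
  also have "\<dots> \<le> norm (bgrad T a) * dist a b" unfolding dist_norm by (rule norm_cauchy_schwarz)
  also have "\<dots> \<le> 1 / \<rho> * dist a b" using norm_bgrad[OF T(1) ab(1)] by (intro mult_right_mono) auto
  finally have "\<rho> \<le> dist a b" using params by (simp add: field_simps)
  moreover have "dist a b \<le> H" using ab vertices_subset dist_le[OF T(1)] by blast
  ultimately show ?thesis using that abc ab vertices_nodes[OF T(1)] by blast
qed

lemma edge_Int_face:
  assumes "E \<in> edges \<T>" "T \<in> \<T>"
  shows "(E \<inter> T) face_of T"
proof -
  obtain T0 where T0: "T0 \<in> \<T>" "E edge_of T0" using assms by (auto simp: edges_def)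
  then have "E face_of T0" by (simp add: edge_of_def)
  then have "(E \<inter> T) face_of (T0 \<inter> T)" by (rule face_of_slice) (rule convex_mem[OF assms(2)])
  then show ?thesis using Int_face2[OF T0(1) assms(2)] by (rule face_of_trans)
qed

lemma edge_subset_edge:
  assumes "E \<in> edges \<T>" "T \<in> \<T>" "E \<subseteq> T"
  shows "E edge_of T"
proof -
  have "E face_of T" using edge_Int_face[OF assms(1,2)] assms(3) by (simp add: inf_absorb1)
  moreover have "aff_dim E = 1" using assms(1) by (auto simp: edges_def edge_of_def)
  ultimately show ?thesis by (simp add: edge_of_def)
qed

text \<open>The intersection is a face of \<open>T\<close>, hence the hull of its extreme points.
  These are nodes, and a node on \<open>E\<close> is an endpoint of \<open>E\<close>; if both
  endpoints occur, all of \<open>E\<close> lies in \<open>T\<close>.\<close>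

lemma edge_Int_cases:
  assumes E: "E \<in> edges \<T>" "E = closed_segment a b" and T: "T \<in> \<T>"
  shows "E \<subseteq> T \<or> E \<inter> T \<subseteq> {a, b}"
proof -
  interpret triangle T using tri[OF T] .
  let ?c = "vertices (E \<inter> T)"
  have F: "(E \<inter> T) face_of T" using edge_Int_face[OF E(1) T] .
  have c: "?c \<subseteq> vertices T" "E \<inter> T = convex hull ?c" using face_vertices[OF F] by auto
  have "?c \<subseteq> {a, b}"
  proof
    fix x assume x: "x \<in> ?c"
    then have "x extreme_point_of T" "x \<in> E" using extreme_point_of_face[OF F] by (auto simp: vertices_def)
    obtain T0 where T0: "T0 \<in> \<T>" "E edge_of T0" using E by (auto simp: edges_def)
    interpret t0: triangle T0 using tri[OF T0(1)] .
    have "x \<in> nodes \<T>" using \<open>x extreme_point_of T\<close> T by (auto simp: nodes_def)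
    then have "x \<in> vertices T0" using node_vertex T0 \<open>x \<in> E\<close> edge_of_imp_subset by blast
    then have "x extreme_point_of E"
      using extreme_point_of_face[of E T0] T0(2) \<open>x \<in> E\<close> by (auto simp: edge_of_def vertices_def)
    then show "x \<in> {a, b}" by (simp add: E(2) extreme_point_of_segment)
  qed
  then consider "?c = {a, b}" | "?c = {a}" | "?c = {b}" | "?c = {}" by blast
  then show ?thesis
  proof cases
    case 1
    then have "E \<inter> T = E" using c(2) by (simp add: E(2) segment_convex_hull)
    then show ?thesis by blast
  qed (use c(2) in auto)
qed

text \<open>If both edges lie in one element, their intersection is a face and so the hull of
  endpoints of \<open>E\<close>; with both endpoints in it, \<open>E\<close> would be a face of
  \<open>E'\<close> of the same dimension, hence equal to \<open>E'\<close>. Otherwise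
  \<open>edge_Int_cases\<close> applies.\<close>

lemma edges_Int:
  assumes E: "E \<in> edges \<T>" "E = closed_segment a b" and E': "E' \<in> edges \<T>" and ne: "E \<noteq> E'"
  shows "E \<inter> E' \<subseteq> {a, b}"
proof -
  obtain T where T: "T \<in> \<T>" "E' edge_of T" using E' by (auto simp: edges_def)
  interpret triangle T using tri[OF T(1)] .
  have E'T: "E' \<subseteq> T" using T(2) edge_of_imp_subset by blast
  show ?thesis
  proof (cases "E \<subseteq> T")
    case True
    have FE: "E face_of T" "E' face_of T" "aff_dim E = 1" "aff_dim E' = 1"
      using edge_subset_edge[OF E(1) T(1) True] T(2) by (auto simp: edge_of_def)
    then have F: "(E \<inter> E') face_of T" by (intro face_of_Int)
    have c: "E \<inter> E' = convex hull vertices (E \<inter> E')" using face_vertices[OF F] by auto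
    have s: "vertices (E \<inter> E') \<subseteq> {a, b}"
    proof
      fix x assume "x \<in> vertices (E \<inter> E')"
      then have "x extreme_point_of T" "x \<in> E" using extreme_point_of_face[OF F] by (auto simp: vertices_def)
      then have "x extreme_point_of E" using extreme_point_of_face[OF FE(1)] by simp
      then show "x \<in> {a, b}" by (simp add: E(2) extreme_point_of_segment)
    qed
    then consider "vertices (E \<inter> E') = {a, b}" | "vertices (E \<inter> E') = {a}" | "vertices (E \<inter> E') = {b}" | "vertices (E \<inter> E') = {}" by blast
    then show ?thesis
    proof cases
      case 1
      then have "E \<inter> E' = E" using c by (simp add: E(2) segment_convex_hull)
      then have "E \<subseteq> E'" by blast
      moreover have "E face_of E'" using face_of_subset[OF FE(1) \<open>E \<subseteq> E'\<close> E'T] .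
      ultimately show ?thesis using ne FE face_of_aff_dim_lt[of E' E] face_of_imp_convex[OF FE(2)] by simp
    qed (use c in auto)
  next
    case False
    then show ?thesis using edge_Int_cases[OF E T(1)] E'T by blast
  qed
qed

lemma interior_disjoint:
  assumes "T \<in> \<T>" "T' \<in> \<T>" "T \<noteq> T'"
  shows "interior T \<inter> interior T' = {}"
proof (rule ccontr)
  assume ne: "interior T \<inter> interior T' \<noteq> {}"
  then obtain x where x: "x \<in> interior T" "x \<in> interior T'" by blast
  then have "x \<in> (T \<inter> T') \<inter> interior T" "x \<in> (T \<inter> T') \<inter> interior T'" using interior_subset by blast+
  then have "T \<inter> T' = T" "T \<inter> T' = T'"
    using face_of_disjoint_interior[OF Int_face[OF assms(1,2)]] face_of_disjoint_interior[OF Int_face2[OF assms(1,2)]] by blast+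
  with assms(3) show False by blast
qed

lemma frontier_edge:
  assumes N: "N \<in> nodes \<T>" "N \<in> frontier \<Omega>"
  obtains E where "E \<in> edges \<T>" "N \<in> E" "E \<subseteq> frontier \<Omega>"
proof -
  obtain B where "B \<subseteq> edges \<T>" "frontier \<Omega> = \<Union>B" using conf by (auto simp: conforming_triangulation_def)
  then show ?thesis using that N by blast
qed

lemma node_edge_endpoint:
  assumes E: "E \<in> edges \<T>" and N: "N \<in> nodes \<T>" "N \<in> E"
  obtains M where "E = closed_segment N M" "N \<noteq> M" "M \<in> nodes \<T>" "\<rho> \<le> dist N M" "dist N M \<le> H"
proof -
  obtain a b where ab: "E = closed_segment a b" "a \<noteq> b" "a \<in> nodes \<T>" "b \<in> nodes \<T>" "\<rho> \<le> dist a b" "dist a b \<le> H"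
    using edge_segment[OF E] by metis
  obtain T where T: "T \<in> \<T>" "E edge_of T" using E by (auto simp: edges_def)
  have "N \<in> vertices T" using node_vertex[OF N(1) T(1)] N(2) T(2) edge_of_imp_subset by blast
  then have "N extreme_point_of E"
    using extreme_point_of_face[of E T] T(2) N(2) by (auto simp: edge_of_def vertices_def)
  then have "N = a \<or> N = b" by (simp add: ab(1) extreme_point_of_segment)
  then show ?thesis
  proof
    assume "N = a" then show ?thesis using that[of b] ab by blast
  next
    assume "N = b" then show ?thesis using that[of a] ab closed_segment_commute[of a b] by (simp add: dist_commute)
  qed
qed

section \<open>The star of a node and the cutoff to it\<close>

definition star :: "pt \<Rightarrow> pt set" where
  "star N = \<Union>(elements_at \<T> N)"

lemma closed_star: "closed (star N)"
  unfolding star_def elements_at_def using finite_mesh compact_mem by (auto intro!: closed_Union compact_imp_closed)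

text \<open>The coordinate of \<open>N\<close> is 1 at \<open>N\<close> and has a gradient of norm
  at most 1 / \<rho>, so it is positive at \<open>x\<close>; on elements without \<open>N\<close> it
  would be zero by \<open>bary_agree\<close>. Within distance \<rho> of \<open>N\<close> the star is
  thus separated from all other elements.\<close>

lemma star_near:
  assumes N: "N \<in> nodes \<T>" and x: "x \<in> star N" "dist N x < \<rho>" and T: "T \<in> \<T>" "x \<in> T"
  shows "N \<in> T"
proof -
  obtain T0 where T0: "T0 \<in> \<T>" "N \<in> T0" "x \<in> T0" using x(1) by (auto simp: star_def elements_at_def)
  interpret t0: triangle T0 using tri[OF T0(1)] .
  have NT0: "N \<in> vertices T0" using node_vertex[OF N T0(1,2)] .
  have "- (bgrad T0 N \<bullet> (x - N)) \<le> norm (bgrad T0 N) * norm (x - N)"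
    using Cauchy_Schwarz_ineq2[of "bgrad T0 N" "x - N"] by simp
  also have "\<dots> \<le> 1 / \<rho> * norm (x - N)" using norm_bgrad[OF T0(1) NT0] by (intro mult_right_mono) auto
  also have "\<dots> < 1" using x(2) params by (simp add: dist_norm norm_minus_commute field_simps)
  finally have "bary T0 N x > 0" by (simp add: bary_def)
  then have "bary T0 N x \<noteq> 0" by simp
  with bary_agree[OF T0(1) T(1) T0(3) T(2) NT0] have "N \<in> vertices T" by metis
  then show ?thesis using full_simplex.vertices_subset[OF triangle.axioms[OF tri[OF T(1)]]] by blast
qed

text \<open>A ball about \<open>N\<close> may meet parts of \<open>\<Omega>\<close> that lie across a gap in \<open>\<Omega>\<close> and have nothing to do with
  \<open>N\<close>. Multiplication by the indicator function of the star removes them; this keeps smoothness because test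
  functions vanish near the boundary.\<close>

lemma cutoff_C1:
  assumes N: "N \<in> nodes \<T>" and x: "dist N x < \<rho>"
    and \<phi>: "\<And>x. GDERIV \<phi> x :> \<phi>' x" "continuous_on UNIV \<phi>'"
    and K: "compact K" "K \<subseteq> \<Omega>" "\<And>x. x \<notin> K \<Longrightarrow> \<phi> x = 0" "\<And>x. x \<notin> K \<Longrightarrow> \<phi>' x = 0"
  shows "GDERIV (\<lambda>x. indicator (star N) x * \<phi> x) x :> indicator (star N) x *\<^sub>R \<phi>' x" (is ?A)
    and "isCont (\<lambda>x. indicator (star N) x *\<^sub>R \<phi>' x) x" (is ?B)
proof -
  let ?w = "\<lambda>x. indicator (star N) x * \<phi> x" and ?w' = "\<lambda>x. indicator (star N) x *\<^sub>R \<phi>' x"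
  have zero: ?A ?B if W: "open W" "x \<in> W" "\<And>y. y \<in> W \<Longrightarrow> ?w y = 0" "\<And>y. y \<in> W \<Longrightarrow> ?w' y = 0" for W
  proof -
    have "((\<lambda>x. 0) has_derivative (\<lambda>h. h \<bullet> 0)) (at x)" by simp
    then have "GDERIV ?w x :> 0"
      unfolding gderiv_def by (rule has_derivative_transform_within_open[OF _ W(1,2)]) (simp add: W(3))
    then show ?A by (simp only: W(4)[OF W(2)])
    have "continuous_on W (\<lambda>x. 0)" by simp
    then have "continuous_on W ?w'" by (rule continuous_on_eq) (simp add: W(4))
    then show ?B using W(1,2) continuous_on_eq_continuous_at by blast
  qed
  consider "x \<notin> star N" | "x \<in> star N" "x \<notin> \<Omega>" | "x \<in> star N" "x \<in> \<Omega>" by blast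
  then have "?A \<and> ?B"
  proof cases
    case 1
    then have W: "open (- star N)" "x \<in> - star N" using closed_star by auto
    show ?thesis by (intro conjI zero[OF W]) auto
  next
    case 2
    then have W: "open (- K)" "x \<in> - K" using K(1,2) by (auto simp: compact_imp_closed)
    show ?thesis by (intro conjI zero[OF W]) (use K(3,4) in auto)
  next
    case 3
    \<comment> \<open>By \<open>star_near\<close> this open set contains \<open>x\<close>. It avoids
      all elements without \<open>N\<close>, so the indicator of the star is constantly 1 on
      it.\<close>
    let ?W = "\<Omega> - \<Union>{T\<in>\<T>. N \<notin> T}"
    have "closed (\<Union>{T\<in>\<T>. N \<notin> T})" using finite_mesh compact_mem by (auto intro!: closed_Union compact_imp_closed)
    then have oW: "open ?W" using open_dom by (rule open_Diff[rotated])
    have xW: "x \<in> ?W" using 3 star_near[OF N _ x] by blast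
    have WS: "?W \<subseteq> star N" using dom_subset by (auto simp: star_def elements_at_def)
    have "(\<phi> has_derivative (\<lambda>h. h \<bullet> \<phi>' x)) (at x)" using \<phi>(1)[of x] by (simp add: gderiv_def)
    then have "(?w has_derivative (\<lambda>h. h \<bullet> \<phi>' x)) (at x)"
      by (rule has_derivative_transform_within_open[OF _ oW xW]) (use WS in \<open>auto simp: indicator_def\<close>)
    then have 1: ?A using 3 by (simp add: gderiv_def)
    have "continuous_on ?W \<phi>'" using \<phi>(2) continuous_on_subset by blast
    then have "continuous_on ?W ?w'" by (rule continuous_on_eq) (use WS in \<open>auto simp: indicator_def\<close>)
    then have ?B using oW xW continuous_on_eq_continuous_at by blast
    with 1 show ?thesis by blast
  qed
  then show ?A ?B by auto
qed

end

subsection \<open>Poincare and trace inequalities\<close>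

text \<open>With d the increment of \<open>h\<close>, the integral of (h' - d / s)^2 is nonnegative;
  expanding the square gives the Cauchy-Schwarz inequality in the form needed.\<close>

lemma power2_diff_le_integral:
  fixes h h' :: "real \<Rightarrow> real"
  assumes s: "s \<ge> 0"
    and h: "\<And>t. t \<in> {0..s} \<Longrightarrow> (h has_real_derivative h' t) (at t within {0..s})"
    and c: "continuous_on {0..s} h'"
  shows "ennreal ((h s - h 0)\<^sup>2) \<le> ennreal s * (sq_int lborel {0..s} (\<lambda>t. h' t))"
proof (cases "s = 0")
  case False
  with s have s: "s > 0" by simp
  let ?d = "h s - h 0"
  have 1: "(h' has_integral ?d) {0..s}"
    using h s by (intro fundamental_theorem_of_calculus) (auto simp: has_real_derivative_iff_has_vector_derivative)
  define I where "I = integral {0..s} (\<lambda>t. (h' t)\<^sup>2)"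
  have 2: "((\<lambda>t. (h' t)\<^sup>2) has_integral I) {0..s}"
    unfolding I_def using c by (intro integrable_integral integrable_continuous_real continuous_intros)
  have "((\<lambda>t. (h' t)\<^sup>2 - 2 * (?d / s) * h' t + (?d / s)\<^sup>2) has_integral (I - 2 * (?d / s) * ?d + (?d / s)\<^sup>2 * s)) {0..s}"
    using has_integral_add[OF has_integral_diff[OF 2 has_integral_mult_right[OF 1, of "2 * (?d / s)"]] has_integral_const_real[of "(?d / s)\<^sup>2" 0 s]] s
    by (simp add: mult.commute)
  then have "0 \<le> I - 2 * (?d / s) * ?d + (?d / s)\<^sup>2 * s"
  proof (rule has_integral_nonneg)
    fix t
    have "(h' t)\<^sup>2 - 2 * (?d / s) * h' t + (?d / s)\<^sup>2 = (h' t - ?d / s)\<^sup>2" by (simp add: power2_diff)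
    then show "0 \<le> (h' t)\<^sup>2 - 2 * (?d / s) * h' t + (?d / s)\<^sup>2" by (metis zero_le_power2)
  qed
  also have "I - 2 * (?d / s) * ?d + (?d / s)\<^sup>2 * s = I - ?d\<^sup>2 / s"
  proof -
    have "I - 2 * (d / s) * d + (d / s)\<^sup>2 * s = I - d\<^sup>2 / s" for d :: real
      using s by (simp add: power2_eq_square field_simps)
    then show ?thesis .
  qed
  finally have "?d\<^sup>2 / s \<le> I" by simp
  then have "?d\<^sup>2 \<le> s * I" using s by (simp only: pos_divide_le_eq mult.commute)
  moreover have "(sq_int lborel {0..s} (\<lambda>t. h' t)) = ennreal I"
    using c by (intro nn_integral_has_integral_lebesgue' 2)
      (auto intro!: borel_measurable_continuous_on_indicator continuous_intros simp: mult.commute)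
  moreover have "I \<ge> 0" using 2 by (rule has_integral_nonneg) simp
  ultimately show ?thesis using s by (simp add: ennreal_leI flip: ennreal_mult)
qed simp

lemma power2_diff_le_line_integral:
  fixes f :: "'a::euclidean_space \<Rightarrow> real"
  assumes s: "s \<ge> 0" and seg: "\<And>t. t \<in> {0..s} \<Longrightarrow> x + t *\<^sub>R v \<in> S"
    and f: "\<And>z. z \<in> S \<Longrightarrow> GDERIV f z :> f' z" and c: "continuous_on S f'"
  shows "ennreal ((f (x + s *\<^sub>R v) - f x)\<^sup>2) \<le>
    ennreal (s * (norm v)\<^sup>2) * (sq_int lborel {0..s} (\<lambda>t. norm (f' (x + t *\<^sub>R v))))"
proof -
  have d: "((\<lambda>t. f (x + t *\<^sub>R v)) has_real_derivative (v \<bullet> f' (x + t *\<^sub>R v))) (at t within {0..s})" if "t \<in> {0..s}" for t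
  proof -
    have "((\<lambda>t. x + t *\<^sub>R v) has_derivative (\<lambda>h. h *\<^sub>R v)) (at t)"
      by (auto intro!: derivative_eq_intros)
    from diff_chain_at[OF this, of f "\<lambda>h. h \<bullet> f' (x + t *\<^sub>R v)"] f[OF seg[OF that]]
    have "((\<lambda>t. f (x + t *\<^sub>R v)) has_derivative (\<lambda>h. (h *\<^sub>R v) \<bullet> f' (x + t *\<^sub>R v))) (at t)"
      by (simp add: gderiv_def o_def)
    then have "((\<lambda>t. f (x + t *\<^sub>R v)) has_real_derivative (v \<bullet> f' (x + t *\<^sub>R v))) (at t)"
      unfolding has_field_derivative_def by (rule has_derivative_eq_rhs) (auto simp: mult.commute)
    then show ?thesis by (rule has_field_derivative_at_within)
  qed
  have c': "continuous_on {0..s} (\<lambda>t. f' (x + t *\<^sub>R v))"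
    using seg by (intro continuous_on_compose2[OF c] continuous_intros) auto
  have "ennreal ((f (x + s *\<^sub>R v) - f x)\<^sup>2) \<le> ennreal s * (sq_int lborel {0..s} (\<lambda>t. v \<bullet> f' (x + t *\<^sub>R v)))"
    using power2_diff_le_integral[where h = "\<lambda>t. f (x + t *\<^sub>R v)" and h' = "\<lambda>t. v \<bullet> f' (x + t *\<^sub>R v)", OF s d] c'
    by (simp add: continuous_intros)
  also have "\<dots> \<le> ennreal s * (\<integral>\<^sup>+t. ennreal ((norm v)\<^sup>2) * (ennreal ((norm (f' (x + t *\<^sub>R v)))\<^sup>2) * indicator {0..s} t) \<partial>lborel)"
  proof (intro mult_left_mono nn_integral_mono)
    fix t
    have "(v \<bullet> f' (x + t *\<^sub>R v))\<^sup>2 \<le> (norm v)\<^sup>2 * (norm (f' (x + t *\<^sub>R v)))\<^sup>2"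
      using power_mono[OF Cauchy_Schwarz_ineq2, of v "f' (x + t *\<^sub>R v)" 2] by (simp add: power_mult_distrib)
    then show "ennreal ((v \<bullet> f' (x + t *\<^sub>R v))\<^sup>2) * indicator {0..s} t \<le>
      ennreal ((norm v)\<^sup>2) * (ennreal ((norm (f' (x + t *\<^sub>R v)))\<^sup>2) * indicator {0..s} t)"
      by (auto simp: indicator_def ennreal_mult[symmetric] intro!: ennreal_leI)
  qed simp
  also have "\<dots> = ennreal (s * (norm v)\<^sup>2) * (sq_int lborel {0..s} (\<lambda>t. norm (f' (x + t *\<^sub>R v))))"
  proof (subst nn_integral_cmult)
    have "(\<lambda>t. indicator {0..s} t *\<^sub>R (norm (f' (x + t *\<^sub>R v)))\<^sup>2) \<in> borel_measurable borel"
      using c' by (intro borel_measurable_continuous_on_indicator continuous_intros) auto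
    then have "(\<lambda>t. ennreal (indicator {0..s} t *\<^sub>R (norm (f' (x + t *\<^sub>R v)))\<^sup>2)) \<in> borel_measurable lborel" by simp
    then show "(\<lambda>t. ennreal ((norm (f' (x + t *\<^sub>R v)))\<^sup>2) * indicator {0..s} t) \<in> borel_measurable lborel"
      by (rule measurable_cong[THEN iffD1, rotated]) (auto simp: indicator_def)
  qed (use s in \<open>simp add: ennreal_mult mult.assoc\<close>)
  finally show ?thesis .
qed

section \<open>Affine substitutions and the Poincare inequality\<close>

lemma nn_integral_affine:
  fixes G :: "'a::euclidean_space \<Rightarrow> ennreal"
  assumes [measurable]: "G \<in> borel_measurable borel" and c: "c \<noteq> 0"
  shows "(\<integral>\<^sup>+x. G x \<partial>lborel) = ennreal (\<bar>c\<bar> ^ DIM('a)) * (\<integral>\<^sup>+x. G (t + c *\<^sub>R x) \<partial>lborel)"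
  by (subst lborel_affine[OF c, of t])
     (simp add: nn_integral_density nn_integral_distr nn_integral_cmult ennreal_power)

text \<open>For c >= 1/2 the Jacobian 1 / c^n of the substitution is at most 2^n; this is where the
  power of 2 in the Poincare inequality comes from.\<close>

lemma nn_integral_affine_le:
  fixes G :: "'a::euclidean_space \<Rightarrow> ennreal"
  assumes G: "G \<in> borel_measurable borel" and c: "c \<ge> 1 / 2"
  shows "(\<integral>\<^sup>+x. G (t + c *\<^sub>R x) \<partial>lborel) \<le> 2 ^ DIM('a) * (\<integral>\<^sup>+x. G x \<partial>lborel)"
proof -
  have "ennreal 1 \<le> ennreal ((2 * c) ^ DIM('a))"
    using c by (intro ennreal_leI one_le_power) auto
  also have "\<dots> = 2 ^ DIM('a) * ennreal (\<bar>c\<bar> ^ DIM('a))"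
    using c by (simp add: power_mult_distrib ennreal_mult ennreal_power[symmetric])
  finally have "ennreal 1 * (\<integral>\<^sup>+x. G (t + c *\<^sub>R x) \<partial>lborel) \<le> (2 ^ DIM('a) * ennreal (\<bar>c\<bar> ^ DIM('a))) * (\<integral>\<^sup>+x. G (t + c *\<^sub>R x) \<partial>lborel)"
    by (rule mult_right_mono) simp
  then show ?thesis
    using nn_integral_affine[OF G, of c t] c by (simp add: mult.assoc)
qed

lemma borel_measurable_sq_indicator:
  fixes g :: "'a::euclidean_space \<Rightarrow> 'b::euclidean_space"
  assumes "S \<in> sets borel" "continuous_on S g"
  shows "(\<lambda>x. ennreal ((norm (g x))\<^sup>2) * indicator S x) \<in> borel_measurable borel"
proof -
  have "(\<lambda>x. indicator S x *\<^sub>R (norm (g x))\<^sup>2) \<in> borel_measurable borel"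
    using assms by (intro borel_measurable_continuous_on_indicator continuous_intros) auto
  then have "(\<lambda>x. ennreal (indicator S x *\<^sub>R (norm (g x))\<^sup>2)) \<in> borel_measurable borel" by simp
  then show ?thesis
    by (rule measurable_cong[THEN iffD1, rotated]) (auto simp: indicator_def)
qed

text \<open>The two halves of the segment from \<open>x\<close> to \<open>y\<close> are treated differently: near \<open>y\<close> one substitutes
  in the variable \<open>y\<close>, near \<open>x\<close> in the variable \<open>x\<close>, so that the Jacobian never degenerates.\<close>

lemma poincare_convex:
  fixes f :: "'a::euclidean_space \<Rightarrow> real"
  assumes S: "convex S" "S \<in> sets borel" and d: "\<And>x y. x \<in> S \<Longrightarrow> y \<in> S \<Longrightarrow> dist x y \<le> d"
    and f: "\<And>z. z \<in> S \<Longrightarrow> GDERIV f z :> f' z" and c: "continuous_on S f'"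
  shows "(\<integral>\<^sup>+x\<in>S. (sq_int lborel S (\<lambda>y. f x - f y)) \<partial>lborel) \<le>
    ennreal (d\<^sup>2) * (2 ^ DIM('a) * (emeasure lborel S * (sq_int lborel S (\<lambda>z. norm (f' z)))))"
proof -
  note [measurable] = S(2)
  define G where "G = (\<lambda>z. ennreal ((norm (f' z))\<^sup>2) * indicator S z)"
  have [measurable]: "G \<in> borel_measurable borel"
    unfolding G_def by (rule borel_measurable_sq_indicator[OF S(2) c])
  let ?I = "\<integral>\<^sup>+z. G z \<partial>lborel"
  \<comment> \<open>\<open>A x y\<close> collects the half of the segment that lies next to
    \<open>y\<close>; the other half turns out to be \<open>A y x\<close>.\<close>
  define A where "A = (\<lambda>x y. \<integral>\<^sup>+t\<in>{0..1/2}. G (y + t *\<^sub>R (x - y)) \<partial>lborel)"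
  have Am[measurable]: "case_prod A \<in> borel_measurable (borel \<Otimes>\<^sub>M borel)"
    unfolding A_def by measurable
  have pt: "ennreal ((f x - f y)\<^sup>2) \<le> ennreal (d\<^sup>2) * (A x y + A y x)" if xy: "x \<in> S" "y \<in> S" for x y
  proof -
    have seg: "y + t *\<^sub>R (x - y) \<in> S" if "t \<in> {0..1}" for t
    proof -
      have "(1 - t) *\<^sub>R y + t *\<^sub>R x \<in> S" using xy that S(1) by (intro convexD) auto
      then show ?thesis by (simp add: algebra_simps)
    qed
    have "ennreal ((f (y + 1 *\<^sub>R (x - y)) - f y)\<^sup>2) \<le> ennreal (1 * (norm (x - y))\<^sup>2) * (sq_int lborel {0..1} (\<lambda>t. norm (f' (y + t *\<^sub>R (x - y)))))"
      by (rule power2_diff_le_line_integral[OF _ seg f c]) auto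
    also have "\<dots> \<le> ennreal (d\<^sup>2) * (sq_int lborel {0..1} (\<lambda>t. norm (f' (y + t *\<^sub>R (x - y)))))"
      using d[OF xy] by (intro mult_right_mono ennreal_leI) (auto simp: dist_norm intro!: power_mono)
    also have "(sq_int lborel {0..1} (\<lambda>t. norm (f' (y + t *\<^sub>R (x - y))))) \<le>
      (\<integral>\<^sup>+t. G (y + t *\<^sub>R (x - y)) * indicator {0..1/2::real} t + G (y + t *\<^sub>R (x - y)) * indicator {1/2..1} t \<partial>lborel)"
      using seg by (intro nn_integral_mono) (auto simp: G_def indicator_def)
    also have "\<dots> = A x y + (\<integral>\<^sup>+t\<in>{1/2..1}. G (y + t *\<^sub>R (x - y)) \<partial>lborel)"
      unfolding A_def by (rule nn_integral_add) measurable
    also have "(\<integral>\<^sup>+t\<in>{1/2..1}. G (y + t *\<^sub>R (x - y)) \<partial>lborel) = A y x"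
    proof -
      have "(\<integral>\<^sup>+t\<in>{1/2..1}. G (y + t *\<^sub>R (x - y)) \<partial>lborel) = (\<integral>\<^sup>+t. G (y + (1 + - 1 * t) *\<^sub>R (x - y)) * indicator {1/2..1} (1 + - 1 * t) \<partial>lborel)"
        by (subst nn_integral_real_affine[where c = "-1" and t = 1]) auto
      also have "\<dots> = A y x"
        unfolding A_def by (intro nn_integral_cong) (auto simp: indicator_def algebra_simps)
      finally show ?thesis .
    qed
    finally show ?thesis by (simp add: mult_left_mono)
  qed
  \<comment> \<open>For fixed t <= 1/2 the map from \<open>y\<close> to
    \<open>y + t *\<^sub>R (x - y)\<close> contracts by the factor 1 - t >= 1/2. Fubini lets the
    integration over \<open>y\<close> come first.\<close>
  have inner: "(\<integral>\<^sup>+y. A x y \<partial>lborel) \<le> 2 ^ DIM('a) * ?I * ennreal (1 / 2)" for x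
  proof -
    have "(\<integral>\<^sup>+y. A x y \<partial>lborel) = (\<integral>\<^sup>+t. \<integral>\<^sup>+y. G (y + t *\<^sub>R (x - y)) * indicator {0..1/2::real} t \<partial>lborel \<partial>lborel)"
      unfolding A_def by (subst lborel_pair.Fubini') auto
    also have "\<dots> \<le> (\<integral>\<^sup>+t. 2 ^ DIM('a) * ?I * indicator {0..1/2::real} t \<partial>lborel)"
    proof (rule nn_integral_mono)
      fix t :: real
      show "(\<integral>\<^sup>+y. G (y + t *\<^sub>R (x - y)) * indicator {0..1/2::real} t \<partial>lborel) \<le> 2 ^ DIM('a) * ?I * indicator {0..1/2::real} t"
      proof (cases "t \<in> {0..1/2}")
        case True
        have "(\<integral>\<^sup>+y. G (y + t *\<^sub>R (x - y)) \<partial>lborel) = (\<integral>\<^sup>+y. G (t *\<^sub>R x + (1 - t) *\<^sub>R y) \<partial>lborel)"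
          by (intro nn_integral_cong) (simp add: algebra_simps)
        also have "\<dots> \<le> 2 ^ DIM('a) * ?I" using True by (intro nn_integral_affine_le) auto
        finally show ?thesis using True by simp
      qed simp
    qed
    also have "\<dots> = 2 ^ DIM('a) * ?I * ennreal (1 / 2)"
      by (subst nn_integral_cmult) auto
    finally show ?thesis .
  qed
  have outer: "(\<integral>\<^sup>+x\<in>S. (\<integral>\<^sup>+y\<in>S. A x y \<partial>lborel) \<partial>lborel) \<le> 2 ^ DIM('a) * ?I * ennreal (1 / 2) * emeasure lborel S"
  proof -
    have "(\<integral>\<^sup>+x\<in>S. (\<integral>\<^sup>+y\<in>S. A x y \<partial>lborel) \<partial>lborel) \<le> (\<integral>\<^sup>+x\<in>S. 2 ^ DIM('a) * ?I * ennreal (1 / 2) \<partial>lborel)"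
      by (intro nn_integral_mono mult_right_mono order_trans[OF nn_integral_mono inner]) (auto simp: indicator_def)
    then show ?thesis by (simp add: nn_integral_cmult)
  qed
  have swap: "(\<integral>\<^sup>+x\<in>S. (\<integral>\<^sup>+y\<in>S. A y x \<partial>lborel) \<partial>lborel) = (\<integral>\<^sup>+x\<in>S. (\<integral>\<^sup>+y\<in>S. A x y \<partial>lborel) \<partial>lborel)"
  proof -
    have "(\<integral>\<^sup>+x\<in>S. (\<integral>\<^sup>+y\<in>S. A y x \<partial>lborel) \<partial>lborel) = (\<integral>\<^sup>+x. (\<integral>\<^sup>+y. A y x * indicator S y * indicator S x \<partial>lborel) \<partial>lborel)"
      by (intro nn_integral_cong nn_integral_multc[symmetric]) measurable
    also have "\<dots> = (\<integral>\<^sup>+y. (\<integral>\<^sup>+x. A y x * indicator S y * indicator S x \<partial>lborel) \<partial>lborel)"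
      by (rule lborel_pair.Fubini') measurable
    also have "\<dots> = (\<integral>\<^sup>+y. (\<integral>\<^sup>+x. A y x * indicator S x * indicator S y \<partial>lborel) \<partial>lborel)"
      by (simp add: mult.assoc mult.commute mult.left_commute)
    also have "\<dots> = (\<integral>\<^sup>+x\<in>S. (\<integral>\<^sup>+y\<in>S. A x y \<partial>lborel) \<partial>lborel)"
      by (intro nn_integral_cong nn_integral_multc) measurable
    finally show ?thesis .
  qed
  have "(\<integral>\<^sup>+x\<in>S. (sq_int lborel S (\<lambda>y. f x - f y)) \<partial>lborel) \<le>
    (\<integral>\<^sup>+x\<in>S. (\<integral>\<^sup>+y\<in>S. ennreal (d\<^sup>2) * (A x y + A y x) \<partial>lborel) \<partial>lborel)"
  proof (intro nn_integral_mono)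
    fix x show "(sq_int lborel S (\<lambda>y. f x - f y)) * indicator S x \<le> (\<integral>\<^sup>+y\<in>S. ennreal (d\<^sup>2) * (A x y + A y x) \<partial>lborel) * indicator S x"
      using pt[of x] by (cases "x \<in> S") (auto intro!: nn_integral_mono split: split_indicator)
  qed
  also have "\<dots> = (\<integral>\<^sup>+x. ennreal (d\<^sup>2) * ((\<integral>\<^sup>+y\<in>S. A x y \<partial>lborel) * indicator S x + (\<integral>\<^sup>+y\<in>S. A y x \<partial>lborel) * indicator S x) \<partial>lborel)"
  proof (intro nn_integral_cong)
    fix x
    have "(\<integral>\<^sup>+y\<in>S. ennreal (d\<^sup>2) * (A x y + A y x) \<partial>lborel) = (\<integral>\<^sup>+y. ennreal (d\<^sup>2) * (A x y * indicator S y + A y x * indicator S y) \<partial>lborel)"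
      by (simp add: distrib_right mult.assoc)
    also have "\<dots> = ennreal (d\<^sup>2) * ((\<integral>\<^sup>+y\<in>S. A x y \<partial>lborel) + (\<integral>\<^sup>+y\<in>S. A y x \<partial>lborel))"
      by (subst nn_integral_cmult, measurable) (subst nn_integral_add, measurable)
    finally show "(\<integral>\<^sup>+y\<in>S. ennreal (d\<^sup>2) * (A x y + A y x) \<partial>lborel) * indicator S x =
      ennreal (d\<^sup>2) * ((\<integral>\<^sup>+y\<in>S. A x y \<partial>lborel) * indicator S x + (\<integral>\<^sup>+y\<in>S. A y x \<partial>lborel) * indicator S x)"
      by (simp add: distrib_right mult.assoc)
  qed
  also have "\<dots> = ennreal (d\<^sup>2) * ((\<integral>\<^sup>+x\<in>S. (\<integral>\<^sup>+y\<in>S. A x y \<partial>lborel) \<partial>lborel) + (\<integral>\<^sup>+x\<in>S. (\<integral>\<^sup>+y\<in>S. A y x \<partial>lborel) \<partial>lborel))"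
    by (subst nn_integral_cmult, measurable) (subst nn_integral_add, measurable)
  also have "\<dots> \<le> ennreal (d\<^sup>2) * (2 ^ DIM('a) * ?I * ennreal (1 / 2) * emeasure lborel S + 2 ^ DIM('a) * ?I * ennreal (1 / 2) * emeasure lborel S)"
    unfolding swap by (intro mult_left_mono add_mono outer) simp
  also have "\<dots> = ennreal (d\<^sup>2) * ((ennreal (1 / 2) + ennreal (1 / 2)) * (2 ^ DIM('a) * (emeasure lborel S * ?I)))"
    by (simp only: distrib_right distrib_left ac_simps)
  also have "ennreal (1 / 2) + ennreal (1 / 2) = 1"
    by (subst ennreal_plus[symmetric]) auto
  finally show ?thesis by (simp add: G_def)
qed

section \<open>Oblique coordinates in the plane and trace inequalities\<close>

lemma lborel_linear2:
  fixes u v :: pt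
  assumes D: "u $ 1 * v $ 2 - u $ 2 * v $ 1 \<noteq> 0"
  shows "lborel = density (distr lborel borel (\<lambda>x::pt. x $ 1 *\<^sub>R u + x $ 2 *\<^sub>R v)) (\<lambda>_. ennreal \<bar>u $ 1 * v $ 2 - u $ 2 * v $ 1\<bar>)"
proof (rule lborel_eqI)
  let ?A = "\<lambda>x::pt. x $ 1 *\<^sub>R u + x $ 2 *\<^sub>R v"
  let ?d = "u $ 1 * v $ 2 - u $ 2 * v $ 1"
  \<comment> \<open>The inverse of \<open>?A\<close> by Cramer's rule. Preimages of boxes under
    \<open>?A\<close> are images under \<open>?B\<close>, whose area is known from the
    determinant.\<close>
  let ?B = "\<lambda>y::pt. vector [(y $ 1 * v $ 2 - y $ 2 * v $ 1) / ?d, (u $ 1 * y $ 2 - u $ 2 * y $ 1) / ?d] :: pt"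
  have Alin: "linear ?A" by (auto simp: linear_iff algebra_simps)
  have Blin: "linear ?B" by (auto simp: linear_iff vec_eq_iff forall_2 algebra_simps add_divide_distrib diff_divide_distrib)
  have AB: "?A (?B y) = y" for y
  proof -
    have 1: "(y $ 1 * v $ 2 - y $ 2 * v $ 1) * u $ 1 + (u $ 1 * y $ 2 - u $ 2 * y $ 1) * v $ 1 = y $ 1 * ?d"
      "(y $ 1 * v $ 2 - y $ 2 * v $ 1) * u $ 2 + (u $ 1 * y $ 2 - u $ 2 * y $ 1) * v $ 2 = y $ 2 * ?d"
      by algebra+
    have 2: "p / d * q + r / d * t = z" if "p * q + r * t = z * d" "d \<noteq> 0" for p q r t z d :: real
      using that by (simp add: field_simps)
    show ?thesis using 2[OF 1(1) D] 2[OF 1(2) D] by (simp add: vec_eq_iff forall_2)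
  qed
  have BA: "?B (?A x) = x" for x
  proof -
    have 1: "(x $ 1 * u $ 1 + x $ 2 * v $ 1) * v $ 2 - (x $ 1 * u $ 2 + x $ 2 * v $ 2) * v $ 1 = x $ 1 * ?d"
      "u $ 1 * (x $ 1 * u $ 2 + x $ 2 * v $ 2) - u $ 2 * (x $ 1 * u $ 1 + x $ 2 * v $ 1) = x $ 2 * ?d"
      by algebra+
    show ?thesis using 1 D by (simp add: vec_eq_iff forall_2)
  qed
  have Am[measurable]: "?A \<in> borel_measurable borel"
    by (intro borel_measurable_continuous_onI continuous_intros)
  have detB: "det (matrix ?B) = 1 / ?d"
  proof -
    have "det (matrix ?B) = (v $ 2 / ?d) * (u $ 1 / ?d) - (- v $ 1 / ?d) * (- u $ 2 / ?d)"
      by (simp add: det_2 matrix_def axis_def)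
    also have "\<dots> = 1 / ?d"
    proof -
      have "(p / d) * (q / d) - (- r / d) * (- s / d) = 1 / d" if "q * p - s * r = d" "d \<noteq> 0" for p q r s d :: real
      proof -
        have "(p / d) * (q / d) - (- r / d) * (- s / d) = (q * p - s * r) / (d * d)"
          by (simp add: diff_divide_distrib mult.commute)
        then show ?thesis using that by simp
      qed
      from this[OF _ D] show ?thesis by simp
    qed
    finally show ?thesis .
  qed
  fix l w :: pt assume lw: "\<And>b. b \<in> Basis \<Longrightarrow> l \<bullet> b \<le> w \<bullet> b"
  have vim: "?A -` box l w = ?B ` box l w"
  proof (intro set_eqI iffI)
    fix x assume "x \<in> ?A -` box l w"
    then have "?A x \<in> box l w" by simp
    then show "x \<in> ?B ` box l w" using imageI[of "?A x" "box l w" ?B] BA[of x] by (simp only:)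
  next
    fix x assume "x \<in> ?B ` box l w"
    then obtain y where y: "x = ?B y" "y \<in> box l w" by (elim imageE)
    have "?A x = y" unfolding y(1) by (rule AB)
    with y(2) show "x \<in> ?A -` box l w" by simp
  qed
  have m: "measure lebesgue (?B ` box l w) = \<bar>1 / ?d\<bar> * measure lebesgue (box l w)"
    using measure_linear_image[OF Blin lmeasurable_box] detB by simp
  have "emeasure lborel (?B ` box l w) = emeasure lebesgue (?B ` box l w)"
    using vim Am[THEN measurable_sets, of "box l w"] by simp
  also have "\<dots> = ennreal (\<bar>1 / ?d\<bar> * measure lebesgue (box l w))"
    using m emeasure_eq_measure2[OF measurable_linear_image[OF Blin lmeasurable_box], of l w] by simp
  finally have "emeasure lborel (?A -` box l w) = ennreal (\<bar>1 / ?d\<bar> * (\<Prod>b\<in>Basis. (w - l) \<bullet> b))"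
    using lw by (simp add: vim)
  then have "ennreal \<bar>?d\<bar> * emeasure lborel (?A -` box l w) = ennreal \<bar>?d\<bar> * ennreal (\<bar>1 / ?d\<bar> * (\<Prod>b\<in>Basis. (w - l) \<bullet> b))"
    by (rule arg_cong)
  also have "\<dots> = ennreal (\<bar>?d\<bar> * (\<bar>1 / ?d\<bar> * (\<Prod>b\<in>Basis. (w - l) \<bullet> b)))"
    by (rule ennreal_mult'[symmetric]) simp
  also have "\<bar>?d\<bar> * (\<bar>1 / ?d\<bar> * (\<Prod>b\<in>Basis. (w - l) \<bullet> b)) = (\<Prod>b\<in>Basis. (w - l) \<bullet> b)"
    using D by (simp add: field_simps)
  finally show "emeasure (density (distr lborel borel ?A) (\<lambda>_. ennreal \<bar>?d\<bar>)) (box l w) = ennreal (\<Prod>b\<in>Basis. (w - l) \<bullet> b)"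
    by (simp add: emeasure_density nn_integral_cmult emeasure_distr)
qed simp

lemma lborel_pt_pair: "lborel = distr (lborel \<Otimes>\<^sub>M lborel) borel (\<lambda>(t, s). vector [t, s] :: pt)"
proof (rule lborel_eqI)
  have cont: "continuous_on UNIV (\<lambda>(t, s). vector [t, s] :: pt)"
    by (subst continuous_on_componentwise) (auto simp: Basis_vec_def cart_eq_inner_axis[symmetric] forall_2 UNIV_2 split_beta intro!: continuous_intros)
  then have [measurable]: "(\<lambda>(t, s). vector [t, s] :: pt) \<in> borel_measurable (lborel \<Otimes>\<^sub>M lborel)"
    by (simp add: lborel_prod borel_measurable_continuous_onI[OF cont])
  fix l u :: pt assume lu: "\<And>b. b \<in> Basis \<Longrightarrow> l \<bullet> b \<le> u \<bullet> b"
  have le: "l $ 1 \<le> u $ 1" "l $ 2 \<le> u $ 2"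
    using lu[of "axis 1 1"] lu[of "axis 2 1"] by (auto simp: cart_eq_inner_axis Basis_vec_def)
  have pre: "(\<lambda>(t, s). vector [t, s] :: pt) -` box l u \<inter> space (lborel \<Otimes>\<^sub>M lborel) = {l $ 1<..<u $ 1} \<times> {l $ 2<..<u $ 2}"
    by (auto simp: mem_box_cart forall_2 space_pair_measure)
  have "(\<Prod>b\<in>Basis. (u - l) \<bullet> b) = (\<Prod>i\<in>UNIV. (u - l) $ i)"
    by (simp add: Basis_vec_def cart_eq_inner_axis prod.UNION_disjoint axis_eq_axis)
  also have "\<dots> = (u $ 1 - l $ 1) * (u $ 2 - l $ 2)" by (simp add: UNIV_2)
  finally show "emeasure (distr (lborel \<Otimes>\<^sub>M lborel) borel (\<lambda>(t, s). vector [t, s] :: pt)) (box l u) = ennreal (\<Prod>b\<in>Basis. (u - l) \<bullet> b)"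
    using le by (simp add: emeasure_distr pre lborel_pair.emeasure_pair_measure_Times lborel.emeasure_pair_measure_Times ennreal_mult)
qed simp

lemma nn_integral_parallelogram:
  fixes a u v :: pt and G :: "pt \<Rightarrow> ennreal"
  assumes [measurable]: "G \<in> borel_measurable borel" and D: "u $ 1 * v $ 2 - u $ 2 * v $ 1 \<noteq> 0"
  shows "(\<integral>\<^sup>+x. G x \<partial>lborel) = ennreal \<bar>u $ 1 * v $ 2 - u $ 2 * v $ 1\<bar> * (\<integral>\<^sup>+t. \<integral>\<^sup>+s. G (a + t *\<^sub>R u + s *\<^sub>R v) \<partial>lborel \<partial>lborel)"
proof -
  let ?d = "u $ 1 * v $ 2 - u $ 2 * v $ 1"
  have cont: "continuous_on UNIV (\<lambda>(t, s). vector [t, s] :: pt)"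
    by (subst continuous_on_componentwise) (auto simp: Basis_vec_def cart_eq_inner_axis[symmetric] forall_2 UNIV_2 split_beta intro!: continuous_intros)
  then have [measurable]: "(\<lambda>(t, s). vector [t, s] :: pt) \<in> borel_measurable (lborel \<Otimes>\<^sub>M lborel)"
    by (simp add: lborel_prod borel_measurable_continuous_onI[OF cont])
  have [measurable]: "(\<lambda>x::pt. x $ 1 *\<^sub>R u + x $ 2 *\<^sub>R v) \<in> borel_measurable borel"
    by (intro borel_measurable_continuous_onI continuous_intros)
  have "(\<integral>\<^sup>+x. G x \<partial>lborel) = (\<integral>\<^sup>+x. G (a + x) \<partial>lborel)"
    using nn_integral_affine[of G 1 a] by simp
  also have "\<dots> = ennreal \<bar>?d\<bar> * (\<integral>\<^sup>+x. G (a + ((x::pt) $ 1 *\<^sub>R u + x $ 2 *\<^sub>R v)) \<partial>lborel)"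
    by (subst lborel_linear2[OF D]) (simp add: nn_integral_density nn_integral_distr nn_integral_cmult)
  also have "(\<integral>\<^sup>+x. G (a + ((x::pt) $ 1 *\<^sub>R u + x $ 2 *\<^sub>R v)) \<partial>lborel) = (\<integral>\<^sup>+(t, s). G (a + (t *\<^sub>R u + s *\<^sub>R v)) \<partial>(lborel \<Otimes>\<^sub>M lborel))"
    by (subst lborel_pt_pair) (simp add: nn_integral_distr split_beta')
  also have "\<dots> = (\<integral>\<^sup>+t. \<integral>\<^sup>+s. G (a + t *\<^sub>R u + s *\<^sub>R v) \<partial>lborel \<partial>lborel)"
    by (subst lborel.nn_integral_fst[symmetric]) (auto simp: add.assoc)
  finally show ?thesis .
qed

text \<open>A point of the half edge is joined in the direction \<open>v\<close> to points of a
  parallelogram. Averaging over the position \<open>s\<close> compares the trace with values of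
  \<open>f\<close> inside, and the area element, at least \<delta>, turns the iterated integral into
  one over \<open>S\<close>.\<close>

lemma trace_half:
  fixes a u v :: pt and f :: "pt \<Rightarrow> real"
  assumes S: "S \<in> sets borel" and f: "\<And>z. z \<in> S \<Longrightarrow> GDERIV f z :> f' z" and c: "continuous_on S f'"
    and sub: "\<And>t s. t \<in> {0..1/2} \<Longrightarrow> s \<in> {0..1/2} \<Longrightarrow> a + t *\<^sub>R u + s *\<^sub>R v \<in> S"
    and D: "0 < \<delta>" "\<delta> \<le> \<bar>u $ 1 * v $ 2 - u $ 2 * v $ 1\<bar>" and v: "norm v \<le> d"
  shows "(sq_int lborel {0..1/2} (\<lambda>t. f (a + t *\<^sub>R u) - m)) \<le>
    ennreal (1 / \<delta>) * (ennreal (d\<^sup>2) * (sq_int lborel S (\<lambda>z. norm (f' z))) + 4 * (sq_int lborel S (\<lambda>z. f z - m)))"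
proof -
  let ?D = "\<bar>u $ 1 * v $ 2 - u $ 2 * v $ 1\<bar>"
  define G1 where "G1 = (\<lambda>z. ennreal ((norm (f' z))\<^sup>2) * indicator S z)"
  define G2 where "G2 = (\<lambda>z. ennreal ((norm (f z - m))\<^sup>2) * indicator S z)"
  have cf: "continuous_on S f"
    using f by (auto intro!: continuous_at_imp_continuous_on has_derivative_continuous simp: gderiv_def)
  have [measurable]: "G1 \<in> borel_measurable borel" "G2 \<in> borel_measurable borel"
    unfolding G1_def G2_def by (rule borel_measurable_sq_indicator[OF S], intro continuous_intros c cf)+
  define J where "J = (\<lambda>t. \<integral>\<^sup>+s\<in>{0..1/2}. G1 (a + t *\<^sub>R u + s *\<^sub>R v) \<partial>lborel)"
  define K where "K = (\<lambda>t. \<integral>\<^sup>+s\<in>{0..1/2}. G2 (a + t *\<^sub>R u + s *\<^sub>R v) \<partial>lborel)"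
  have [measurable]: "J \<in> borel_measurable borel" "K \<in> borel_measurable borel"
    unfolding J_def K_def by measurable
  have pt: "ennreal ((f (a + t *\<^sub>R u) - m)\<^sup>2) \<le> ennreal (d\<^sup>2) * J t + 4 * K t" if t: "t \<in> {0..1/2}" for t
  proof -
    let ?x = "a + t *\<^sub>R u"
    let ?X = "ennreal ((f ?x - m)\<^sup>2)"
    \<comment> \<open>As s <= 1/2, the factor 2 of the squared triangle inequality leaves d^2 in
      front of \<open>J\<close>. Integrating over an interval of length 1/2 and doubling makes 4 out
      of the 2 before \<open>G2\<close>.\<close>
    have "?X \<le> ennreal (d\<^sup>2) * J t + 2 * G2 (?x + s *\<^sub>R v)" if s: "s \<in> {0..1/2}" for s
    proof -
      have "ennreal ((f (?x + s *\<^sub>R v) - f ?x)\<^sup>2) \<le> ennreal (s * (norm v)\<^sup>2) * (sq_int lborel {0..s} (\<lambda>t. norm (f' (?x + t *\<^sub>R v))))"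
        using s t by (intro power2_diff_le_line_integral[OF _ _ f c] sub) auto
      also have "\<dots> \<le> ennreal (1/2 * d\<^sup>2) * J t"
        unfolding J_def
      proof (rule mult_mono)
        show "ennreal (s * (norm v)\<^sup>2) \<le> ennreal (1/2 * d\<^sup>2)"
          using s v by (intro ennreal_leI mult_mono power_mono) auto
        show "(sq_int lborel {0..s} (\<lambda>t. norm (f' (?x + t *\<^sub>R v)))) \<le> (\<integral>\<^sup>+s\<in>{0..1/2}. G1 (?x + s *\<^sub>R v) \<partial>lborel)"
        proof (rule nn_integral_mono)
        fix \<tau>
        show "ennreal ((norm (f' (?x + \<tau> *\<^sub>R v)))\<^sup>2) * indicator {0..s} \<tau> \<le> G1 (?x + \<tau> *\<^sub>R v) * indicator {0..1/2} \<tau>"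
        proof (cases "\<tau> \<in> {0..s}")
          case True
          then have "\<tau> \<in> {0..1/2}" using s by auto
          then show ?thesis using sub[OF t, of \<tau>] True by (simp add: G1_def)
        qed simp
        qed
      qed auto
      finally have 1: "ennreal ((f (?x + s *\<^sub>R v) - f ?x)\<^sup>2) \<le> ennreal (1/2 * d\<^sup>2) * J t" .
      have "(f ?x - m)\<^sup>2 \<le> 2 * (f (?x + s *\<^sub>R v) - f ?x)\<^sup>2 + 2 * (f (?x + s *\<^sub>R v) - m)\<^sup>2"
        using zero_le_power2[of "(f (?x + s *\<^sub>R v) - f ?x) + (f (?x + s *\<^sub>R v) - m)"] by (simp add: power2_eq_square algebra_simps)
      then have "?X \<le> ennreal (2 * (f (?x + s *\<^sub>R v) - f ?x)\<^sup>2 + 2 * (f (?x + s *\<^sub>R v) - m)\<^sup>2)" by (rule ennreal_leI)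
      also have "\<dots> = 2 * ennreal ((f (?x + s *\<^sub>R v) - f ?x)\<^sup>2) + 2 * G2 (?x + s *\<^sub>R v)"
        using sub[OF t s] by (simp add: G2_def ennreal_mult)
      also have "\<dots> \<le> 2 * (ennreal (1/2 * d\<^sup>2) * J t) + 2 * G2 (?x + s *\<^sub>R v)"
        using 1 by (intro add_right_mono mult_left_mono) auto
      also have "2 * (ennreal (1/2 * d\<^sup>2) * J t) = ennreal (2 * (1/2 * d\<^sup>2)) * J t"
        by (subst ennreal_mult) (auto simp: mult.assoc)
      finally show ?thesis by simp
    qed
    then have "(\<integral>\<^sup>+s. ?X * indicator {0..1/2::real} s \<partial>lborel) \<le> (\<integral>\<^sup>+s. (ennreal (d\<^sup>2) * J t) * indicator {0..1/2::real} s + 2 * (G2 (?x + s *\<^sub>R v) * indicator {0..1/2} s) \<partial>lborel)"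
      by (intro nn_integral_mono) (auto simp: indicator_def)
    also have "\<dots> = (ennreal (d\<^sup>2) * J t) * ennreal (1/2) + 2 * K t"
      unfolding K_def by (subst nn_integral_add, measurable) (simp add: nn_integral_cmult)
    also have "(\<integral>\<^sup>+s. ?X * indicator {0..1/2::real} s \<partial>lborel) = ?X * ennreal (1/2)"
      by (simp add: nn_integral_cmult)
    finally have "2 * (?X * ennreal (1/2)) \<le> 2 * ((ennreal (d\<^sup>2) * J t) * ennreal (1/2) + 2 * K t)"
      by (rule mult_left_mono) simp
    moreover have "2 * (Y * ennreal (1/2)) = Y" for Y :: ennreal
    proof -
      have "2 * (Y * ennreal (1/2)) = Y * (ennreal 2 * ennreal (1/2))" by (simp add: ac_simps)
      also have "ennreal 2 * ennreal (1/2) = 1" by (subst ennreal_mult[symmetric]) auto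
      finally show ?thesis by simp
    qed
    moreover have "2 * (2 * K t) = 4 * K t" by (simp flip: mult.assoc)
    ultimately show ?thesis by (simp only: distrib_left)
  qed
  have par: "(\<integral>\<^sup>+t. (\<integral>\<^sup>+s\<in>{0..1/2}. G (a + t *\<^sub>R u + s *\<^sub>R v) \<partial>lborel) \<partial>lborel) \<le> ennreal (1 / \<delta>) * (\<integral>\<^sup>+z. G z \<partial>lborel)"
    if [measurable]: "G \<in> borel_measurable borel" for G
  proof -
    have "(\<integral>\<^sup>+t. (\<integral>\<^sup>+s\<in>{0..1/2}. G (a + t *\<^sub>R u + s *\<^sub>R v) \<partial>lborel) \<partial>lborel) \<le> (\<integral>\<^sup>+t. \<integral>\<^sup>+s. G (a + t *\<^sub>R u + s *\<^sub>R v) \<partial>lborel \<partial>lborel)" (is "_ \<le> ?P")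
      by (intro nn_integral_mono) (auto simp: indicator_def)
    also have "?P = ennreal (1 / \<delta> * \<delta>) * ?P" using D by simp
    also have "\<dots> = ennreal (1 / \<delta>) * (ennreal \<delta> * ?P)" using D by (subst ennreal_mult) (auto simp: mult.assoc)
    also have "\<dots> \<le> ennreal (1 / \<delta>) * (ennreal ?D * ?P)"
      using D by (intro mult_left_mono mult_right_mono ennreal_leI) auto
    also have "ennreal ?D * ?P = (\<integral>\<^sup>+z. G z \<partial>lborel)"
      using nn_integral_parallelogram[of G u v a] D by auto
    finally show ?thesis .
  qed
  have "(sq_int lborel {0..1/2} (\<lambda>t. f (a + t *\<^sub>R u) - m)) \<le> (\<integral>\<^sup>+t. ennreal (d\<^sup>2) * J t + 4 * K t \<partial>lborel)"
    using pt by (intro nn_integral_mono) (auto simp: indicator_def)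
  also have "\<dots> = ennreal (d\<^sup>2) * (\<integral>\<^sup>+t. J t \<partial>lborel) + 4 * (\<integral>\<^sup>+t. K t \<partial>lborel)"
    by (subst nn_integral_add, measurable) (simp add: nn_integral_cmult)
  also have "\<dots> \<le> ennreal (d\<^sup>2) * (ennreal (1 / \<delta>) * (\<integral>\<^sup>+z. G1 z \<partial>lborel)) + 4 * (ennreal (1 / \<delta>) * (\<integral>\<^sup>+z. G2 z \<partial>lborel))"
    unfolding J_def K_def by (intro add_mono mult_left_mono par) auto
  finally show ?thesis
    by (simp add: G1_def G2_def distrib_left ac_simps)
qed

text \<open>A parallelogram with sides of full length at \<open>a\<close> would leave the triangle,
  with halved sides it stays inside. So the segment is halved and each half is treated from its own
  end; the two determinants agree up to sign.\<close>

lemma trace_segment: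
  fixes a b p :: pt and f :: "pt \<Rightarrow> real"
  assumes S: "S \<in> sets borel" "convex S" "a \<in> S" "b \<in> S" "p \<in> S"
    and f: "\<And>z. z \<in> S \<Longrightarrow> GDERIV f z :> f' z" and c: "continuous_on S f'"
    and D: "0 < \<delta>" "\<delta> \<le> \<bar>(b - a) $ 1 * (p - a) $ 2 - (b - a) $ 2 * (p - a) $ 1\<bar>" and d: "dist a p \<le> d" "dist b p \<le> d"
  shows "(sq_int lborel {0..1} (\<lambda>t. f (a + t *\<^sub>R (b - a)) - m)) \<le>
    ennreal (2 / \<delta>) * (ennreal (d\<^sup>2) * (sq_int lborel S (\<lambda>z. norm (f' z))) + 4 * (sq_int lborel S (\<lambda>z. f z - m)))"
    (is "_ \<le> ennreal (2 / \<delta>) * ?R")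
proof -
  have mem: "a + t *\<^sub>R (b - a) + s *\<^sub>R (p - a) \<in> S" if "a \<in> S" "b \<in> S" "t \<in> {0..1/2}" "s \<in> {0..1/2}" for a b t s
  proof -
    have "(1 - 2 * t) *\<^sub>R a + (2 * t) *\<^sub>R b \<in> S" "(1 - 2 * s) *\<^sub>R a + (2 * s) *\<^sub>R p \<in> S"
      using that by (auto intro!: convexD[OF S(2)] S)
    then have "(1/2) *\<^sub>R ((1 - 2 * t) *\<^sub>R a + (2 * t) *\<^sub>R b) + (1/2) *\<^sub>R ((1 - 2 * s) *\<^sub>R a + (2 * s) *\<^sub>R p) \<in> S"
      by (rule convexD[OF S(2)]) auto
    also have "(1/2) *\<^sub>R ((1 - 2 * t) *\<^sub>R a + (2 * t) *\<^sub>R b) + (1/2) *\<^sub>R ((1 - 2 * s) *\<^sub>R a + (2 * s) *\<^sub>R p) =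
      ((1/2) *\<^sub>R a + (1/2) *\<^sub>R a) + t *\<^sub>R (b - a) + s *\<^sub>R (p - a)"
      by (simp add: algebra_simps)
    also have "(1/2) *\<^sub>R a + (1/2) *\<^sub>R a = a" by (simp flip: scaleR_add_left)
    finally show ?thesis .
  qed
  have 1: "(sq_int lborel {0..1/2} (\<lambda>t. f (a + t *\<^sub>R (b - a)) - m)) \<le> ennreal (1 / \<delta>) * ?R"
    using d by (intro trace_half[OF S(1) f c mem[OF S(3,4)] D]) (auto simp: dist_norm norm_minus_commute)
  have "\<delta> \<le> \<bar>(a - b) $ 1 * (p - b) $ 2 - (a - b) $ 2 * (p - b) $ 1\<bar>"
    using D(2) by (simp add: algebra_simps abs_minus_commute)
  then have 2: "(sq_int lborel {0..1/2} (\<lambda>t. f (b + t *\<^sub>R (a - b)) - m)) \<le> ennreal (1 / \<delta>) * ?R"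
    using d by (intro trace_half[OF S(1) f c mem[OF S(4,3)] D(1)]) (auto simp: dist_norm norm_minus_commute)
  have cf: "continuous_on S f"
    using f by (auto intro!: continuous_at_imp_continuous_on has_derivative_continuous simp: gderiv_def)
  have seg: "a + t *\<^sub>R (b - a) \<in> S" if "t \<in> {0..1}" for t
  proof -
    have "(1 - t) *\<^sub>R a + t *\<^sub>R b \<in> S" using that S by (intro convexD) auto
    then show ?thesis by (simp add: algebra_simps)
  qed
  let ?h = "\<lambda>t. ennreal ((norm (f (a + t *\<^sub>R (b - a)) - m))\<^sup>2)"
  have hm: "(\<lambda>t. ?h t * indicator A t) \<in> borel_measurable borel" if "A \<in> sets borel" "A \<subseteq> {0..1}" for A
    using that seg by (intro borel_measurable_sq_indicator continuous_intros continuous_on_compose2[OF cf]) auto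
  have "(sq_int lborel {0..1} (\<lambda>t. f (a + t *\<^sub>R (b - a)) - m)) \<le>
    (\<integral>\<^sup>+t. ?h t * indicator {0..1/2} t + ?h t * indicator {1/2..1} t \<partial>lborel)"
    by (intro nn_integral_mono) (auto simp: indicator_def)
  also have "\<dots> = (\<integral>\<^sup>+t. ?h t * indicator {0..1/2} t \<partial>lborel) + (\<integral>\<^sup>+t. ?h t * indicator {1/2..1} t \<partial>lborel)"
    using hm by (intro nn_integral_add) auto
  also have "(\<integral>\<^sup>+t. ?h t * indicator {1/2..1} t \<partial>lborel) = (\<integral>\<^sup>+t. ?h (1 + - 1 * t) * indicator {1/2..1} (1 + - 1 * t) \<partial>lborel)"
    using hm[of "{1/2..1}"] by (subst nn_integral_real_affine[where c = "-1" and t = 1]) auto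
  also have "\<dots> = (sq_int lborel {0..1/2} (\<lambda>t. f (b + t *\<^sub>R (a - b)) - m))"
    by (intro nn_integral_cong) (auto simp: indicator_def algebra_simps)
  finally have "(sq_int lborel {0..1} (\<lambda>t. f (a + t *\<^sub>R (b - a)) - m)) \<le> ennreal (1 / \<delta>) * ?R + ennreal (1 / \<delta>) * ?R"
    using add_mono[OF 1 2] by simp
  also have "\<dots> = ennreal (1 / \<delta> + 1 / \<delta>) * ?R"
    using D by (subst ennreal_plus) (auto simp: distrib_right)
  finally show ?thesis by simp
qed

text \<open>The inequality (f x - f z)^2 <= 2 (f x - f y)^2 + 2 (f y - f z)^2 is integrated over all
  \<open>x\<close> in \<open>A\<close>, \<open>y\<close> in \<open>B\<close> and \<open>z\<close> in
  \<open>C\<close>. The middle set appears on the left by its measure, which therefore has to be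
  bounded below in applications.\<close>

lemma double_integral_chain:
  fixes f :: "'a::euclidean_space \<Rightarrow> real"
  assumes [measurable]: "f \<in> borel_measurable borel" "A \<in> sets borel" "B \<in> sets borel" "C \<in> sets borel"
  defines "P \<equiv> \<lambda>A B. \<integral>\<^sup>+x\<in>A. (sq_int lborel B (\<lambda>y. f x - f y)) \<partial>lborel"
  shows "emeasure lborel B * P A C \<le> 2 * (emeasure lborel C * P A B + emeasure lborel A * P B C)"
proof -
  let ?e = "\<lambda>x y. ennreal ((f x - f y)\<^sup>2)"
  have tri: "?e x z \<le> 2 * (?e x y + ?e y z)" for x y z
  proof -
    have "(f x - f z)\<^sup>2 \<le> 2 * ((f x - f y)\<^sup>2 + (f y - f z)\<^sup>2)"
      using zero_le_power2[of "(f x - f y) - (f y - f z)"] by (simp add: power2_eq_square algebra_simps)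
    then have "?e x z \<le> ennreal (2 * ((f x - f y)\<^sup>2 + (f y - f z)\<^sup>2))" by (rule ennreal_leI)
    also have "\<dots> = 2 * (?e x y + ?e y z)" by (simp add: ennreal_mult)
    finally show ?thesis .
  qed
  have x: "emeasure lborel B * (\<integral>\<^sup>+z\<in>C. ?e x z \<partial>lborel) \<le> 2 * (emeasure lborel C * (\<integral>\<^sup>+y\<in>B. ?e x y \<partial>lborel) + P B C)" for x
  proof -
    have "emeasure lborel B * (\<integral>\<^sup>+z\<in>C. ?e x z \<partial>lborel) = (\<integral>\<^sup>+y\<in>B. (\<integral>\<^sup>+z\<in>C. ?e x z \<partial>lborel) \<partial>lborel)"
      using nn_integral_cmult_indicator[of B lborel "\<integral>\<^sup>+z\<in>C. ?e x z \<partial>lborel"] by (simp add: mult.commute)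
    also have "\<dots> \<le> (\<integral>\<^sup>+y\<in>B. (\<integral>\<^sup>+z\<in>C. 2 * (?e x y + ?e y z) \<partial>lborel) \<partial>lborel)"
      by (intro nn_integral_mono mult_right_mono tri) auto
    also have "\<dots> = (\<integral>\<^sup>+y. 2 * (emeasure lborel C * (?e x y * indicator B y) + (\<integral>\<^sup>+z\<in>C. ?e y z \<partial>lborel) * indicator B y) \<partial>lborel)"
    proof (intro nn_integral_cong)
      fix y
      have "(\<integral>\<^sup>+z\<in>C. 2 * (?e x y + ?e y z) \<partial>lborel) = (\<integral>\<^sup>+z. 2 * (?e x y * indicator C z + ?e y z * indicator C z) \<partial>lborel)"
        by (simp add: distrib_right mult.assoc)
      also have "\<dots> = 2 * (?e x y * emeasure lborel C + (\<integral>\<^sup>+z\<in>C. ?e y z \<partial>lborel))"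
        by (subst nn_integral_cmult, measurable) (subst nn_integral_add, measurable, simp add: nn_integral_cmult)
      finally show "(\<integral>\<^sup>+z\<in>C. 2 * (?e x y + ?e y z) \<partial>lborel) * indicator B y = 2 * (emeasure lborel C * (?e x y * indicator B y) + (\<integral>\<^sup>+z\<in>C. ?e y z \<partial>lborel) * indicator B y)"
        by (simp add: distrib_left distrib_right ac_simps)
    qed
    also have "\<dots> = 2 * (emeasure lborel C * (\<integral>\<^sup>+y\<in>B. ?e x y \<partial>lborel) + P B C)"
      unfolding P_def by (subst nn_integral_cmult, measurable) (subst nn_integral_add, measurable, simp add: nn_integral_cmult)
    finally show ?thesis .
  qed
  have "emeasure lborel B * P A C = (\<integral>\<^sup>+x\<in>A. (emeasure lborel B * (\<integral>\<^sup>+z\<in>C. ?e x z \<partial>lborel)) \<partial>lborel)"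
    unfolding P_def by (subst nn_integral_cmult[symmetric], measurable) (simp add: mult.assoc)
  also have "\<dots> \<le> (\<integral>\<^sup>+x\<in>A. (2 * (emeasure lborel C * (\<integral>\<^sup>+y\<in>B. ?e x y \<partial>lborel) + P B C)) \<partial>lborel)"
    by (intro nn_integral_mono mult_right_mono x) auto
  also have "\<dots> = (\<integral>\<^sup>+x. 2 * (emeasure lborel C * ((\<integral>\<^sup>+y\<in>B. ?e x y \<partial>lborel) * indicator A x) + P B C * indicator A x) \<partial>lborel)"
    by (intro nn_integral_cong) (simp add: distrib_left distrib_right ac_simps)
  also have "\<dots> = 2 * (emeasure lborel C * P A B + P B C * emeasure lborel A)"
    unfolding P_def by (subst nn_integral_cmult, measurable) (subst nn_integral_add, measurable, simp add: nn_integral_cmult)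
  finally show ?thesis by (simp add: mult.commute)
qed

text \<open>The form s^2 F - 2 s t P + t^2 G is the integral of a square. It is evaluated at (s, t)
  = (P, F) if F is nonzero and at (G + 1, P) if F = 0, where it forces P = 0.\<close>

lemma Cauchy_Schwarz_set_integral:
  fixes f g :: "'a \<Rightarrow> real"
  assumes f: "set_integrable M A (\<lambda>x. (f x)\<^sup>2)" and g: "set_integrable M A (\<lambda>x. (g x)\<^sup>2)" and fg: "set_integrable M A (\<lambda>x. f x * g x)"
  shows "(LINT x:A|M. f x * g x)\<^sup>2 \<le> (LINT x:A|M. (f x)\<^sup>2) * (LINT x:A|M. (g x)\<^sup>2)"
proof -
  let ?F = "LINT x:A|M. (f x)\<^sup>2" and ?G = "LINT x:A|M. (g x)\<^sup>2" and ?P = "LINT x:A|M. f x * g x"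
  have q: "0 \<le> s\<^sup>2 * ?F - 2 * s * t * ?P + t\<^sup>2 * ?G" for s t :: real
  proof -
    have "0 \<le> (LINT x:A|M. (s * f x - t * g x)\<^sup>2)"
      unfolding set_lebesgue_integral_def by (intro integral_nonneg_AE AE_I2) simp
    also have "(LINT x:A|M. (s * f x - t * g x)\<^sup>2) = (LINT x:A|M. s\<^sup>2 * (f x)\<^sup>2 - (2 * s * t) * (f x * g x) + t\<^sup>2 * (g x)\<^sup>2)"
    proof -
      have "(\<lambda>x. (s * f x - t * g x)\<^sup>2) = (\<lambda>x. s\<^sup>2 * (f x)\<^sup>2 - (2 * s * t) * (f x * g x) + t\<^sup>2 * (g x)\<^sup>2)"
        by (intro ext) (simp add: power2_eq_square algebra_simps)
      then show ?thesis by simp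
    qed
    also have "\<dots> = s\<^sup>2 * ?F - 2 * s * t * ?P + t\<^sup>2 * ?G"
      using f g fg by (simp add: set_integral_add set_integral_diff)
    finally show ?thesis .
  qed
  have nn: "0 \<le> ?F" "0 \<le> ?G"
    unfolding set_lebesgue_integral_def by (auto intro!: integral_nonneg_AE AE_I2)
  show ?thesis
  proof (cases "?F = 0")
    case False
    have "0 \<le> ?P\<^sup>2 * ?F - 2 * ?P * ?F * ?P + ?F\<^sup>2 * ?G" by (rule q)
    then have "0 \<le> ?F * (?F * ?G - ?P\<^sup>2)" by (simp add: power2_eq_square algebra_simps)
    then show ?thesis using nn False by (simp add: zero_le_mult_iff)
  next
    case True
    show ?thesis
    proof (cases "?P = 0")
      case False
      have "0 \<le> (?G + 1)\<^sup>2 * ?F - 2 * (?G + 1) * ?P * ?P + ?P\<^sup>2 * ?G" by (rule q)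
      then have "0 \<le> - (?P\<^sup>2 * (?G + 2))" using True by (simp add: power2_eq_square algebra_simps)
      moreover have "0 < ?P\<^sup>2 * (?G + 2)" using False nn by (intro mult_pos_pos) auto
      ultimately show ?thesis by linarith
    qed (use True in simp)
  qed
qed

subsection \<open>Functions on an interval with square integrable weak derivative\<close>

lemma mollifier_exists:
  fixes g :: "real \<Rightarrow> real"
  assumes s: "0 < s" "s < L" and g: "continuous_on {0<..<L} g" and \<eta>: "\<eta> > 0"
  obtains \<rho> m M where "\<And>k. k_times_cont_diff k \<rho>" "\<And>x. \<rho> x \<ge> 0" "0 < m" "m < M" "M < L" "\<And>x. x \<notin> {m..M} \<Longrightarrow> \<rho> x = 0"
    "integral {m..M} \<rho> = 1" "\<bar>integral {m..M} (\<lambda>x. g x * \<rho> x) - g s\<bar> \<le> \<eta>"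
proof -
  have "isCont g s"
    using g s by (simp add: continuous_on_eq_continuous_at)
  then obtain \<delta>0 where \<delta>0: "\<delta>0 > 0" "\<And>x. dist x s < \<delta>0 \<Longrightarrow> dist (g x) (g s) < \<eta>"
    using \<eta> unfolding continuous_at_eps_delta by blast
  \<comment> \<open>Halving the distances keeps the support strictly inside the interval and within
    the radius where \<open>g\<close> varies by less than \<eta>.\<close>
  define \<delta> where "\<delta> = min (\<delta>0 / 2) (min (s / 2) ((L - s) / 2))"
  have \<delta>: "\<delta> > 0" "\<delta> < \<delta>0" "0 < s - \<delta>" "s + \<delta> < L"
  proof -
    have "\<delta> \<le> \<delta>0 / 2" unfolding \<delta>_def by (rule min.cobounded1)
    moreover have "\<delta> \<le> s / 2" unfolding \<delta>_def by (rule min.coboundedI2, rule min.cobounded1)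
    moreover have "\<delta> \<le> (L - s) / 2" unfolding \<delta>_def by (rule min.coboundedI2, rule min.cobounded2)
    ultimately have "\<delta> \<le> \<delta>0 / 2" "2 * \<delta> \<le> s" "2 * \<delta> \<le> L - s" by simp_all
    then show "\<delta> < \<delta>0" "0 < s - \<delta>" "s + \<delta> < L" using \<delta>0(1) s by linarith+
    show "\<delta> > 0" using \<delta>0(1) s unfolding \<delta>_def by auto
  qed
  let ?m = "s - \<delta>" and ?M = "s + \<delta>"
  let ?b = "box_bump ?m ?M"
  have bk: "k_times_cont_diff k ?b" for k by (rule k_times_cont_diff_box_bump)
  have bc: "continuous_on UNIV ?b" using bk[of 0] by simp
  have b0: "?b x = 0" if "x \<notin> {?m..?M}" for x
    using box_bump_pos[of ?m ?M x] box_bump_nonneg[of ?m ?M x] that by (auto simp: box_real)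
  define c where "c = integral {?m..?M} ?b"
  have bi: "?b integrable_on {?m..?M}"
    using bc by (intro integrable_continuous_real) (rule continuous_on_subset, auto)
  have "c \<ge> 0" unfolding c_def using box_bump_nonneg by (intro integral_nonneg bi) auto
  moreover have "c \<noteq> 0"
  proof
    assume "c = 0"
    then have "(?b has_integral 0) (cbox ?m ?M)" using bi unfolding c_def by (metis box_real(2) has_integral_integral)
    then have "?b s = 0"
      using \<delta> box_bump_nonneg continuous_on_subset[OF bc] by (intro has_integral_0_cbox_imp_0[of ?m ?M ?b]) (auto simp: box_real)
    moreover have "?b s > 0" using \<delta> by (simp add: box_bump_pos box_real)
    ultimately show False by simp
  qed
  ultimately have c: "c > 0" by simp
  let ?\<rho> = "\<lambda>x. ?b x * (1 / c)"
  have \<rho>c: "continuous_on A ?\<rho>" for A using bc by (intro continuous_intros) (rule continuous_on_subset, auto)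
  show ?thesis
  proof (rule that[of ?\<rho> ?m ?M])
    show "k_times_cont_diff k ?\<rho>" for k by (intro k_times_cont_diff_mult bk k_times_cont_diff_const)
    show "0 \<le> ?\<rho> x" for x using box_bump_nonneg[of ?m ?M x] c by simp
    show one: "integral {?m..?M} ?\<rho> = 1" using c by (simp add: c_def)
    have gc: "continuous_on {?m..?M} g" using \<delta> by (intro continuous_on_subset[OF g]) auto
    have i1: "(\<lambda>x. g x * ?\<rho> x) integrable_on {?m..?M}" "?\<rho> integrable_on {?m..?M}" "(\<lambda>x. g s * ?\<rho> x) integrable_on {?m..?M}" "(\<lambda>x. \<eta> * ?\<rho> x) integrable_on {?m..?M}"
      by (intro integrable_continuous_real continuous_on_mult gc \<rho>c continuous_on_const)+
    have eq: "integral {?m..?M} (\<lambda>x. g x * ?\<rho> x) - g s = integral {?m..?M} (\<lambda>x. g x * ?\<rho> x - g s * ?\<rho> x)"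
      using i1 one by (subst Henstock_Kurzweil_Integration.integral_diff) auto
    have "\<bar>integral {?m..?M} (\<lambda>x. g x * ?\<rho> x - g s * ?\<rho> x)\<bar> \<le> integral {?m..?M} (\<lambda>x. \<eta> * ?\<rho> x)"
    proof -
      have "norm (integral {?m..?M} (\<lambda>x. g x * ?\<rho> x - g s * ?\<rho> x)) \<le> integral {?m..?M} (\<lambda>x. \<eta> * ?\<rho> x)"
      proof (rule integral_norm_bound_integral)
        show "(\<lambda>x. g x * ?\<rho> x - g s * ?\<rho> x) integrable_on {?m..?M}" using i1 by (intro integrable_diff)
        fix x assume x: "x \<in> {?m..?M}"
        then have "dist (g x) (g s) < \<eta>" using \<delta> by (intro \<delta>0) (auto simp: dist_real_def)
        then have "\<bar>g x - g s\<bar> * ?\<rho> x \<le> \<eta> * ?\<rho> x"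
          using box_bump_nonneg[of ?m ?M x] c by (intro mult_right_mono) (auto simp: dist_real_def)
        moreover have "norm (g x * ?\<rho> x - g s * ?\<rho> x) = \<bar>g x - g s\<bar> * ?\<rho> x"
        proof -
          have "g x * ?\<rho> x - g s * ?\<rho> x = (g x - g s) * ?\<rho> x" by (rule left_diff_distrib[symmetric])
          moreover have "\<bar>?\<rho> x\<bar> = ?\<rho> x" using box_bump_nonneg[of ?m ?M x] c by simp
          ultimately show ?thesis by (simp only: real_norm_def abs_mult)
        qed
        ultimately show "norm (g x * ?\<rho> x - g s * ?\<rho> x) \<le> \<eta> * ?\<rho> x" by simp
      qed (rule i1)
      then show ?thesis by simp
    qed
    also have "\<dots> = \<eta>" using one by simp
    finally show "\<bar>integral {?m..?M} (\<lambda>x. g x * ?\<rho> x) - g s\<bar> \<le> \<eta>" unfolding eq .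
  qed (use \<delta> b0 in auto)
qed

lemma integral_enlarge:
  fixes f :: "real \<Rightarrow> real"
  assumes "{m..M} \<subseteq> S" "\<And>x. x \<notin> {m..M} \<Longrightarrow> f x = 0"
  shows "integral S f = integral {m..M} f"
proof (rule integral_spike_set)
  have "{x \<in> S - {m..M}. f x \<noteq> 0} = {}" "{x \<in> {m..M} - S. f x \<noteq> 0} = {}" using assms by auto
  then show "negligible {x \<in> S - {m..M}. f x \<noteq> 0}" "negligible {x \<in> {m..M} - S. f x \<noteq> 0}" by (simp_all only: negligible_empty)
qed

lemma set_integral_compact_support:
  fixes f :: "real \<Rightarrow> real"
  assumes "continuous_on {m..M} f" "\<And>x. x \<notin> {m..M} \<Longrightarrow> f x = 0" "{m..M} \<subseteq> S"
  shows "set_integrable lebesgue S f" "(LINT x:S|lebesgue. f x) = integral {m..M} f"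
proof -
  have *: "(\<lambda>x. indicator S x *\<^sub>R f x) = (\<lambda>x. indicator {m..M} x *\<^sub>R f x)"
    using assms(2,3) by (auto simp: fun_eq_iff indicator_def)
  have i: "f absolutely_integrable_on {m..M}"
    using assms(1) by (rule absolutely_integrable_continuous_real)
  then show "set_integrable lebesgue S f" unfolding set_integrable_def * .
  show "(LINT x:S|lebesgue. f x) = integral {m..M} f"
    using set_lebesgue_integral_eq_integral(2)[OF i] unfolding set_lebesgue_integral_def * .
qed

text \<open>The test function is the antiderivative of the difference of two mollifiers, which
  concentrate at the two points.\<close>

lemma weak_derivative_increment:
  fixes g h :: "real \<Rightarrow> real"
  assumes g: "continuous_on {0<..<L} g" and h: "h \<in> L2 lebesgue {0<..<L}" and w: "weak_gradient {0<..<L} g h"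
    and s: "0 < s" "s < L" and t: "0 < t" "t < L"
  shows "\<bar>g s - g t\<bar> \<le> (LINT x:{0<..<L}|lebesgue. \<bar>h x\<bar>)"
proof (rule field_le_epsilon)
  fix e :: real assume e: "e > 0"
  obtain \<rho> m M where \<rho>: "\<And>k. k_times_cont_diff k \<rho>" "\<And>x. \<rho> x \<ge> 0" "0 < m" "m < M" "M < L" "\<And>x. x \<notin> {m..M} \<Longrightarrow> \<rho> x = 0"
    "integral {m..M} \<rho> = 1" "\<bar>integral {m..M} (\<lambda>x. g x * \<rho> x) - g s\<bar> \<le> e / 2"
    using mollifier_exists[OF s g, of "e / 2"] e by auto
  obtain \<sigma> n K where \<sigma>: "\<And>k. k_times_cont_diff k \<sigma>" "\<And>x. \<sigma> x \<ge> 0" "0 < n" "n < K" "K < L" "\<And>x. x \<notin> {n..K} \<Longrightarrow> \<sigma> x = 0"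
    "integral {n..K} \<sigma> = 1" "\<bar>integral {n..K} (\<lambda>x. g x * \<sigma> x) - g t\<bar> \<le> e / 2"
    using mollifier_exists[OF t g, of "e / 2"] e by auto
  define a b where "a = min m n" and "b = max M K"
  have ab: "0 < a" "a \<le> m" "a \<le> n" "M \<le> b" "K \<le> b" "b < L" "a < b" using \<rho> \<sigma> by (auto simp: a_def b_def)
  define k where "k = (\<lambda>x. \<rho> x - \<sigma> x)"
  \<comment> \<open>The base point -1 lies to the left of both supports; for x < -1 the interval is
    empty and the integral 0, so \<phi> vanishes there as well.\<close>
  define \<phi> where "\<phi> = (\<lambda>x. integral {-1..x} k)"
  have kk: "k_times_cont_diff j k" for j
    using k_times_cont_diff_add[OF \<rho>(1) k_times_cont_diff_mult[OF k_times_cont_diff_const[of j "-1"] \<sigma>(1)]]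
    by (simp add: k_def)
  have c: "continuous_on A \<rho>" "continuous_on A \<sigma>" "continuous_on A k" for A
    using \<rho>(1)[of 0] \<sigma>(1)[of 0] kk[of 0] by (auto intro: continuous_on_subset)
  have k0: "k x = 0" if "x \<notin> {a..b}" for x
    using that ab \<rho>(6)[of x] \<sigma>(6)[of x] by (auto simp: k_def)
  have tot: "integral {-1..x} \<rho> = 1" "integral {-1..x} \<sigma> = 1" if "x \<ge> b" for x
  proof -
    have "integral {-1..x} \<rho> = integral {m..M} \<rho>"
      using that ab \<rho>(6) by (intro integral_enlarge) auto
    moreover have "integral {-1..x} \<sigma> = integral {n..K} \<sigma>"
      using that ab \<sigma>(6) by (intro integral_enlarge) auto
    ultimately show "integral {-1..x} \<rho> = 1" "integral {-1..x} \<sigma> = 1" using \<rho>(7) \<sigma>(7) by auto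
  qed
  have split: "\<phi> x = integral {-1..x} \<rho> - integral {-1..x} \<sigma>" for x
    unfolding \<phi>_def k_def by (intro Henstock_Kurzweil_Integration.integral_diff integrable_continuous_real c)
  have \<phi>0: "\<phi> x = 0" if "x \<notin> {a..b}" for x
  proof (cases "x < a")
    case True
    then have "integral {-1..x} k = integral {-1..x} (\<lambda>x. 0)" by (intro Henstock_Kurzweil_Integration.integral_cong k0) auto
    then show ?thesis by (simp add: \<phi>_def)
  next
    case False
    then show ?thesis using that tot[of x] by (simp add: split)
  qed
  \<comment> \<open>Both antiderivatives take values between 0 and 1, so their difference is at most
    1 in absolute value; hence the constant 1 in front of the integral of |h|.\<close>
  have bd: "\<bar>\<phi> x\<bar> \<le> 1" for x
  proof -
    have "0 \<le> integral {-1..x} f \<and> integral {-1..x} f \<le> 1" if f: "\<And>x. 0 \<le> f x" "\<And>A. continuous_on A f" "integral {-1..max x b} f = 1" for f :: "real \<Rightarrow> real"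
    proof
      show "0 \<le> integral {-1..x} f" by (rule Henstock_Kurzweil_Integration.integral_nonneg[OF integrable_continuous_real]) (use f in auto)
      have "integral {-1..x} f \<le> integral {-1..max x b} f"
        by (rule integral_subset_le) (use f in \<open>auto intro!: integrable_continuous_real\<close>)
      then show "integral {-1..x} f \<le> 1" using f by simp
    qed
    from this[of \<rho>] this[of \<sigma>] show ?thesis
      using \<rho>(2) \<sigma>(2) c tot[of "max x b"] by (simp add: split abs_le_iff)
  qed
  have der: "(\<phi> has_real_derivative k x) (at x)" for x
  proof (cases "x < a")
    case True
    have "((\<lambda>x. 0) has_real_derivative k x) (at x)" using k0[of x] True by simp
    then show ?thesis
      by (rule has_field_derivative_transform_within_open[where S = "{..<a}"]) (use True \<phi>0 in auto)
  next
    case False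
    have "(\<phi> has_vector_derivative k x) (at x within {-1..x + 1})"
      unfolding \<phi>_def using False ab by (intro integral_has_vector_derivative c) auto
    then have "(\<phi> has_vector_derivative k x) (at x)"
      using False ab by (subst (asm) at_within_interior) auto
    then show ?thesis by (simp add: has_real_derivative_iff_has_vector_derivative)
  qed
  have \<phi>k: "k_times_cont_diff j \<phi>" for j
  proof (cases j)
    case 0
    then show ?thesis using der by (auto intro!: continuous_at_imp_continuous_on DERIV_isCont)
  next
    case (Suc i)
    then show ?thesis using der kk by (auto intro!: exI[of _ k])
  qed
  have \<phi>t: "\<phi> \<in> test_functions {0<..<L}"
    by (rule test_functions_cboxI[OF \<phi>k, of a b]) (use \<phi>0 ab in auto)
  have int: "integral {a..b} (\<lambda>x. g x * \<rho> x) = integral {m..M} (\<lambda>x. g x * \<rho> x)"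
    "integral {a..b} (\<lambda>x. g x * \<sigma> x) = integral {n..K} (\<lambda>x. g x * \<sigma> x)"
    using ab \<rho>(6) \<sigma>(6) by (auto intro!: integral_enlarge)
  have gc: "continuous_on {a..b} g" using ab by (intro continuous_on_subset[OF g]) auto
  have "(LINT x:{0<..<L}|lebesgue. g x * k x) = integral {a..b} (\<lambda>x. g x * k x)"
    using ab k0 gc c by (intro set_integral_compact_support continuous_on_mult) auto
  also have "\<dots> = integral {a..b} (\<lambda>x. g x * \<rho> x - g x * \<sigma> x)" by (simp add: k_def right_diff_distrib)
  also have "\<dots> = integral {m..M} (\<lambda>x. g x * \<rho> x) - integral {n..K} (\<lambda>x. g x * \<sigma> x)"
    unfolding int[symmetric]
    by (intro Henstock_Kurzweil_Integration.integral_diff integrable_continuous_real continuous_on_mult gc c)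
  finally have eq: "(LINT x:{0<..<L}|lebesgue. g x * k x) = integral {m..M} (\<lambda>x. g x * \<rho> x) - integral {n..K} (\<lambda>x. g x * \<sigma> x)" .
  have eq2: "(LINT x:{0<..<L}|lebesgue. g x * k x) = - (LINT x:{0<..<L}|lebesgue. \<phi> x * h x)"
    using w \<phi>t der unfolding weak_gradient_def by auto
  have "\<bar>LINT x:{0<..<L}|lebesgue. \<phi> x * h x\<bar> \<le> (LINT x:{0<..<L}|lebesgue. \<bar>h x\<bar>)"
  proof -
    have h1: "set_integrable lebesgue {0<..<L} h"
      by (rule set_integrable_L2_lmeasurable[OF h]) auto
    have "\<bar>LINT x:{0<..<L}|lebesgue. \<phi> x * h x\<bar> \<le> (LINT x:{0<..<L}|lebesgue. norm (\<phi> x * h x))"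
      unfolding set_lebesgue_integral_def
      by (rule order_trans[OF integral_abs_bound]) (auto intro!: Bochner_Integration.integral_mono_AE' simp: indicator_def abs_mult)
    also have "\<dots> \<le> (LINT x:{0<..<L}|lebesgue. \<bar>h x\<bar>)"
    proof (rule set_integral_mono)
      show "set_integrable lebesgue {0<..<L} (\<lambda>x. norm (\<phi> x * h x))"
        using set_integrable_norm[OF set_integrable_test_L2[OF h \<phi>t]] by simp
      show "set_integrable lebesgue {0<..<L} (\<lambda>x. \<bar>h x\<bar>)" using set_integrable_norm[OF h1] by simp
      show "norm (\<phi> x * h x) \<le> \<bar>h x\<bar>" for x using bd[of x] by (simp add: abs_mult mult_left_le_one_le)
    qed
    finally show ?thesis .
  qed
  then show "\<bar>g s - g t\<bar> \<le> (LINT x:{0<..<L}|lebesgue. \<bar>h x\<bar>) + e"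
    using eq eq2 \<rho>(8) \<sigma>(8) by linarith
qed

text \<open>The bound for interior points extends to the closed square by continuity in both points
  jointly, and Cauchy-Schwarz against the constant 1 produces the factor \<open>L\<close>.\<close>

lemma weak_derivative_increment_sq:
  fixes g h :: "real \<Rightarrow> real"
  assumes L: "L > 0" and g: "continuous_on {0..L} g" and h: "h \<in> L2 lebesgue {0<..<L}" and w: "weak_gradient {0<..<L} g h"
    and st: "s \<in> {0..L}" "t \<in> {0..L}"
  shows "(g s - g t)\<^sup>2 \<le> L * (LINT x:{0<..<L}|lebesgue. (h x)\<^sup>2)"
proof -
  let ?R = "LINT x:{0<..<L}|lebesgue. \<bar>h x\<bar>"
  have g': "continuous_on {0<..<L} g" using g by (rule continuous_on_subset) auto
  have h1: "set_integrable lebesgue {0<..<L} h"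
    by (rule set_integrable_L2_lmeasurable[OF h]) auto
  have h2: "set_integrable lebesgue {0<..<L} (\<lambda>x. (h x)\<^sup>2)"
    using L2_integrable[OF h] by simp
  have 1: "\<bar>g s - g t\<bar> \<le> ?R"
  proof -
    let ?D = "{0<..<L} \<times> {0<..<L}"
    have cl: "closure ?D = {0..L} \<times> {0..L}" using L by (simp add: closure_Times)
    have "\<bar>g (fst p) - g (snd p)\<bar> \<le> ?R" if "p \<in> closure ?D" for p
    proof (rule continuous_le_on_closure[OF _ that])
      show "continuous_on (closure ?D) (\<lambda>p. \<bar>g (fst p) - g (snd p)\<bar>)"
        unfolding cl by (intro continuous_intros continuous_on_compose2[OF g]) auto
      show "\<bar>g (fst p) - g (snd p)\<bar> \<le> ?R" if "p \<in> ?D" for p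
        using that weak_derivative_increment[OF g' h w] by auto
    qed
    from this[of "(s, t)"] show ?thesis using st cl by simp
  qed
  have "?R\<^sup>2 = (LINT x:{0<..<L}|lebesgue. 1 * \<bar>h x\<bar>)\<^sup>2" by simp
  also have "\<dots> \<le> (LINT x:{0<..<L}|lebesgue. 1\<^sup>2) * (LINT x:{0<..<L}|lebesgue. \<bar>h x\<bar>\<^sup>2)"
    using L h2 set_integrable_norm[OF h1] by (intro Cauchy_Schwarz_set_integral) (auto simp: set_integrable_def intro!: integrable_real_indicator emeasure_bounded_finite)
  also have "(LINT x:{0<..<L}|lebesgue. 1\<^sup>2) = L"
    using L by (simp add: set_lebesgue_integral_def)
  finally have "?R\<^sup>2 \<le> L * (LINT x:{0<..<L}|lebesgue. (h x)\<^sup>2)" by simp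
  moreover have "\<bar>g s - g t\<bar>\<^sup>2 \<le> ?R\<^sup>2" using 1 by (intro power_mono) auto
  ultimately show ?thesis by simp
qed

subsection \<open>Estimates on the star of a node\<close>

text \<open>The oscillation of \<open>f\<close> between two sets, free of mean values: this is what
  the Poincare inequality bounds and what can be passed on through an intermediate set.\<close>

definition dbl :: "('a::euclidean_space \<Rightarrow> real) \<Rightarrow> 'a set \<Rightarrow> 'a set \<Rightarrow> ennreal" where
  "dbl f A B = (\<integral>\<^sup>+x\<in>A. (sq_int lborel B (\<lambda>y. f x - f y)) \<partial>lborel)"

lemma nn_set_integral_mono_set:
  "A \<subseteq> B \<Longrightarrow> (\<And>x. x \<in> A \<Longrightarrow> f x \<le> g x) \<Longrightarrow> (\<integral>\<^sup>+x\<in>A. f x \<partial>M) \<le> (\<integral>\<^sup>+x\<in>B. (g x :: ennreal) \<partial>M)"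
  by (intro nn_integral_mono) (auto simp: indicator_def)

lemma dbl_mono: "A \<subseteq> A' \<Longrightarrow> B \<subseteq> B' \<Longrightarrow> dbl f A B \<le> dbl f A' B'"
  unfolding dbl_def by (intro nn_set_integral_mono_set) auto

lemma dbl_cong:
  assumes "\<And>x. x \<in> A \<Longrightarrow> f x = g x" "\<And>x. x \<in> B \<Longrightarrow> f x = g x"
  shows "dbl f A B = dbl g A B"
proof -
  have *: "(sq_int lborel B (\<lambda>y. f x - f y)) = (sq_int lborel B (\<lambda>y. f x - g y))" for x
    using assms(2) by (intro nn_integral_cong) (auto simp: indicator_def)
  show ?thesis
    unfolding dbl_def * using assms(1) by (intro nn_integral_cong) (auto simp: indicator_def)
qed

lemma ennreal_mult_le_divide:
  assumes "ennreal k * X \<le> ennreal c * D" "k > 0" "c \<ge> 0"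
  shows "X \<le> ennreal (c / k) * D"
proof -
  have "X = ennreal (1 / k) * (ennreal k * X)"
    using assms(2) by (simp flip: mult.assoc ennreal_mult)
  also have "\<dots> \<le> ennreal (1 / k) * (ennreal c * D)" using assms(1) by (rule mult_left_mono) simp
  also have "\<dots> = ennreal (c / k) * D"
    using assms(2,3) by (simp flip: mult.assoc ennreal_mult)
  finally show ?thesis .
qed

lemma dbl_chain:
  fixes f :: "'a::euclidean_space \<Rightarrow> real"
  assumes "f \<in> borel_measurable borel" "A \<in> sets borel" "B \<in> sets borel" "C \<in> sets borel"
    and k: "k > 0" "ennreal k \<le> emeasure lborel B" and M: "M \<ge> 0" "emeasure lborel A \<le> ennreal M" "emeasure lborel C \<le> ennreal M"
    and p: "p \<ge> 0" "dbl f A B \<le> ennreal p * D" and q: "q \<ge> 0" "dbl f B C \<le> ennreal q * D"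
  shows "dbl f A C \<le> ennreal (2 * M * (p + q) / k) * D"
proof (rule ennreal_mult_le_divide)
  have "ennreal k * dbl f A C \<le> emeasure lborel B * dbl f A C" using k by (intro mult_right_mono) auto
  also have "\<dots> \<le> 2 * (emeasure lborel C * dbl f A B + emeasure lborel A * dbl f B C)"
    using double_integral_chain[OF assms(1-4)] by (simp add: dbl_def)
  also have "\<dots> \<le> 2 * (ennreal M * (ennreal p * D) + ennreal M * (ennreal q * D))"
    using M p q by (intro mult_left_mono add_mono mult_mono) auto
  also have "\<dots> = ennreal (2 * M * (p + q)) * D"
  proof -
    have "ennreal (2 * M * (p + q)) = 2 * (ennreal M * (ennreal p + ennreal q))"
      using M p q by (simp add: ennreal_mult mult.assoc)
    then show ?thesis by (simp only: distrib_left distrib_right ac_simps)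
  qed
  finally show "ennreal k * dbl f A C \<le> ennreal (2 * M * (p + q)) * D" .
qed (use k M p q in auto)

context mesh
begin

definition \<kappa> :: real where "\<kappa> = 3 / (64 * \<gamma> ^ 4)"
text \<open>Each of two applications of \<open>dbl_chain\<close>, with areas at most 4 H^2 and a
  corner of area at least \<open>\<kappa> * H\<^sup>2\<close>, multiplies the sum of two constants
  by 8 / \<kappa>. The Poincare constant of an element is 16, and 256 is 8 times 16 + 16.\<close>

definition C1 :: real where "C1 = 8 / \<kappa> * (256 / \<kappa> + 16)"
text \<open>The trace inequality gives 2 / \<rho>^2 times 4 H^4 (1 + C1), and H^2 / \<rho>^2 = 4
  \<gamma>^2.\<close>

definition C2 :: real where "C2 = 32 * \<gamma>\<^sup>2 * (1 + C1)"

lemma const_pos: "\<kappa> > 0" "C1 > 0" "C2 > 0"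
proof -
  show "\<kappa> > 0" using params by (simp add: \<kappa>_def)
  then show "C1 > 0" unfolding C1_def by (intro mult_pos_pos divide_pos_pos add_pos_pos) auto
  then show "C2 > 0" unfolding C2_def using params by (intro mult_pos_pos add_pos_pos) auto
qed

lemma const16: "ennreal (H\<^sup>2) * (ennreal 4 * (ennreal (4 * H\<^sup>2) * D)) = ennreal (16 * H ^ 4) * D"
proof -
  have "ennreal (H\<^sup>2 * (4 * (4 * H\<^sup>2))) = ennreal (H\<^sup>2) * (ennreal 4 * ennreal (4 * H\<^sup>2))"
    by (subst ennreal_mult, simp, simp, subst ennreal_mult, simp, simp, rule refl)
  moreover have "H\<^sup>2 * (4 * (4 * H\<^sup>2)) = 16 * H ^ 4" by (simp add: power2_eq_square eval_nat_numeral)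
  ultimately show ?thesis by (simp only: mult.assoc)
qed

lemma borel_mem: "T \<in> \<T> \<Longrightarrow> T \<in> sets borel"
  using compact_mem compact_imp_closed borel_closed by blast

lemma emeasure_tri:
  assumes "T \<in> \<T>"
  shows "emeasure lborel T = ennreal (measure lebesgue T)"
proof -
  have "emeasure lborel T = emeasure lebesgue T" using borel_mem[OF assms] by simp
  also have "\<dots> = ennreal (measure lebesgue T)"
    using fmeasurableD2[OF measure_tri(3)[OF assms]] by (intro emeasure_eq_ennreal_measure) simp
  finally show ?thesis .
qed

lemma emeasure_tri_le: "T \<in> \<T> \<Longrightarrow> emeasure lborel T \<le> ennreal (4 * H\<^sup>2)"
  using measure_tri(2) by (simp add: emeasure_tri ennreal_leI)

lemma emeasure_tri_ge: "T \<in> \<T> \<Longrightarrow> ennreal (3 * \<rho>\<^sup>2) \<le> emeasure lborel T"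
  using measure_tri(1) by (simp add: emeasure_tri ennreal_leI)

text \<open>The copy of \<open>T\<close> shrunk towards \<open>N\<close> by the factor 1 / (4
  \<gamma>) lies in the corner, since H / (4 \<gamma>) = \<rho> / 2. Its area is at least 3 \<rho>^2
  / (16 \<gamma>^2), which is \<open>\<kappa> * H\<^sup>2\<close>.\<close>

lemma emeasure_corner:
  assumes T: "T \<in> \<T>" "N \<in> T"
  shows "ennreal (\<kappa> * H\<^sup>2) \<le> emeasure lborel (T \<inter> ball N \<rho>)"
proof -
  let ?c = "1 / (4 * \<gamma>)" and ?A = "T \<inter> ball N \<rho>"
  have c: "0 < ?c" "?c \<le> 1" using params by auto
  have [measurable]: "?A \<in> sets borel" "T \<in> sets borel" using borel_mem[OF T(1)] by auto
  have mem: "(1 - ?c) *\<^sub>R N + ?c *\<^sub>R x \<in> ?A" if "x \<in> T" for x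
  proof
    show "(1 - ?c) *\<^sub>R N + ?c *\<^sub>R x \<in> T" using convex_mem[OF T(1)] T(2) that c by (intro convexD) auto
    have "(1 - ?c) *\<^sub>R N + ?c *\<^sub>R x - N = ?c *\<^sub>R (x - N)" by (simp add: algebra_simps)
    then have "dist N ((1 - ?c) *\<^sub>R N + ?c *\<^sub>R x) = ?c * dist x N"
      using c by (metis abs_of_pos dist_commute dist_norm norm_scaleR)
    also have "\<dots> \<le> ?c * H" using dist_le[OF T(1) that T(2)] c by (intro mult_left_mono) auto
    also have "\<dots> < \<rho>" using params by (simp add: \<rho>_def field_simps)
    finally show "(1 - ?c) *\<^sub>R N + ?c *\<^sub>R x \<in> ball N \<rho>" by simp
  qed
  have "\<kappa> * H\<^sup>2 = ?c\<^sup>2 * (3 * \<rho>\<^sup>2)" using params(1) by (simp add: \<kappa>_def \<rho>_def power2_eq_square field_simps eval_nat_numeral)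
  then have "ennreal (\<kappa> * H\<^sup>2) = ennreal (?c\<^sup>2) * ennreal (3 * \<rho>\<^sup>2)" by (simp add: ennreal_mult)
  also have "\<dots> \<le> ennreal (?c\<^sup>2) * (\<integral>\<^sup>+x. indicator T x \<partial>lborel)"
    using emeasure_tri_ge[OF T(1)] by (intro mult_left_mono) auto
  also have "\<dots> \<le> ennreal (?c\<^sup>2) * (\<integral>\<^sup>+x. indicator ?A ((1 - ?c) *\<^sub>R N + ?c *\<^sub>R x) \<partial>lborel)"
    using mem by (intro mult_left_mono nn_integral_mono) (auto simp: indicator_def)
  also have "\<dots> = (\<integral>\<^sup>+x. indicator ?A x \<partial>lborel)"
    using c by (subst nn_integral_affine[where c = ?c and t = "(1 - ?c) *\<^sub>R N"]) (auto simp: power2_eq_square)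
  finally show ?thesis by simp
qed

text \<open>Two functions are needed: \<open>f\<close> is regular on whole elements and
  \<open>w\<close> on the whole ball. They coincide on the two corners, where the chain passes from
  one to the other; the corners have area comparable to H^2, so each passage costs only a
  constant.\<close>

lemma local_estimate:
  assumes T: "T \<in> \<T>" "N \<in> T" "T' \<in> \<T>" "N \<in> T'"
    and f: "\<And>z. GDERIV f z :> f' z" "continuous_on UNIV f'"
    and w: "\<And>z. z \<in> ball N \<rho> \<Longrightarrow> GDERIV w z :> w' z" "continuous_on (ball N \<rho>) w'"
    and eq: "\<And>z. z \<in> (T \<union> T') \<inter> ball N \<rho> \<Longrightarrow> w z = f z"
    and D: "(sq_int lborel T (\<lambda>z. norm (f' z))) \<le> D" "(sq_int lborel T' (\<lambda>z. norm (f' z))) \<le> D"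
      "(sq_int lborel (ball N \<rho>) (\<lambda>z. norm (w' z))) \<le> D"
  shows "dbl f T' T \<le> ennreal (C1 * H ^ 4) * D"
proof -
  let ?B = "ball N \<rho>"
  have cf: "continuous_on UNIV f"
    using f(1) by (auto intro!: continuous_at_imp_continuous_on GDERIV_isCont)
  then have fm: "f \<in> borel_measurable borel" by (rule borel_measurable_continuous_onI)
  have pT: "dbl f S S \<le> ennreal (16 * H ^ 4) * D" if S: "S \<in> \<T>" "(sq_int lborel S (\<lambda>z. norm (f' z))) \<le> D" for S
  proof -
    have "dbl f S S \<le> ennreal (H\<^sup>2) * (2 ^ DIM(pt) * (emeasure lborel S * (sq_int lborel S (\<lambda>z. norm (f' z)))))"
      unfolding dbl_def
      by (rule poincare_convex[OF convex_mem[OF S(1)] borel_mem[OF S(1)] dist_le[OF S(1)] f(1) continuous_on_subset[OF f(2)]]) auto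
    also have "\<dots> \<le> ennreal (H\<^sup>2) * (ennreal 4 * (ennreal (4 * H\<^sup>2) * D))"
      using emeasure_tri_le[OF S(1)] S(2) by (intro mult_left_mono mult_mono) auto
    also have "\<dots> = ennreal (16 * H ^ 4) * D"
      by (rule const16)
    finally show ?thesis .
  qed
  have pB: "dbl w ?B ?B \<le> ennreal (16 * H ^ 4) * D"
  proof -
    have d: "dist x y \<le> H" if "x \<in> ?B" "y \<in> ?B" for x y
      using that params dist_triangle2[of x y N] by (auto simp: dist_commute)
    have eB: "emeasure lborel ?B \<le> ennreal (4 * H\<^sup>2)"
    proof -
      have "emeasure lborel ?B = ennreal (pi * \<rho>\<^sup>2)"
        using emeasure_ball[of \<rho> N] params by (simp add: unit_ball_vol_2 ennreal_mult)
      also have "\<dots> \<le> ennreal (4 * H\<^sup>2)"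
        using pi_less_4 params by (intro ennreal_leI mult_mono power_mono) auto
      finally show ?thesis .
    qed
    have "dbl w ?B ?B \<le> ennreal (H\<^sup>2) * (2 ^ DIM(pt) * (emeasure lborel ?B * (sq_int lborel ?B (\<lambda>z. norm (w' z)))))"
      unfolding dbl_def by (rule poincare_convex[OF convex_ball _ d w]) auto
    also have "\<dots> \<le> ennreal (H\<^sup>2) * (ennreal 4 * (ennreal (4 * H\<^sup>2) * D))"
      using eB D(3) by (intro mult_left_mono mult_mono) auto
    also have "\<dots> = ennreal (16 * H ^ 4) * D"
      by (rule const16)
    finally show ?thesis .
  qed
  have s: "T \<in> sets borel" "T' \<in> sets borel" "T \<inter> ?B \<in> sets borel" "T' \<inter> ?B \<in> sets borel"
    using borel_mem T by auto
  have k: "\<kappa> * H\<^sup>2 > 0" using const_pos params by simp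
  have em: "emeasure lborel (S \<inter> ?B) \<le> ennreal (4 * H\<^sup>2)" if "S \<in> \<T>" for S
    by (rule order_trans[OF emeasure_mono emeasure_tri_le[OF that]]) (use borel_mem[OF that] in auto)
  have "dbl f (T' \<inter> ?B) (T \<inter> ?B) = dbl w (T' \<inter> ?B) (T \<inter> ?B)"
    using eq by (intro dbl_cong) auto
  also have "\<dots> \<le> dbl w ?B ?B" by (rule dbl_mono) auto
  finally have 2: "dbl f (T' \<inter> ?B) (T \<inter> ?B) \<le> ennreal (16 * H ^ 4) * D" using pB by (rule order_trans)
  have 1: "dbl f T' (T' \<inter> ?B) \<le> ennreal (16 * H ^ 4) * D"
    by (rule order_trans[OF dbl_mono pT[OF T(3) D(2)]]) auto
  have 3: "dbl f (T \<inter> ?B) T \<le> ennreal (16 * H ^ 4) * D"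
    by (rule order_trans[OF dbl_mono pT[OF T(1) D(1)]]) auto
  have "dbl f T' (T \<inter> ?B) \<le> ennreal (2 * (4 * H\<^sup>2) * (16 * H ^ 4 + 16 * H ^ 4) / (\<kappa> * H\<^sup>2)) * D"
    using T by (intro dbl_chain[OF fm s(2,4,3) k emeasure_corner _ emeasure_tri_le em _ 1 _ 2]) auto
  also have "2 * (4 * H\<^sup>2) * (16 * H ^ 4 + 16 * H ^ 4) / (\<kappa> * H\<^sup>2) = 256 / \<kappa> * H ^ 4"
    using params const_pos by (simp add: field_simps)
  finally have 4: "dbl f T' (T \<inter> ?B) \<le> ennreal (256 / \<kappa> * H ^ 4) * D" .
  have "dbl f T' T \<le> ennreal (2 * (4 * H\<^sup>2) * (256 / \<kappa> * H ^ 4 + 16 * H ^ 4) / (\<kappa> * H\<^sup>2)) * D"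
    using T const_pos by (intro dbl_chain[OF fm s(2,3,1) k emeasure_corner _ emeasure_tri_le emeasure_tri_le _ 4 _ 3]) auto
  also have "2 * (4 * H\<^sup>2) * (256 / \<kappa> * H ^ 4 + 16 * H ^ 4) / (\<kappa> * H\<^sup>2) = C1 * H ^ 4"
    using params const_pos unfolding C1_def by (simp add: field_simps)
  finally show ?thesis .
qed

section \<open>The trace inequality on edges of the mesh\<close>

lemma edge_determinant:
  assumes T: "T \<in> \<T>" "vertices T = {a, b, p}" "a \<noteq> b" "a \<noteq> p" "b \<noteq> p"
  shows "\<rho>\<^sup>2 \<le> \<bar>(b - a) $ 1 * (p - a) $ 2 - (b - a) $ 2 * (p - a) $ 1\<bar>"
proof -
  interpret triangle T using tri[OF T(1)] .
  let ?u = "b - a" and ?v = "p - a" and ?\<alpha> = "bgrad T b" and ?\<beta> = "bgrad T p"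
  have v: "a \<in> vertices T" "b \<in> vertices T" "p \<in> vertices T" using T by auto
  have ip: "x \<bullet> y = x $ 1 * y $ 1 + x $ 2 * y $ 2" for x y :: pt by (simp add: inner_vec_def sum_2)
  have e: "?\<alpha> \<bullet> ?u = 1" "?\<alpha> \<bullet> ?v = 0" "?\<beta> \<bullet> ?u = 0" "?\<beta> \<bullet> ?v = 1"
    using bary_diff[of T b b a] bary_diff[of T b p a] bary_diff[of T p b a] bary_diff[of T p p a] T v bary_vertex by auto
  let ?d = "?u $ 1 * ?v $ 2 - ?u $ 2 * ?v $ 1" and ?e = "?\<alpha> $ 1 * ?\<beta> $ 2 - ?\<alpha> $ 2 * ?\<beta> $ 1"
  \<comment> \<open>The product formula for determinants: the two gradients form the basis dual to
    the edge vectors, so the determinants are reciprocal.\<close>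
  have "?e * ?d = (?\<alpha> \<bullet> ?u) * (?\<beta> \<bullet> ?v) - (?\<alpha> \<bullet> ?v) * (?\<beta> \<bullet> ?u)"
    unfolding ip by algebra
  then have 1: "?e * ?d = 1" using e by simp
  \<comment> \<open>Lagrange's identity, which bounds the determinant of the gradients by the
    product of their norms.\<close>
  have "?e\<^sup>2 + (?\<alpha> \<bullet> ?\<beta>)\<^sup>2 = (?\<alpha> \<bullet> ?\<alpha>) * (?\<beta> \<bullet> ?\<beta>)" unfolding ip by algebra
  then have "?e\<^sup>2 \<le> (norm ?\<alpha> * norm ?\<beta>)\<^sup>2" by (simp add: power_mult_distrib power2_norm_eq_inner) (metis le_add_same_cancel1 zero_le_power2)
  then have "\<bar>?e\<bar> \<le> norm ?\<alpha> * norm ?\<beta>" by (metis abs_le_square_iff abs_mult abs_norm_cancel)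
  also have "\<dots> \<le> 1 / \<rho> * (1 / \<rho>)" using norm_bgrad[OF T(1)] v params by (intro mult_mono) auto
  finally have "\<bar>?e\<bar> * \<rho>\<^sup>2 \<le> 1" using params by (simp add: power2_eq_square field_simps)
  then have "\<bar>?e\<bar> * \<rho>\<^sup>2 * \<bar>?d\<bar> \<le> 1 * \<bar>?d\<bar>" by (rule mult_right_mono) simp
  moreover have "\<bar>?e\<bar> * \<bar>?d\<bar> = 1" using 1 by (metis abs_mult abs_one)
  have "\<bar>?e\<bar> * \<rho>\<^sup>2 * \<bar>?d\<bar> = \<rho>\<^sup>2 * (\<bar>?e\<bar> * \<bar>?d\<bar>)" by (simp only: ac_simps)
  then have "\<bar>?e\<bar> * \<rho>\<^sup>2 * \<bar>?d\<bar> = \<rho>\<^sup>2" unfolding \<open>\<bar>?e\<bar> * \<bar>?d\<bar> = 1\<close> by simp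
  ultimately show ?thesis by (simp only: mult_1)
qed

lemma edge_third_vertex:
  assumes T: "T \<in> \<T>" and E: "closed_segment a b edge_of T"
  obtains p where "vertices T = {a, b, p}" "a \<noteq> b" "a \<noteq> p" "b \<noteq> p"
proof -
  interpret triangle T using tri[OF T] .
  obtain a' b' p where v: "vertices T = {a', b', p}" "a' \<noteq> b'" "a' \<noteq> p" "b' \<noteq> p" "closed_segment a b = closed_segment a' b'"
    using edge_obtain[OF E] by metis
  then have "{a, b} = {a', b'}" by (simp add: closed_segment_eq)
  then show ?thesis using that[of p] v by (auto simp: doubleton_eq_iff insert_commute)
qed

lemma trace_edge:
  assumes T: "T \<in> \<T>" and E: "closed_segment a b edge_of T"
    and f: "\<And>z. z \<in> T \<Longrightarrow> GDERIV f z :> f' z" "continuous_on T f'"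
  shows "(sq_int lborel {0..1} (\<lambda>t. f (a + t *\<^sub>R (b - a)) - m)) \<le>
    ennreal (2 / \<rho>\<^sup>2) * (ennreal (H\<^sup>2) * (sq_int lborel T (\<lambda>z. norm (f' z))) + 4 * (sq_int lborel T (\<lambda>z. f z - m)))"
proof -
  interpret triangle T using tri[OF T] .
  obtain p where p: "vertices T = {a, b, p}" "a \<noteq> b" "a \<noteq> p" "b \<noteq> p" using edge_third_vertex[OF T E] by blast
  then have m: "a \<in> T" "b \<in> T" "p \<in> T" using vertices_subset by auto
  show ?thesis
    by (rule trace_segment[OF borel_mem[OF T] convex_mem[OF T] m f]) (use edge_determinant[OF T p] params dist_le[OF T] m in auto)
qed

text \<open>The trace inequality on \<open>T'\<close> is used with the constant \<open>f z\<close>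
  and then integrated over \<open>z\<close> in \<open>T\<close>; the remaining double integral over
  \<open>T\<close> and \<open>T'\<close> is the one bounded by
  \<open>local_estimate\<close>.\<close>

lemma local_trace:
  assumes T: "T \<in> \<T>" "N \<in> T" "T' \<in> \<T>" "N \<in> T'" and E: "closed_segment a b edge_of T'"
    and f: "\<And>z. GDERIV f z :> f' z" "continuous_on UNIV f'"
    and w: "\<And>z. z \<in> ball N \<rho> \<Longrightarrow> GDERIV w z :> w' z" "continuous_on (ball N \<rho>) w'"
    and eq: "\<And>z. z \<in> (T \<union> T') \<inter> ball N \<rho> \<Longrightarrow> w z = f z"
    and D: "(sq_int lborel T (\<lambda>z. norm (f' z))) \<le> D" "(sq_int lborel T' (\<lambda>z. norm (f' z))) \<le> D"
      "(sq_int lborel (ball N \<rho>) (\<lambda>z. norm (w' z))) \<le> D"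
  shows "(\<integral>\<^sup>+z\<in>T. (sq_int lborel {0..1} (\<lambda>t. f (a + t *\<^sub>R (b - a)) - f z)) \<partial>lborel) \<le> ennreal (C2 * H\<^sup>2) * D"
proof -
  have cf: "continuous_on UNIV f"
    using f(1) by (auto intro!: continuous_at_imp_continuous_on GDERIV_isCont)
  then have [measurable]: "f \<in> borel_measurable borel" by (rule borel_measurable_continuous_onI)
  have [measurable]: "T \<in> sets borel" "T' \<in> sets borel" using borel_mem T by auto
  let ?J = "\<lambda>z. \<integral>\<^sup>+x\<in>T'. ennreal ((f x - f z)\<^sup>2) \<partial>lborel"
  have "(\<integral>\<^sup>+z\<in>T. (sq_int lborel {0..1} (\<lambda>t. f (a + t *\<^sub>R (b - a)) - f z)) \<partial>lborel) \<le>
    (\<integral>\<^sup>+z\<in>T. (ennreal (2 / \<rho>\<^sup>2) * (ennreal (H\<^sup>2) * D + 4 * ?J z)) \<partial>lborel)"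
  proof (intro nn_set_integral_mono_set order_refl)
    fix z
    have "(sq_int lborel {0..1} (\<lambda>t. f (a + t *\<^sub>R (b - a)) - f z)) \<le>
      ennreal (2 / \<rho>\<^sup>2) * (ennreal (H\<^sup>2) * (sq_int lborel T' (\<lambda>x. norm (f' x))) + 4 * ?J z)"
      using f(1) continuous_on_subset[OF f(2)] by (intro trace_edge[OF T(3) E]) auto
    also have "\<dots> \<le> ennreal (2 / \<rho>\<^sup>2) * (ennreal (H\<^sup>2) * D + 4 * ?J z)"
      using D(2) by (intro mult_left_mono add_right_mono) auto
    finally show "(sq_int lborel {0..1} (\<lambda>t. f (a + t *\<^sub>R (b - a)) - f z)) \<le> ennreal (2 / \<rho>\<^sup>2) * (ennreal (H\<^sup>2) * D + 4 * ?J z)" .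
  qed
  also have "\<dots> = (\<integral>\<^sup>+z. ennreal (2 / \<rho>\<^sup>2) * (ennreal (H\<^sup>2) * D * indicator T z + 4 * (?J z * indicator T z)) \<partial>lborel)"
    by (intro nn_integral_cong) (simp add: distrib_right mult.assoc)
  also have "\<dots> = ennreal (2 / \<rho>\<^sup>2) * (ennreal (H\<^sup>2) * D * emeasure lborel T + 4 * (\<integral>\<^sup>+z\<in>T. ?J z \<partial>lborel))"
    by (subst nn_integral_cmult, measurable) (subst nn_integral_add, measurable, simp add: nn_integral_cmult)
  also have "(\<integral>\<^sup>+z\<in>T. ?J z \<partial>lborel) = dbl f T T'"
    unfolding dbl_def by (simp add: power2_commute)
  also have "ennreal (2 / \<rho>\<^sup>2) * (ennreal (H\<^sup>2) * D * emeasure lborel T + 4 * dbl f T T') \<le>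
    ennreal (2 / \<rho>\<^sup>2) * (ennreal (H\<^sup>2) * D * ennreal (4 * H\<^sup>2) + ennreal 4 * (ennreal (C1 * H ^ 4) * D))"
    using eq by (intro mult_left_mono add_mono emeasure_tri_le T mult_mono local_estimate[OF T(3,4,1,2) f w _ D(2,1,3)]) auto
  also have "\<dots> = ennreal (2 / \<rho>\<^sup>2 * (H\<^sup>2 * (4 * H\<^sup>2) + 4 * (C1 * H ^ 4))) * D"
  proof -
    have "ennreal (H\<^sup>2) * D * ennreal (4 * H\<^sup>2) = ennreal (H\<^sup>2 * (4 * H\<^sup>2)) * D"
      by (subst ennreal_mult) (auto simp: ac_simps)
    moreover have "ennreal 4 * (ennreal (C1 * H ^ 4) * D) = ennreal (4 * (C1 * H ^ 4)) * D"
      using const_pos by (subst (2) ennreal_mult) (auto simp: ac_simps)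
    ultimately show ?thesis
      using const_pos by (subst ennreal_mult, simp, simp, subst ennreal_plus) (auto simp: distrib_right mult.assoc)
  qed
  also have "2 / \<rho>\<^sup>2 * (H\<^sup>2 * (4 * H\<^sup>2) + 4 * (C1 * H ^ 4)) = C2 * H\<^sup>2"
    using params(1-3) unfolding C2_def \<rho>_def by (simp add: field_simps power2_eq_square eval_nat_numeral)
  finally show ?thesis .
qed

end

subsection \<open>Arc length\<close>

lemma arc_param_measurable:
  assumes "finite \<E>"
  shows "(\<lambda>(E, t). arc_param E t) \<in> borel_measurable (count_space \<E> \<Otimes>\<^sub>M lborel)"
proof (rule measurable_pair_measure_countable1)
  show "countable \<E>" using assms by (rule countable_finite)
  fix E
  have "continuous_on UNIV (arc_param E)" unfolding arc_param_def by (intro continuous_intros)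
  then show "(\<lambda>y. case (E, y) of (E, t) \<Rightarrow> arc_param E t) \<in> borel_measurable lborel"
    by (simp add: borel_measurable_continuous_onI)
qed

lemma nn_integral_arc_length:
  assumes fin: "finite \<E>" and f[measurable]: "f \<in> borel_measurable borel"
  shows "(\<integral>\<^sup>+x. f x \<partial>arc_length \<E>) = (\<Sum>E\<in>\<E>. \<integral>\<^sup>+t\<in>{0..diameter E}. f (arc_param E t) \<partial>lborel)"
proof -
  let ?M = "count_space \<E> \<Otimes>\<^sub>M (lborel :: real measure)" and ?S = "SIGMA E:\<E>. {0..diameter E}"
  have S: "?S \<in> sets ?M"
  proof -
    have "?S = (\<Union>E\<in>\<E>. {E} \<times> {0..diameter E})" by auto
    also have "\<dots> \<in> sets ?M" using fin by (intro sets.finite_UN) auto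
    finally show ?thesis .
  qed
  note pm = arc_param_measurable[OF fin]
  have "(\<integral>\<^sup>+x. f x \<partial>arc_length \<E>) = (\<integral>\<^sup>+p. f (case p of (E, t) \<Rightarrow> arc_param E t) \<partial>restrict_space ?M ?S)"
    unfolding arc_length_def by (intro nn_integral_distr measurable_restrict_space1 pm) simp
  also have "\<dots> = (\<integral>\<^sup>+p. f (case p of (E, t) \<Rightarrow> arc_param E t) * indicator ?S p \<partial>?M)"
    using S by (subst nn_integral_restrict_space) auto
  also have "\<dots> = (\<integral>\<^sup>+E. \<integral>\<^sup>+t. f (arc_param E t) * indicator ?S (E, t) \<partial>lborel \<partial>count_space \<E>)"
  proof (subst lborel.nn_integral_fst[symmetric])
    show "(\<lambda>p. f (case p of (E, t) \<Rightarrow> arc_param E t) * indicator ?S p) \<in> borel_measurable ?M"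
      by (intro borel_measurable_times_ennreal measurable_compose[OF pm f] borel_measurable_indicator S)
  qed simp
  also have "\<dots> = (\<Sum>E\<in>\<E>. \<integral>\<^sup>+t. f (arc_param E t) * indicator ?S (E, t) \<partial>lborel)"
    by (rule nn_integral_count_space_finite[OF fin])
  also have "\<dots> = (\<Sum>E\<in>\<E>. \<integral>\<^sup>+t\<in>{0..diameter E}. f (arc_param E t) \<partial>lborel)"
    by (intro sum.cong refl nn_integral_cong) (auto simp: indicator_def)
  finally show ?thesis .
qed

lemma endpoints_segment:
  assumes "E = closed_segment a b"
  shows "E = closed_segment (fst (endpoints E)) (snd (endpoints E))"
    "endpoints E = (a, b) \<or> endpoints E = (b, a)"
proof -
  have "case endpoints E of (p, q) \<Rightarrow> E = closed_segment p q"
    unfolding endpoints_def by (rule someI[of _ "(a, b)"]) (simp add: assms)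
  then show 1: "E = closed_segment (fst (endpoints E)) (snd (endpoints E))" by (simp add: case_prod_beta)
  then have "{a, b} = {fst (endpoints E), snd (endpoints E)}" using assms by (metis closed_segment_eq)
  then show "endpoints E = (a, b) \<or> endpoints E = (b, a)" by (auto simp: doubleton_eq_iff prod_eq_iff)
qed

lemma diameter_segment:
  fixes a b :: "'a::euclidean_space"
  shows "diameter (closed_segment a b) = dist a b"
proof (rule antisym)
  show "diameter (closed_segment a b) \<le> dist a b"
  proof (rule diameter_le)
    fix x y assume xy: "x \<in> closed_segment a b" "y \<in> closed_segment a b"
    have "norm (x - y) \<le> norm (x - a) \<or> norm (x - y) \<le> norm (x - b)"
      using segment_furthest_le[OF xy(2), of x] .
    then show "norm (x - y) \<le> dist a b"
      using segment_bound[OF xy(1)] by (auto simp: dist_norm norm_minus_commute)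
  qed simp
  show "dist a b \<le> diameter (closed_segment a b)"
    by (intro diameter_bounded_bound) (auto simp: compact_imp_bounded)
qed

lemma arc_param_scaled:
  assumes "E = closed_segment a b" "a \<noteq> b"
  shows "arc_param E (diameter E * t) = fst (endpoints E) + t *\<^sub>R (snd (endpoints E) - fst (endpoints E))"
proof -
  let ?p = "fst (endpoints E)" and ?q = "snd (endpoints E)"
  have "?p \<noteq> ?q" using endpoints_segment(2)[OF assms(1)] assms(2) by auto
  moreover have "diameter E = norm (?q - ?p)"
    using endpoints_segment(2)[OF assms(1)] assms(1) by (auto simp: diameter_segment dist_norm norm_minus_commute)
  ultimately show ?thesis
    by (simp add: arc_param_def tangent_def sgn_div_norm)
qed

lemma arc_param_image:
  assumes "E = closed_segment a b" "a \<noteq> b"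
  shows "arc_param E ` {0..diameter E} = E" "arc_param E ` {0<..<diameter E} = E - {a, b}"
    "inj (arc_param E)" "diameter E > 0"
proof -
  let ?p = "fst (endpoints E)" and ?q = "snd (endpoints E)"
  show d: "diameter E > 0" using assms by (simp add: diameter_segment)
  have pq: "?p \<noteq> ?q" "{?p, ?q} = {a, b}" using endpoints_segment(2)[OF assms(1)] assms(2) by auto
  have Epq: "E = closed_segment ?p ?q" using endpoints_segment(1)[OF assms(1)] .
  have s: "arc_param E ` ((\<lambda>t. diameter E * t) ` A) = (\<lambda>t. ?p + t *\<^sub>R (?q - ?p)) ` A" for A
    unfolding image_image arc_param_scaled[OF assms] ..
  have "(\<lambda>t. diameter E * t) ` {0..1} = {0..diameter E}" using d by (simp add: image_mult_atLeastAtMost)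
  moreover have "(\<lambda>t. ?p + t *\<^sub>R (?q - ?p)) ` {0..1} = closed_segment ?p ?q"
    unfolding closed_segment_image_interval by (intro image_cong refl) (simp add: algebra_simps)
  ultimately show "arc_param E ` {0..diameter E} = E" using s[of "{0..1}"] Epq by simp
  have "(\<lambda>t. diameter E * t) ` {0<..<1} = {0<..<diameter E}"
  proof
    show "(\<lambda>t. diameter E * t) ` {0<..<1} \<subseteq> {0<..<diameter E}" using d by auto
    show "{0<..<diameter E} \<subseteq> (\<lambda>t. diameter E * t) ` {0<..<1}"
    proof
      fix x assume x: "x \<in> {0<..<diameter E}"
      then have "x / diameter E \<in> {0<..<1}" using d by auto
      moreover have "x = diameter E * (x / diameter E)" using d by simp
      ultimately show "x \<in> (\<lambda>t. diameter E * t) ` {0<..<1}" by (rule image_eqI[rotated])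
    qed
  qed
  moreover have "(\<lambda>t. ?p + t *\<^sub>R (?q - ?p)) ` {0<..<1} = open_segment ?p ?q"
    using pq(1) unfolding open_segment_image_interval by (auto simp: algebra_simps)
  ultimately show "arc_param E ` {0<..<diameter E} = E - {a, b}"
    using s[of "{0<..<1}"] Epq pq(2) by (simp add: open_segment_def)
  have "tangent E \<noteq> 0" using pq(1) by (simp add: tangent_def sgn_zero_iff)
  then show "inj (arc_param E)" by (auto simp: inj_def arc_param_def)
qed

text \<open>The orientation chosen by \<open>endpoints\<close> is unknown. Reflection of the
  parameter from t to 1 - t shows that it does not affect the integral, so the endpoints may be
  taken in any order.\<close>

lemma arc_integral:
  assumes E: "E = closed_segment a b" "a \<noteq> b" and F[measurable]: "F \<in> borel_measurable borel"
  shows "(\<integral>\<^sup>+t\<in>{0..diameter E}. F (arc_param E t) \<partial>lborel) = ennreal (dist a b) * (\<integral>\<^sup>+t\<in>{0..1}. F (a + t *\<^sub>R (b - a)) \<partial>lborel)"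
proof -
  have d: "diameter E = dist a b" "dist a b > 0" using E by (auto simp: diameter_segment)
  let ?p = "fst (endpoints E)" and ?q = "snd (endpoints E)"
  have am: "arc_param E \<in> borel_measurable borel"
    unfolding arc_param_def by (intro borel_measurable_continuous_onI continuous_intros)
  have [measurable]: "(\<lambda>t. F (arc_param E t)) \<in> borel_measurable borel"
    by (rule measurable_compose[OF am F])
  have "(\<integral>\<^sup>+t\<in>{0..diameter E}. F (arc_param E t) \<partial>lborel) =
    ennreal (dist a b) * (\<integral>\<^sup>+t. F (arc_param E (0 + dist a b * t)) * indicator {0..diameter E} (0 + dist a b * t) \<partial>lborel)"
    using d by (subst nn_integral_real_affine[where c = "dist a b" and t = 0]) auto
  also have "(\<integral>\<^sup>+t. F (arc_param E (0 + dist a b * t)) * indicator {0..diameter E} (0 + dist a b * t) \<partial>lborel) =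
    (\<integral>\<^sup>+t\<in>{0..1}. F (?p + t *\<^sub>R (?q - ?p)) \<partial>lborel)"
  proof (intro nn_integral_cong)
    fix t
    have "0 + dist a b * t \<in> {0..diameter E} \<longleftrightarrow> t \<in> {0..1}"
      using d by (auto simp: zero_le_mult_iff mult_le_cancel_left1 mult_le_cancel_left2)
    then show "F (arc_param E (0 + dist a b * t)) * indicator {0..diameter E} (0 + dist a b * t) = F (?p + t *\<^sub>R (?q - ?p)) * indicator {0..1} t"
      using arc_param_scaled[OF E, of t] d by (simp add: indicator_def)
  qed
  also have "\<dots> = (\<integral>\<^sup>+t\<in>{0..1}. F (a + t *\<^sub>R (b - a)) \<partial>lborel)"
  proof (cases "endpoints E = (a, b)")
    case False
    then have e: "?p = b" "?q = a" using endpoints_segment(2)[OF E(1)] by auto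
    have [measurable]: "(\<lambda>t::real. F (b + t *\<^sub>R (a - b))) \<in> borel_measurable borel"
      by (rule measurable_compose[OF _ F]) (intro borel_measurable_continuous_onI continuous_intros)
    have "(\<integral>\<^sup>+t\<in>{0..1}. F (b + t *\<^sub>R (a - b)) \<partial>lborel) = (\<integral>\<^sup>+t. F (b + (1 + - 1 * t) *\<^sub>R (a - b)) * indicator {0..1} (1 + - 1 * t) \<partial>lborel)"
      by (subst nn_integral_real_affine[where c = "-1" and t = 1]) auto
    also have "\<dots> = (\<integral>\<^sup>+t\<in>{0..1}. F (a + t *\<^sub>R (b - a)) \<partial>lborel)"
      by (intro nn_integral_cong) (auto simp: indicator_def algebra_simps)
    finally show ?thesis unfolding e .
  qed simp
  finally show ?thesis .
qed

section \<open>Estimates for test functions about a node, at all scales\<close>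

context mesh
begin

text \<open>The Dirichlet integral near \<open>N\<close> at the relative scale \<open>s\<close>; for
  \<open>s = 1\<close> the ball contains the whole star, because elements have diameter at most
  \<open>H\<close>.\<close>

definition energy :: "(pt \<Rightarrow> pt) \<Rightarrow> pt \<Rightarrow> real \<Rightarrow> ennreal" where
  "energy g N s = (sq_int lborel (star N \<inter> cball N (s * H)) (\<lambda>z. norm (g z)))"

lemma star_mem: "T \<in> \<T> \<Longrightarrow> N \<in> T \<Longrightarrow> T \<subseteq> star N"
  by (auto simp: star_def elements_at_def)

text \<open>The estimates at \<open>N\<close> are applied to \<open>x \<mapsto> \<phi> (N + s (x - N))\<close>, which sees \<open>\<phi>\<close> only at distance
  at most \<open>s H\<close> from \<open>N\<close>; the Dirichlet integral is invariant under this scaling in two dimensions.\<close>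

lemma scaled_hypotheses:
  assumes N: "N \<in> nodes \<T>" and s: "0 < s" "s \<le> 1"
    and \<phi>: "\<phi> \<in> test_functions \<Omega>" and \<phi>': "\<And>x. GDERIV \<phi> x :> \<phi>' x"
  defines "c \<equiv> \<lambda>x. N + s *\<^sub>R (x - N)"
  defines "f' \<equiv> \<lambda>x. s *\<^sub>R \<phi>' (c x)" and "w \<equiv> \<lambda>x. indicator (star N) (c x) * \<phi> (c x)"
    and "w' \<equiv> \<lambda>x. s *\<^sub>R (indicator (star N) (c x) *\<^sub>R \<phi>' (c x))"
  shows "GDERIV (\<lambda>x. \<phi> (c x)) z :> f' z" "continuous_on UNIV f'"
    "z \<in> ball N \<rho> \<Longrightarrow> GDERIV w z :> w' z" "continuous_on (ball N \<rho>) w'"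
    "\<And>T. T \<in> \<T> \<Longrightarrow> N \<in> T \<Longrightarrow> (sq_int lborel T (\<lambda>z. norm (f' z))) \<le> energy \<phi>' N s"
    "(sq_int lborel (ball N \<rho>) (\<lambda>z. norm (w' z))) \<le> energy \<phi>' N s"
    "\<And>T. T \<in> \<T> \<Longrightarrow> N \<in> T \<Longrightarrow> z \<in> T \<Longrightarrow> c z \<in> T"
    "\<And>T. T \<in> \<T> \<Longrightarrow> N \<in> T \<Longrightarrow> z \<in> T \<Longrightarrow> w z = \<phi> (c z)"
proof -
  obtain \<psi> K where \<psi>: "\<And>x. GDERIV \<phi> x :> \<psi> x" "continuous_on UNIV \<psi>" "compact K" "K \<subseteq> \<Omega>"
    "\<And>x. x \<notin> K \<Longrightarrow> \<phi> x = 0" "\<And>x. x \<notin> K \<Longrightarrow> \<psi> x = 0"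
    using test_functions_bounded_gradient[OF \<phi>] by metis
  have "\<phi>' = \<psi>" using \<phi>' \<psi>(1) GDERIV_unique by blast
  note \<psi> = \<psi>[folded this]
  have cd: "(c has_derivative (\<lambda>h. s *\<^sub>R h)) (at x)" for x
    unfolding c_def by (auto intro!: derivative_eq_intros)
  have chain: "GDERIV (\<lambda>x. g (c x)) x :> s *\<^sub>R D" if "GDERIV g (c x) :> D" for g x D
    using diff_chain_at[OF cd[of x], of g "\<lambda>h. h \<bullet> D"] that by (simp add: gderiv_def o_def)
  have cc: "continuous_on A c" for A unfolding c_def by (intro continuous_intros)
  show "GDERIV (\<lambda>x. \<phi> (c x)) z :> f' z" unfolding f'_def by (rule chain[OF \<phi>'])
  show "continuous_on UNIV f'"
    unfolding f'_def by (intro continuous_intros continuous_on_compose2[OF \<psi>(2) cc]) auto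
  have near: "dist N (c x) < \<rho>" if "x \<in> ball N \<rho>" for x
  proof -
    have "dist N (c x) = s * dist N x" using s by (simp add: c_def dist_norm norm_minus_commute)
    also have "\<dots> \<le> dist N x" using s by (simp add: mult_left_le_one_le)
    finally show ?thesis using that by simp
  qed
  have cut1: "GDERIV (\<lambda>x. indicator (star N) x * \<phi> x) y :> indicator (star N) y *\<^sub>R \<phi>' y"
    and cut2: "isCont (\<lambda>x. indicator (star N) x *\<^sub>R \<phi>' x) y" if "dist N y < \<rho>" for y
    by (rule cutoff_C1[OF N that \<phi>' \<psi>(2,3,4)]; use \<psi> in blast)+
  show "z \<in> ball N \<rho> \<Longrightarrow> GDERIV w z :> w' z"
    unfolding w_def w'_def by (rule chain[OF cut1[OF near]])
  show "continuous_on (ball N \<rho>) w'"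
  proof (intro continuous_at_imp_continuous_on ballI)
    fix x assume x: "x \<in> ball N \<rho>"
    have "isCont c x" using cc[of UNIV] by (simp add: continuous_on_eq_continuous_at)
    from isCont_scaleR[OF continuous_const[of _ s] isCont_o2[OF this cut2[OF near[OF x]]]] show "isCont w' x"
      unfolding w'_def .
  qed
  show cT: "c z \<in> T" if "T \<in> \<T>" "N \<in> T" "z \<in> T" for T z
  proof -
    have "(1 - s) *\<^sub>R N + s *\<^sub>R z \<in> T" using that s convex_mem by (intro convexD) auto
    then show ?thesis by (simp add: c_def algebra_simps)
  qed
  show "w z = \<phi> (c z)" if "T \<in> \<T>" "N \<in> T" "z \<in> T" for T
    using cT[OF that] star_mem[OF that(1,2)] by (simp add: w_def indicator_def subset_iff)
  let ?S = "star N \<inter> cball N (s * H)"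
  let ?G = "\<lambda>z. ennreal ((norm (\<phi>' z))\<^sup>2) * indicator ?S z"
  have Gm: "?G \<in> borel_measurable borel"
    using closed_star continuous_on_subset[OF \<psi>(2)] by (intro borel_measurable_sq_indicator) auto
  have scale: "(\<integral>\<^sup>+z. ennreal (s\<^sup>2) * ?G (c z) \<partial>lborel) = energy \<phi>' N s"
  proof -
    have "(\<lambda>z. ?G (c z)) \<in> borel_measurable borel"
      by (rule measurable_compose[OF _ Gm]) (rule borel_measurable_continuous_onI[OF cc])
    then have "(\<integral>\<^sup>+z. ennreal (s\<^sup>2) * ?G (c z) \<partial>lborel) = ennreal (\<bar>s\<bar> ^ DIM(pt)) * (\<integral>\<^sup>+z. ?G ((N - s *\<^sub>R N) + s *\<^sub>R z) \<partial>lborel)"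
      by (subst nn_integral_cmult) (auto simp: c_def algebra_simps power2_eq_square)
    also have "\<dots> = (\<integral>\<^sup>+z. ?G z \<partial>lborel)" using nn_integral_affine[OF Gm, of s "N - s *\<^sub>R N"] s by simp
    finally show ?thesis by (simp add: energy_def)
  qed
  have dc: "dist N (c x) \<le> s * H" if "dist N x \<le> H" for x
    using that s by (simp add: c_def dist_norm norm_minus_commute)
  show "(sq_int lborel T (\<lambda>z. norm (f' z))) \<le> energy \<phi>' N s" if T: "T \<in> \<T>" "N \<in> T" for T
    unfolding scale[symmetric]
  proof (intro nn_integral_mono)
    fix z
    show "ennreal ((norm (f' z))\<^sup>2) * indicator T z \<le> ennreal (s\<^sup>2) * ?G (c z)"
    proof (cases "z \<in> T")
      case True
      then have "c z \<in> ?S" using cT[OF T] star_mem[OF T] dc[of z] dist_le[OF T True] by auto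
      then show ?thesis using True s by (simp add: f'_def power_mult_distrib ennreal_mult)
    qed simp
  qed
  show "(sq_int lborel (ball N \<rho>) (\<lambda>z. norm (w' z))) \<le> energy \<phi>' N s"
    unfolding scale[symmetric]
  proof (intro nn_integral_mono)
    fix z
    show "ennreal ((norm (w' z))\<^sup>2) * indicator (ball N \<rho>) z \<le> ennreal (s\<^sup>2) * ?G (c z)"
    proof (cases "z \<in> ball N \<rho> \<and> c z \<in> star N")
      case True
      then have "dist N z \<le> H" using params by auto
      then have "c z \<in> ?S" using dc[of z] True by auto
      then show ?thesis using True s by (simp add: w'_def power_mult_distrib ennreal_mult)
    qed (auto simp: w'_def indicator_def)
  qed
qed

lemma test_dbl:
  assumes N: "N \<in> nodes \<T>" and T: "T \<in> \<T>" "N \<in> T" "T' \<in> \<T>" "N \<in> T'"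
    and \<phi>: "\<phi> \<in> test_functions \<Omega>" "\<And>x. GDERIV \<phi> x :> \<phi>' x"
  shows "dbl \<phi> T' T \<le> ennreal (C1 * H ^ 4) * energy \<phi>' N 1"
proof -
  note h = scaled_hypotheses[OF N _ _ \<phi>, of 1]
  have "dbl (\<lambda>x. \<phi> (N + 1 *\<^sub>R (x - N))) T' T \<le> ennreal (C1 * H ^ 4) * energy \<phi>' N 1"
    by (rule local_estimate[OF T h(1) h(2) h(3) h(4) _ h(5) h(5) h(6)]) (use T h(8) in auto)
  then show ?thesis by simp
qed

lemma test_trace:
  assumes N: "N \<in> nodes \<T>" and T: "T \<in> \<T>" "N \<in> T" "T' \<in> \<T>" "N \<in> T'" and E: "closed_segment a b edge_of T'"
    and \<phi>: "\<phi> \<in> test_functions \<Omega>" "\<And>x. GDERIV \<phi> x :> \<phi>' x" and s: "0 < s" "s \<le> 1"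
  shows "(\<integral>\<^sup>+z\<in>T. (sq_int lborel {0..1} (\<lambda>t. \<phi> (N + s *\<^sub>R (a + t *\<^sub>R (b - a) - N)) - \<phi> (N + s *\<^sub>R (z - N)))) \<partial>lborel)
    \<le> ennreal (C2 * H\<^sup>2) * energy \<phi>' N s"
proof -
  note h = scaled_hypotheses[OF N s \<phi>]
  show ?thesis
    by (rule local_trace[OF T E h(1) h(2) h(3) h(4) _ h(5) h(5) h(6)]) (use T h(8) in auto)
qed

lemma test_zero_on_frontier: "\<phi> \<in> test_functions \<Omega> \<Longrightarrow> x \<in> frontier \<Omega> \<Longrightarrow> \<phi> x = 0"
  using closure_subset[of "{x. \<phi> x \<noteq> 0}"] open_dom by (auto simp: test_functions_def frontier_def interior_open)

text \<open>A boundary edge at \<open>N\<close>, shrunk towards \<open>N\<close>, stays within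
  itself. The test function is zero on it, so the comparison of edge and element becomes a bound for
  the function itself, uniformly in \<open>s\<close>.\<close>

lemma test_friedrichs:
  assumes N: "N \<in> nodes \<T>" "N \<in> frontier \<Omega>" and T: "T \<in> \<T>" "N \<in> T"
    and \<phi>: "\<phi> \<in> test_functions \<Omega>" "\<And>x. GDERIV \<phi> x :> \<phi>' x" and s: "0 < s" "s \<le> 1"
  shows "(sq_int lborel T (\<lambda>z. \<phi> (N + s *\<^sub>R (z - N)))) \<le> ennreal (C2 * H\<^sup>2) * energy \<phi>' N s"
proof -
  obtain E where E: "E \<in> edges \<T>" "N \<in> E" "E \<subseteq> frontier \<Omega>" using frontier_edge[OF N] by blast
  obtain T' where T': "T' \<in> \<T>" "E edge_of T'" using E(1) by (auto simp: edges_def)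
  obtain a b where ab: "E = closed_segment a b" using edge_segment[OF E(1)] by metis
  have NT': "N \<in> T'" using E(2) T'(2) edge_of_imp_subset by blast
  have zero: "\<phi> (N + s *\<^sub>R (a + t *\<^sub>R (b - a) - N)) = 0" if "t \<in> {0..1}" for t
  proof -
    have cE: "convex E" unfolding ab by simp
    have "(1 - t) *\<^sub>R a + t *\<^sub>R b \<in> E" using that cE unfolding ab by (intro convexD) auto
    then have m: "a + t *\<^sub>R (b - a) \<in> E" by (simp add: algebra_simps)
    have "(1 - s) *\<^sub>R N + s *\<^sub>R (a + t *\<^sub>R (b - a)) \<in> E" using m E(2) s cE by (intro convexD) auto
    then have "N + s *\<^sub>R (a + t *\<^sub>R (b - a) - N) \<in> E" by (simp add: algebra_simps)
    then show ?thesis using test_zero_on_frontier[OF \<phi>(1)] E(3) by blast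
  qed
  have "(sq_int lborel T (\<lambda>z. \<phi> (N + s *\<^sub>R (z - N)))) =
    (\<integral>\<^sup>+z\<in>T. (sq_int lborel {0..1} (\<lambda>t. \<phi> (N + s *\<^sub>R (a + t *\<^sub>R (b - a) - N)) - \<phi> (N + s *\<^sub>R (z - N)))) \<partial>lborel)"
  proof (intro nn_integral_cong arg_cong2[where f = "(*)"] refl)
    fix z
    have "(sq_int lborel {0..1} (\<lambda>t. \<phi> (N + s *\<^sub>R (a + t *\<^sub>R (b - a) - N)) - \<phi> (N + s *\<^sub>R (z - N)))) =
      (\<integral>\<^sup>+t. ennreal ((\<phi> (N + s *\<^sub>R (z - N)))\<^sup>2) * indicator {0..1::real} t \<partial>lborel)"
      using zero by (intro nn_integral_cong) (auto simp: indicator_def)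
    then show "ennreal ((\<phi> (N + s *\<^sub>R (z - N)))\<^sup>2) =
      (sq_int lborel {0..1} (\<lambda>t. \<phi> (N + s *\<^sub>R (a + t *\<^sub>R (b - a) - N)) - \<phi> (N + s *\<^sub>R (z - N))))"
      by (simp add: nn_integral_cmult)
  qed
  also have "\<dots> \<le> ennreal (C2 * H\<^sup>2) * energy \<phi>' N s"
    using T'(2) unfolding ab by (intro test_trace[OF N(1) T T'(1) NT' _ \<phi> s])
  finally show ?thesis .
qed

definition C3 :: real where "C3 = 16 * \<gamma>\<^sup>2 * C2 / 3"

text \<open>The edge at \<open>N\<close> may run through the interior of the domain. It is compared
  with an element that contains it, and the element with zero by \<open>test_friedrichs\<close>;
  dividing by the area, at least 3 \<rho>^2, leaves a constant without any power of H or
  \<open>s\<close>.\<close>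

lemma test_trace_friedrichs:
  assumes N: "N \<in> nodes \<T>" "N \<in> frontier \<Omega>" and E: "E \<in> edges \<T>" "E = closed_segment a b" "N \<in> E"
    and \<phi>: "\<phi> \<in> test_functions \<Omega>" "\<And>x. GDERIV \<phi> x :> \<phi>' x" and s: "0 < s" "s \<le> 1"
  shows "(sq_int lborel {0..1} (\<lambda>t. \<phi> (N + s *\<^sub>R (a + t *\<^sub>R (b - a) - N)))) \<le> ennreal C3 * energy \<phi>' N s"
proof -
  obtain T where T: "T \<in> \<T>" "E edge_of T" using E(1) by (auto simp: edges_def)
  have NT: "N \<in> T" using E(3) T(2) edge_of_imp_subset by blast
  have [measurable]: "T \<in> sets borel" using borel_mem[OF T(1)] .
  let ?e = "\<lambda>t. \<phi> (N + s *\<^sub>R (a + t *\<^sub>R (b - a) - N))" and ?f = "\<lambda>z. \<phi> (N + s *\<^sub>R (z - N))"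
  have \<phi>c: "continuous_on UNIV \<phi>" by (rule test_functions_continuous[OF \<phi>(1)])
  have [measurable]: "\<phi> \<in> borel_measurable borel" using \<phi>c by (rule borel_measurable_continuous_onI)
  let ?X = "\<integral>\<^sup>+t\<in>{0..1}. ennreal ((?e t)\<^sup>2) \<partial>lborel"
  have pt: "?X \<le> 2 * (sq_int lborel {0..1} (\<lambda>t. ?e t - ?f z)) + 2 * ennreal ((?f z)\<^sup>2)" for z
  proof -
    have "?X \<le> (\<integral>\<^sup>+t. 2 * (ennreal ((?e t - ?f z)\<^sup>2) * indicator {0..1} t) + 2 * ennreal ((?f z)\<^sup>2) * indicator {0..1::real} t \<partial>lborel)"
    proof (intro nn_integral_mono)
      fix t :: real
      have "(?e t)\<^sup>2 \<le> 2 * (?e t - ?f z)\<^sup>2 + 2 * (?f z)\<^sup>2"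
        using zero_le_power2[of "(?e t - ?f z) - ?f z"] by (simp add: power2_eq_square algebra_simps)
      then have "ennreal ((?e t)\<^sup>2) \<le> ennreal (2 * (?e t - ?f z)\<^sup>2 + 2 * (?f z)\<^sup>2)" by (rule ennreal_leI)
      also have "\<dots> = 2 * ennreal ((?e t - ?f z)\<^sup>2) + 2 * ennreal ((?f z)\<^sup>2)" by (simp add: ennreal_mult)
      finally show "ennreal ((?e t)\<^sup>2) * indicator {0..1} t \<le> 2 * (ennreal ((?e t - ?f z)\<^sup>2) * indicator {0..1} t) + 2 * ennreal ((?f z)\<^sup>2) * indicator {0..1::real} t"
        by (simp add: indicator_def)
    qed
    also have "\<dots> = 2 * (sq_int lborel {0..1} (\<lambda>t. ?e t - ?f z)) + 2 * ennreal ((?f z)\<^sup>2)"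
      by (subst nn_integral_add, measurable) (simp add: nn_integral_cmult)
    finally show ?thesis .
  qed
  have "ennreal (3 * \<rho>\<^sup>2) * ?X \<le> emeasure lborel T * ?X"
    by (rule mult_right_mono[OF emeasure_tri_ge[OF T(1)]]) simp
  also have "\<dots> = (\<integral>\<^sup>+z\<in>T. ?X \<partial>lborel)" using nn_integral_cmult_indicator[of T lborel ?X] by (simp add: mult.commute)
  also have "\<dots> \<le> (\<integral>\<^sup>+z\<in>T. (2 * (sq_int lborel {0..1} (\<lambda>t. ?e t - ?f z)) + 2 * ennreal ((?f z)\<^sup>2)) \<partial>lborel)"
    by (intro nn_integral_mono mult_right_mono pt) auto
  also have "\<dots> = (\<integral>\<^sup>+z. 2 * ((sq_int lborel {0..1} (\<lambda>t. ?e t - ?f z)) * indicator T z) + 2 * (ennreal ((?f z)\<^sup>2) * indicator T z) \<partial>lborel)"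
    by (intro nn_integral_cong) (simp add: distrib_right mult.assoc)
  also have "\<dots> = 2 * (\<integral>\<^sup>+z\<in>T. (sq_int lborel {0..1} (\<lambda>t. ?e t - ?f z)) \<partial>lborel) + 2 * (sq_int lborel T (\<lambda>z. ?f z))"
    by (subst nn_integral_add, measurable) (simp add: nn_integral_cmult)
  also have "\<dots> \<le> 2 * (ennreal (C2 * H\<^sup>2) * energy \<phi>' N s) + 2 * (ennreal (C2 * H\<^sup>2) * energy \<phi>' N s)"
    using T(2) unfolding E(2)
    by (intro add_mono mult_left_mono test_trace[OF N(1) T(1) NT T(1) NT _ \<phi> s] test_friedrichs[OF N T(1) NT \<phi> s]) auto
  also have "\<dots> = ennreal (4 * (C2 * H\<^sup>2)) * energy \<phi>' N s"
    using const_pos by (subst ennreal_mult) (auto simp: mult.assoc simp flip: distrib_right)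
  finally have "?X \<le> ennreal (4 * (C2 * H\<^sup>2) / (3 * \<rho>\<^sup>2)) * energy \<phi>' N s"
    using params const_pos by (intro ennreal_mult_le_divide) auto
  also have "4 * (C2 * H\<^sup>2) / (3 * \<rho>\<^sup>2) = C3"
    using params(1-3) unfolding C3_def \<rho>_def by (simp add: field_simps power2_eq_square)
  finally show ?thesis .
qed

end

subsection \<open>Passage to the limit\<close>

lemma L2_diff:
  assumes f: "f \<in> L2 M S" and g: "g \<in> L2 M S"
  shows "(\<lambda>x. f x - g x) \<in> L2 M S"
proof -
  have m: "(\<lambda>x. indicator S x *\<^sub>R (f x - g x)) \<in> borel_measurable M"
    using borel_measurable_diff[OF L2_measurable[OF f, unfolded set_borel_measurable_def] L2_measurable[OF g, unfolded set_borel_measurable_def]]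
    by (simp add: scaleR_diff_right)
  have "set_integrable M S (\<lambda>x. (norm (f x - g x))\<^sup>2)"
    unfolding set_integrable_def
  proof (rule Bochner_Integration.integrable_bound)
    show "integrable M (\<lambda>x. 2 * (indicator S x *\<^sub>R (norm (f x))\<^sup>2) + 2 * (indicator S x *\<^sub>R (norm (g x))\<^sup>2))"
      using L2_integrable[OF f] L2_integrable[OF g] unfolding set_integrable_def
      by (intro Bochner_Integration.integrable_add integrable_mult_right)
    have "(\<lambda>x. (norm (indicator S x *\<^sub>R (f x - g x)))\<^sup>2) \<in> borel_measurable M"
      using m by measurable
    then show "(\<lambda>x. indicator S x *\<^sub>R (norm (f x - g x))\<^sup>2) \<in> borel_measurable M"
      by (rule measurable_cong[THEN iffD1, rotated]) (auto simp: indicator_def)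
    show "AE x in M. norm (indicator S x *\<^sub>R (norm (f x - g x))\<^sup>2) \<le> norm (2 * (indicator S x *\<^sub>R (norm (f x))\<^sup>2) + 2 * (indicator S x *\<^sub>R (norm (g x))\<^sup>2))"
    proof (rule AE_I2)
      fix x
      have "(norm (f x - g x))\<^sup>2 \<le> (norm (f x) + norm (g x))\<^sup>2" by (intro power_mono norm_triangle_ineq4) simp
      also have "\<dots> \<le> 2 * (norm (f x))\<^sup>2 + 2 * (norm (g x))\<^sup>2"
        using zero_le_power2[of "norm (f x) - norm (g x)"] by (simp add: power2_eq_square algebra_simps)
      finally show "norm (indicator S x *\<^sub>R (norm (f x - g x))\<^sup>2) \<le> norm (2 * (indicator S x *\<^sub>R (norm (f x))\<^sup>2) + 2 * (indicator S x *\<^sub>R (norm (g x))\<^sup>2))"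
        by (auto simp: indicator_def)
    qed
  qed
  with m show ?thesis by (simp add: L2_def set_borel_measurable_def)
qed

lemma L2_norm_nonneg: "L2_norm M A f \<ge> 0"
  unfolding L2_norm_def set_lebesgue_integral_def by (intro real_sqrt_ge_zero integral_nonneg_AE AE_I2) simp

lemma L2_norm_sq: "(L2_norm M A f)\<^sup>2 = (LINT x:A|M. (norm (f x))\<^sup>2)"
proof -
  have "0 \<le> (LINT x:A|M. (norm (f x))\<^sup>2)" unfolding set_lebesgue_integral_def by (intro integral_nonneg_AE AE_I2) simp
  then show ?thesis by (simp add: L2_norm_def)
qed

lemma nn_integral_L2:
  assumes "f \<in> L2 M A"
  shows "(sq_int M A (\<lambda>x. norm (f x))) = ennreal ((L2_norm M A f)\<^sup>2)"
proof -
  have "(sq_int M A (\<lambda>x. norm (f x))) = (\<integral>\<^sup>+x. ennreal (indicator A x *\<^sub>R (norm (f x))\<^sup>2) \<partial>M)"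
    by (intro nn_integral_cong) (auto simp: indicator_def)
  also have "\<dots> = ennreal (\<integral>x. indicator A x *\<^sub>R (norm (f x))\<^sup>2 \<partial>M)"
    using L2_integrable[OF assms] unfolding set_integrable_def by (intro nn_integral_eq_integral) auto
  finally show ?thesis by (simp add: L2_norm_sq set_lebesgue_integral_def)
qed

text \<open>In the nonintegrable case the integral behind \<open>L2_norm\<close> is 0 by convention,
  and the bound is trivial.\<close>

lemma L2_norm_le_nn_integral:
  assumes "(sq_int M A (\<lambda>x. norm (f x))) \<le> ennreal c" "c \<ge> 0"
  shows "(L2_norm M A f)\<^sup>2 \<le> c"
proof (cases "set_integrable M A (\<lambda>x. (norm (f x))\<^sup>2)")
  case True
  have "ennreal (LINT x:A|M. (norm (f x))\<^sup>2) = (\<integral>\<^sup>+x. ennreal (indicator A x *\<^sub>R (norm (f x))\<^sup>2) \<partial>M)"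
    using True unfolding set_lebesgue_integral_def set_integrable_def by (intro nn_integral_eq_integral[symmetric]) auto
  also have "\<dots> = (sq_int M A (\<lambda>x. norm (f x)))"
    by (intro nn_integral_cong) (auto simp: indicator_def)
  finally have "ennreal (LINT x:A|M. (norm (f x))\<^sup>2) \<le> ennreal c" using assms(1) by (simp only:)
  then show ?thesis using assms(2) by (simp only: L2_norm_sq ennreal_le_iff)
next
  case False
  then show ?thesis using assms(2) by (simp add: L2_norm_sq set_lebesgue_integral_def set_integrable_def not_integrable_integral_eq)
qed

lemma weak_gradient_diff:
  fixes u :: "'a::euclidean_space \<Rightarrow> real"
  assumes u: "u \<in> L2 lebesgue S" "g \<in> L2 lebesgue S" "weak_gradient S u g"
    and v: "v \<in> L2 lebesgue S" "h \<in> L2 lebesgue S" "weak_gradient S v h"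
  shows "weak_gradient S (\<lambda>x. u x - v x) (\<lambda>x. g x - h x)"
  unfolding weak_gradient_def
proof (intro ballI allI impI)
  fix \<phi> :: "'a \<Rightarrow> real" and \<phi>' assume \<phi>: "\<phi> \<in> test_functions S" and \<phi>': "\<forall>x. GDERIV \<phi> x :> \<phi>' x"
  obtain \<psi> K where \<psi>: "\<And>x. GDERIV \<phi> x :> \<psi> x" "continuous_on UNIV \<psi>" "compact K" "K \<subseteq> S" "\<And>x. x \<notin> K \<Longrightarrow> \<psi> x = 0"
    using test_functions_bounded_gradient[OF \<phi>] by metis
  have "\<phi>' = \<psi>" using \<phi>' \<psi>(1) GDERIV_unique by blast
  note \<psi> = \<psi>[folded this]
  note i = set_integrable_L2_scaleR_compact_support[OF _ \<psi>(2-5)]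
  have "(LINT x:S|lebesgue. (u x - v x) *\<^sub>R \<phi>' x) = (LINT x:S|lebesgue. u x *\<^sub>R \<phi>' x) - (LINT x:S|lebesgue. v x *\<^sub>R \<phi>' x)"
    unfolding scaleR_diff_left by (intro set_integral_diff(2) i u v)
  also have "\<dots> = - ((LINT x:S|lebesgue. \<phi> x *\<^sub>R g x) - (LINT x:S|lebesgue. \<phi> x *\<^sub>R h x))"
    using u(3) v(3) \<phi> \<phi>' unfolding weak_gradient_def by simp
  also have "(LINT x:S|lebesgue. \<phi> x *\<^sub>R g x) - (LINT x:S|lebesgue. \<phi> x *\<^sub>R h x) = (LINT x:S|lebesgue. \<phi> x *\<^sub>R (g x - h x))"
    unfolding scaleR_diff_right by (intro set_integral_diff(2)[symmetric] set_integrable_test_L2[OF _ \<phi>] u v)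
  finally show "(LINT x:S|lebesgue. (u x - v x) *\<^sub>R \<phi>' x) = - (LINT x:S|lebesgue. \<phi> x *\<^sub>R (g x - h x))" .
qed

lemma grad_props:
  assumes "g \<in> L2 lebesgue S" "weak_gradient S u g"
  shows "grad S u \<in> L2 lebesgue S" "weak_gradient S u (grad S u)"
proof -
  have "grad S u \<in> L2 lebesgue S \<and> weak_gradient S u (grad S u)"
    unfolding grad_def by (rule someI[of _ g]) (use assms in blast)
  then show "grad S u \<in> L2 lebesgue S" "weak_gradient S u (grad S u)" by auto
qed

lemma grad_eq_AE:
  fixes u :: "'a::euclidean_space \<Rightarrow> real"
  assumes "open S" "g \<in> L2 lebesgue S" "weak_gradient S u g"
  shows "AE x in lebesgue. x \<in> S \<longrightarrow> grad S u x = g x"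
  using grad_props[OF assms(2,3)] assms by (intro weak_gradient_unique[OF assms(1)]) auto

lemma borel_representative_real:
  fixes f :: "'a::euclidean_space \<Rightarrow> real"
  assumes "set_borel_measurable lebesgue S f"
  obtains f0 where "f0 \<in> borel_measurable borel" "AE x in lebesgue. x \<in> S \<longrightarrow> f x = f0 x"
proof -
  have "(\<lambda>x. indicator S x *\<^sub>R f x) \<in> borel_measurable (completion lborel)"
    using assms by (simp add: set_borel_measurable_def)
  then obtain f0 where f0: "f0 \<in> borel_measurable lborel" "AE x in lborel. indicator S x *\<^sub>R f x = f0 x"
    using completion_ex_borel_measurable_real by blast
  have "AE x in lebesgue. indicator S x *\<^sub>R f x = f0 x" using f0(2) by (rule AE_completion)
  then have "AE x in lebesgue. x \<in> S \<longrightarrow> f x = f0 x" by eventually_elim (auto simp: indicator_def)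
  with f0(1) show ?thesis using that by simp
qed

text \<open>Members of \<open>L2 lebesgue\<close> are measurable for the completed measure only,
  while iterated integrals over \<open>lborel\<close> call for Borel functions; hence the passage to
  a Borel function that agrees almost everywhere.\<close>

lemma borel_representative:
  fixes f :: "'a::euclidean_space \<Rightarrow> 'b::euclidean_space"
  assumes f: "set_borel_measurable lebesgue S f"
  obtains f0 where "f0 \<in> borel_measurable borel" "AE x in lebesgue. x \<in> S \<longrightarrow> f x = f0 x"
proof -
  have "\<exists>f0. f0 \<in> borel_measurable borel \<and> (AE x in lebesgue. x \<in> S \<longrightarrow> f x \<bullet> b = f0 x)" for b
  proof -
    have "(\<lambda>x. (indicator S x *\<^sub>R f x) \<bullet> b) \<in> borel_measurable lebesgue"
      using f unfolding set_borel_measurable_def by measurable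
    then have "set_borel_measurable lebesgue S (\<lambda>x. f x \<bullet> b)" by (simp add: set_borel_measurable_def)
    then show ?thesis using borel_representative_real by metis
  qed
  then obtain F where F: "\<And>b. F b \<in> borel_measurable borel" "\<And>b. AE x in lebesgue. x \<in> S \<longrightarrow> f x \<bullet> b = F b x" by metis
  have "AE x in lebesgue. \<forall>b\<in>Basis. x \<in> S \<longrightarrow> f x \<bullet> b = F b x"
    using F(2) by (intro AE_ball_countable[THEN iffD2] ballI countable_finite finite_Basis)
  then have "AE x in lebesgue. x \<in> S \<longrightarrow> f x = (\<Sum>b\<in>Basis. F b x *\<^sub>R b)"
  proof eventually_elim
    case (elim x)
    show ?case
    proof
      assume "x \<in> S"
      then have "(\<Sum>b\<in>Basis. F b x *\<^sub>R b) = (\<Sum>b\<in>Basis. (f x \<bullet> b) *\<^sub>R b)" using elim by (intro sum.cong) auto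
      then show "f x = (\<Sum>b\<in>Basis. F b x *\<^sub>R b)" by (simp add: euclidean_representation)
    qed
  qed
  moreover have "(\<lambda>x. \<Sum>b\<in>Basis. F b x *\<^sub>R b) \<in> borel_measurable borel" using F(1) by measurable
  ultimately show ?thesis using that by blast
qed

text \<open>The common shape of all passages to the limit: one null sequence comes from functions or
  traces, the other from gradients. The coefficients must be finite, since an infinite multiple of a
  null sequence need not tend to zero.\<close>

lemma le_of_tendsto_ennreal:
  fixes X A b c :: ennreal
  assumes le: "\<And>n. X \<le> A + b * q n + c * r n" and "q \<longlonglongrightarrow> 0" "r \<longlonglongrightarrow> 0" "b < \<infinity>" "c < \<infinity>"
  shows "X \<le> A"
proof -
  have "(\<lambda>n. A + b * q n + c * r n) \<longlonglongrightarrow> A + b * 0 + c * 0"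
    using assms by (intro tendsto_add ennreal_tendsto_cmult tendsto_const) auto
  then show ?thesis using LIMSEQ_le_const[OF _ exI[of _ 0], of _ _ X] le by fastforce
qed

text \<open>Splitting f - h through the approximants gives three squares, hence the factor 3. The
  measure for \<open>x\<close> is general, as \<open>x\<close> runs over an element in one
  application and over the parameter interval of an edge in another.\<close>

lemma double_integral_split:
  fixes M :: "'a measure" and f \<phi>0 :: "'a \<Rightarrow> real" and h \<phi> :: "pt \<Rightarrow> real"
  assumes "sigma_finite_measure M"
    and [measurable]: "f \<in> borel_measurable M" "\<phi>0 \<in> borel_measurable M" "h \<in> borel_measurable borel" "\<phi> \<in> borel_measurable borel"
      "A \<in> sets M" "T \<in> sets borel"
  shows "(\<integral>\<^sup>+z\<in>T. (sq_int M A (\<lambda>x. f x - h z)) \<partial>lborel) \<le>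
    3 * (\<integral>\<^sup>+z\<in>T. (sq_int M A (\<lambda>x. \<phi>0 x - \<phi> z)) \<partial>lborel)
    + 3 * emeasure lborel T * (sq_int M A (\<lambda>x. \<phi>0 x - f x))
    + 3 * emeasure M A * (sq_int lborel T (\<lambda>z. \<phi> z - h z))"
proof -
  interpret sigma_finite_measure M by fact
  let ?F = "\<integral>\<^sup>+x\<in>A. ennreal ((\<phi>0 x - f x)\<^sup>2) \<partial>M"
  let ?P = "\<lambda>z. \<integral>\<^sup>+x\<in>A. ennreal ((\<phi>0 x - \<phi> z)\<^sup>2) \<partial>M"
  have [measurable]: "?P \<in> borel_measurable lborel" by measurable
  have in1: "(sq_int M A (\<lambda>x. f x - h z)) \<le> 3 * ?F + 3 * ?P z + 3 * ennreal ((\<phi> z - h z)\<^sup>2) * emeasure M A" for z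
  proof -
    have "(sq_int M A (\<lambda>x. f x - h z)) \<le>
      (\<integral>\<^sup>+x. (3 * (ennreal ((\<phi>0 x - f x)\<^sup>2) * indicator A x) + 3 * (ennreal ((\<phi>0 x - \<phi> z)\<^sup>2) * indicator A x)) + 3 * ennreal ((\<phi> z - h z)\<^sup>2) * indicator A x \<partial>M)"
    proof (intro nn_integral_mono)
      fix x
      have "(f x - h z)\<^sup>2 \<le> 3 * (\<phi>0 x - f x)\<^sup>2 + 3 * (\<phi>0 x - \<phi> z)\<^sup>2 + 3 * (\<phi> z - h z)\<^sup>2"
      proof -
        have *: "(- a + b + c)\<^sup>2 \<le> 3 * a\<^sup>2 + 3 * b\<^sup>2 + 3 * c\<^sup>2" for a b c :: real
          using zero_le_power2[of "a + b"] zero_le_power2[of "a + c"] zero_le_power2[of "b - c"]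
          by (simp add: power2_eq_square algebra_simps)
        show ?thesis using *[of "\<phi>0 x - f x" "\<phi>0 x - \<phi> z" "\<phi> z - h z"] by simp
      qed
      then have "ennreal ((f x - h z)\<^sup>2) \<le> ennreal (3 * (\<phi>0 x - f x)\<^sup>2 + 3 * (\<phi>0 x - \<phi> z)\<^sup>2 + 3 * (\<phi> z - h z)\<^sup>2)" by (rule ennreal_leI)
      also have "\<dots> = 3 * ennreal ((\<phi>0 x - f x)\<^sup>2) + 3 * ennreal ((\<phi>0 x - \<phi> z)\<^sup>2) + 3 * ennreal ((\<phi> z - h z)\<^sup>2)"
        by (simp add: ennreal_mult)
      finally show "ennreal ((f x - h z)\<^sup>2) * indicator A x \<le>
        (3 * (ennreal ((\<phi>0 x - f x)\<^sup>2) * indicator A x) + 3 * (ennreal ((\<phi>0 x - \<phi> z)\<^sup>2) * indicator A x)) + 3 * ennreal ((\<phi> z - h z)\<^sup>2) * indicator A x"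
        by (simp add: indicator_def)
    qed
    also have "\<dots> = 3 * ?F + 3 * ?P z + 3 * ennreal ((\<phi> z - h z)\<^sup>2) * emeasure M A"
      by (subst nn_integral_add, measurable) (subst nn_integral_add, measurable, simp add: nn_integral_cmult)
    finally show ?thesis .
  qed
  have "(\<integral>\<^sup>+z\<in>T. (sq_int M A (\<lambda>x. f x - h z)) \<partial>lborel) \<le>
    (\<integral>\<^sup>+z\<in>T. (3 * ?F + 3 * ?P z + 3 * ennreal ((\<phi> z - h z)\<^sup>2) * emeasure M A) \<partial>lborel)"
    by (intro nn_integral_mono mult_right_mono in1) auto
  also have "\<dots> = (\<integral>\<^sup>+z. (3 * ?F * indicator T z + 3 * (?P z * indicator T z)) + 3 * emeasure M A * (ennreal ((\<phi> z - h z)\<^sup>2) * indicator T z) \<partial>lborel)"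
    by (intro nn_integral_cong) (simp add: indicator_def ac_simps)
  also have "\<dots> = (3 * ?F * emeasure lborel T + 3 * (\<integral>\<^sup>+z\<in>T. ?P z \<partial>lborel)) + 3 * emeasure M A * (sq_int lborel T (\<lambda>z. \<phi> z - h z))"
    by (subst nn_integral_add, measurable) (subst nn_integral_add, measurable, simp add: nn_integral_cmult)
  finally show ?thesis by (simp add: ac_simps)
qed

lemma tendsto_ennreal_sq:
  assumes "a \<longlonglongrightarrow> (0::real)" shows "(\<lambda>n. ennreal ((a n)\<^sup>2)) \<longlonglongrightarrow> 0"
proof -
  have "(\<lambda>n. ennreal ((a n)\<^sup>2)) \<longlonglongrightarrow> ennreal (0\<^sup>2)" using assms by (intro tendsto_ennrealI tendsto_power)
  then show ?thesis by simp
qed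

lemma sets_arc_length[simp, measurable_cong]: "sets (arc_length \<E>) = sets borel"
  by (simp add: arc_length_def)

lemma space_arc_length[simp]: "space (arc_length \<E>) = UNIV"
  by (simp add: arc_length_def)

lemma measurable_arc_length[simp]: "borel_measurable (arc_length \<E>) = (borel_measurable borel :: (pt \<Rightarrow> 'b::topological_space) set)"
  by (rule measurable_cong_sets) simp_all

lemma real_sq_triangle: "(a - c)\<^sup>2 \<le> 2 * (a - b)\<^sup>2 + 2 * (b - (c::real))\<^sup>2"
  using zero_le_power2[of "(a - b) - (b - c)"] by (simp add: power2_eq_square algebra_simps)

lemma ennreal_sq_triangle: "ennreal ((a - c)\<^sup>2) \<le> 2 * ennreal ((a - b)\<^sup>2) + 2 * ennreal ((b - c)\<^sup>2)"
  using ennreal_leI[OF real_sq_triangle[of a c b]] by (simp add: ennreal_mult)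

lemma nn_integral_sq_triangle:
  assumes [measurable]: "f \<in> borel_measurable M" "g \<in> borel_measurable M" "h \<in> borel_measurable M" "A \<in> sets M"
  shows "(sq_int M A (\<lambda>x. f x - h x)) \<le> 2 * (sq_int M A (\<lambda>x. f x - g x)) + 2 * (sq_int M A (\<lambda>x. g x - h x))"
proof -
  have "(sq_int M A (\<lambda>x. f x - h x)) \<le>
    (\<integral>\<^sup>+x. 2 * (ennreal ((f x - g x)\<^sup>2) * indicator A x) + 2 * (ennreal ((g x - h x)\<^sup>2) * indicator A x) \<partial>M)"
    using ennreal_sq_triangle by (intro nn_integral_mono) (auto simp: indicator_def)
  also have "\<dots> = 2 * (sq_int M A (\<lambda>x. f x - g x)) + 2 * (sq_int M A (\<lambda>x. g x - h x))"
    by (subst nn_integral_add, measurable) (simp add: nn_integral_cmult)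
  finally show ?thesis .
qed

lemma nn_integral_norm_sq_le:
  fixes g h :: "'a \<Rightarrow> 'b::euclidean_space"
  assumes [measurable]: "g \<in> borel_measurable M" "h \<in> borel_measurable M" "A \<in> sets M"
  shows "(sq_int M A (\<lambda>x. norm (g x))) \<le> 2 * (sq_int M A (\<lambda>x. norm (g x - h x))) + 2 * (sq_int M A (\<lambda>x. norm (h x)))"
proof -
  have "(sq_int M A (\<lambda>x. norm (g x))) \<le>
    (\<integral>\<^sup>+x. 2 * (ennreal ((norm (g x - h x))\<^sup>2) * indicator A x) + 2 * (ennreal ((norm (h x))\<^sup>2) * indicator A x) \<partial>M)"
  proof (intro nn_integral_mono)
    fix x
    have "(norm (g x))\<^sup>2 \<le> (norm (g x - h x) + norm (h x))\<^sup>2"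
      using norm_triangle_sub[of "g x" "h x"] by (intro power_mono) (auto simp: add.commute)
    also have "\<dots> \<le> 2 * (norm (g x - h x))\<^sup>2 + 2 * (norm (h x))\<^sup>2"
      using zero_le_power2[of "norm (g x - h x) - norm (h x)"] by (simp add: power2_eq_square algebra_simps)
    finally have "ennreal ((norm (g x))\<^sup>2) \<le> ennreal (2 * (norm (g x - h x))\<^sup>2 + 2 * (norm (h x))\<^sup>2)" by (rule ennreal_leI)
    then show "ennreal ((norm (g x))\<^sup>2) * indicator A x \<le> 2 * (ennreal ((norm (g x - h x))\<^sup>2) * indicator A x) + 2 * (ennreal ((norm (h x))\<^sup>2) * indicator A x)"
      by (auto simp: indicator_def ennreal_mult)
  qed
  also have "\<dots> = 2 * (sq_int M A (\<lambda>x. norm (g x - h x))) + 2 * (sq_int M A (\<lambda>x. norm (h x)))"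
    by (subst nn_integral_add, measurable) (simp add: nn_integral_cmult)
  finally show ?thesis .
qed

section \<open>The function \<open>v\<close>: Borel versions and approximation by test
  functions\<close>

locale mesh_function = mesh \<Omega> \<T> \<gamma> H for \<Omega> \<T> \<gamma> H +
  fixes \<Gamma> :: "pt set" and v :: "pt \<Rightarrow> real"
  assumes interface: "\<Gamma> = \<Union>(interface_edges \<T> \<Gamma>)"
    and v: "v \<in> V_space \<Omega> (interface_edges \<T> \<Gamma>)"
begin

abbreviation \<E> :: "pt set set" where "\<E> \<equiv> interface_edges \<T> \<Gamma>"

lemma edges_\<E>: "E \<in> \<E> \<Longrightarrow> E \<in> edges \<T>" and \<E>_subset: "E \<in> \<E> \<Longrightarrow> E \<subseteq> \<Gamma>"
  by (auto simp: interface_edges_def)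

lemma finite_\<E>: "finite \<E>"
proof -
  have "\<E> \<subseteq> (\<lambda>(a, b). closed_segment a b) ` (nodes \<T> \<times> nodes \<T>)"
  proof
    fix E assume "E \<in> \<E>"
    then obtain a b where "E = closed_segment a b" "a \<in> nodes \<T>" "b \<in> nodes \<T>" using edge_segment[OF edges_\<E>] by metis
    then show "E \<in> (\<lambda>(a, b). closed_segment a b) ` (nodes \<T> \<times> nodes \<T>)" by auto
  qed
  then show ?thesis using finite_nodes by (meson finite_SigmaI finite_imageI finite_subset)
qed

lemma v_H1_0: "v \<in> H1_0 \<Omega>" using v by (simp add: V_space_def)

lemma v_L2: "v \<in> L2 lebesgue \<Omega>" using v_H1_0 by (simp add: H1_0_def H1_def)

lemma grad_v: "grad \<Omega> v \<in> L2 lebesgue \<Omega>" "weak_gradient \<Omega> v (grad \<Omega> v)"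
  using v_H1_0 grad_props[of _ \<Omega> v] by (auto simp: H1_0_def H1_def)

definition v0 :: "pt \<Rightarrow> real" where
  "v0 = (SOME f. f \<in> borel_measurable borel \<and> (AE x in lebesgue. x \<in> \<Omega> \<longrightarrow> v x = f x))"

definition g0 :: "pt \<Rightarrow> pt" where
  "g0 = (SOME f. f \<in> borel_measurable borel \<and> (AE x in lebesgue. x \<in> \<Omega> \<longrightarrow> grad \<Omega> v x = f x))"

lemma v0: "v0 \<in> borel_measurable borel" "AE x in lebesgue. x \<in> \<Omega> \<longrightarrow> v x = v0 x"
proof -
  have "\<exists>f. f \<in> borel_measurable borel \<and> (AE x in lebesgue. x \<in> \<Omega> \<longrightarrow> v x = f x)"
    by (rule borel_representative[OF L2_measurable[OF v_L2]]) (rule exI, rule conjI)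
  from someI_ex[OF this] show "v0 \<in> borel_measurable borel" "AE x in lebesgue. x \<in> \<Omega> \<longrightarrow> v x = v0 x"
    unfolding v0_def by auto
qed

lemma g0: "g0 \<in> borel_measurable borel" "AE x in lebesgue. x \<in> \<Omega> \<longrightarrow> grad \<Omega> v x = g0 x"
proof -
  have "\<exists>f. f \<in> borel_measurable borel \<and> (AE x in lebesgue. x \<in> \<Omega> \<longrightarrow> grad \<Omega> v x = f x)"
    by (rule borel_representative[OF L2_measurable[OF grad_v(1)]]) (rule exI, rule conjI)
  from someI_ex[OF this] show "g0 \<in> borel_measurable borel" "AE x in lebesgue. x \<in> \<Omega> \<longrightarrow> grad \<Omega> v x = g0 x"
    unfolding g0_def by auto
qed

lemma closed_interface: "closed \<Gamma>"
proof -
  have "closed (\<Union>\<E>)" using finite_\<E> edge_segment[OF edges_\<E>] by (intro closed_Union) (metis closed_segment)+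
  then show ?thesis using interface by metis
qed

lemma borel_interface: "\<Gamma> \<in> sets borel"
  using closed_interface by simp

lemma fmeasurable_arc:
  assumes "A \<in> sets borel" shows "A \<in> fmeasurable (arc_length \<E>)"
proof -
  have "emeasure (arc_length \<E>) UNIV < \<infinity>"
    using nn_integral_arc_length[OF finite_\<E>, of "\<lambda>_. 1"] by (simp add: emeasure_lborel_Icc_eq)
  then show ?thesis using assms by (intro fmeasurableI) (auto intro: le_less_trans[OF emeasure_mono])
qed

text \<open>One sequence serves the function, its gradient and the trace, as in
  \<open>is_trace\<close>. The H1 norm there involves a chosen weak gradient of the difference;
  uniqueness identifies it almost everywhere with the difference of the gradients.\<close>

lemma approximation:
  assumes "is_trace \<Omega> \<E> v g"
  obtains \<phi> \<phi>' where "\<And>n::nat. \<phi> n \<in> test_functions \<Omega>" "\<And>n x. GDERIV (\<phi> n) x :> \<phi>' n x" "\<And>n. continuous_on UNIV (\<phi>' n)"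
    "(\<lambda>n. sq_int lborel \<Omega> (\<lambda>x. \<phi> n x - v0 x)) \<longlonglongrightarrow> 0"
    "(\<lambda>n. sq_int lborel \<Omega> (\<lambda>x. norm (\<phi>' n x - g0 x))) \<longlonglongrightarrow> 0"
    "(\<lambda>n. sq_int (arc_length \<E>) \<Gamma> (\<lambda>x. \<phi> n x - g x)) \<longlonglongrightarrow> 0"
proof -
  from assms obtain \<phi> where \<phi>: "\<And>n::nat. \<phi> n \<in> test_functions \<Omega>"
    "(\<lambda>n. H1_norm \<Omega> (\<lambda>x. \<phi> n x - v x)) \<longlonglongrightarrow> 0" "(\<lambda>n. L2_norm (arc_length \<E>) (\<Union>\<E>) (\<lambda>x. \<phi> n x - g x)) \<longlonglongrightarrow> 0"
    and g: "g \<in> L2 (arc_length \<E>) (\<Union>\<E>)"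
    unfolding is_trace_def by blast
  have "\<forall>n. \<exists>\<psi>. (\<forall>x. GDERIV (\<phi> n) x :> \<psi> x) \<and> continuous_on UNIV \<psi>"
    using test_functions_gradient[OF \<phi>(1)] by metis
  then obtain \<phi>' where \<phi>': "\<And>n x. GDERIV (\<phi> n) x :> \<phi>' n x" "\<And>n. continuous_on UNIV (\<phi>' n)" by metis
  note w = weak_gradient_test_function[OF open_dom \<phi>(1) \<phi>'(1)]
  have d: "(\<lambda>x. \<phi> n x - v x) \<in> L2 lebesgue \<Omega>" "(\<lambda>x. \<phi>' n x - grad \<Omega> v x) \<in> L2 lebesgue \<Omega>"
    "weak_gradient \<Omega> (\<lambda>x. \<phi> n x - v x) (\<lambda>x. \<phi>' n x - grad \<Omega> v x)" for n
    by (intro L2_diff weak_gradient_diff w v_L2 grad_v)+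
  note gr = grad_props[OF d(2,3)]
  have "L2_norm lebesgue \<Omega> (\<lambda>x. \<phi> n x - v x) \<le> H1_norm \<Omega> (\<lambda>x. \<phi> n x - v x)"
    "L2_norm lebesgue \<Omega> (grad \<Omega> (\<lambda>x. \<phi> n x - v x)) \<le> H1_norm \<Omega> (\<lambda>x. \<phi> n x - v x)" for n
    unfolding H1_norm_def using L2_norm_nonneg by (auto intro: real_le_rsqrt)
  then have l: "(\<lambda>n. L2_norm lebesgue \<Omega> (\<lambda>x. \<phi> n x - v x)) \<longlonglongrightarrow> 0" "(\<lambda>n. L2_norm lebesgue \<Omega> (grad \<Omega> (\<lambda>x. \<phi> n x - v x))) \<longlonglongrightarrow> 0"
    using \<phi>(2) by (auto intro!: tendsto_sandwich[OF _ _ tendsto_const \<phi>(2)] simp: L2_norm_nonneg)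
  have 1: "(sq_int lborel \<Omega> (\<lambda>x. \<phi> n x - v0 x)) = ennreal ((L2_norm lebesgue \<Omega> (\<lambda>x. \<phi> n x - v x))\<^sup>2)" for n
  proof -
    have "(sq_int lborel \<Omega> (\<lambda>x. \<phi> n x - v0 x)) = (sq_int lebesgue \<Omega> (\<lambda>x. norm (\<phi> n x - v x)))"
      unfolding nn_integral_completion[of lborel, symmetric]
      using v0(2) by (intro nn_integral_cong_AE) (auto elim!: eventually_mono simp: indicator_def)
    then show ?thesis using nn_integral_L2[OF d(1)] by simp
  qed
  have 2: "(sq_int lborel \<Omega> (\<lambda>x. norm (\<phi>' n x - g0 x))) = ennreal ((L2_norm lebesgue \<Omega> (grad \<Omega> (\<lambda>x. \<phi> n x - v x)))\<^sup>2)" for n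
  proof -
    have "AE x in lebesgue. x \<in> \<Omega> \<longrightarrow> grad \<Omega> (\<lambda>x. \<phi> n x - v x) x = \<phi>' n x - g0 x"
      using grad_eq_AE[OF open_dom d(2,3)] g0(2) by eventually_elim auto
    then have "(sq_int lborel \<Omega> (\<lambda>x. norm (\<phi>' n x - g0 x))) = (sq_int lebesgue \<Omega> (\<lambda>x. norm (grad \<Omega> (\<lambda>x. \<phi> n x - v x) x)))"
      unfolding nn_integral_completion[of lborel, symmetric]
      by (intro nn_integral_cong_AE) (auto elim!: eventually_mono simp: indicator_def)
    then show ?thesis using nn_integral_L2[OF gr(1)] by simp
  qed
  have 3: "(sq_int (arc_length \<E>) \<Gamma> (\<lambda>x. \<phi> n x - g x)) = ennreal ((L2_norm (arc_length \<E>) (\<Union>\<E>) (\<lambda>x. \<phi> n x - g x))\<^sup>2)" for n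
  proof -
    obtain B where B: "\<And>x. \<bar>\<phi> n x\<bar> \<le> B" using test_functions_bounded_gradient[OF \<phi>(1)[of n]] by metis
    have fm: "\<Union>\<E> \<in> fmeasurable (arc_length \<E>)"
      using fmeasurable_arc[OF borel_interface] unfolding interface[symmetric] .
    have "\<phi> n \<in> borel_measurable borel" using test_functions_continuous[OF \<phi>(1)] by (rule borel_measurable_continuous_onI)
    then have "\<phi> n \<in> L2 (arc_length \<E>) (\<Union>\<E>)"
      using fm B by (intro L2_bounded[OF fm, of _ B]) (auto simp: set_borel_measurable_def dest: fmeasurableD)
    from nn_integral_L2[OF L2_diff[OF this g]] show ?thesis using interface by simp
  qed
  show ?thesis
    by (rule that[of \<phi> \<phi>']) (use \<phi> \<phi>' in \<open>auto simp: 1 2 3 intro!: tendsto_ennreal_sq l\<close>)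
qed

lemma tri_sub_nn_integral:
  assumes "T \<in> \<T>" and [measurable]: "F \<in> borel_measurable borel"
  shows "(\<integral>\<^sup>+x\<in>T. F x \<partial>lborel) \<le> (\<integral>\<^sup>+x\<in>\<Omega>. F x \<partial>lborel)"
proof -
  have "T \<subseteq> \<Omega> \<union> frontier \<Omega>" using assms(1) Union_mesh by (auto simp: closure_Un_frontier)
  moreover have "AE x in lebesgue. x \<notin> frontier \<Omega>" using negligible_frontier_dom by (intro AE_not_in) (simp add: negligible_iff_null_sets)
  ultimately have "(\<integral>\<^sup>+x\<in>T. F x \<partial>lebesgue) \<le> (\<integral>\<^sup>+x\<in>\<Omega>. F x \<partial>lebesgue)"
    by (intro nn_integral_mono_AE) (auto elim!: eventually_mono simp: indicator_def)
  then show ?thesis by (simp add: nn_integral_completion)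
qed

lemma star_sub_nn_integral:
  assumes [measurable]: "F \<in> borel_measurable borel"
  shows "(\<integral>\<^sup>+x\<in>star N \<inter> A. F x \<partial>lborel) \<le> (\<integral>\<^sup>+x\<in>\<Omega>. F x \<partial>lborel)"
proof -
  have "star N \<subseteq> \<Omega> \<union> frontier \<Omega>" using Union_mesh by (auto simp: closure_Un_frontier star_def elements_at_def)
  moreover have "AE x in lebesgue. x \<notin> frontier \<Omega>" using negligible_frontier_dom by (intro AE_not_in) (simp add: negligible_iff_null_sets)
  ultimately have "(\<integral>\<^sup>+x\<in>star N \<inter> A. F x \<partial>lebesgue) \<le> (\<integral>\<^sup>+x\<in>\<Omega>. F x \<partial>lebesgue)"
    by (intro nn_integral_mono_AE) (auto elim!: eventually_mono simp: indicator_def)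
  then show ?thesis by (simp add: nn_integral_completion)
qed

lemma energy_le:
  assumes c: "continuous_on UNIV \<phi>'"
  shows "energy \<phi>' N s \<le> 2 * energy g0 N s + 2 * (sq_int lborel \<Omega> (\<lambda>x. norm (\<phi>' x - g0 x)))"
proof -
  have [measurable]: "\<phi>' \<in> borel_measurable borel" using c by (rule borel_measurable_continuous_onI)
  note [measurable] = g0(1)
  let ?S = "star N \<inter> cball N (s * H)"
  have [measurable]: "?S \<in> sets borel" using closed_star by auto
  have "energy \<phi>' N s \<le> 2 * (sq_int lborel ?S (\<lambda>x. norm (\<phi>' x - g0 x))) + 2 * energy g0 N s"
    unfolding energy_def by (rule nn_integral_norm_sq_le) auto
  also have "\<dots> \<le> 2 * (sq_int lborel \<Omega> (\<lambda>x. norm (\<phi>' x - g0 x))) + 2 * energy g0 N s"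
    by (intro add_right_mono mult_left_mono star_sub_nn_integral) auto
  finally show ?thesis by (simp add: add.commute)
qed

lemma const_energy_le:
  assumes c: "continuous_on UNIV \<phi>'" and k: "k \<ge> 0"
  shows "ennreal k * energy \<phi>' N s \<le> ennreal (2 * k) * energy g0 N s + ennreal (2 * k) * (sq_int lborel \<Omega> (\<lambda>x. norm (\<phi>' x - g0 x)))"
proof -
  have "ennreal k * energy \<phi>' N s \<le> ennreal k * (2 * energy g0 N s + 2 * (sq_int lborel \<Omega> (\<lambda>x. norm (\<phi>' x - g0 x))))"
    by (intro mult_left_mono energy_le c) simp
  also have "\<dots> = ennreal (2 * k) * energy g0 N s + ennreal (2 * k) * (sq_int lborel \<Omega> (\<lambda>x. norm (\<phi>' x - g0 x)))"
    using k by (simp add: ennreal_mult distrib_left ac_simps)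
  finally show ?thesis .
qed

lemma trace_exists: "\<exists>g\<in>H1_interface \<E>. is_trace \<Omega> \<E> v g"
  using v by (simp add: V_space_def)

text \<open>The constant 6 is 3 from \<open>double_integral_split\<close> times 2 from replacing the
  gradient of the test function by that of \<open>v\<close> in the energy.\<close>

lemma v_double_estimate:
  assumes N: "N \<in> nodes \<T>" and T: "T \<in> \<T>" "N \<in> T" "T' \<in> \<T>" "N \<in> T'"
  shows "dbl v0 T' T \<le> ennreal (6 * C1 * H ^ 4) * energy g0 N 1"
proof -
  note [measurable] = v0(1) g0(1)
  have [measurable]: "T \<in> sets borel" "T' \<in> sets borel" using T borel_mem by auto
  obtain g where g: "is_trace \<Omega> \<E> v g" using trace_exists by blast
  obtain \<phi> \<phi>' where \<phi>: "\<And>n::nat. \<phi> n \<in> test_functions \<Omega>" "\<And>n x. GDERIV (\<phi> n) x :> \<phi>' n x" "\<And>n. continuous_on UNIV (\<phi>' n)"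
    and q: "(\<lambda>n. sq_int lborel \<Omega> (\<lambda>x. \<phi> n x - v0 x)) \<longlonglongrightarrow> 0" (is "?q \<longlonglongrightarrow> 0")
    and r: "(\<lambda>n. sq_int lborel \<Omega> (\<lambda>x. norm (\<phi>' n x - g0 x))) \<longlonglongrightarrow> 0" (is "?r \<longlonglongrightarrow> 0")
    by (rule approximation[OF g]) (rule that)
  have \<phi>m[measurable]: "\<phi> n \<in> borel_measurable borel" for n using test_functions_continuous[OF \<phi>(1)] by (rule borel_measurable_continuous_onI)
  show ?thesis
  proof (rule le_of_tendsto_ennreal[OF _ q r])
    fix n
    have qT: "(sq_int lborel S (\<lambda>x. \<phi> n x - v0 x)) \<le> ?q n" if "S \<in> \<T>" for S
      by (rule tri_sub_nn_integral[OF that]) measurable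
    have "dbl v0 T' T = (\<integral>\<^sup>+z\<in>T'. (sq_int lborel T (\<lambda>x. v0 x - v0 z)) \<partial>lborel)"
      unfolding dbl_def by (simp add: power2_commute)
    also have "\<dots> \<le> 3 * (\<integral>\<^sup>+z\<in>T'. (sq_int lborel T (\<lambda>x. \<phi> n x - \<phi> n z)) \<partial>lborel)
      + 3 * emeasure lborel T' * (sq_int lborel T (\<lambda>x. \<phi> n x - v0 x))
      + 3 * emeasure lborel T * (sq_int lborel T' (\<lambda>z. \<phi> n z - v0 z))"
      by (rule double_integral_split[OF sigma_finite_lborel]) measurable
    also have "(\<integral>\<^sup>+z\<in>T'. (sq_int lborel T (\<lambda>x. \<phi> n x - \<phi> n z)) \<partial>lborel) = dbl (\<phi> n) T' T"
      unfolding dbl_def by (simp add: power2_commute)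
    also have "3 * dbl (\<phi> n) T' T + 3 * emeasure lborel T' * (sq_int lborel T (\<lambda>x. \<phi> n x - v0 x))
      + 3 * emeasure lborel T * (sq_int lborel T' (\<lambda>z. \<phi> n z - v0 z)) \<le>
      3 * (ennreal (C1 * H ^ 4) * energy (\<phi>' n) N 1) + 3 * ennreal (4 * H\<^sup>2) * ?q n + 3 * ennreal (4 * H\<^sup>2) * ?q n"
      using T by (intro add_mono mult_mono mult_left_mono test_dbl[OF N T \<phi>(1,2)] emeasure_tri_le qT) auto
    also have "3 * (ennreal (C1 * H ^ 4) * energy (\<phi>' n) N 1) = ennreal (3 * (C1 * H ^ 4)) * energy (\<phi>' n) N 1"
      using const_pos by (simp add: ennreal_mult mult.assoc)
    also have "\<dots> \<le> ennreal (2 * (3 * (C1 * H ^ 4))) * energy g0 N 1 + ennreal (2 * (3 * (C1 * H ^ 4))) * ?r n"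
      using const_pos by (intro const_energy_le \<phi>(3)) simp
    finally show "dbl v0 T' T \<le> ennreal (6 * C1 * H ^ 4) * energy g0 N 1 + (3 * ennreal (4 * H\<^sup>2) + 3 * ennreal (4 * H\<^sup>2)) * ?q n + ennreal (2 * (3 * (C1 * H ^ 4))) * ?r n"
      by (simp add: ac_simps distrib_right distrib_left)
  qed (auto simp: ennreal_mult_less_top)
qed

lemma v_friedrichs:
  assumes N: "N \<in> nodes \<T>" "N \<in> frontier \<Omega>" and T: "T \<in> \<T>" "N \<in> T"
  shows "(sq_int lborel T (\<lambda>z. v0 z)) \<le> ennreal (4 * C2 * H\<^sup>2) * energy g0 N 1"
proof -
  note [measurable] = v0(1) g0(1)
  have [measurable]: "T \<in> sets borel" using T borel_mem by auto
  obtain g where g: "is_trace \<Omega> \<E> v g" using trace_exists by blast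
  obtain \<phi> \<phi>' where \<phi>: "\<And>n::nat. \<phi> n \<in> test_functions \<Omega>" "\<And>n x. GDERIV (\<phi> n) x :> \<phi>' n x" "\<And>n. continuous_on UNIV (\<phi>' n)"
    and q: "(\<lambda>n. sq_int lborel \<Omega> (\<lambda>x. \<phi> n x - v0 x)) \<longlonglongrightarrow> 0" (is "?q \<longlonglongrightarrow> 0")
    and r: "(\<lambda>n. sq_int lborel \<Omega> (\<lambda>x. norm (\<phi>' n x - g0 x))) \<longlonglongrightarrow> 0" (is "?r \<longlonglongrightarrow> 0")
    by (rule approximation[OF g]) (rule that)
  have \<phi>m[measurable]: "\<phi> n \<in> borel_measurable borel" for n using test_functions_continuous[OF \<phi>(1)] by (rule borel_measurable_continuous_onI)
  show ?thesis
  proof (rule le_of_tendsto_ennreal[OF _ q r])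
    fix n
    have qT: "(sq_int lborel T (\<lambda>x. \<phi> n x - v0 x)) \<le> ?q n"
      by (rule tri_sub_nn_integral[OF T(1)]) measurable
    have "(sq_int lborel T (\<lambda>z. v0 z)) = (sq_int lborel T (\<lambda>z. 0 - v0 z))" by simp
    also have "\<dots> \<le> 2 * (sq_int lborel T (\<lambda>z. 0 - \<phi> n z)) + 2 * (sq_int lborel T (\<lambda>z. \<phi> n z - v0 z))"
      by (rule nn_integral_sq_triangle) measurable
    also have "\<dots> \<le> 2 * (ennreal (C2 * H\<^sup>2) * energy (\<phi>' n) N 1) + 2 * ?q n"
      using test_friedrichs[OF N T \<phi>(1,2), of 1] qT by (intro add_mono mult_left_mono) auto
    also have "2 * (ennreal (C2 * H\<^sup>2) * energy (\<phi>' n) N 1) = ennreal (2 * (C2 * H\<^sup>2)) * energy (\<phi>' n) N 1"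
      using const_pos by (simp add: ennreal_mult mult.assoc)
    also have "\<dots> \<le> ennreal (2 * (2 * (C2 * H\<^sup>2))) * energy g0 N 1 + ennreal (2 * (2 * (C2 * H\<^sup>2))) * ?r n"
      using const_pos by (intro const_energy_le \<phi>(3)) simp
    finally show "(sq_int lborel T (\<lambda>z. v0 z)) \<le> ennreal (4 * C2 * H\<^sup>2) * energy g0 N 1 + 2 * ?q n + ennreal (2 * (2 * (C2 * H\<^sup>2))) * ?r n"
      by (simp add: ac_simps)
  qed auto
qed

lemma edge_repr:
  assumes "E \<in> \<E>"
  obtains a b where "E = closed_segment a b" "a \<noteq> b" "a \<in> nodes \<T>" "b \<in> nodes \<T>" "\<rho> \<le> diameter E" "diameter E \<le> H"
  using edge_segment[OF edges_\<E>[OF assms]] that by (metis diameter_segment)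

lemma diameter_pos: "E \<in> \<E> \<Longrightarrow> diameter E > 0"
  using edge_repr params by (metis less_le_trans)

lemma arc_in: "E \<in> \<E> \<Longrightarrow> t \<in> {0..diameter E} \<Longrightarrow> arc_param E t \<in> E"
  using edge_repr arc_param_image(1) by (metis image_eqI)

lemma arc_edge_le:
  assumes E: "E \<in> \<E>" "E \<subseteq> A" "A \<in> sets borel" and F[measurable]: "F \<in> borel_measurable borel"
  shows "(\<integral>\<^sup>+t\<in>{0..diameter E}. F (arc_param E t) \<partial>lborel) \<le> (\<integral>\<^sup>+x\<in>A. F x \<partial>arc_length \<E>)"
proof -
  note [measurable] = E(3)
  have "(\<integral>\<^sup>+t\<in>{0..diameter E}. F (arc_param E t) \<partial>lborel) = (\<integral>\<^sup>+t\<in>{0..diameter E}. F (arc_param E t) * indicator A (arc_param E t) \<partial>lborel)"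
  proof (rule nn_integral_cong)
    fix t show "F (arc_param E t) * indicator {0..diameter E} t = F (arc_param E t) * indicator A (arc_param E t) * indicator {0..diameter E} t"
      using arc_in[OF E(1), of t] E(2) by (cases "t \<in> {0..diameter E}") (auto simp: subset_iff)
  qed
  also have "\<dots> \<le> (\<Sum>E\<in>\<E>. \<integral>\<^sup>+t\<in>{0..diameter E}. F (arc_param E t) * indicator A (arc_param E t) \<partial>lborel)"
    by (rule member_le_sum[OF E(1) _ finite_\<E>]) simp
  also have "\<dots> = (\<integral>\<^sup>+x\<in>A. F x \<partial>arc_length \<E>)"
    by (rule nn_integral_arc_length[OF finite_\<E>, symmetric]) measurable
  finally show ?thesis .
qed

lemma arc_le:
  assumes E: "E \<in> \<E>" "E = closed_segment a b" "a \<noteq> b" and F: "F \<in> borel_measurable borel"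
  shows "(\<integral>\<^sup>+t\<in>{0..1}. F (a + t *\<^sub>R (b - a)) \<partial>lborel) \<le> ennreal (1 / dist a b) * (\<integral>\<^sup>+x\<in>\<Gamma>. F x \<partial>arc_length \<E>)"
  using arc_edge_le[OF E(1) \<E>_subset[OF E(1)] borel_interface F] E(3) unfolding arc_integral[OF E(2,3) F]
  by (intro ennreal_mult_le_divide) auto

end

section \<open>Uniqueness of the trace and its behaviour at nodes\<close>

context mesh_function
begin

lemma is_trace_cong:
  assumes "is_trace \<Omega> \<E> v g" "\<And>x. x \<in> \<Gamma> \<Longrightarrow> g x = h x"
  shows "is_trace \<Omega> \<E> v h"
proof -
  have eq: "g x = h x" if "x \<in> \<Union>\<E>" for x using assms(2) that interface by metis
  have "(\<lambda>x. indicator (\<Union>\<E>) x *\<^sub>R F x (g x)) = (\<lambda>x. indicator (\<Union>\<E>) x *\<^sub>R F x (h x))" for F :: "pt \<Rightarrow> real \<Rightarrow> real"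
  proof (rule ext)
    fix x show "indicator (\<Union>\<E>) x *\<^sub>R F x (g x) = indicator (\<Union>\<E>) x *\<^sub>R F x (h x)"
    proof (cases "x \<in> \<Union>\<E>")
      case False
      then have "indicator (\<Union>\<E>) x = (0::real)" by (rule indicator_simps(2))
      then show ?thesis by (simp only: scaleR_zero_left)
    qed (simp only: eq)
  qed
  from this[of "\<lambda>x y. y"] this[of "\<lambda>x y. (norm y)\<^sup>2"] this[of "\<lambda>x y. (norm (\<phi> x - y))\<^sup>2" for \<phi> :: "pt \<Rightarrow> real"]
  show ?thesis
    using assms(1) unfolding is_trace_def L2_def L2_norm_def set_borel_measurable_def set_integrable_def set_lebesgue_integral_def
    by simp
qed

lemma trace_borel:
  assumes "is_trace \<Omega> \<E> v g"
  shows "is_trace \<Omega> \<E> v (\<lambda>x. indicator \<Gamma> x * g x)" "(\<lambda>x. indicator \<Gamma> x * g x) \<in> borel_measurable borel"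
proof -
  show "is_trace \<Omega> \<E> v (\<lambda>x. indicator \<Gamma> x * g x)" by (rule is_trace_cong[OF assms]) simp
  have "set_borel_measurable (arc_length \<E>) (\<Union>\<E>) g" using assms by (simp add: is_trace_def L2_def)
  then show "(\<lambda>x. indicator \<Gamma> x * g x) \<in> borel_measurable borel"
    using interface by (simp add: set_borel_measurable_def)
qed

text \<open>Each trace has its own approximating sequence. The differences of the two sequences tend
  to zero in H1 on an element that contains the edge, so by the trace inequality also on the edge.
  This allows \<open>trace_on\<close>, an arbitrary choice, to be exchanged for the continuous
  trace.\<close>

lemma trace_unique:
  assumes g: "is_trace \<Omega> \<E> v g" "g \<in> borel_measurable borel" and h: "is_trace \<Omega> \<E> v h" "h \<in> borel_measurable borel"
    and E: "E \<in> \<E>" "E = closed_segment a b" "a \<noteq> b"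
  shows "(sq_int lborel {0..1} (\<lambda>t. g (a + t *\<^sub>R (b - a)) - h (a + t *\<^sub>R (b - a)))) = 0"
proof -
  note [measurable] = v0(1) g0(1) g(2) h(2)
  obtain T where T: "T \<in> \<T>" "closed_segment a b edge_of T" using edges_\<E>[OF E(1)] E(2) by (auto simp: edges_def)
  have [measurable]: "T \<in> sets borel" using T borel_mem by auto
  obtain \<phi> \<phi>' where \<phi>: "\<And>n::nat. \<phi> n \<in> test_functions \<Omega>" "\<And>n x. GDERIV (\<phi> n) x :> \<phi>' n x" "\<And>n. continuous_on UNIV (\<phi>' n)"
    and q1: "(\<lambda>n. sq_int lborel \<Omega> (\<lambda>x. \<phi> n x - v0 x)) \<longlonglongrightarrow> 0" (is "?q1 \<longlonglongrightarrow> 0")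
    and r1: "(\<lambda>n. sq_int lborel \<Omega> (\<lambda>x. norm (\<phi>' n x - g0 x))) \<longlonglongrightarrow> 0" (is "?r1 \<longlonglongrightarrow> 0")
    and s1: "(\<lambda>n. sq_int (arc_length \<E>) \<Gamma> (\<lambda>x. \<phi> n x - g x)) \<longlonglongrightarrow> 0" (is "?s1 \<longlonglongrightarrow> 0")
    by (rule approximation[OF g(1)]) (rule that)
  obtain \<psi> \<psi>' where \<psi>: "\<And>n::nat. \<psi> n \<in> test_functions \<Omega>" "\<And>n x. GDERIV (\<psi> n) x :> \<psi>' n x" "\<And>n. continuous_on UNIV (\<psi>' n)"
    and q2: "(\<lambda>n. sq_int lborel \<Omega> (\<lambda>x. \<psi> n x - v0 x)) \<longlonglongrightarrow> 0" (is "?q2 \<longlonglongrightarrow> 0")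
    and r2: "(\<lambda>n. sq_int lborel \<Omega> (\<lambda>x. norm (\<psi>' n x - g0 x))) \<longlonglongrightarrow> 0" (is "?r2 \<longlonglongrightarrow> 0")
    and s2: "(\<lambda>n. sq_int (arc_length \<E>) \<Gamma> (\<lambda>x. \<psi> n x - h x)) \<longlonglongrightarrow> 0" (is "?s2 \<longlonglongrightarrow> 0")
    by (rule approximation[OF h(1)]) (rule that)
  have [measurable]: "\<phi> n \<in> borel_measurable borel" "\<psi> n \<in> borel_measurable borel" "\<phi>' n \<in> borel_measurable borel" "\<psi>' n \<in> borel_measurable borel" for n
    using test_functions_continuous[OF \<phi>(1)] test_functions_continuous[OF \<psi>(1)] \<phi>(3) \<psi>(3) by (auto intro: borel_measurable_continuous_onI)
  let ?e = "\<lambda>t. a + t *\<^sub>R (b - a)" and ?k = "ennreal (1 / dist a b)"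
  have [measurable]: "?e \<in> borel_measurable borel" by (intro borel_measurable_continuous_onI continuous_intros)
  let ?X = "\<integral>\<^sup>+t\<in>{0..1}. ennreal ((g (?e t) - h (?e t))\<^sup>2) \<partial>lborel"
  have "?X \<le> 0"
  proof (rule le_of_tendsto_ennreal)
    show "(\<lambda>n. ?s1 n + ?s2 n) \<longlonglongrightarrow> 0" using tendsto_add[OF s1 s2] by simp
    show "(\<lambda>n. ?r1 n + ?r2 n + (?q1 n + ?q2 n)) \<longlonglongrightarrow> 0" using tendsto_add[OF tendsto_add[OF r1 r2] tendsto_add[OF q1 q2]] by simp
    fix n
    have A: "(sq_int lborel {0..1} (\<lambda>t. g (?e t) - \<phi> n (?e t))) \<le> ?k * ?s1 n"
      using arc_le[OF E, of "\<lambda>x. ennreal ((\<phi> n x - g x)\<^sup>2)"] by (simp add: power2_commute)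
    have B: "(sq_int lborel {0..1} (\<lambda>t. \<psi> n (?e t) - h (?e t))) \<le> ?k * ?s2 n"
      by (rule arc_le[OF E]) measurable
    have C: "(sq_int lborel {0..1} (\<lambda>t. \<phi> n (?e t) - \<psi> n (?e t))) \<le>
      ennreal (2 / \<rho>\<^sup>2) * (ennreal (H\<^sup>2) * (2 * ?r1 n + 2 * ?r2 n) + 4 * (2 * ?q1 n + 2 * ?q2 n))"
    proof -
      have "(sq_int lborel {0..1} (\<lambda>t. \<phi> n (?e t) - \<psi> n (?e t))) \<le>
        ennreal (2 / \<rho>\<^sup>2) * (ennreal (H\<^sup>2) * (sq_int lborel T (\<lambda>z. norm (\<phi>' n z - \<psi>' n z))) + 4 * (sq_int lborel T (\<lambda>z. \<phi> n z - \<psi> n z)))"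
        using trace_edge[OF T, of "\<lambda>z. \<phi> n z - \<psi> n z" "\<lambda>z. \<phi>' n z - \<psi>' n z" 0]
          GDERIV_diff[OF \<phi>(2) \<psi>(2)] continuous_on_diff[OF \<phi>(3) \<psi>(3)] continuous_on_subset by (simp add: continuous_on_subset[of UNIV])
      also have "\<dots> \<le> ennreal (2 / \<rho>\<^sup>2) * (ennreal (H\<^sup>2) * (2 * ?r1 n + 2 * ?r2 n) + 4 * (2 * ?q1 n + 2 * ?q2 n))"
      proof (intro mult_left_mono add_mono)
        \<comment> \<open>The intermediate function is \<open>g0 - \<psi>'\<close>, so that the
          first summand collapses to the distance of \<open>\<phi>'\<close> from
          \<open>g0\<close>.\<close>
        have "(sq_int lborel T (\<lambda>z. norm (\<phi>' n z - \<psi>' n z))) \<le>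
          2 * (sq_int lborel T (\<lambda>z. norm (\<phi>' n z - \<psi>' n z - (g0 z - \<psi>' n z)))) + 2 * (sq_int lborel T (\<lambda>z. norm (g0 z - \<psi>' n z)))"
          by (rule nn_integral_norm_sq_le) measurable
        also have "\<dots> = 2 * (sq_int lborel T (\<lambda>z. norm (\<phi>' n z - g0 z))) + 2 * (sq_int lborel T (\<lambda>z. norm (\<psi>' n z - g0 z)))"
          by (simp add: norm_minus_commute)
        also have "\<dots> \<le> 2 * ?r1 n + 2 * ?r2 n"
          by (intro add_mono mult_left_mono tri_sub_nn_integral T) auto
        finally show "(sq_int lborel T (\<lambda>z. norm (\<phi>' n z - \<psi>' n z))) \<le> 2 * ?r1 n + 2 * ?r2 n" .
        have "(sq_int lborel T (\<lambda>z. \<phi> n z - \<psi> n z)) \<le>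
          2 * (sq_int lborel T (\<lambda>z. \<phi> n z - v0 z)) + 2 * (sq_int lborel T (\<lambda>z. v0 z - \<psi> n z))"
          by (rule nn_integral_sq_triangle) measurable
        also have "\<dots> = 2 * (sq_int lborel T (\<lambda>z. \<phi> n z - v0 z)) + 2 * (sq_int lborel T (\<lambda>z. \<psi> n z - v0 z))"
          by (simp add: power2_commute)
        also have "\<dots> \<le> 2 * ?q1 n + 2 * ?q2 n"
          by (intro add_mono mult_left_mono tri_sub_nn_integral T) auto
        finally show "(sq_int lborel T (\<lambda>z. \<phi> n z - \<psi> n z)) \<le> 2 * ?q1 n + 2 * ?q2 n" .
      qed auto
      finally show ?thesis .
    qed
    have "?X \<le> 2 * (sq_int lborel {0..1} (\<lambda>t. g (?e t) - \<phi> n (?e t))) + 2 * (sq_int lborel {0..1} (\<lambda>t. \<phi> n (?e t) - h (?e t)))"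
      by (rule nn_integral_sq_triangle) measurable
    also have "\<dots> \<le> 2 * (?k * ?s1 n) + 2 * (2 * (sq_int lborel {0..1} (\<lambda>t. \<phi> n (?e t) - \<psi> n (?e t))) + 2 * (sq_int lborel {0..1} (\<lambda>t. \<psi> n (?e t) - h (?e t))))"
      by (intro add_mono mult_left_mono A nn_integral_sq_triangle) auto
    also have "\<dots> \<le> 2 * (?k * ?s1 n) + 2 * (2 * (ennreal (2 / \<rho>\<^sup>2) * (ennreal (H\<^sup>2) * (2 * ?r1 n + 2 * ?r2 n) + 4 * (2 * ?q1 n + 2 * ?q2 n))) + 2 * (?k * ?s2 n))"
      by (intro add_mono mult_left_mono B C order_refl) auto
    also have "\<dots> \<le> 0 + (4 * ?k) * (?s1 n + ?s2 n) + (8 * ennreal (2 / \<rho>\<^sup>2) * (ennreal (H\<^sup>2) + 4)) * (?r1 n + ?r2 n + (?q1 n + ?q2 n))"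
    proof -
      have *: "2 * (k * s1) + 2 * (2 * (d * (e * (2 * x + 2 * y) + 4 * (2 * z + 2 * w))) + 2 * (k * s2)) \<le> 0 + (4 * k) * (s1 + s2) + (8 * d * (e + 4)) * (x + y + (z + w))"
        for k s1 s2 d e x y z w :: ennreal
      proof -
        have "2 * (k * s1) \<le> 4 * (k * s1)" by (intro mult_right_mono) auto
        moreover have "2 * (2 * (k * s2)) = 4 * (k * s2)" by (simp flip: mult.assoc)
        moreover have "2 * (2 * (d * (e * (2 * x + 2 * y) + 4 * (2 * z + 2 * w)))) = 8 * d * (e * (x + y) + 4 * (z + w))"
          by (simp add: distrib_left ac_simps)
        moreover have "8 * d * (e * (x + y) + 4 * (z + w)) \<le> 8 * d * ((e + 4) * (x + y + (z + w)))"
        proof (rule mult_left_mono)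
          have "e * (x + y) + 4 * (z + w) \<le> (e + 4) * (x + y) + (e + 4) * (z + w)" by (intro add_mono mult_right_mono) (auto simp: add_increasing add_increasing2)
          then show "e * (x + y) + 4 * (z + w) \<le> (e + 4) * (x + y + (z + w))" by (simp add: distrib_left)
        qed simp
        ultimately have "2 * (k * s1) + (2 * (2 * (d * (e * (2 * x + 2 * y) + 4 * (2 * z + 2 * w)))) + 2 * (2 * (k * s2))) \<le> 4 * (k * s1) + (8 * d * ((e + 4) * (x + y + (z + w))) + 4 * (k * s2))"
          by (simp add: add_mono)
        then show ?thesis by (simp add: distrib_left ac_simps)
      qed
      show ?thesis by (rule *)
    qed
    finally show "?X \<le> 0 + (4 * ?k) * (?s1 n + ?s2 n) + (8 * ennreal (2 / \<rho>\<^sup>2) * (ennreal (H\<^sup>2) + 4)) * (?r1 n + ?r2 n + (?q1 n + ?q2 n))" .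
  qed (auto simp: ennreal_mult_less_top)
  then show ?thesis by simp
qed

lemma v_trace_estimate:
  assumes g: "is_trace \<Omega> \<E> v g" "g \<in> borel_measurable borel" and E: "E \<in> \<E>" "E = closed_segment a b" "a \<noteq> b"
    and N: "N \<in> nodes \<T>" "N \<in> E" and T: "T \<in> \<T>" "N \<in> T"
  shows "(\<integral>\<^sup>+z\<in>T. (sq_int lborel {0..1} (\<lambda>t. g (a + t *\<^sub>R (b - a)) - v0 z)) \<partial>lborel) \<le> ennreal (6 * C2 * H\<^sup>2) * energy g0 N 1"
proof -
  note [measurable] = v0(1) g0(1) g(2)
  obtain T' where T': "T' \<in> \<T>" "closed_segment a b edge_of T'" using edges_\<E>[OF E(1)] E(2) by (auto simp: edges_def)
  have NT': "N \<in> T'" using N(2) T'(2) edge_of_imp_subset E(2) by blast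
  have [measurable]: "T \<in> sets borel" using T borel_mem by auto
  obtain \<phi> \<phi>' where \<phi>: "\<And>n::nat. \<phi> n \<in> test_functions \<Omega>" "\<And>n x. GDERIV (\<phi> n) x :> \<phi>' n x" "\<And>n. continuous_on UNIV (\<phi>' n)"
    and q: "(\<lambda>n. sq_int lborel \<Omega> (\<lambda>x. \<phi> n x - v0 x)) \<longlonglongrightarrow> 0" (is "?q \<longlonglongrightarrow> 0")
    and r: "(\<lambda>n. sq_int lborel \<Omega> (\<lambda>x. norm (\<phi>' n x - g0 x))) \<longlonglongrightarrow> 0" (is "?r \<longlonglongrightarrow> 0")
    and s: "(\<lambda>n. sq_int (arc_length \<E>) \<Gamma> (\<lambda>x. \<phi> n x - g x)) \<longlonglongrightarrow> 0" (is "?s \<longlonglongrightarrow> 0")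
    by (rule approximation[OF g(1)]) (rule that)
  have [measurable]: "\<phi> n \<in> borel_measurable borel" for n using test_functions_continuous[OF \<phi>(1)] by (rule borel_measurable_continuous_onI)
  let ?e = "\<lambda>t. a + t *\<^sub>R (b - a)" and ?k = "ennreal (1 / dist a b)"
  have [measurable]: "?e \<in> borel_measurable borel" by (intro borel_measurable_continuous_onI continuous_intros)
  have qs: "(\<lambda>n. ?q n + ?s n) \<longlonglongrightarrow> 0" using tendsto_add[OF q s] by simp
  show ?thesis
  proof (rule le_of_tendsto_ennreal[OF _ qs r])
    fix n
    have qT: "(sq_int lborel T (\<lambda>x. \<phi> n x - v0 x)) \<le> ?q n"
      by (rule tri_sub_nn_integral[OF T(1)]) measurable
    have sE: "(sq_int lborel {0..1} (\<lambda>t. \<phi> n (?e t) - g (?e t))) \<le> ?k * ?s n"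
      by (rule arc_le[OF E]) measurable
    have "(\<integral>\<^sup>+z\<in>T. (sq_int lborel {0..1} (\<lambda>t. g (?e t) - v0 z)) \<partial>lborel) \<le>
      3 * (\<integral>\<^sup>+z\<in>T. (sq_int lborel {0..1} (\<lambda>t. \<phi> n (?e t) - \<phi> n z)) \<partial>lborel)
      + 3 * emeasure lborel T * (sq_int lborel {0..1} (\<lambda>t. \<phi> n (?e t) - g (?e t)))
      + 3 * emeasure lborel {0..1::real} * (sq_int lborel T (\<lambda>z. \<phi> n z - v0 z))"
      by (rule double_integral_split[OF sigma_finite_lborel]) measurable
    also have "\<dots> \<le> 3 * (ennreal (C2 * H\<^sup>2) * energy (\<phi>' n) N 1) + 3 * ennreal (4 * H\<^sup>2) * (?k * ?s n) + 3 * 1 * ?q n"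
      using test_trace[OF N(1) T T'(1) NT' T'(2) \<phi>(1,2), of 1] T
      by (intro add_mono mult_mono mult_left_mono sE qT emeasure_tri_le) auto
    also have "3 * (ennreal (C2 * H\<^sup>2) * energy (\<phi>' n) N 1) = ennreal (3 * (C2 * H\<^sup>2)) * energy (\<phi>' n) N 1"
      using const_pos by (simp add: ennreal_mult mult.assoc)
    also have "\<dots> \<le> ennreal (2 * (3 * (C2 * H\<^sup>2))) * energy g0 N 1 + ennreal (2 * (3 * (C2 * H\<^sup>2))) * ?r n"
      using const_pos by (intro const_energy_le \<phi>(3)) simp
    finally have "(\<integral>\<^sup>+z\<in>T. (sq_int lborel {0..1} (\<lambda>t. g (?e t) - v0 z)) \<partial>lborel) \<le>
      ennreal (2 * (3 * (C2 * H\<^sup>2))) * energy g0 N 1 + ennreal (2 * (3 * (C2 * H\<^sup>2))) * ?r n + 3 * ennreal (4 * H\<^sup>2) * (?k * ?s n) + 3 * 1 * ?q n" by simp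
    also have "\<dots> \<le> ennreal (2 * (3 * (C2 * H\<^sup>2))) * energy g0 N 1 + ennreal (2 * (3 * (C2 * H\<^sup>2))) * ?r n + (3 * ennreal (4 * H\<^sup>2) * ?k + 3) * ?s n + (3 * ennreal (4 * H\<^sup>2) * ?k + 3) * ?q n"
      by (intro add_mono order_refl) (auto simp: distrib_right mult.assoc add_increasing add_increasing2)
    finally show "(\<integral>\<^sup>+z\<in>T. (sq_int lborel {0..1} (\<lambda>t. g (?e t) - v0 z)) \<partial>lborel) \<le>
      ennreal (6 * C2 * H\<^sup>2) * energy g0 N 1 + (3 * ennreal (4 * H\<^sup>2) * ?k + 3) * (?q n + ?s n) + ennreal (2 * (3 * (C2 * H\<^sup>2))) * ?r n"
      by (simp add: distrib_left ac_simps)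
  qed (auto simp: ennreal_mult_less_top)
qed

text \<open>The balls shrink to the single point \<open>N\<close>, a null set, and the energy
  density on the whole star is an integrable majorant.\<close>

lemma energy_tendsto_0: "(\<lambda>k. energy g0 N (1 / real (Suc k))) \<longlonglongrightarrow> 0"
proof -
  note [measurable] = g0(1)
  have [measurable]: "star N \<in> sets borel" "star N \<inter> cball N c \<in> sets borel" for c using closed_star by auto
  let ?G = "\<lambda>z. ennreal ((norm (g0 z))\<^sup>2)"
  let ?u = "\<lambda>k z. ?G z * indicator (star N \<inter> cball N (1 / real (Suc k) * H)) z"
  have fin: "(\<integral>\<^sup>+z. ?G z * indicator (star N) z \<partial>lborel) < \<infinity>"
  proof -
    have "(\<integral>\<^sup>+z. ?G z * indicator (star N) z \<partial>lborel) \<le> (\<integral>\<^sup>+z\<in>\<Omega>. ?G z \<partial>lborel)"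
      using star_sub_nn_integral[of ?G N UNIV] by simp
    also have "\<dots> = (sq_int lebesgue \<Omega> (\<lambda>z. norm (grad \<Omega> v z)))"
      unfolding nn_integral_completion[of lborel, symmetric]
      using g0(2) by (intro nn_integral_cong_AE) (auto elim!: eventually_mono simp: indicator_def)
    also have "\<dots> < \<infinity>" by (simp add: nn_integral_L2[OF grad_v(1)])
    finally show ?thesis .
  qed
  have "(\<lambda>k. \<integral>\<^sup>+z. ?u k z \<partial>lborel) \<longlonglongrightarrow> (\<integral>\<^sup>+z. 0 \<partial>(lborel :: pt measure))"
  proof (rule nn_integral_dominated_convergence[where w = "\<lambda>z. ?G z * indicator (star N) z"])
    show "AE z in lborel. (\<lambda>k. ?u k z) \<longlonglongrightarrow> 0"
    proof -
      have "AE z in lborel. z \<noteq> N" by (rule AE_lborel_singleton)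
      then show ?thesis
      proof eventually_elim
        case (elim z)
        have "(\<lambda>k. 1 / real (Suc k) * H) \<longlonglongrightarrow> 0 * H"
          using LIMSEQ_inverse_real_of_nat by (intro tendsto_mult tendsto_const) (simp add: inverse_eq_divide)
        then have "eventually (\<lambda>k. 1 / real (Suc k) * H < dist N z) sequentially"
          using elim by (intro order_tendstoD(2)) auto
        then have "eventually (\<lambda>k. ?u k z = 0) sequentially"
          by eventually_elim (auto simp: indicator_def)
        then show ?case by (rule tendsto_eventually)
      qed
    qed
    show "AE z in lborel. ?u k z \<le> ?G z * indicator (star N) z" for k by (intro AE_I2) (auto simp: indicator_def)
  qed (use fin in auto)
  then show ?thesis by (simp add: energy_def)
qed

text \<open>The mean square of the trace over the piece of the edge next to \<open>N\<close> of
  relative length \<open>s\<close> is bounded by the energy at scale \<open>s\<close>, with a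
  constant free of \<open>s\<close>. That energy tends to zero, while continuity would keep |g|
  above |g N| / 2 near \<open>N\<close>.\<close>

lemma v_trace_zero:
  assumes g: "is_trace \<Omega> \<E> v g" "g \<in> borel_measurable borel" "continuous_on \<Gamma> g"
    and N: "N \<in> nodes \<T>" "N \<in> frontier \<Omega>" and E: "E \<in> \<E>" "N \<in> E"
  shows "g N = 0"
proof (rule ccontr)
  assume gN: "g N \<noteq> 0"
  note [measurable] = v0(1) g0(1) g(2)
  obtain M where M: "E = closed_segment N M" "N \<noteq> M" using node_edge_endpoint[OF edges_\<E>[OF E(1)] N(1) E(2)] by metis
  obtain \<phi> \<phi>' where \<phi>: "\<And>n::nat. \<phi> n \<in> test_functions \<Omega>" "\<And>n x. GDERIV (\<phi> n) x :> \<phi>' n x" "\<And>n. continuous_on UNIV (\<phi>' n)"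
    and r: "(\<lambda>n. sq_int lborel \<Omega> (\<lambda>x. norm (\<phi>' n x - g0 x))) \<longlonglongrightarrow> 0" (is "?r \<longlonglongrightarrow> 0")
    and s: "(\<lambda>n. sq_int (arc_length \<E>) \<Gamma> (\<lambda>x. \<phi> n x - g x)) \<longlonglongrightarrow> 0" (is "?s \<longlonglongrightarrow> 0")
    by (rule approximation[OF g(1)]) (rule that)
  have [measurable]: "\<phi> n \<in> borel_measurable borel" for n using test_functions_continuous[OF \<phi>(1)] by (rule borel_measurable_continuous_onI)
  let ?X = "\<lambda>s. \<integral>\<^sup>+t\<in>{0..1}. ennreal ((g (N + (s * t) *\<^sub>R (M - N)))\<^sup>2) \<partial>lborel"
  have C3: "C3 \<ge> 0" using const_pos by (simp add: C3_def)
  \<comment> \<open>For fixed \<open>s\<close> the index \<open>n\<close> goes to infinity. The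
    factor 1 / s in front of the trace error does no harm, because \<open>s\<close> tends to zero
    only afterwards.\<close>
  have Xle: "?X s \<le> ennreal (4 * C3) * energy g0 N s" if s01: "0 < s" "s \<le> 1" for s
  proof (rule le_of_tendsto_ennreal[OF _ s r])
    fix n
    let ?e = "\<lambda>t. N + (s * t) *\<^sub>R (M - N)"
    have [measurable]: "?e \<in> borel_measurable borel" "(\<lambda>t. N + t *\<^sub>R (M - N)) \<in> borel_measurable borel"
      by (intro borel_measurable_continuous_onI continuous_intros)+
    have 1: "(sq_int lborel {0..1} (\<lambda>t. \<phi> n (?e t))) \<le> ennreal C3 * energy (\<phi>' n) N s"
      using test_trace_friedrichs[OF N edges_\<E>[OF E(1)] M(1) E(2) \<phi>(1,2) s01, of n] by simp
    have 2: "(sq_int lborel {0..1} (\<lambda>t. \<phi> n (?e t) - g (?e t))) \<le> ennreal (1 / s) * (ennreal (1 / dist N M) * ?s n)"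
    proof -
      let ?F = "\<lambda>t. ennreal ((\<phi> n (N + t *\<^sub>R (M - N)) - g (N + t *\<^sub>R (M - N)))\<^sup>2)"
      \<comment> \<open>The substitution covers only the initial piece of relative length
        \<open>s\<close>; the error there is bounded by the error on the whole edge.\<close>
      have "ennreal s * (\<integral>\<^sup>+t\<in>{0..1}. ?F (s * t) \<partial>lborel) \<le> ennreal s * (\<integral>\<^sup>+t. ?F (0 + s * t) * indicator {0..1} (0 + s * t) \<partial>lborel)"
        using s01 by (intro mult_left_mono nn_integral_mono) (auto simp: indicator_def mult_le_one)
      also have "\<dots> = (\<integral>\<^sup>+t\<in>{0..1}. ?F t \<partial>lborel)"
        using s01 by (subst nn_integral_real_affine[where c = s and t = 0]) auto
      also have "\<dots> \<le> ennreal (1 / dist N M) * ?s n" by (rule arc_le[OF E(1) M]) measurable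
      finally have "ennreal s * (\<integral>\<^sup>+t\<in>{0..1}. ?F (s * t) \<partial>lborel) \<le> ennreal 1 * (ennreal (1 / dist N M) * ?s n)" by simp
      then show ?thesis using s01 by (intro ennreal_mult_le_divide) auto
    qed
    have "?X s = (sq_int lborel {0..1} (\<lambda>t. 0 - g (?e t)))" by simp
    also have "\<dots> \<le> 2 * (sq_int lborel {0..1} (\<lambda>t. 0 - \<phi> n (?e t))) + 2 * (sq_int lborel {0..1} (\<lambda>t. \<phi> n (?e t) - g (?e t)))"
      by (rule nn_integral_sq_triangle) measurable
    also have "\<dots> \<le> 2 * (ennreal C3 * energy (\<phi>' n) N s) + 2 * (ennreal (1 / s) * (ennreal (1 / dist N M) * ?s n))"
      using 1 2 by (intro add_mono mult_left_mono) auto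
    also have "2 * (ennreal C3 * energy (\<phi>' n) N s) = ennreal (2 * C3) * energy (\<phi>' n) N s"
      using C3 by (simp add: ennreal_mult mult.assoc)
    also have "\<dots> \<le> ennreal (2 * (2 * C3)) * energy g0 N s + ennreal (2 * (2 * C3)) * ?r n"
      using C3 by (intro const_energy_le \<phi>(3)) simp
    finally show "?X s \<le> ennreal (4 * C3) * energy g0 N s + (2 * (ennreal (1 / s) * ennreal (1 / dist N M))) * ?s n + ennreal (2 * (2 * C3)) * ?r n"
      by (simp add: ac_simps)
  qed (auto simp: ennreal_mult_less_top)
  define \<delta> where "\<delta> = \<bar>g N\<bar> / 2"
  have \<delta>: "\<delta> > 0" using gN by (simp add: \<delta>_def)
  have N\<Gamma>: "N \<in> \<Gamma>" using E \<E>_subset by blast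
  obtain \<eta> where \<eta>: "\<eta> > 0" "\<And>x. x \<in> \<Gamma> \<Longrightarrow> dist x N < \<eta> \<Longrightarrow> dist (g x) (g N) < \<delta>"
    using g(3) N\<Gamma> \<delta> unfolding continuous_on_iff by metis
  have lower: "ennreal (\<delta>\<^sup>2) \<le> ?X s" if s01: "0 < s" "s \<le> 1" "s * dist N M < \<eta>" for s
  proof -
    have "\<delta>\<^sup>2 \<le> (g (N + (s * t) *\<^sub>R (M - N)))\<^sup>2" if t: "t \<in> {0..1}" for t
    proof -
      let ?x = "N + (s * t) *\<^sub>R (M - N)"
      have st: "0 \<le> s * t" "s * t \<le> s" using s01 t by (auto intro: mult_left_le)
      have "(1 - s * t) *\<^sub>R N + (s * t) *\<^sub>R M \<in> E" unfolding M(1) in_segment(1)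
        using st s01(2) order_trans[OF st(2) s01(2)] by (intro exI[of _ "s * t"]) auto
      then have x: "?x \<in> \<Gamma>" using \<E>_subset[OF E(1)] by (auto simp: algebra_simps)
      have "dist ?x N = s * t * dist N M" using st by (simp add: dist_norm norm_minus_commute)
      also have "\<dots> \<le> s * dist N M" using st by (intro mult_right_mono) auto
      finally have "dist (g ?x) (g N) < \<delta>" using x s01 \<eta> by auto
      then have "\<bar>g ?x - g N\<bar> < \<bar>g N\<bar> / 2" by (simp only: \<delta>_def dist_real_def)
      then have "\<delta> \<le> \<bar>g ?x\<bar>" unfolding \<delta>_def by linarith
      then show ?thesis using \<delta> by (metis abs_le_square_iff abs_of_pos)
    qed
    then have "(\<integral>\<^sup>+t. ennreal (\<delta>\<^sup>2) * indicator {0..1::real} t \<partial>lborel) \<le> ?X s"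
      by (intro nn_integral_mono) (auto simp: indicator_def intro!: ennreal_leI)
    then show ?thesis by (simp add: nn_integral_cmult)
  qed
  have "(\<lambda>k. 1 / real (Suc k) * dist N M) \<longlonglongrightarrow> 0 * dist N M"
    using LIMSEQ_inverse_real_of_nat by (intro tendsto_mult tendsto_const) (simp add: inverse_eq_divide)
  then have "eventually (\<lambda>k. 1 / real (Suc k) * dist N M < \<eta>) sequentially"
    using \<eta>(1) by (intro order_tendstoD(2)) auto
  then have ev: "eventually (\<lambda>k. ennreal (\<delta>\<^sup>2) \<le> ennreal (4 * C3) * energy g0 N (1 / real (Suc k))) sequentially"
  proof eventually_elim
    case (elim k)
    have k: "0 < 1 / real (Suc k)" "1 / real (Suc k) \<le> 1" by auto
    show ?case by (rule order_trans[OF lower[OF k elim] Xle[OF k]])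
  qed
  have "(\<lambda>k. ennreal (4 * C3) * energy g0 N (1 / real (Suc k))) \<longlonglongrightarrow> ennreal (4 * C3) * 0"
    by (intro ennreal_tendsto_cmult energy_tendsto_0) simp
  then have "ennreal (\<delta>\<^sup>2) \<le> ennreal (4 * C3) * 0"
    using ev by (rule tendsto_lowerbound) simp
  then show False using \<delta> by simp
qed

end

subsection \<open>Dual basis functions\<close>

text \<open>Gram-Schmidt for a form that is only semidefinite: the Gram matrix of all nodal
  functions on one domain may be singular, since functions of distant nodes vanish there. A new
  residual of length zero is orthogonal to everything by Cauchy-Schwarz and is skipped.\<close>

lemma gram_projection:
  fixes G :: "'i \<Rightarrow> 'i \<Rightarrow> real"
  assumes K: "finite K" and sym: "\<And>i j. G i j = G j i"
  defines "B \<equiv> \<lambda>c d. \<Sum>i\<in>K. \<Sum>j\<in>K. c i * d j * G i j"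
  assumes psd: "\<And>c. 0 \<le> B c c" and J: "J \<subseteq> K"
  shows "\<exists>d. (\<forall>i. i \<notin> J \<longrightarrow> d i = 0) \<and> (\<forall>i\<in>J. B (\<lambda>k. c k - d k) (\<lambda>k. if k = i then 1 else 0) = 0)"
proof -
  let ?e = "\<lambda>i k. if k = i then 1 else (0::real)"
  have Bsym: "B c d = B d c" for c d
    unfolding B_def by (subst sum.swap) (simp add: sym mult.commute mult.left_commute)
  have Blin: "B (\<lambda>k. c k - t * d k) f = B c f - t * B d f" for c d f t
    unfolding B_def by (simp add: left_diff_distrib sum_subtractf sum_distrib_left mult.assoc)
  have Brep: "B f d = (\<Sum>j\<in>K. d j * B f (?e j))" for d f
  proof -
    have "B f (?e j) = (\<Sum>i\<in>K. f i * G i j)" if "j \<in> K" for j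
    proof -
      have "B f (?e j) = (\<Sum>i\<in>K. \<Sum>k\<in>K. if k = j then f i * G i j else 0)"
        unfolding B_def by (intro sum.cong refl) simp
      then show ?thesis using that K by simp
    qed
    then have "(\<Sum>j\<in>K. d j * B f (?e j)) = (\<Sum>j\<in>K. \<Sum>i\<in>K. f i * d j * G i j)"
      by (simp add: sum_distrib_left ac_simps)
    also have "\<dots> = B f d" unfolding B_def by (rule sum.swap)
    finally show ?thesis ..
  qed
  have CS: "B c r = 0" if "B r r = 0" for c r
  proof (rule ccontr)
    assume ne: "B c r \<noteq> 0"
    \<comment> \<open>At this value the squared length of c - t r would be -1.\<close>
    define t where "t = (B c c + 1) / (2 * B c r)"
    have "B (\<lambda>k. c k - t * r k) (\<lambda>k. c k - t * r k) = B c c - 2 * t * B c r + t\<^sup>2 * B r r"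
      using Blin[of c t r "\<lambda>k. c k - t * r k"] Bsym[of c "\<lambda>k. c k - t * r k"] Bsym[of r "\<lambda>k. c k - t * r k"] Blin[of c t r c] Blin[of c t r r] Bsym[of r c]
      by (simp add: power2_eq_square algebra_simps)
    also have "\<dots> = -1" using ne that by (simp add: t_def field_simps)
    finally show False using psd[of "\<lambda>k. c k - t * r k"] by simp
  qed
  have "finite J" using J K finite_subset by blast
  then show ?thesis using J
  proof (induction J arbitrary: c)
    case empty
    show ?case by (intro exI[of _ "\<lambda>_. 0"]) simp
  next
    case (insert k J)
    have JK: "J \<subseteq> K" "k \<in> K" using insert.prems by auto
    obtain d where d: "\<forall>i. i \<notin> J \<longrightarrow> d i = 0" "\<forall>i\<in>J. B (\<lambda>l. c l - d l) (?e i) = 0" using insert.IH[OF JK(1), of c] by auto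
    obtain d' where d': "\<forall>i. i \<notin> J \<longrightarrow> d' i = 0" "\<forall>i\<in>J. B (\<lambda>l. ?e k l - d' l) (?e i) = 0" using insert.IH[OF JK(1), of "?e k"] by auto
    let ?f = "\<lambda>l. c l - d l" and ?r = "\<lambda>l. ?e k l - d' l"
    have ek: "B f ?r = B f (?e k)" if "\<forall>i\<in>J. B f (?e i) = 0" for f
    proof -
      have "B f ?r = B f (?e k) - B f d'" using Blin[of "?e k" 1 d' f] Bsym by simp
      moreover have "B f d' = 0" unfolding Brep[of f d'] using d'(1) that by (intro sum.neutral ballI) (metis mult_eq_0_iff)
      ultimately show ?thesis by simp
    qed
    show ?case
    proof (cases "B ?r ?r = 0")
      case True
      have "B ?f (?e k) = 0" using ek[OF d(2)] CS[OF True, of ?f] by simp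
      then show ?thesis using d by (intro exI[of _ d]) auto
    next
      case False
      define t where "t = B ?f ?r / B ?r ?r"
      let ?d = "\<lambda>l. d l + t * ?r l"
      have eq: "(\<lambda>l. c l - ?d l) = (\<lambda>l. ?f l - t * ?r l)" by (simp add: fun_eq_iff algebra_simps)
      have l: "B (\<lambda>l. c l - ?d l) g = B ?f g - t * B ?r g" for g unfolding eq by (rule Blin)
      have 1: "\<forall>i\<in>J. B (\<lambda>l. c l - ?d l) (?e i) = 0" unfolding l using d d' by simp
      have "B (\<lambda>l. c l - ?d l) (?e k) = B (\<lambda>l. c l - ?d l) ?r" using ek[OF 1] by simp
      also have "\<dots> = B ?f ?r - t * B ?r ?r" by (rule l)
      also have "\<dots> = 0" using False by (simp add: t_def)
      finally show ?thesis using 1 d(1) d'(1) by (intro exI[of _ ?d]) auto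
    qed
  qed
qed

text \<open>The residual of the unit vector at \<open>n\<close> after projection to the span of the
  others is orthogonal to them and has the coefficient 1 at \<open>n\<close>. Its product with that
  unit vector equals its own squared length, positive by hypothesis; dividing by it gives the dual
  vector.\<close>

lemma gram_dual:
  fixes G :: "'i \<Rightarrow> 'i \<Rightarrow> real"
  assumes K: "finite K" "n \<in> K" and sym: "\<And>i j. G i j = G j i"
    and psd: "\<And>c. 0 \<le> (\<Sum>i\<in>K. \<Sum>j\<in>K. c i * c j * G i j)"
    and pos: "\<And>c. c n \<noteq> 0 \<Longrightarrow> 0 < (\<Sum>i\<in>K. \<Sum>j\<in>K. c i * c j * G i j)"
  shows "\<exists>c. \<forall>i\<in>K. (\<Sum>j\<in>K. c j * G j i) = (if i = n then 1 else 0)"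
proof -
  let ?e = "\<lambda>i k. if k = i then 1 else (0::real)"
  let ?B = "\<lambda>c d. \<Sum>i\<in>K. \<Sum>j\<in>K. c i * d j * G i j"
  have Be: "?B c (?e i) = (\<Sum>j\<in>K. c j * G j i)" if "i \<in> K" for c i
  proof -
    have "?B c (?e i) = (\<Sum>j\<in>K. \<Sum>k\<in>K. if k = i then c j * G j i else 0)" by (intro sum.cong refl) simp
    then show ?thesis using that K by simp
  qed
  obtain d where d: "\<forall>i. i \<notin> K - {n} \<longrightarrow> d i = 0" "\<forall>i\<in>K - {n}. ?B (\<lambda>k. ?e n k - d k) (?e i) = 0"
    using gram_projection[OF K(1) sym psd, of "K - {n}" "?e n"] by blast
  define r where "r = (\<lambda>k. ?e n k - d k)"
  define a where "a = (\<Sum>j\<in>K. r j * G j n)"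
  have z: "(\<Sum>j\<in>K. r j * G j i) = 0" if "i \<in> K" "i \<noteq> n" for i
    using d(2) Be[of i r] that unfolding r_def by simp
  have rn: "r n = 1" using d(1) by (simp add: r_def)
  have "?B r r = (\<Sum>j\<in>K. r j * (\<Sum>i\<in>K. r i * G i j))"
    by (subst sum.swap) (simp add: sum_distrib_left ac_simps)
  also have "\<dots> = (\<Sum>j\<in>K. if j = n then r j * a else 0)"
    using z by (intro sum.cong refl) (auto simp: a_def)
  also have "\<dots> = a" using K rn by simp
  finally have "a > 0" using pos[of r] rn by simp
  then show ?thesis
    using z by (intro exI[of _ "\<lambda>j. r j / a"]) (auto simp: a_def sum_divide_distrib[symmetric])
qed

lemma affine_value_sq_le: "(2 * y - x)\<^sup>2 \<le> 8 * y\<^sup>2 + 2 * (x::real)\<^sup>2"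
  using zero_le_power2[of "2 * y + x"] by (simp add: power2_eq_square algebra_simps)

section \<open>Piecewise linear functions: inverse estimates and duality\<close>

context mesh
begin

lemma sum_hat:
  assumes "T \<in> \<T>" "x \<in> T"
  shows "(\<Sum>N\<in>nodes \<T>. c N * hat N x) = (\<Sum>N\<in>vertices T. c N * bary T N x)"
proof -
  have "(\<Sum>N\<in>nodes \<T>. c N * hat N x) = (\<Sum>N\<in>nodes \<T>. if N \<in> vertices T then c N * bary T N x else 0)"
    by (intro sum.cong refl) (simp add: hat_eq[OF assms])
  also have "\<dots> = (\<Sum>N\<in>nodes \<T> \<inter> vertices T. c N * bary T N x)"
    using finite_nodes by (simp add: sum.inter_restrict)
  also have "nodes \<T> \<inter> vertices T = vertices T" using vertices_nodes[OF assms(1)] by blast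
  finally show ?thesis .
qed

lemma sum_hat_one: "x \<in> \<Union>\<T> \<Longrightarrow> (\<Sum>N\<in>nodes \<T>. hat N x) = 1"
proof -
  assume "x \<in> \<Union>\<T>"
  then obtain T where T: "T \<in> \<T>" "x \<in> T" by blast
  show ?thesis using sum_hat[OF T, of "\<lambda>_. 1"] full_simplex.bary_sums(1)[OF triangle.axioms[OF tri[OF T(1)]], of x] by simp
qed

lemma hat_bounds: "0 \<le> hat N x" "hat N x \<le> 1"
proof -
  have "0 \<le> hat N x \<and> hat N x \<le> 1"
  proof (cases "x \<in> \<Union>\<T>")
    case True
    then obtain T where T: "T \<in> \<T>" "x \<in> T" by blast
    interpret triangle T using tri[OF T(1)] .
    show ?thesis using hat_eq[OF T, of N] mem_iff_bary T(2) bary_le_1[OF T(2)] by auto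
  qed (simp add: hat_outside)
  then show "0 \<le> hat N x" "hat N x \<le> 1" by auto
qed

lemma hat_measurable: "hat N \<in> borel_measurable borel"
proof -
  have "closed (\<Union>\<T>)" using Union_mesh by simp
  then have "(\<lambda>x. indicator (\<Union>\<T>) x *\<^sub>R hat N x) \<in> borel_measurable borel"
    using continuous_hat by (intro borel_measurable_continuous_on_indicator) auto
  moreover have "(\<lambda>x. indicator (\<Union>\<T>) x *\<^sub>R hat N x) = hat N"
    using hat_outside by (auto simp: fun_eq_iff indicator_def)
  ultimately show ?thesis by simp
qed

definition pl :: "(pt \<Rightarrow> real) \<Rightarrow> pt \<Rightarrow> real" where
  "pl c x = (\<Sum>N\<in>nodes \<T>. c N * hat N x)"

lemma pl_measurable: "pl c \<in> borel_measurable borel"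
proof -
  note [measurable] = hat_measurable
  show ?thesis unfolding pl_def by measurable
qed

lemma pl_bounded: "\<bar>pl c x\<bar> \<le> (\<Sum>N\<in>nodes \<T>. \<bar>c N\<bar>)"
  unfolding pl_def
proof (rule order_trans[OF sum_abs sum_mono])
  fix N show "\<bar>c N * hat N x\<bar> \<le> \<bar>c N\<bar>" using hat_bounds[of N x] by (simp add: abs_mult mult_left_le)
qed

lemma pl_affine:
  assumes T: "T \<in> \<T>" "x \<in> T"
  shows "pl c x = (\<Sum>N\<in>vertices T. c N *\<^sub>R bgrad T N) \<bullet> x + (\<Sum>N\<in>vertices T. c N * (1 - bgrad T N \<bullet> N))"
  unfolding pl_def sum_hat[OF T] bary_affine
  by (simp add: inner_sum_left sum.distrib distrib_left)

lemma pl_node: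
  assumes "N \<in> nodes \<T>" shows "pl c N = c N"
proof -
  have "pl c N = (\<Sum>M\<in>nodes \<T>. if M = N then c M else 0)"
    unfolding pl_def using hat_node[OF _ assms] by (intro sum.cong refl) auto
  then show ?thesis using finite_nodes assms by simp
qed

text \<open>On \<open>T\<close> the value at \<open>N\<close> is twice the value at the midpoint of
  \<open>N\<close> and \<open>x\<close> minus the value at \<open>x\<close>. Squaring gives the
  weights 8 and 2, the substitution of midpoints costs 2^2, and 34 = 8 * 4 + 2.\<close>

lemma pl_sq_triangle:
  assumes T: "T \<in> \<T>" "N \<in> nodes \<T>" "N \<in> T"
  shows "ennreal (measure lebesgue T / 34 * (c N)\<^sup>2) \<le> (sq_int lborel T (\<lambda>x. pl c x))"
proof -
  note [measurable] = pl_measurable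
  have [measurable]: "T \<in> sets borel" using borel_mem[OF T(1)] .
  let ?h = "\<lambda>x. N + (1/2) *\<^sub>R (x - N)"
  let ?F = "\<lambda>x. ennreal ((pl c x)\<^sup>2) * indicator T x"
  have [measurable]: "?h \<in> borel_measurable borel" by (intro borel_measurable_continuous_onI continuous_intros)
  have "ennreal ((c N)\<^sup>2) * emeasure lborel T = (\<integral>\<^sup>+x. ennreal ((c N)\<^sup>2) * indicator T x \<partial>lborel)"
    by (simp add: nn_integral_cmult)
  also have "\<dots> \<le> (\<integral>\<^sup>+x. 8 * ?F ((1/2) *\<^sub>R N + (1/2) *\<^sub>R x) + 2 * ?F x \<partial>lborel)"
  proof (intro nn_integral_mono)
    fix x
    show "ennreal ((c N)\<^sup>2) * indicator T x \<le> 8 * ?F ((1/2) *\<^sub>R N + (1/2) *\<^sub>R x) + 2 * ?F x"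
    proof (cases "x \<in> T")
      case True
      let ?y = "(1/2) *\<^sub>R N + (1/2) *\<^sub>R x"
      have y: "?y \<in> T" using True T convex_mem by (intro convexD) auto
      have "pl c N = 2 * pl c ?y - pl c x"
        unfolding pl_affine[OF T(1,3)] pl_affine[OF T(1) True] pl_affine[OF T(1) y]
        by (simp add: inner_add_right)
      then have "(c N)\<^sup>2 \<le> 8 * (pl c ?y)\<^sup>2 + 2 * (pl c x)\<^sup>2"
        using affine_value_sq_le[of "pl c ?y" "pl c x"] pl_node[OF T(2)] by simp
      then have "ennreal ((c N)\<^sup>2) \<le> ennreal (8 * (pl c ?y)\<^sup>2 + 2 * (pl c x)\<^sup>2)" by (rule ennreal_leI)
      then show ?thesis using True y by (simp add: ennreal_mult)
    qed simp
  qed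
  also have "\<dots> = 8 * (\<integral>\<^sup>+x. ?F ((1/2) *\<^sub>R N + (1/2) *\<^sub>R x) \<partial>lborel) + 2 * (\<integral>\<^sup>+x. ?F x \<partial>lborel)"
    by (subst nn_integral_add, measurable) (subst nn_integral_cmult, measurable, simp add: nn_integral_cmult)
  also have "\<dots> \<le> 8 * (2 ^ DIM(pt) * (\<integral>\<^sup>+x. ?F x \<partial>lborel)) + 2 * (\<integral>\<^sup>+x. ?F x \<partial>lborel)"
    by (intro add_right_mono mult_left_mono nn_integral_affine_le) auto
  also have "\<dots> = 34 * (\<integral>\<^sup>+x. ?F x \<partial>lborel)"
    by (simp add: mult.assoc[symmetric]) (simp flip: distrib_right)
  finally have "ennreal ((c N)\<^sup>2) * emeasure lborel T \<le> 34 * (\<integral>\<^sup>+x. ?F x \<partial>lborel)" .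
  then have "ennreal (1/34) * (ennreal ((c N)\<^sup>2) * emeasure lborel T) \<le> ennreal (1/34) * (ennreal 34 * (\<integral>\<^sup>+x. ?F x \<partial>lborel))"
    by (intro mult_left_mono) auto
  also have "\<dots> = (\<integral>\<^sup>+x. ?F x \<partial>lborel)"
  proof -
    have "ennreal (1/34) * ennreal 34 = 1" by (subst ennreal_mult[symmetric]) auto
    then show ?thesis by (simp only: mult.assoc[symmetric] mult_1)
  qed
  also have "ennreal (1/34) * (ennreal ((c N)\<^sup>2) * emeasure lborel T) = ennreal (measure lebesgue T / 34 * (c N)\<^sup>2)"
    unfolding emeasure_tri[OF T(1)] by (simp add: ennreal_mult[symmetric] mult.commute)
  finally show ?thesis .
qed

text \<open>The midpoint identity of the triangle, now along the edge, where the substitution costs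
  only 2; thus 18 = 8 * 2 + 2.\<close>

lemma pl_sq_edge:
  assumes E: "E \<in> edges \<T>" "E = closed_segment N M" "N \<noteq> M" and N: "N \<in> nodes \<T>"
  shows "ennreal (1 / 18 * (c N)\<^sup>2) \<le> (sq_int lborel {0..1} (\<lambda>t. pl c (N + t *\<^sub>R (M - N))))"
proof -
  note [measurable] = pl_measurable
  obtain T where T: "T \<in> \<T>" "E edge_of T" using E by (auto simp: edges_def)
  have ET: "E \<subseteq> T" using T(2) edge_of_imp_subset by blast
  let ?e = "\<lambda>t. N + t *\<^sub>R (M - N)"
  have [measurable]: "?e \<in> borel_measurable borel" by (intro borel_measurable_continuous_onI continuous_intros)
  have eT: "?e t \<in> T" if "t \<in> {0..1}" for t
  proof -
    have "(1 - t) *\<^sub>R N + t *\<^sub>R M \<in> E" unfolding E(2) in_segment(1) using that by (intro exI[of _ t]) auto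
    then show ?thesis using ET by (auto simp: algebra_simps)
  qed
  let ?F = "\<lambda>t. ennreal ((pl c (?e t))\<^sup>2) * indicator {0..1} t"
  have "ennreal ((c N)\<^sup>2) = (\<integral>\<^sup>+t. ennreal ((c N)\<^sup>2) * indicator {0..1::real} t \<partial>lborel)"
    by (simp add: nn_integral_cmult)
  also have "\<dots> \<le> (\<integral>\<^sup>+t. 8 * ?F (0 + (1/2) *\<^sub>R t) + 2 * ?F t \<partial>lborel)"
  proof (intro nn_integral_mono)
    fix t :: real
    show "ennreal ((c N)\<^sup>2) * indicator {0..1} t \<le> 8 * ?F (0 + (1/2) *\<^sub>R t) + 2 * ?F t"
    proof (cases "t \<in> {0..1}")
      case True
      then have h: "t / 2 \<in> {0..1}" by auto
      have "N \<in> T" using eT[of 0] by simp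
      then have "pl c N = 2 * pl c (?e (t / 2)) - pl c (?e t)"
        unfolding pl_affine[OF T(1) \<open>N \<in> T\<close>] pl_affine[OF T(1) eT[OF True]] pl_affine[OF T(1) eT[OF h]]
        by (simp add: inner_add_right inner_diff_right)
      then have "(c N)\<^sup>2 \<le> 8 * (pl c (?e (t / 2)))\<^sup>2 + 2 * (pl c (?e t))\<^sup>2"
        using affine_value_sq_le[of "pl c (?e (t / 2))" "pl c (?e t)"] pl_node[OF N] by simp
      then have "ennreal ((c N)\<^sup>2) \<le> ennreal (8 * (pl c (?e (t / 2)))\<^sup>2 + 2 * (pl c (?e t))\<^sup>2)" by (rule ennreal_leI)
      then show ?thesis using True h by (simp add: ennreal_mult)
    qed simp
  qed
  also have "\<dots> = 8 * (\<integral>\<^sup>+t. ?F (0 + (1/2) *\<^sub>R t) \<partial>lborel) + 2 * (\<integral>\<^sup>+t. ?F t \<partial>lborel)"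
    by (subst nn_integral_add, measurable) (subst nn_integral_cmult, measurable, simp add: nn_integral_cmult)
  also have "\<dots> \<le> 8 * (2 ^ DIM(real) * (\<integral>\<^sup>+t. ?F t \<partial>lborel)) + 2 * (\<integral>\<^sup>+t. ?F t \<partial>lborel)"
    by (intro add_right_mono mult_left_mono nn_integral_affine_le) auto
  also have "\<dots> = 18 * (\<integral>\<^sup>+t. ?F t \<partial>lborel)"
    by (simp add: mult.assoc[symmetric]) (simp flip: distrib_right)
  finally have "ennreal (1/18) * ennreal ((c N)\<^sup>2) \<le> ennreal (1/18) * (ennreal 18 * (\<integral>\<^sup>+t. ?F t \<partial>lborel))"
    by (intro mult_left_mono) auto
  also have "\<dots> = (\<integral>\<^sup>+t. ?F t \<partial>lborel)"
  proof -
    have "ennreal (1/18) * ennreal 18 = 1" by (subst ennreal_mult[symmetric]) auto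
    then show ?thesis by (simp only: mult.assoc[symmetric] mult_1)
  qed
  finally show ?thesis by (simp add: ennreal_mult[symmetric])
qed

text \<open>For \<open>\<psi> = \<Sum> c \<lambda>\<close> dual to \<open>\<lambda>\<^sub>N\<close> one has \<open>\<integral> \<psi>\<^sup>2 = c N\<close>; the inverse estimate
  \<open>k (c N)\<^sup>2 \<le> \<integral> \<psi>\<^sup>2\<close> therefore gives both existence and the bound \<open>\<integral> \<psi>\<^sup>2 \<le> 1 / k\<close>.\<close>

lemma dual_basis_props:
  assumes N: "N \<in> nodes \<T>" and \<sigma>: "\<sigma> \<in> fmeasurable M" "\<sigma> \<subseteq> \<Union>\<T>"
    and hm: "\<And>N. hat N \<in> borel_measurable M"
    and k: "k > 0" "\<And>c. ennreal (k * (c N)\<^sup>2) \<le> (sq_int M \<sigma> (\<lambda>x. pl c x))"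
    and f: "f \<in> L2 M \<sigma>"
  shows "((LINT x:\<sigma>|M. dual_basis M \<T> N \<sigma> x * f x) - m)\<^sup>2 \<le> 1 / k * (LINT x:\<sigma>|M. (f x - m)\<^sup>2)"
proof -
  have plm: "pl c \<in> borel_measurable M" for c unfolding pl_def using hm by measurable
  have bi: "set_integrable M \<sigma> g" if "g \<in> borel_measurable M" "\<And>x. \<bar>g x\<bar> \<le> B" for g :: "pt \<Rightarrow> real" and B
    unfolding set_integrable_def
  proof (rule Bochner_Integration.integrable_bound[where f = "\<lambda>x. B * indicator \<sigma> x"])
    show "integrable M (\<lambda>x. B * indicator \<sigma> x)"
      using \<sigma>(1) by (intro integrable_mult_right integrable_real_indicator) (auto simp: fmeasurable_def)
    show "(\<lambda>x. indicator \<sigma> x *\<^sub>R g x) \<in> borel_measurable M"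
      using that(1) \<sigma>(1) by (intro borel_measurable_scaleR borel_measurable_indicator) (auto simp: fmeasurableD)
    show "AE x in M. norm (indicator \<sigma> x *\<^sub>R g x) \<le> norm (B * indicator \<sigma> x)"
      using that(2) by (intro AE_I2) (auto simp: indicator_def intro: order_trans[OF that(2) abs_ge_self])
  qed
  have hh: "set_integrable M \<sigma> (\<lambda>x. hat i x * hat j x)" for i j
  proof (rule bi)
    show "(\<lambda>x. hat i x * hat j x) \<in> borel_measurable M" using hm by measurable
    show "\<bar>hat i x * hat j x\<bar> \<le> 1" for x using hat_bounds[of i x] hat_bounds[of j x] by (simp add: abs_mult mult_le_one)
  qed
  have ph: "set_integrable M \<sigma> (\<lambda>x. pl c x * hat j x)" for c j
  proof (rule bi)
    show "(\<lambda>x. pl c x * hat j x) \<in> borel_measurable M" using hm plm by measurable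
    show "\<bar>pl c x * hat j x\<bar> \<le> (\<Sum>N\<in>nodes \<T>. \<bar>c N\<bar>)" for x
      using mult_mono[OF pl_bounded[of c x] hat_bounds(2)[of j x]] hat_bounds(1)[of j x] by (simp add: abs_mult sum_nonneg)
  qed
  have p2: "set_integrable M \<sigma> (\<lambda>x. (pl c x)\<^sup>2)" for c
  proof (rule bi)
    show "(\<lambda>x. (pl c x)\<^sup>2) \<in> borel_measurable M" using plm by measurable
    show "\<bar>(pl c x)\<^sup>2\<bar> \<le> (\<Sum>N\<in>nodes \<T>. \<bar>c N\<bar>)\<^sup>2" for x
      using power_mono[OF pl_bounded[of c x], of 2] by simp
  qed
  let ?G = "\<lambda>i j. LINT x:\<sigma>|M. hat i x * hat j x"
  have plG: "(LINT x:\<sigma>|M. pl c x * hat j x) = (\<Sum>i\<in>nodes \<T>. c i * ?G i j)" for c j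
  proof -
    have "(LINT x:\<sigma>|M. pl c x * hat j x) = (LINT x:\<sigma>|M. \<Sum>i\<in>nodes \<T>. c i * (hat i x * hat j x))"
      by (simp add: pl_def sum_distrib_right mult.assoc)
    also have "\<dots> = (\<Sum>i\<in>nodes \<T>. LINT x:\<sigma>|M. c i * (hat i x * hat j x))"
      using hh unfolding set_integrable_def set_lebesgue_integral_def scaleR_sum_right
      by (intro Bochner_Integration.integral_sum) (simp add: mult.left_commute)
    finally show ?thesis by simp
  qed
  have pp: "(LINT x:\<sigma>|M. (pl c x)\<^sup>2) = (\<Sum>j\<in>nodes \<T>. c j * (LINT x:\<sigma>|M. pl c x * hat j x))" for c
  proof -
    have "(LINT x:\<sigma>|M. (pl c x)\<^sup>2) = (LINT x:\<sigma>|M. \<Sum>j\<in>nodes \<T>. c j * (pl c x * hat j x))"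
    proof -
      have "(pl c x)\<^sup>2 = (\<Sum>j\<in>nodes \<T>. c j * (pl c x * hat j x))" for x
        by (simp add: power2_eq_square pl_def[of c x] sum_distrib_left sum_distrib_right ac_simps)
      then show ?thesis by simp
    qed
    also have "\<dots> = (\<Sum>j\<in>nodes \<T>. LINT x:\<sigma>|M. c j * (pl c x * hat j x))"
      using ph unfolding set_integrable_def set_lebesgue_integral_def scaleR_sum_right
      by (intro Bochner_Integration.integral_sum) (simp add: mult.left_commute)
    finally show ?thesis by simp
  qed
  have ppG: "(LINT x:\<sigma>|M. (pl c x)\<^sup>2) = (\<Sum>i\<in>nodes \<T>. \<Sum>j\<in>nodes \<T>. c i * c j * ?G i j)" for c
    unfolding pp plG by (subst sum.swap) (simp add: sum_distrib_left ac_simps)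
  have nn: "(sq_int M \<sigma> (\<lambda>x. pl c x)) = ennreal (LINT x:\<sigma>|M. (pl c x)\<^sup>2)" for c
  proof -
    have "(sq_int M \<sigma> (\<lambda>x. pl c x)) = (\<integral>\<^sup>+x. ennreal (indicator \<sigma> x *\<^sub>R (pl c x)\<^sup>2) \<partial>M)"
      by (intro nn_integral_cong) (auto simp: indicator_def)
    also have "\<dots> = ennreal (LINT x:\<sigma>|M. (pl c x)\<^sup>2)"
      using p2 unfolding set_integrable_def set_lebesgue_integral_def by (intro nn_integral_eq_integral) auto
    finally show ?thesis .
  qed
  have pos: "0 \<le> (LINT x:\<sigma>|M. (pl c x)\<^sup>2)" for c
    unfolding set_lebesgue_integral_def by (intro integral_nonneg_AE AE_I2) simp
  have inv: "k * (c N)\<^sup>2 \<le> (LINT x:\<sigma>|M. (pl c x)\<^sup>2)" for c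
    using k(2)[of c] pos[of c] unfolding nn by simp
  \<comment> \<open>Positivity at vectors with a nonzero entry at \<open>N\<close> is the inverse
    estimate; vectors without such an entry may have length zero.\<close>
  have "\<exists>c. \<forall>i\<in>nodes \<T>. (\<Sum>j\<in>nodes \<T>. c j * ?G j i) = (if i = N then 1 else 0)"
  proof (rule gram_dual[OF finite_nodes N])
    show "?G i j = ?G j i" for i j by (simp add: mult.commute)
    show "0 \<le> (\<Sum>i\<in>nodes \<T>. \<Sum>j\<in>nodes \<T>. c i * c j * ?G i j)" for c using pos[of c] by (simp only: ppG)
    show "0 < (\<Sum>i\<in>nodes \<T>. \<Sum>j\<in>nodes \<T>. c i * c j * ?G i j)" if "c N \<noteq> 0" for c
    proof -
      have "0 < k * (c N)\<^sup>2" using k(1) that by simp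
      then show ?thesis using inv[of c] by (simp only: ppG)
    qed
  qed
  then obtain c0 where c0: "\<forall>i\<in>nodes \<T>. (LINT x:\<sigma>|M. pl c0 x * hat i x) = (if i = N then 1 else 0)"
    unfolding plG by blast
  define \<psi> where "\<psi> = dual_basis M \<T> N \<sigma>"
  let ?P = "\<lambda>\<psi>. (\<exists>c. \<forall>x\<in>\<sigma>. \<psi> x = (\<Sum>N'\<in>nodes \<T>. c N' * nodal_basis \<T> N' x)) \<and>
     (\<forall>N'\<in>nodes \<T>. (LINT x:\<sigma>|M. \<psi> x * nodal_basis \<T> N' x) = (if N' = N then 1 else 0))"
  have nb: "(\<Sum>N'\<in>nodes \<T>. c N' * nodal_basis \<T> N' x) = pl c x" for c x
    unfolding pl_def by (intro sum.cong refl) (simp add: nodal_basis_eq)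
  have "?P (pl c0)"
  proof
    show "\<exists>c. \<forall>x\<in>\<sigma>. pl c0 x = (\<Sum>N'\<in>nodes \<T>. c N' * nodal_basis \<T> N' x)" unfolding nb by blast
    show "\<forall>N'\<in>nodes \<T>. (LINT x:\<sigma>|M. pl c0 x * nodal_basis \<T> N' x) = (if N' = N then 1 else 0)"
      using c0 by (simp add: nodal_basis_eq)
  qed
  then have "?P \<psi>" unfolding \<psi>_def dual_basis_def by (rule someI[where P = ?P])
  then obtain c where c: "\<forall>x\<in>\<sigma>. \<psi> x = pl c x" and d: "\<forall>N'\<in>nodes \<T>. (LINT x:\<sigma>|M. \<psi> x * hat N' x) = (if N' = N then 1 else 0)"
    unfolding nb by (auto simp: nodal_basis_eq)
  have cong: "(LINT x:\<sigma>|M. \<psi> x * g x) = (LINT x:\<sigma>|M. pl c x * g x)" for g :: "pt \<Rightarrow> real"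
    unfolding set_lebesgue_integral_def using c by (intro Bochner_Integration.integral_cong) (auto simp: indicator_def)
  have d': "(LINT x:\<sigma>|M. pl c x * hat j x) = (if j = N then 1 else 0)" if "j \<in> nodes \<T>" for j
    using d that cong[of "hat j"] by simp
  have sq: "(LINT x:\<sigma>|M. (pl c x)\<^sup>2) = c N"
  proof -
    have "(LINT x:\<sigma>|M. (pl c x)\<^sup>2) = (\<Sum>j\<in>nodes \<T>. if j = N then c j else 0)"
      unfolding pp by (intro sum.cong refl) (simp add: d')
    then show ?thesis using finite_nodes N by simp
  qed
  have bound: "(LINT x:\<sigma>|M. (pl c x)\<^sup>2) \<le> 1 / k"
  proof (cases "c N = 0")
    case False
    then have "c N > 0" using pos[of c] sq by simp
    moreover have "c N * (k * c N) \<le> c N * 1" using inv[of c] sq by (simp add: power2_eq_square ac_simps)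
    ultimately have "k * c N \<le> 1" by (simp only: mult_le_cancel_left_pos)
    then show ?thesis using k(1) sq by (simp add: field_simps)
  qed (use sq k(1) in simp)
  have i1: "set_integrable M \<sigma> (pl c)"
    by (rule bi[OF plm pl_bounded])
  \<comment> \<open>The nodal functions add up to 1 on \<sigma>, so the duality relations add up to
    integral 1. Constants are thus reproduced, and \<open>m\<close> may be subtracted under the
    integral.\<close>
  have one: "(LINT x:\<sigma>|M. pl c x) = 1"
  proof -
    have "(LINT x:\<sigma>|M. pl c x) = (LINT x:\<sigma>|M. \<Sum>j\<in>nodes \<T>. pl c x * hat j x)"
      unfolding set_lebesgue_integral_def using \<sigma>(2) sum_hat_one
      by (intro Bochner_Integration.integral_cong refl) (auto simp: indicator_def simp flip: sum_distrib_left)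
    also have "\<dots> = (\<Sum>j\<in>nodes \<T>. LINT x:\<sigma>|M. pl c x * hat j x)"
      using ph unfolding set_integrable_def set_lebesgue_integral_def scaleR_sum_right
      by (intro Bochner_Integration.integral_sum) simp
    also have "\<dots> = (\<Sum>j\<in>nodes \<T>. if j = N then 1 else 0)" by (intro sum.cong refl d')
    finally show ?thesis using finite_nodes N by simp
  qed
  have fi: "set_integrable M \<sigma> f" by (rule set_integrable_L2_lmeasurable[OF f \<sigma>(1)]) simp
  have pf: "set_integrable M \<sigma> (\<lambda>x. pl c x * f x)"
    unfolding set_integrable_def
  proof (rule Bochner_Integration.integrable_bound)
    let ?B = "\<Sum>N\<in>nodes \<T>. \<bar>c N\<bar>"
    show "integrable M (\<lambda>x. ?B * norm (indicator \<sigma> x *\<^sub>R f x))"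
      using fi unfolding set_integrable_def by (intro integrable_mult_right integrable_norm)
    have "(\<lambda>x. pl c x * (indicator \<sigma> x *\<^sub>R f x)) \<in> borel_measurable M"
      using fi unfolding set_integrable_def by (intro borel_measurable_times plm borel_measurable_integrable)
    then show "(\<lambda>x. indicator \<sigma> x *\<^sub>R (pl c x * f x)) \<in> borel_measurable M" by (simp add: mult.left_commute)
    show "AE x in M. norm (indicator \<sigma> x *\<^sub>R (pl c x * f x)) \<le> norm (?B * norm (indicator \<sigma> x *\<^sub>R f x))"
      using pl_bounded[of c] by (intro AE_I2) (auto simp: indicator_def abs_mult sum_nonneg intro!: mult_right_mono)
  qed
  have fm2: "set_integrable M \<sigma> (\<lambda>x. (f x - m)\<^sup>2)"
  proof -
    have "(\<lambda>_. m) \<in> L2 M \<sigma>"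
      using \<sigma>(1) by (intro L2_bounded[of _ _ _ "\<bar>m\<bar>"]) (auto simp: set_borel_measurable_def fmeasurableD)
    from L2_integrable[OF L2_diff[OF f this]] show ?thesis by simp
  qed
  have pm: "set_integrable M \<sigma> (\<lambda>x. pl c x * (f x - m))"
  proof -
    have "set_integrable M \<sigma> (\<lambda>x. pl c x * m)" using i1 by simp
    from set_integral_diff(1)[OF pf this] show ?thesis by (simp add: right_diff_distrib)
  qed
  have "(LINT x:\<sigma>|M. \<psi> x * f x) - m = (LINT x:\<sigma>|M. pl c x * f x) - (LINT x:\<sigma>|M. pl c x * m)"
    using cong[of f] one i1 by simp
  also have "\<dots> = (LINT x:\<sigma>|M. pl c x * (f x - m))"
    unfolding right_diff_distrib by (rule set_integral_diff(2)[symmetric, OF pf]) (use i1 in simp)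
  finally have "((LINT x:\<sigma>|M. \<psi> x * f x) - m)\<^sup>2 \<le> (LINT x:\<sigma>|M. (pl c x)\<^sup>2) * (LINT x:\<sigma>|M. (f x - m)\<^sup>2)"
    using Cauchy_Schwarz_set_integral[OF p2 fm2 pm] by simp
  also have "\<dots> \<le> 1 / k * (LINT x:\<sigma>|M. (f x - m)\<^sup>2)"
    using bound by (intro mult_right_mono) (auto simp: set_lebesgue_integral_def intro!: integral_nonneg_AE AE_I2)
  finally show ?thesis unfolding \<psi>_def .
qed

end

subsection \<open>Traces and tangential gradients\<close>

lemma weak_gradient_cong_AE:
  fixes u :: "'a::euclidean_space \<Rightarrow> real"
  assumes w: "weak_gradient S u g" and S: "S \<in> sets lebesgue"
    and m: "set_borel_measurable lebesgue S u" "set_borel_measurable lebesgue S u'" "set_borel_measurable lebesgue S g" "set_borel_measurable lebesgue S g'"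
    and u: "AE x in lebesgue. x \<in> S \<longrightarrow> u x = u' x" and g: "AE x in lebesgue. x \<in> S \<longrightarrow> g x = g' x"
  shows "weak_gradient S u' g'"
  unfolding weak_gradient_def
proof (intro ballI allI impI)
  fix \<phi> :: "'a \<Rightarrow> real" and \<phi>' assume \<phi>: "\<phi> \<in> test_functions S" and \<phi>': "\<forall>x. GDERIV \<phi> x :> \<phi>' x"
  obtain \<psi> where \<psi>: "\<And>x. GDERIV \<phi> x :> \<psi> x" "continuous_on UNIV \<psi>" using test_functions_gradient[OF \<phi>] by metis
  have "\<phi>' = \<psi>" using \<phi>' \<psi>(1) GDERIV_unique by blast
  with \<psi>(2) have [measurable]: "\<phi>' \<in> borel_measurable lebesgue" by (intro measurable_completion) (simp add: borel_measurable_continuous_onI)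
  have [measurable]: "\<phi> \<in> borel_measurable lebesgue"
    using test_functions_continuous[OF \<phi>] by (intro measurable_completion) (simp add: borel_measurable_continuous_onI)
  note [measurable] = m[unfolded set_borel_measurable_def]
  have "(LINT x:S|lebesgue. u x *\<^sub>R \<phi>' x) = (LINT x|lebesgue. (indicator S x *\<^sub>R u x) *\<^sub>R \<phi>' x)" for u :: "'a \<Rightarrow> real"
    by (simp add: set_lebesgue_integral_def)
  moreover have "(LINT x:S|lebesgue. \<phi> x *\<^sub>R g x) = (LINT x|lebesgue. \<phi> x *\<^sub>R (indicator S x *\<^sub>R g x))" for g :: "'a \<Rightarrow> 'a"
    by (simp add: set_lebesgue_integral_def mult.commute)
  moreover have "(LINT x|lebesgue. (indicator S x *\<^sub>R u x) *\<^sub>R \<phi>' x) = (LINT x|lebesgue. (indicator S x *\<^sub>R u' x) *\<^sub>R \<phi>' x)"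
    using u by (intro integral_cong_AE) (measurable, auto elim!: eventually_mono simp: indicator_def)
  moreover have "(LINT x|lebesgue. \<phi> x *\<^sub>R (indicator S x *\<^sub>R g x)) = (LINT x|lebesgue. \<phi> x *\<^sub>R (indicator S x *\<^sub>R g' x))"
    using g by (intro integral_cong_AE) (measurable, auto elim!: eventually_mono simp: indicator_def)
  moreover have "(LINT x:S|lebesgue. u x *\<^sub>R \<phi>' x) = - (LINT x:S|lebesgue. \<phi> x *\<^sub>R g x)"
    using w \<phi> \<phi>' by (simp add: weak_gradient_def)
  ultimately show "(LINT x:S|lebesgue. u' x *\<^sub>R \<phi>' x) = - (LINT x:S|lebesgue. \<phi> x *\<^sub>R g' x)" by simp
qed

lemma L2_nn_integral_finiteI:
  assumes "set_borel_measurable M A f" "(sq_int M A (\<lambda>x. norm (f x))) < \<infinity>"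
  shows "f \<in> L2 M A"
proof -
  have "(\<lambda>x. (norm (indicator A x *\<^sub>R f x))\<^sup>2) \<in> borel_measurable M"
    using assms(1) unfolding set_borel_measurable_def by measurable
  then have m: "(\<lambda>x. indicator A x *\<^sub>R (norm (f x))\<^sup>2) \<in> borel_measurable M"
    by (rule measurable_cong[THEN iffD1, rotated]) (auto simp: indicator_def)
  have "(\<integral>\<^sup>+x. ennreal (norm (indicator A x *\<^sub>R (norm (f x))\<^sup>2)) \<partial>M) = (sq_int M A (\<lambda>x. norm (f x)))"
    by (intro nn_integral_cong) (auto simp: indicator_def)
  then have "set_integrable M A (\<lambda>x. (norm (f x))\<^sup>2)"
    using m assms(2) unfolding set_integrable_def by (intro integrableI_bounded) auto
  with assms(1) show ?thesis by (simp add: L2_def)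
qed

lemma L2_subset:
  assumes "f \<in> L2 M A" "B \<in> sets M" "B \<subseteq> A"
  shows "f \<in> L2 M B"
proof -
  have "(\<lambda>x. indicator B x *\<^sub>R (indicator A x *\<^sub>R f x)) \<in> borel_measurable M"
    using L2_measurable[OF assms(1)] assms(2) unfolding set_borel_measurable_def by measurable
  moreover have "(\<lambda>x. indicator B x *\<^sub>R (indicator A x *\<^sub>R f x)) = (\<lambda>x. indicator B x *\<^sub>R f x)"
    using assms(3) by (auto simp: fun_eq_iff indicator_def)
  ultimately have "set_borel_measurable M B f" by (simp add: set_borel_measurable_def)
  then show ?thesis using set_integrable_subset[OF L2_integrable[OF assms(1)] assms(2,3)] by (simp add: L2_def)
qed

text \<open>Elements and patches are closed and may reach beyond the open domain, but only by a part
  of the frontier, which is negligible.\<close>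

lemma L2_add_null_set:
  fixes f :: "'a::euclidean_space \<Rightarrow> 'b::euclidean_space"
  assumes f: "f \<in> L2 lebesgue A" and B: "B \<in> sets lebesgue" and N: "B \<subseteq> A \<union> N" "negligible N"
  shows "f \<in> L2 lebesgue B"
proof (rule L2_nn_integral_finiteI)
  have ae: "AE x in lebesgue. x \<notin> N" using N(2) by (intro AE_not_in) (simp add: negligible_iff_null_sets)
  have "(\<lambda>x. indicator B x *\<^sub>R (indicator A x *\<^sub>R f x)) \<in> borel_measurable lebesgue"
    using L2_measurable[OF f] B unfolding set_borel_measurable_def by measurable
  then have "(\<lambda>x. indicator B x *\<^sub>R f x) \<in> borel_measurable lebesgue"
    by (rule borel_measurable_AE) (use ae N(1) in \<open>auto elim!: eventually_mono simp: indicator_def\<close>)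
  then show "set_borel_measurable lebesgue B f" by (simp add: set_borel_measurable_def)
  have "(sq_int lebesgue B (\<lambda>x. norm (f x))) \<le> (sq_int lebesgue A (\<lambda>x. norm (f x)))"
    using ae N(1) by (intro nn_integral_mono_AE) (auto elim!: eventually_mono simp: indicator_def)
  also have "\<dots> < \<infinity>" by (simp add: nn_integral_L2[OF f])
  finally show "(sq_int lebesgue B (\<lambda>x. norm (f x))) < \<infinity>" .
qed

section \<open>Tangential gradients glued from single edges\<close>

context mesh_function
begin

lemma norm_tangent: "E \<in> \<E> \<Longrightarrow> norm (tangent E) = 1"
proof -
  assume "E \<in> \<E>"
  then obtain a b where "E = closed_segment a b" "a \<noteq> b" using edge_repr by metis
  then show ?thesis using endpoints_segment(2)[of E a b] by (auto simp: tangent_def norm_sgn)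
qed

lemma arc_measurable: "arc_param E \<in> borel_measurable borel"
  unfolding arc_param_def by (intro borel_measurable_continuous_onI continuous_intros)

lemma arc_interior_eq:
  assumes E: "E \<in> \<E>" "t \<in> {0<..<diameter E}" and E': "E' \<in> \<E>" and m: "arc_param E t \<in> E'"
  shows "E' = E"
proof (rule ccontr)
  assume ne: "E' \<noteq> E"
  obtain a b where ab: "E = closed_segment a b" "a \<noteq> b" using edge_repr[OF E(1)] by metis
  have "arc_param E t \<in> E - {a, b}" using arc_param_image(2)[OF ab] E(2) by blast
  then show False using edges_Int[OF edges_\<E>[OF E(1)] ab(1) edges_\<E>[OF E']] ne m by blast
qed

text \<open>The predicate behind the choice in \<open>tangential_grad\<close>, named so that its
  satisfiability can be applied to the trace and to the interpolant alike.\<close>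

definition tgrad_spec :: "(pt \<Rightarrow> real) \<Rightarrow> (pt \<Rightarrow> pt) \<Rightarrow> bool" where
  "tgrad_spec u G \<longleftrightarrow> G \<in> L2 (arc_length \<E>) \<Gamma> \<and>
     (\<forall>E\<in>\<E>. weak_gradient {0<..<diameter E} (\<lambda>t. u (arc_param E t)) (\<lambda>t. G (arc_param E t) \<bullet> tangent E) \<and>
       (\<forall>t\<in>{0<..<diameter E}. G (arc_param E t) = (G (arc_param E t) \<bullet> tangent E) *\<^sub>R tangent E))"

text \<open>The derivatives on the edges are taken Borel and glued to one field. Projection to the
  tangent recovers the arc length parameter of a point, and an interior point of an edge lies on no
  other edge, so only one summand is nonzero there; endpoints have length zero.\<close>

lemma tgrad_exists:
  assumes u: "\<And>E. E \<in> \<E> \<Longrightarrow> \<exists>h\<in>L2 lebesgue {0<..<diameter E}. weak_gradient {0<..<diameter E} (\<lambda>t. u (arc_param E t)) h"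
    and um: "\<And>E. E \<in> \<E> \<Longrightarrow> set_borel_measurable lebesgue {0<..<diameter E} (\<lambda>t. u (arc_param E t))"
  shows "tgrad_spec u (tangential_grad \<E> u)"
proof -
  have "\<exists>h. h \<in> borel_measurable borel \<and> weak_gradient {0<..<diameter E} (\<lambda>t. u (arc_param E t)) h \<and>
    (sq_int lborel ({0<..<diameter E}) (\<lambda>t. h t)) < \<infinity>" if E: "E \<in> \<E>" for E
  proof -
    obtain h where h: "h \<in> L2 lebesgue {0<..<diameter E}" "weak_gradient {0<..<diameter E} (\<lambda>t. u (arc_param E t)) h" using u[OF E] by blast
    obtain h0 where h0: "h0 \<in> borel_measurable borel" "AE t in lebesgue. t \<in> {0<..<diameter E} \<longrightarrow> h t = h0 t"
      by (rule borel_representative_real[OF L2_measurable[OF h(1)]])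
    have h0m: "set_borel_measurable lebesgue {0<..<diameter E} h0"
      unfolding set_borel_measurable_def using h0(1) by (intro measurable_completion) simp
    have "weak_gradient {0<..<diameter E} (\<lambda>t. u (arc_param E t)) h0"
      by (rule weak_gradient_cong_AE[OF h(2) _ um[OF E] um[OF E] L2_measurable[OF h(1)] h0m _ h0(2)]) auto
    moreover have "(sq_int lborel ({0<..<diameter E}) (\<lambda>t. h0 t)) = (sq_int lebesgue ({0<..<diameter E}) (\<lambda>t. norm (h t)))"
      unfolding nn_integral_completion[of lborel, symmetric]
      using h0(2) by (intro nn_integral_cong_AE) (auto elim!: eventually_mono simp: indicator_def)
    ultimately show ?thesis using h0(1) nn_integral_L2[OF h(1)] by (intro exI[of _ h0]) simp
  qed
  then have "\<forall>E\<in>\<E>. \<exists>h. h \<in> borel_measurable borel \<and> weak_gradient {0<..<diameter E} (\<lambda>t. u (arc_param E t)) h \<and>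
    (sq_int lborel ({0<..<diameter E}) (\<lambda>t. h t)) < \<infinity>" by blast
  from bchoice[OF this] obtain h where h: "\<And>E. E \<in> \<E> \<Longrightarrow> h E \<in> borel_measurable borel"
    "\<And>E. E \<in> \<E> \<Longrightarrow> weak_gradient {0<..<diameter E} (\<lambda>t. u (arc_param E t)) (h E)"
    "\<And>E. E \<in> \<E> \<Longrightarrow> (sq_int lborel ({0<..<diameter E}) (\<lambda>t. h E t)) < \<infinity>" by blast
  define s where "s = (\<lambda>E x. (x - fst (endpoints E)) \<bullet> tangent E)"
  have s: "s E (arc_param E t) = t" if "E \<in> \<E>" for E t
    using norm_tangent[OF that] by (simp add: s_def arc_param_def dot_square_norm)
  define G where "G = (\<lambda>x. \<Sum>E\<in>\<E>. indicator (arc_param E ` {0<..<diameter E}) x *\<^sub>R (h E (s E x) *\<^sub>R tangent E))"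
  have Gm: "G \<in> borel_measurable borel"
    unfolding G_def
  proof (rule borel_measurable_sum)
    fix E assume E: "E \<in> \<E>"
    obtain a b where ab: "E = closed_segment a b" "a \<noteq> b" using edge_repr[OF E] by metis
    have "arc_param E ` {0<..<diameter E} \<in> sets borel" unfolding arc_param_image(2)[OF ab] unfolding ab(1) by simp
    moreover have "s E \<in> borel_measurable borel" unfolding s_def by measurable
    then have "(\<lambda>x. h E (s E x)) \<in> borel_measurable borel" using h(1)[OF E] by (rule measurable_compose)
    ultimately show "(\<lambda>x. indicator (arc_param E ` {0<..<diameter E}) x *\<^sub>R (h E (s E x) *\<^sub>R tangent E)) \<in> borel_measurable borel"
      by measurable
  qed
  have Ga: "G (arc_param E t) = h E t *\<^sub>R tangent E" if E: "E \<in> \<E>" "t \<in> {0<..<diameter E}" for E t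
  proof -
    have "G (arc_param E t) = (\<Sum>E'\<in>\<E>. if E' = E then h E t *\<^sub>R tangent E else 0)"
      unfolding G_def
    proof (intro sum.cong refl)
      fix E' assume E': "E' \<in> \<E>"
      show "indicator (arc_param E' ` {0<..<diameter E'}) (arc_param E t) *\<^sub>R (h E' (s E' (arc_param E t)) *\<^sub>R tangent E') = (if E' = E then h E t *\<^sub>R tangent E else 0)"
      proof (cases "E' = E")
        case True then show ?thesis using E s by simp
      next
        case False
        have "arc_param E t \<notin> E'" using arc_interior_eq[OF E E'] False by blast
        then have "arc_param E t \<notin> arc_param E' ` {0<..<diameter E'}" using arc_in[OF E'] by fastforce
        then show ?thesis using False by simp
      qed
    qed
    then show ?thesis using E(1) finite_\<E> by simp
  qed
  have tt: "tangent E \<bullet> tangent E = 1" if "E \<in> \<E>" for E using norm_tangent[OF that] by (simp add: dot_square_norm)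
  have "tgrad_spec u G"
    unfolding tgrad_spec_def
  proof (intro conjI ballI)
    show "G \<in> L2 (arc_length \<E>) \<Gamma>"
    proof (rule L2_nn_integral_finiteI)
      note [measurable] = Gm borel_interface
      show "set_borel_measurable (arc_length \<E>) \<Gamma> G" unfolding set_borel_measurable_def by measurable
      have "(sq_int (arc_length \<E>) \<Gamma> (\<lambda>x. norm (G x))) =
        (\<Sum>E\<in>\<E>. \<integral>\<^sup>+t\<in>{0..diameter E}. ennreal ((norm (G (arc_param E t)))\<^sup>2) * indicator \<Gamma> (arc_param E t) \<partial>lborel)"
        by (rule nn_integral_arc_length[OF finite_\<E>]) measurable
      also have "\<dots> < \<infinity>"
        unfolding infinity_ennreal_def ennreal_sum_less_top[OF finite_\<E>]
      proof
        fix E assume E: "E \<in> \<E>"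
        have "(\<integral>\<^sup>+t\<in>{0..diameter E}. ennreal ((norm (G (arc_param E t)))\<^sup>2) * indicator \<Gamma> (arc_param E t) \<partial>lborel) \<le> (sq_int lborel ({0<..<diameter E}) (\<lambda>t. h E t))"
        proof (rule nn_integral_mono_AE)
          have "AE t in lborel. t \<noteq> 0" "AE t in lborel. t \<noteq> diameter E" by (rule AE_lborel_singleton)+
          then show "AE t in lborel. ennreal ((norm (G (arc_param E t)))\<^sup>2) * indicator \<Gamma> (arc_param E t) * indicator {0..diameter E} t \<le> ennreal ((h E t)\<^sup>2) * indicator {0<..<diameter E} t"
          proof eventually_elim
            case (elim t)
            show ?case
            proof (cases "t \<in> {0<..<diameter E}")
              case True
              then show ?thesis using norm_tangent[OF E] by (simp add: Ga[OF E True] indicator_def)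
            qed (use elim in \<open>auto simp: indicator_def\<close>)
          qed
        qed
        then show "(\<integral>\<^sup>+t\<in>{0..diameter E}. ennreal ((norm (G (arc_param E t)))\<^sup>2) * indicator \<Gamma> (arc_param E t) \<partial>lborel) < top"
          using h(3)[OF E] by (auto intro: le_less_trans)
      qed
      finally show "(sq_int (arc_length \<E>) \<Gamma> (\<lambda>x. norm (G x))) < \<infinity>" .
    qed
    fix E assume E: "E \<in> \<E>"
    have hm: "set_borel_measurable lebesgue {0<..<diameter E} (h E)"
      unfolding set_borel_measurable_def using h(1)[OF E] by (intro measurable_completion) simp
    have gm: "set_borel_measurable lebesgue {0<..<diameter E} (\<lambda>t. G (arc_param E t) \<bullet> tangent E)"
      unfolding set_borel_measurable_def using measurable_compose[OF arc_measurable Gm] by (intro measurable_completion) simp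
    show "weak_gradient {0<..<diameter E} (\<lambda>t. u (arc_param E t)) (\<lambda>t. G (arc_param E t) \<bullet> tangent E)"
      by (rule weak_gradient_cong_AE[OF h(2)[OF E] _ um[OF E] um[OF E] hm gm]) (auto simp: Ga[OF E] tt[OF E])
    show "G (arc_param E t) = (G (arc_param E t) \<bullet> tangent E) *\<^sub>R tangent E" if "t \<in> {0<..<diameter E}" for t
      using Ga[OF E that] tt[OF E] by simp
  qed
  then have "\<exists>G. tgrad_spec u G" by blast
  from someI_ex[OF this] have "tgrad_spec u (SOME G. tgrad_spec u G)" .
  moreover have "tangential_grad \<E> u = (SOME G. tgrad_spec u G)"
    unfolding tangential_grad_def tgrad_spec_def interface[symmetric] ..
  ultimately show ?thesis by simp
qed

lemma tgrad_L2_edge: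
  assumes G: "tgrad_spec u G" and E: "E \<in> \<E>"
  shows "(\<lambda>t. G (arc_param E t) \<bullet> tangent E) \<in> L2 lebesgue {0<..<diameter E}"
    "\<And>A. E \<subseteq> A \<Longrightarrow> A \<in> sets borel \<Longrightarrow> A \<subseteq> \<Gamma> \<Longrightarrow>
      ennreal (LINT t:{0<..<diameter E}|lebesgue. (G (arc_param E t) \<bullet> tangent E)\<^sup>2) \<le> (sq_int (arc_length \<E>) A (\<lambda>x. norm (G x)))"
proof -
  let ?h = "\<lambda>t. G (arc_param E t) \<bullet> tangent E" and ?I = "{0<..<diameter E}"
  have GL: "G \<in> L2 (arc_length \<E>) \<Gamma>" using G by (simp add: tgrad_spec_def)
  define G1 where "G1 = (\<lambda>x. indicator \<Gamma> x *\<^sub>R G x)"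
  have G1m[measurable]: "G1 \<in> borel_measurable borel" using L2_measurable[OF GL] by (simp add: G1_def set_borel_measurable_def)
  have eq: "G1 (arc_param E t) = G (arc_param E t)" if "t \<in> {0..diameter E}" for t
    using arc_in[OF E that] \<E>_subset[OF E] by (simp add: G1_def indicator_def subset_iff)
  have m1: "(\<lambda>t. G1 (arc_param E t) \<bullet> tangent E) \<in> borel_measurable borel"
    using measurable_compose[OF arc_measurable G1m] by measurable
  have "(\<lambda>t. indicator ?I t *\<^sub>R (G1 (arc_param E t) \<bullet> tangent E)) \<in> borel_measurable lebesgue"
    using m1 by (intro measurable_completion) simp
  moreover have "(\<lambda>t. indicator ?I t *\<^sub>R (G1 (arc_param E t) \<bullet> tangent E)) = (\<lambda>t. indicator ?I t *\<^sub>R ?h t)"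
    using eq by (auto simp: fun_eq_iff indicator_def)
  ultimately have hm: "set_borel_measurable lebesgue ?I ?h" by (simp add: set_borel_measurable_def)
  have le: "(sq_int lebesgue ?I (\<lambda>t. norm (?h t))) \<le> (sq_int (arc_length \<E>) A (\<lambda>x. norm (G x)))"
    if A: "E \<subseteq> A" "A \<in> sets borel" "A \<subseteq> \<Gamma>" for A
  proof -
    have "(sq_int lebesgue ?I (\<lambda>t. norm (?h t))) = (sq_int lborel ?I (\<lambda>t. norm (?h t)))"
      by (rule nn_integral_completion)
    also have "\<dots> \<le> (sq_int lborel ({0..diameter E}) (\<lambda>t. norm (G1 (arc_param E t))))"
    proof (rule nn_integral_mono)
      fix t
      show "ennreal ((norm (?h t))\<^sup>2) * indicator ?I t \<le> ennreal ((norm (G1 (arc_param E t)))\<^sup>2) * indicator {0..diameter E} t"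
      proof (cases "t \<in> ?I")
        case True
        have "norm (?h t) \<le> norm (G (arc_param E t)) * norm (tangent E)" by (simp add: Cauchy_Schwarz_ineq2)
        then have "(norm (?h t))\<^sup>2 \<le> (norm (G (arc_param E t)))\<^sup>2" using norm_tangent[OF E] by (intro power_mono) auto
        then show ?thesis using True eq[of t] by (auto simp: indicator_def intro!: ennreal_leI)
      qed simp
    qed
    also have "\<dots> \<le> (sq_int (arc_length \<E>) A (\<lambda>x. norm (G1 x)))"
      by (rule arc_edge_le[OF E A(1,2)]) measurable
    also have "\<dots> = (sq_int (arc_length \<E>) A (\<lambda>x. norm (G x)))"
      using A(3) by (intro nn_integral_cong) (auto simp: G1_def indicator_def)
    finally show ?thesis .
  qed
  show L: "?h \<in> L2 lebesgue ?I"
  proof (rule L2_nn_integral_finiteI[OF hm])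
    have "(sq_int lebesgue ?I (\<lambda>t. norm (?h t))) \<le> (sq_int (arc_length \<E>) \<Gamma> (\<lambda>x. norm (G x)))"
      using \<E>_subset[OF E] borel_interface by (intro le) auto
    also have "\<dots> < \<infinity>" by (simp add: nn_integral_L2[OF GL])
    finally show "(sq_int lebesgue ?I (\<lambda>t. norm (?h t))) < \<infinity>" .
  qed
  show "ennreal (LINT t:?I|lebesgue. (?h t)\<^sup>2) \<le> (sq_int (arc_length \<E>) A (\<lambda>x. norm (G x)))"
    if A: "E \<subseteq> A" "A \<in> sets borel" "A \<subseteq> \<Gamma>" for A
    using le[OF A] nn_integral_L2[OF L] L2_norm_sq[of lebesgue ?I ?h] by simp
qed

section \<open>The chosen trace and the continuous trace\<close>

definition tr :: "pt \<Rightarrow> real" where "tr = trace_on \<Omega> \<E> v"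

text \<open>Node values are taken of the continuous trace, since \<open>tr\<close> is determined only up to null sets.\<close>

definition tg :: "pt \<Rightarrow> real" where
  "tg = (\<lambda>x. indicator \<Gamma> x * (SOME g. g \<in> H1_interface \<E> \<and> is_trace \<Omega> \<E> v g) x)"

lemma tr_trace: "is_trace \<Omega> \<E> v tr"
  unfolding tr_def trace_on_def using trace_exists by (metis someI_ex)

lemma tg_props: "is_trace \<Omega> \<E> v tg" "tg \<in> borel_measurable borel" "continuous_on \<Gamma> tg"
  "E \<in> \<E> \<Longrightarrow> \<exists>h\<in>L2 lebesgue {0<..<diameter E}. weak_gradient {0<..<diameter E} (\<lambda>t. tg (arc_param E t)) h"
proof -
  let ?g = "SOME g. g \<in> H1_interface \<E> \<and> is_trace \<Omega> \<E> v g"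
  have "\<exists>g. g \<in> H1_interface \<E> \<and> is_trace \<Omega> \<E> v g" using trace_exists by blast
  from someI_ex[OF this] have g: "?g \<in> H1_interface \<E>" "is_trace \<Omega> \<E> v ?g" by auto
  show "is_trace \<Omega> \<E> v tg" "tg \<in> borel_measurable borel" unfolding tg_def using trace_borel[OF g(2)] by auto
  have "continuous_on \<Gamma> ?g" using g(1) interface unfolding H1_interface_def by (metis (no_types, lifting) mem_Collect_eq)
  then show "continuous_on \<Gamma> tg" by (rule continuous_on_eq) (simp add: tg_def)
  assume E: "E \<in> \<E>"
  have "(\<lambda>t. ?g (arc_param E t)) \<in> H1 {0<..<diameter E}" using g(1) E by (simp add: H1_interface_def)
  then obtain h where h: "h \<in> L2 lebesgue {0<..<diameter E}" "weak_gradient {0<..<diameter E} (\<lambda>t. ?g (arc_param E t)) h"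
    unfolding H1_def by blast
  have eq: "?g (arc_param E t) = tg (arc_param E t)" if "t \<in> {0<..<diameter E}" for t
    using arc_in[OF E, of t] \<E>_subset[OF E] that by (auto simp: tg_def indicator_def)
  have "(LINT t:{0<..<diameter E}|lebesgue. ?g (arc_param E t) *\<^sub>R f t) = (LINT t:{0<..<diameter E}|lebesgue. tg (arc_param E t) *\<^sub>R f t)" for f :: "real \<Rightarrow> real"
    unfolding set_lebesgue_integral_def using eq by (intro Bochner_Integration.integral_cong) (auto simp: indicator_def)
  then have "weak_gradient {0<..<diameter E} (\<lambda>t. tg (arc_param E t)) h" using h(2) by (simp add: weak_gradient_def)
  then show "\<exists>h\<in>L2 lebesgue {0<..<diameter E}. weak_gradient {0<..<diameter E} (\<lambda>t. tg (arc_param E t)) h" using h(1) by blast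
qed

lemma tr_eq_tg:
  assumes E: "E \<in> \<E>"
  shows "AE t in lborel. t \<in> {0..diameter E} \<longrightarrow> tr (arc_param E t) = tg (arc_param E t)"
proof -
  obtain a b where ab: "E = closed_segment a b" "a \<noteq> b" using edge_repr[OF E] by metis
  define t0 where "t0 = (\<lambda>x. indicator \<Gamma> x * tr x)"
  have t0: "is_trace \<Omega> \<E> v t0" "t0 \<in> borel_measurable borel" unfolding t0_def by (rule trace_borel[OF tr_trace])+
  note [measurable] = tg_props(2) t0(2) arc_measurable
  have "(sq_int lborel ({0..diameter E}) (\<lambda>t. t0 (arc_param E t) - tg (arc_param E t))) =
    ennreal (dist a b) * (sq_int lborel {0..1} (\<lambda>t. t0 (a + t *\<^sub>R (b - a)) - tg (a + t *\<^sub>R (b - a))))"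
    by (rule arc_integral[OF ab, where F = "\<lambda>x. ennreal ((t0 x - tg x)\<^sup>2)"]) measurable
  also have "\<dots> = 0"
    using trace_unique[OF t0 tg_props(1,2) E ab] by simp
  finally have z: "(sq_int lborel ({0..diameter E}) (\<lambda>t. t0 (arc_param E t) - tg (arc_param E t))) = 0" .
  have m: "(\<lambda>t. t0 (arc_param E t)) \<in> borel_measurable lborel" "(\<lambda>t. tg (arc_param E t)) \<in> borel_measurable lborel"
    using measurable_compose[OF arc_measurable t0(2)] measurable_compose[OF arc_measurable tg_props(2)] by simp_all
  from z have "AE t in lborel. ennreal ((t0 (arc_param E t) - tg (arc_param E t))\<^sup>2) * indicator {0..diameter E} t = 0"
    by (rule nn_integral_0_iff_AE[THEN iffD1, rotated]) (use m in measurable)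
  then show ?thesis
  proof eventually_elim
    case (elim t)
    show ?case
    proof
      assume t: "t \<in> {0..diameter E}"
      then have "arc_param E t \<in> \<Gamma>" using arc_in[OF E t] \<E>_subset[OF E] by blast
      then show "tr (arc_param E t) = tg (arc_param E t)" using elim t by (simp add: ennreal_eq_0_iff t0_def)
    qed
  qed
qed

lemma tr_measurable_edge:
  assumes E: "E \<in> \<E>"
  shows "set_borel_measurable lebesgue {0<..<diameter E} (\<lambda>t. tr (arc_param E t))"
    "set_borel_measurable lebesgue {0<..<diameter E} (\<lambda>t. tg (arc_param E t))"
proof -
  have *: "set_borel_measurable lebesgue {0<..<diameter E} (\<lambda>t. f (arc_param E t))" if "f \<in> borel_measurable borel" for f :: "pt \<Rightarrow> real"
    unfolding set_borel_measurable_def using measurable_compose[OF arc_measurable that] by (intro measurable_completion) simp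
  show "set_borel_measurable lebesgue {0<..<diameter E} (\<lambda>t. tg (arc_param E t))" by (rule *[OF tg_props(2)])
  have "(\<lambda>t. indicator {0<..<diameter E} t *\<^sub>R (indicator \<Gamma> (arc_param E t) * tr (arc_param E t))) = (\<lambda>t. indicator {0<..<diameter E} t *\<^sub>R tr (arc_param E t))"
    using arc_in[OF E] \<E>_subset[OF E] by (auto simp: fun_eq_iff indicator_def subset_iff)
  then show "set_borel_measurable lebesgue {0<..<diameter E} (\<lambda>t. tr (arc_param E t))"
    using *[OF trace_borel(2)[OF tr_trace]] by (simp add: set_borel_measurable_def)
qed

lemma tr_tgrad: "tgrad_spec tr (tangential_grad \<E> tr)"
proof (rule tgrad_exists)
  fix E assume E: "E \<in> \<E>"
  show "set_borel_measurable lebesgue {0<..<diameter E} (\<lambda>t. tr (arc_param E t))" by (rule tr_measurable_edge(1)[OF E])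
  obtain h where h: "h \<in> L2 lebesgue {0<..<diameter E}" "weak_gradient {0<..<diameter E} (\<lambda>t. tg (arc_param E t)) h" using tg_props(4)[OF E] by blast
  have "AE t in lebesgue. t \<in> {0<..<diameter E} \<longrightarrow> tg (arc_param E t) = tr (arc_param E t)"
    using AE_completion[OF tr_eq_tg[OF E]] by eventually_elim auto
  then have "weak_gradient {0<..<diameter E} (\<lambda>t. tr (arc_param E t)) h"
    by (intro weak_gradient_cong_AE[OF h(2) _ tr_measurable_edge(2)[OF E] tr_measurable_edge(1)[OF E] L2_measurable[OF h(1)] L2_measurable[OF h(1)]]) auto
  then show "\<exists>h\<in>L2 lebesgue {0<..<diameter E}. weak_gradient {0<..<diameter E} (\<lambda>t. tr (arc_param E t)) h" using h(1) by blast
qed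

text \<open>\<open>tr\<close> carries the tangential gradient, \<open>tg\<close> has values at
  points. They agree almost everywhere on edges, so the weak derivative of one is a weak derivative
  of the other, and it controls the increments of the continuous one.\<close>

lemma tg_increment:
  assumes E: "E \<in> \<E>" "E \<subseteq> A" "A \<in> sets borel" "A \<subseteq> \<Gamma>" and xy: "x \<in> E" "y \<in> E"
  shows "(tg x - tg y)\<^sup>2 \<le> H * (L2_norm (arc_length \<E>) A (tangential_grad \<E> tr))\<^sup>2"
proof -
  let ?G = "tangential_grad \<E> tr" and ?L = "diameter E"
  let ?h = "\<lambda>t. ?G (arc_param E t) \<bullet> tangent E"
  obtain a b where ab: "E = closed_segment a b" "a \<noteq> b" "?L \<le> H" using edge_repr[OF E(1)] by metis
  obtain s t where st: "s \<in> {0..?L}" "t \<in> {0..?L}" "x = arc_param E s" "y = arc_param E t"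
    using xy arc_param_image(1)[OF ab(1,2)] by blast
  have h: "?h \<in> L2 lebesgue {0<..<?L}" by (rule tgrad_L2_edge(1)[OF tr_tgrad E(1)])
  have w: "weak_gradient {0<..<?L} (\<lambda>t. tr (arc_param E t)) ?h" using tr_tgrad E(1) by (simp add: tgrad_spec_def)
  have "AE t in lebesgue. t \<in> {0<..<?L} \<longrightarrow> tr (arc_param E t) = tg (arc_param E t)"
    using AE_completion[OF tr_eq_tg[OF E(1)]] by eventually_elim auto
  then have w': "weak_gradient {0<..<?L} (\<lambda>t. tg (arc_param E t)) ?h"
    by (intro weak_gradient_cong_AE[OF w _ tr_measurable_edge[OF E(1)] L2_measurable[OF h] L2_measurable[OF h]]) auto
  have c: "continuous_on {0..?L} (\<lambda>t. tg (arc_param E t))"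
  proof (rule continuous_on_compose2[OF tg_props(3)])
    show "continuous_on {0..?L} (arc_param E)" unfolding arc_param_def by (intro continuous_intros)
    show "arc_param E ` {0..?L} \<subseteq> \<Gamma>" using arc_param_image(1)[OF ab(1,2)] \<E>_subset[OF E(1)] by simp
  qed
  have "(tg x - tg y)\<^sup>2 \<le> ?L * (LINT t:{0<..<?L}|lebesgue. (?h t)\<^sup>2)"
    unfolding st(3,4) by (rule weak_derivative_increment_sq[OF diameter_pos[OF E(1)] c h w' st(1,2)])
  also have "\<dots> \<le> H * (L2_norm (arc_length \<E>) A ?G)\<^sup>2"
  proof (rule mult_mono)
    have GA: "?G \<in> L2 (arc_length \<E>) A" using tr_tgrad E(3,4) unfolding tgrad_spec_def by (intro L2_subset[OF _ _ E(4)]) auto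
    show "(LINT t:{0<..<?L}|lebesgue. (?h t)\<^sup>2) \<le> (L2_norm (arc_length \<E>) A ?G)\<^sup>2"
      using tgrad_L2_edge(2)[OF tr_tgrad E(1,2,3,4)] nn_integral_L2[OF GA] by (simp add: ennreal_le_iff)
    show "0 \<le> (LINT t:{0<..<?L}|lebesgue. (?h t)\<^sup>2)"
      unfolding set_lebesgue_integral_def by (intro integral_nonneg_AE AE_I2) simp
  qed (use ab params in auto)
  finally show ?thesis .
qed

lemma card_edges_in:
  assumes T: "T \<in> \<T>"
  shows "card {E \<in> \<E>. E \<subseteq> T} \<le> 3"
proof -
  interpret triangle T using tri[OF T] .
  have "{E \<in> \<E>. E \<subseteq> T} \<subseteq> (\<lambda>p. convex hull (vertices T - {p})) ` vertices T"
    using edge_subset_edge[OF edges_\<E> T] edge_iff by blast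
  then have "card {E \<in> \<E>. E \<subseteq> T} \<le> card ((\<lambda>p. convex hull (vertices T - {p})) ` vertices T)"
    using vs(1) by (intro card_mono) auto
  also have "\<dots> \<le> 3" using card_image_le[OF vs(1)] card3 by metis
  finally show ?thesis .
qed

text \<open>An edge not contained in \<open>T\<close> meets it at most in its endpoints, a set of
  length zero; at most three edges remain.\<close>

lemma arc_triangle_le:
  assumes T: "T \<in> \<T>" and F[measurable]: "F \<in> borel_measurable borel"
    and b: "\<And>E. E \<in> \<E> \<Longrightarrow> E \<subseteq> T \<Longrightarrow> (\<integral>\<^sup>+t\<in>{0..diameter E}. F (arc_param E t) \<partial>lborel) \<le> B"
  shows "(\<integral>\<^sup>+x\<in>\<Gamma> \<inter> T. F x \<partial>arc_length \<E>) \<le> 3 * B"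
proof -
  have [measurable]: "\<Gamma> \<inter> T \<in> sets borel" using borel_interface borel_mem[OF T] by auto
  have e: "(\<integral>\<^sup>+t\<in>{0..diameter E}. F (arc_param E t) * indicator (\<Gamma> \<inter> T) (arc_param E t) \<partial>lborel) \<le> (if E \<subseteq> T then B else 0)" if E: "E \<in> \<E>" for E
  proof (cases "E \<subseteq> T")
    case True
    have "(\<integral>\<^sup>+t\<in>{0..diameter E}. F (arc_param E t) * indicator (\<Gamma> \<inter> T) (arc_param E t) \<partial>lborel) \<le> (\<integral>\<^sup>+t\<in>{0..diameter E}. F (arc_param E t) \<partial>lborel)"
      by (intro nn_integral_mono) (auto simp: indicator_def)
    then show ?thesis using b[OF E True] True by simp
  next
    case False
    obtain a c where ab: "E = closed_segment a c" "a \<noteq> c" using edge_repr[OF E] by metis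
    have ET: "E \<inter> T \<subseteq> {a, c}" using edge_Int_cases[OF edges_\<E>[OF E] ab(1) T] False by blast
    have "AE t in lborel. t \<noteq> 0" "AE t in lborel. t \<noteq> diameter E" by (rule AE_lborel_singleton)+
    then have "AE t in lborel. F (arc_param E t) * indicator (\<Gamma> \<inter> T) (arc_param E t) * indicator {0..diameter E} t = 0"
    proof eventually_elim
      case (elim t)
      show ?case
      proof (cases "t \<in> {0<..<diameter E}")
        case True
        then have "arc_param E t \<in> E - {a, c}" using arc_param_image(2)[OF ab] by blast
        then have "arc_param E t \<notin> T" using ET by blast
        then show ?thesis by simp
      qed (use elim in \<open>auto simp: indicator_def\<close>)
    qed
    then have "(\<integral>\<^sup>+t\<in>{0..diameter E}. F (arc_param E t) * indicator (\<Gamma> \<inter> T) (arc_param E t) \<partial>lborel) = (\<integral>\<^sup>+t. 0 \<partial>(lborel :: real measure))"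
      by (rule nn_integral_cong_AE)
    then show ?thesis by simp
  qed
  have "(\<integral>\<^sup>+x\<in>\<Gamma> \<inter> T. F x \<partial>arc_length \<E>) = (\<Sum>E\<in>\<E>. \<integral>\<^sup>+t\<in>{0..diameter E}. F (arc_param E t) * indicator (\<Gamma> \<inter> T) (arc_param E t) \<partial>lborel)"
    by (rule nn_integral_arc_length[OF finite_\<E>]) measurable
  also have "\<dots> \<le> (\<Sum>E\<in>\<E>. if E \<subseteq> T then B else 0)" by (intro sum_mono e)
  also have "\<dots> = (\<Sum>E\<in>{E \<in> \<E>. E \<subseteq> T}. B)" using finite_\<E> by (simp add: sum.If_cases Int_def)
  also have "\<dots> = of_nat (card {E \<in> \<E>. E \<subseteq> T}) * B" by simp
  also have "\<dots> \<le> of_nat 3 * B" using card_edges_in[OF T] by (intro mult_right_mono) (simp_all add: of_nat_le_iff del: of_nat_numeral)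
  finally show ?thesis by simp
qed

end

subsection \<open>Coefficients of the interpolant\<close>

lemma avg_sq_le:
  fixes f :: "'i \<Rightarrow> real"
  assumes S: "finite S" "S \<noteq> {}" and f: "\<And>i. i \<in> S \<Longrightarrow> (f i - m)\<^sup>2 \<le> B"
  shows "(1 / real (card S) * (\<Sum>i\<in>S. f i) - m)\<^sup>2 \<le> B"
proof -
  have c: "real (card S) > 0" using S by (simp add: card_gt_0_iff)
  have a: "\<bar>f i - m\<bar> \<le> sqrt B" if "i \<in> S" for i using real_sqrt_le_mono[OF f[OF that]] by simp
  have "1 / real (card S) * (\<Sum>i\<in>S. f i) - m = (\<Sum>i\<in>S. f i - m) / real (card S)"
    using c by (simp add: sum_subtractf field_simps)
  also have "\<bar>\<dots>\<bar> = \<bar>\<Sum>i\<in>S. f i - m\<bar> / real (card S)" by simp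
  finally have "\<bar>1 / real (card S) * (\<Sum>i\<in>S. f i) - m\<bar> = \<bar>\<Sum>i\<in>S. f i - m\<bar> / real (card S)" .
  moreover have "\<bar>\<Sum>i\<in>S. f i - m\<bar> \<le> real (card S) * sqrt B"
    using a by (intro order_trans[OF sum_abs sum_bounded_above]) auto
  ultimately have le: "\<bar>1 / real (card S) * (\<Sum>i\<in>S. f i) - m\<bar> \<le> sqrt B" using c by (simp add: field_simps)
  have "B \<ge> 0" using f S(2) zero_le_power2 order_trans by blast
  have "\<bar>1 / real (card S) * (\<Sum>i\<in>S. f i) - m\<bar>\<^sup>2 \<le> (sqrt B)\<^sup>2" using le by (intro power_mono) auto
  then show ?thesis using \<open>B \<ge> 0\<close> by simp
qed

lemma nn_integral_Icc_bound:
  assumes "AE t in lborel. t \<in> {0..L} \<longrightarrow> F t \<le> ennreal b" "0 \<le> L" "L \<le> H" "b \<ge> 0"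
  shows "(\<integral>\<^sup>+t\<in>{0..L::real}. F t \<partial>lborel) \<le> ennreal (H * b)"
proof -
  have "(\<integral>\<^sup>+t\<in>{0..L}. F t \<partial>lborel) \<le> (\<integral>\<^sup>+t. ennreal b * indicator {0..L} t \<partial>lborel)"
    using assms(1) by (intro nn_integral_mono_AE) (auto elim!: eventually_mono simp: indicator_def)
  also have "\<dots> = ennreal b * ennreal L" using assms(2) by (simp add: nn_integral_cmult)
  also have "\<dots> = ennreal (b * L)" using assms by (simp add: ennreal_mult)
  also have "\<dots> \<le> ennreal (H * b)" using mult_left_mono[OF assms(3,4)] by (intro ennreal_leI) (simp add: mult.commute)
  finally show ?thesis .
qed

context mesh
begin

text \<open>\<open>K1\<close> to \<open>K4\<close> have the form 4 \<gamma>^2 c / 3 that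
  \<open>div_area\<close> produces, with c = 6 C1, 4 C2, 12 C2 and 34 K1. In \<open>K5\<close> the
  number 432 is the product of 18 from the inverse estimate on an edge, 3 for the edges of a
  triangle, 4 from \<open>tg_element\<close> and 2 from H / \<rho> = 2 \<gamma>.\<close>

definition "K1 = 8 * \<gamma>\<^sup>2 * C1"
definition "K2 = 16 * \<gamma>\<^sup>2 * C2 / 3"
definition "K3 = 16 * \<gamma>\<^sup>2 * C2"
definition "K4 = 136 * \<gamma>\<^sup>2 * K1 / 3"
definition "K5 = 432 * \<gamma>"
text \<open>Large enough for every kind of node: \<open>K4\<close> belongs to free nodes off the
  interface, \<open>K2\<close> to fixed nodes and the rest to free nodes on the interface. The last
  summand dominates \<open>(2 * K5 + 4) * H\<close>.\<close>

definition "K6 = K4 + K2 + 2 * K3 + (2 * K5 + 4) * (\<gamma> * diameter (closure \<Omega>))"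

lemma K_pos: "K1 \<ge> 0" "K2 \<ge> 0" "K3 \<ge> 0" "K4 \<ge> 0" "K5 \<ge> 0" "K6 \<ge> 0"
proof -
  show K: "K1 \<ge> 0" "K2 \<ge> 0" "K3 \<ge> 0" "K4 \<ge> 0" "K5 \<ge> 0"
    unfolding K1_def K2_def K3_def K4_def K5_def using const_pos params by auto
  have "0 \<le> \<gamma> * diameter (closure \<Omega>)" using H_le params by linarith
  then show "K6 \<ge> 0" using K unfolding K6_def by (intro add_nonneg_nonneg mult_nonneg_nonneg[of "2 * K5 + 4"]) auto
qed

lemma H_div: "H\<^sup>2 / \<rho>\<^sup>2 = 4 * \<gamma>\<^sup>2" "H / \<rho> = 2 * \<gamma>"
proof -
  have "H / \<rho> = 2 * \<gamma>" using arg_cong[OF params(5), of "\<lambda>h. h / \<rho>"] params(3) by simp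
  then show "H / \<rho> = 2 * \<gamma>" "H\<^sup>2 / \<rho>\<^sup>2 = 4 * \<gamma>\<^sup>2" by (auto simp: power_divide[symmetric] power_mult_distrib)
qed

end

section \<open>A fixed element: deviations from its mean value\<close>

locale mesh_element = mesh_function \<Omega> \<T> \<gamma> H \<Gamma> v for \<Omega> \<T> \<gamma> H \<Gamma> v +
  fixes T :: "pt set"
  assumes T: "T \<in> \<T>"
begin

definition m :: real where "m = (LINT x:T|lebesgue. v x) / measure lebesgue T"
definition DU :: real where "DU = (L2_norm lebesgue (patch \<T> T) (grad \<Omega> v))\<^sup>2"
definition GU :: real where "GU = (L2_norm (arc_length \<E>) (patch \<T> T \<inter> \<Gamma>) (tangential_grad \<E> tr))\<^sup>2"

lemma DU_nonneg: "DU \<ge> 0" and GU_nonneg: "GU \<ge> 0" by (simp_all add: DU_def GU_def)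

lemma patch_sub: "T' \<in> \<T> \<Longrightarrow> N \<in> T \<Longrightarrow> N \<in> T' \<Longrightarrow> T' \<subseteq> patch \<T> T"
  unfolding patch_def by blast

lemma borel_patch: "patch \<T> T \<in> sets borel"
  unfolding patch_def using finite_mesh borel_mem by (intro sets.finite_Union) auto

lemma grad_patch: "grad \<Omega> v \<in> L2 lebesgue (patch \<T> T)"
proof (rule L2_add_null_set[OF grad_v(1)])
  show "patch \<T> T \<subseteq> \<Omega> \<union> frontier \<Omega>" using Union_mesh by (auto simp: closure_Un_frontier patch_def)
qed (use borel_patch negligible_frontier_dom in auto)

lemma AE_dom:
  assumes "S \<subseteq> \<Union>\<T>" shows "AE x in lebesgue. x \<in> S \<longrightarrow> x \<in> \<Omega>"
proof -
  have "AE x in lebesgue. x \<notin> frontier \<Omega>" using negligible_frontier_dom by (intro AE_not_in) (simp add: negligible_iff_null_sets)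
  then show ?thesis
  proof eventually_elim
    case (elim x)
    then show ?case using assms Union_mesh by (auto simp: closure_Un_frontier)
  qed
qed

lemma energy_le_DU:
  assumes "N \<in> T"
  shows "energy g0 N 1 \<le> ennreal DU"
proof -
  have sub: "star N \<inter> cball N (1 * H) \<subseteq> patch \<T> T"
    using patch_sub[OF _ assms] by (auto simp: star_def elements_at_def)
  have "AE x in lebesgue. x \<in> patch \<T> T \<longrightarrow> x \<in> \<Omega>" by (rule AE_dom) (auto simp: patch_def)
  with g0(2) have ae: "AE x in lebesgue. x \<in> patch \<T> T \<longrightarrow> grad \<Omega> v x = g0 x" by eventually_elim blast
  have "energy g0 N 1 = (sq_int lebesgue (star N \<inter> cball N (1 * H)) (\<lambda>z. norm (g0 z)))"
    unfolding energy_def by (simp add: nn_integral_completion)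
  also have "\<dots> \<le> (sq_int lebesgue (patch \<T> T) (\<lambda>z. norm (grad \<Omega> v z)))"
    using ae
  proof (intro nn_integral_mono_AE, eventually_elim)
    case (elim x)
    then show ?case using sub by (auto simp: indicator_def)
  qed
  also have "\<dots> = ennreal DU" unfolding DU_def by (rule nn_integral_L2[OF grad_patch])
  finally show ?thesis .
qed

lemma v_element:
  assumes "T' \<in> \<T>"
  shows "v \<in> L2 lebesgue T'" "AE x in lebesgue. x \<in> T' \<longrightarrow> v x = v0 x"
proof -
  show "v \<in> L2 lebesgue T'"
  proof (rule L2_add_null_set[OF v_L2])
    show "T' \<subseteq> \<Omega> \<union> frontier \<Omega>" using Union_mesh assms by (auto simp: closure_Un_frontier)
  qed (use borel_mem[OF assms] negligible_frontier_dom in auto)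
  have "AE x in lebesgue. x \<in> T' \<longrightarrow> x \<in> \<Omega>" using assms by (intro AE_dom) auto
  with v0(2) show "AE x in lebesgue. x \<in> T' \<longrightarrow> v x = v0 x" by eventually_elim blast
qed

lemma const_L2: "A \<in> fmeasurable M \<Longrightarrow> (\<lambda>_. c::real) \<in> L2 M A"
  by (intro L2_bounded[of _ _ _ "\<bar>c\<bar>"]) (auto simp: set_borel_measurable_def fmeasurableD)

lemma nn_integral_v0:
  assumes "T' \<in> \<T>"
  shows "(sq_int lborel T' (\<lambda>z. v0 z - c)) = ennreal (LINT z:T'|lebesgue. (v z - c)\<^sup>2)"
proof -
  have "(sq_int lborel T' (\<lambda>z. v0 z - c)) = (sq_int lebesgue T' (\<lambda>z. norm (v z - c)))"
    unfolding nn_integral_completion[of lborel, symmetric]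
    using v_element(2)[OF assms] by (intro nn_integral_cong_AE) (auto elim!: eventually_mono simp: indicator_def)
  also have "\<dots> = ennreal ((L2_norm lebesgue T' (\<lambda>z. v z - c))\<^sup>2)"
    by (intro nn_integral_L2 L2_diff v_element(1) const_L2 measure_tri assms)
  finally show ?thesis by (simp add: L2_norm_sq)
qed

lemma area: "3 * \<rho>\<^sup>2 \<le> measure lebesgue T'" "measure lebesgue T' \<le> 4 * H\<^sup>2" "measure lebesgue T' > 0" if "T' \<in> \<T>" for T'
proof -
  show "3 * \<rho>\<^sup>2 \<le> measure lebesgue T'" "measure lebesgue T' \<le> 4 * H\<^sup>2" using measure_tri[OF that] by auto
  moreover have "0 < 3 * \<rho>\<^sup>2" using params by simp
  ultimately show "measure lebesgue T' > 0" by linarith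
qed

text \<open>Cauchy-Schwarz against the constant 1, since the integral of v - c over \<open>T\<close>
  is the area times m - c.\<close>

lemma mean_sq_le: "measure lebesgue T * (m - c)\<^sup>2 \<le> (LINT z:T|lebesgue. (v z - c)\<^sup>2)"
proof -
  let ?A = "measure lebesgue T"
  note Tm = measure_tri(3)[OF T]
  have L: "(\<lambda>z. v z - c) \<in> L2 lebesgue T" by (intro L2_diff v_element(1) const_L2 Tm T)
  have i: "set_integrable lebesgue T (\<lambda>z. v z - c)" "set_integrable lebesgue T v" "set_integrable lebesgue T (\<lambda>_. c)"
    using L v_element(1)[OF T] const_L2[OF Tm] by (auto intro: set_integrable_L2_lmeasurable Tm)
  have one: "(LINT z:T|lebesgue. (1::real)) = ?A"
    unfolding set_lebesgue_integral_def using Tm by simp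
  have "(LINT z:T|lebesgue. (v z - c) * 1)\<^sup>2 \<le> (LINT z:T|lebesgue. (v z - c)\<^sup>2) * (LINT z:T|lebesgue. 1\<^sup>2)"
    using L2_integrable[OF L] L2_integrable[OF const_L2[OF Tm, of 1]] i(1) by (intro Cauchy_Schwarz_set_integral) simp_all
  moreover have "(LINT z:T|lebesgue. v z - c) = ?A * (m - c)"
  proof -
    have "(LINT z:T|lebesgue. v z - c) = (LINT z:T|lebesgue. v z) - (LINT z:T|lebesgue. c)" by (rule set_integral_diff(2)[OF i(2,3)])
    also have "(LINT z:T|lebesgue. c) = c * ?A"
      unfolding set_lebesgue_integral_def using Tm by simp
    finally have "(LINT z:T|lebesgue. v z - c) = (LINT z:T|lebesgue. v z) - c * ?A" .
    moreover have "?A * m = (LINT z:T|lebesgue. v z)" using area(3)[OF T] by (simp add: m_def)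
    ultimately show ?thesis by (simp only: right_diff_distrib) (simp add: mult.commute)
  qed
  ultimately have "?A * (?A * (m - c)\<^sup>2) \<le> ?A * (LINT z:T|lebesgue. (v z - c)\<^sup>2)"
    using one by (simp add: power_mult_distrib power2_eq_square[of ?A] ac_simps)
  then show ?thesis using area(3)[OF T] by (simp only: mult_le_cancel_left_pos)
qed

lemma mean_sq_nn_le: "ennreal (measure lebesgue T * (m - c)\<^sup>2) \<le> (sq_int lborel T (\<lambda>z. v0 z - c))"
  unfolding nn_integral_v0[OF T] by (rule ennreal_leI[OF mean_sq_le])

text \<open>The area is at least 3 \<rho>^2, and H^2 / \<rho>^2 = 4 \<gamma>^2.\<close>

lemma div_area:
  assumes "measure lebesgue T' * x \<le> c * H\<^sup>2 * d" "T' \<in> \<T>" "c \<ge> 0" "d \<ge> 0"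
  shows "x \<le> 4 * \<gamma>\<^sup>2 * c / 3 * d"
proof -
  have "x \<le> c * H\<^sup>2 * d / measure lebesgue T'" using assms(1) area(3)[OF assms(2)] by (simp add: field_simps)
  also have "\<dots> \<le> c * H\<^sup>2 * d / (3 * \<rho>\<^sup>2)" using area[OF assms(2)] assms params by (intro divide_left_mono) auto
  also have "\<dots> = 4 * \<gamma>\<^sup>2 * c / 3 * d"
    unfolding H_div(1)[symmetric] by (simp add: ac_simps)
  finally show ?thesis .
qed

text \<open>For fixed \<open>x\<close> the area of \<open>T\<close> times the squared distance of v
  x from the mean is at most the integral of (v x - v y)^2 over \<open>y\<close> in
  \<open>T\<close>. Integrating over \<open>x\<close> in \<open>T'\<close> leaves the double
  integral of \<open>v_double_estimate\<close>.\<close>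

lemma element_deviation:
  assumes N: "N \<in> nodes \<T>" "N \<in> T" and T': "T' \<in> \<T>" "N \<in> T'"
  shows "(LINT z:T'|lebesgue. (v z - m)\<^sup>2) \<le> K1 * H\<^sup>2 * DU"
proof -
  note [measurable] = v0(1) borel_mem[OF T] borel_mem[OF T'(1)]
  let ?A = "measure lebesgue T"
  have "ennreal ?A * ennreal (LINT z:T'|lebesgue. (v z - m)\<^sup>2) = ennreal ?A * (sq_int lborel T' (\<lambda>x. v0 x - m))"
    by (simp add: nn_integral_v0[OF T'(1)])
  also have "\<dots> = (\<integral>\<^sup>+x. ennreal ?A * (ennreal ((v0 x - m)\<^sup>2) * indicator T' x) \<partial>lborel)"
    by (rule nn_integral_cmult[symmetric]) measurable
  also have "\<dots> \<le> (\<integral>\<^sup>+x\<in>T'. (sq_int lborel T (\<lambda>y. v0 x - v0 y)) \<partial>lborel)"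
  proof (rule nn_integral_mono)
    fix x
    have "ennreal ?A * ennreal ((v0 x - m)\<^sup>2) = ennreal (?A * (m - v0 x)\<^sup>2)" by (simp add: ennreal_mult power2_commute)
    also have "\<dots> \<le> (sq_int lborel T (\<lambda>y. v0 x - v0 y))" using mean_sq_nn_le[of "v0 x"] by (simp add: power2_commute)
    finally show "ennreal ?A * (ennreal ((v0 x - m)\<^sup>2) * indicator T' x) \<le> (sq_int lborel T (\<lambda>y. v0 x - v0 y)) * indicator T' x"
      by (auto simp: indicator_def)
  qed
  also have "\<dots> = dbl v0 T' T" by (simp add: dbl_def)
  also have "\<dots> \<le> ennreal (6 * C1 * H ^ 4) * energy g0 N 1" by (rule v_double_estimate[OF N(1) T N(2) T'])
  also have "\<dots> \<le> ennreal (6 * C1 * H ^ 4) * ennreal DU" by (intro mult_left_mono energy_le_DU[OF N(2)]) simp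
  finally have "ennreal (?A * (LINT z:T'|lebesgue. (v z - m)\<^sup>2)) \<le> ennreal (6 * C1 * H ^ 4 * DU)"
    using const_pos DU_nonneg area(3)[OF T] by (subst ennreal_mult') (simp_all add: ennreal_mult)
  then have "?A * (LINT z:T'|lebesgue. (v z - m)\<^sup>2) \<le> 6 * C1 * H ^ 4 * DU"
    using const_pos DU_nonneg by (subst (asm) ennreal_le_iff) auto
  also have "\<dots> = (6 * C1 * H\<^sup>2) * H\<^sup>2 * DU" by (simp add: power2_eq_square power4_eq_xxxx)
  finally have "(LINT z:T'|lebesgue. (v z - m)\<^sup>2) \<le> 4 * \<gamma>\<^sup>2 * (6 * C1 * H\<^sup>2) / 3 * DU"
    by (rule div_area) (use T const_pos DU_nonneg in auto)
  then show ?thesis by (simp add: K1_def ac_simps)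
qed

lemma mean_frontier:
  assumes N: "N \<in> nodes \<T>" "N \<in> T" "N \<in> frontier \<Omega>"
  shows "m\<^sup>2 \<le> K2 * DU"
proof -
  have "ennreal (measure lebesgue T * (m - 0)\<^sup>2) \<le> (sq_int lborel T (\<lambda>z. v0 z))" using mean_sq_nn_le[of 0] by simp
  also have "\<dots> \<le> ennreal (4 * C2 * H\<^sup>2) * energy g0 N 1" by (rule v_friedrichs[OF N(1,3) T N(2)])
  also have "\<dots> \<le> ennreal (4 * C2 * H\<^sup>2) * ennreal DU" by (intro mult_left_mono energy_le_DU[OF N(2)]) simp
  also have "\<dots> = ennreal (4 * C2 * H\<^sup>2 * DU)" using const_pos DU_nonneg by (simp add: ennreal_mult)
  finally have "measure lebesgue T * m\<^sup>2 \<le> 4 * C2 * H\<^sup>2 * DU"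
    using const_pos DU_nonneg by (subst (asm) ennreal_le_iff) auto
  then have "m\<^sup>2 \<le> 4 * \<gamma>\<^sup>2 * (4 * C2) / 3 * DU" by (rule div_area) (use T const_pos DU_nonneg in auto)
  then show ?thesis by (simp add: K2_def ac_simps)
qed

lemma edge_patch:
  assumes E: "E \<in> \<E>" and p: "p \<in> E" "p \<in> T"
  shows "E \<subseteq> patch \<T> T \<inter> \<Gamma>"
proof -
  obtain T' where T': "T' \<in> \<T>" "E edge_of T'" using edges_\<E>[OF E] by (auto simp: edges_def)
  have "E \<subseteq> T'" using T'(2) edge_of_imp_subset by blast
  then show ?thesis using patch_sub[OF T'(1) p(2)] p(1) \<E>_subset[OF E] by blast
qed

lemma tg_edge:
  assumes E: "E \<in> \<E>" "E \<subseteq> patch \<T> T" and xy: "x \<in> E" "y \<in> E"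
  shows "(tg x - tg y)\<^sup>2 \<le> H * GU"
  unfolding GU_def using E \<E>_subset[OF E(1)] borel_patch borel_interface by (intro tg_increment[OF E(1) _ _ _ xy]) auto

text \<open>The value at \<open>N\<close> is exchanged for values along the edge, at the cost of 2 H
  GU, and these are compared with values in \<open>T\<close>. The term with \<open>GU\<close> keeps
  a factor H that the other one lacks; \<open>K6\<close> disposes of it through the diameter of the
  domain.\<close>

lemma tg_mean:
  assumes E: "E \<in> \<E>" and N: "N \<in> nodes \<T>" "N \<in> E" "N \<in> T"
  shows "(tg N - m)\<^sup>2 \<le> K3 * DU + 2 * H * GU"
proof -
  obtain a b where ab: "E = closed_segment a b" "a \<noteq> b" using edge_repr[OF E] by metis
  have EU: "E \<subseteq> patch \<T> T" using edge_patch[OF E N(2,3)] by blast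
  note [measurable] = v0(1) tg_props(2) borel_mem[OF T]
  let ?A = "measure lebesgue T" and ?e = "\<lambda>t. a + t *\<^sub>R (b - a)"
  have [measurable]: "?e \<in> borel_measurable borel" by (intro borel_measurable_continuous_onI continuous_intros)
  have eE: "?e t \<in> E" if "t \<in> {0..1}" for t
  proof -
    have "(1 - t) *\<^sub>R a + t *\<^sub>R b \<in> E" unfolding ab(1) in_segment(1) using that by (intro exI[of _ t]) auto
    then show ?thesis by (auto simp: algebra_simps)
  qed
  have z: "ennreal ((v0 z - tg N)\<^sup>2) \<le> 2 * (sq_int lborel {0..1} (\<lambda>t. tg (?e t) - v0 z)) + ennreal (2 * H * GU)" for z
  proof -
    have "ennreal ((v0 z - tg N)\<^sup>2) = (\<integral>\<^sup>+t. ennreal ((v0 z - tg N)\<^sup>2) * indicator {0..1::real} t \<partial>lborel)"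
      by (simp add: nn_integral_cmult)
    also have "\<dots> \<le> (\<integral>\<^sup>+t. 2 * (ennreal ((tg (?e t) - v0 z)\<^sup>2) * indicator {0..1} t) + ennreal (2 * H * GU) * indicator {0..1} t \<partial>lborel)"
    proof (rule nn_integral_mono)
      fix t :: real
      show "ennreal ((v0 z - tg N)\<^sup>2) * indicator {0..1} t \<le> 2 * (ennreal ((tg (?e t) - v0 z)\<^sup>2) * indicator {0..1} t) + ennreal (2 * H * GU) * indicator {0..1} t"
      proof (cases "t \<in> {0..1}")
        case True
        have "(v0 z - tg N)\<^sup>2 \<le> 2 * (tg (?e t) - v0 z)\<^sup>2 + 2 * H * GU"
          using real_sq_triangle[of "v0 z" "tg N" "tg (?e t)"] tg_edge[OF E EU eE[OF True] N(2)] by (simp add: power2_commute)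
        then have "ennreal ((v0 z - tg N)\<^sup>2) \<le> ennreal (2 * (tg (?e t) - v0 z)\<^sup>2 + 2 * H * GU)" by (rule ennreal_leI)
        then show ?thesis using True params GU_nonneg by (simp add: ennreal_mult)
      qed simp
    qed
    also have "\<dots> = 2 * (sq_int lborel {0..1} (\<lambda>t. tg (?e t) - v0 z)) + ennreal (2 * H * GU)"
      by (subst nn_integral_add, measurable) (simp add: nn_integral_cmult)
    finally show ?thesis .
  qed
  have "ennreal (?A * (m - tg N)\<^sup>2) \<le> (sq_int lborel T (\<lambda>z. v0 z - tg N))" by (rule mean_sq_nn_le)
  also have "\<dots> \<le> (\<integral>\<^sup>+z. 2 * ((sq_int lborel {0..1} (\<lambda>t. tg (?e t) - v0 z)) * indicator T z) + ennreal (2 * H * GU) * indicator T z \<partial>lborel)"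
    using z by (intro nn_integral_mono) (auto simp: indicator_def)
  also have "\<dots> = 2 * (\<integral>\<^sup>+z\<in>T. (sq_int lborel {0..1} (\<lambda>t. tg (?e t) - v0 z)) \<partial>lborel) + ennreal (2 * H * GU) * emeasure lborel T"
    by (subst nn_integral_add, measurable) (simp add: nn_integral_cmult)
  also have "\<dots> \<le> 2 * (ennreal (6 * C2 * H\<^sup>2) * ennreal DU) + ennreal (2 * H * GU) * ennreal ?A"
  proof (intro add_mono mult_left_mono)
    have "(\<integral>\<^sup>+z\<in>T. (sq_int lborel {0..1} (\<lambda>t. tg (?e t) - v0 z)) \<partial>lborel) \<le> ennreal (6 * C2 * H\<^sup>2) * energy g0 N 1"
      by (rule v_trace_estimate[OF tg_props(1,2) E ab N(1,2) T N(3)])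
    also have "\<dots> \<le> ennreal (6 * C2 * H\<^sup>2) * ennreal DU" by (intro mult_left_mono energy_le_DU N) simp
    finally show "(\<integral>\<^sup>+z\<in>T. (sq_int lborel {0..1} (\<lambda>t. tg (?e t) - v0 z)) \<partial>lborel) \<le> ennreal (6 * C2 * H\<^sup>2) * ennreal DU" .
  qed (auto simp: emeasure_tri[OF T])
  also have "\<dots> = ennreal (12 * C2 * H\<^sup>2 * DU + 2 * H * GU * ?A)"
  proof -
    have "0 \<le> 6 * C2 * H\<^sup>2 * DU" "0 \<le> 2 * H * GU * ?A" using const_pos params DU_nonneg GU_nonneg by auto
    moreover have "ennreal (2 * X + Y) = 2 * ennreal X + ennreal Y" if "0 \<le> X" "0 \<le> Y" for X Y
      using that by (simp add: ennreal_mult)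
    ultimately have "ennreal (2 * (6 * C2 * H\<^sup>2 * DU) + 2 * H * GU * ?A) = 2 * ennreal (6 * C2 * H\<^sup>2 * DU) + ennreal (2 * H * GU * ?A)"
      by blast
    moreover have "12 * C2 * H\<^sup>2 * DU = 2 * (6 * C2 * H\<^sup>2 * DU)" by simp
    moreover have "ennreal (6 * C2 * H\<^sup>2 * DU) = ennreal (6 * C2 * H\<^sup>2) * ennreal DU" "ennreal (2 * H * GU * ?A) = ennreal (2 * H * GU) * ennreal ?A"
      using const_pos params DU_nonneg GU_nonneg by (intro ennreal_mult; simp)+
    ultimately show ?thesis by (simp only:)
  qed
  finally have "?A * (m - tg N)\<^sup>2 \<le> 12 * C2 * H\<^sup>2 * DU + 2 * H * GU * ?A"
    using const_pos params DU_nonneg GU_nonneg by (subst (asm) ennreal_le_iff) auto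
  \<comment> \<open>The term with \<open>GU\<close> already contains the area as a factor, so it is
    moved to the left before the division.\<close>
  then have "?A * ((m - tg N)\<^sup>2 - 2 * H * GU) \<le> 12 * C2 * H\<^sup>2 * DU" by (simp add: algebra_simps)
  then have "(m - tg N)\<^sup>2 - 2 * H * GU \<le> 4 * \<gamma>\<^sup>2 * (12 * C2) / 3 * DU" by (rule div_area) (use T const_pos DU_nonneg in auto)
  then show ?thesis by (simp add: K3_def ac_simps power2_commute)
qed

end

lemma (in triangle) edges_meet:
  assumes "E edge_of T" "E' edge_of T"
  obtains p where "p \<in> E" "p \<in> E'"
proof -
  obtain a b where ab: "E = convex hull (vertices T - {a})" "E' = convex hull (vertices T - {b})" using assms edge_iff by metis
  have "card {a, b} \<le> 2" by (simp add: card_insert_if)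
  then have "vertices T - {a, b} \<noteq> {}"
    using card3 card_mono[of "{a, b}" "vertices T"] by auto
  then obtain p where p: "p \<in> vertices T" "p \<noteq> a" "p \<noteq> b" by blast
  show ?thesis
    by (rule that[of p]) (use p ab in \<open>auto intro: hull_inc\<close>)
qed

section \<open>The interpolant as a piecewise linear function\<close>

context mesh_function
begin

text \<open>The value 0 at fixed nodes turns the interpolant into \<open>pl coef\<close>, a sum over
  all nodes, so that on each element it is a combination of barycentric coordinates.\<close>

definition coef :: "pt \<Rightarrow> real" where
  "coef N = (if N \<notin> free_nodes \<Omega> \<T> then 0
     else if interface_elements_at \<T> \<Gamma> N \<noteq> {} then
       1 / real (card (interface_elements_at \<T> \<Gamma> N)) *
       (\<Sum>T\<in>interface_elements_at \<T> \<Gamma> N. LINT y:\<Gamma> \<inter> T|arc_length \<E>. dual_basis (arc_length \<E>) \<T> N (\<Gamma> \<inter> T) y * tr y)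
     else 1 / real (card (elements_at \<T> N)) * (\<Sum>T\<in>elements_at \<T> N. LINT y:T|lebesgue. dual_basis lebesgue \<T> N T y * v y))"

lemma interpolation_eq: "interpolation \<Omega> \<T> \<Gamma> v = pl coef"
proof
  fix x
  let ?A = "{N \<in> free_nodes \<Omega> \<T>. interface_elements_at \<T> \<Gamma> N \<noteq> {}}"
  let ?B = "{N \<in> free_nodes \<Omega> \<T>. interface_elements_at \<T> \<Gamma> N = {}}"
  have sub: "?A \<union> ?B \<subseteq> nodes \<T>" by (auto simp: free_nodes_def)
  then have fin: "finite ?A" "finite ?B" using finite_nodes finite_subset by auto
  have "pl coef x = (\<Sum>N\<in>?A \<union> ?B. coef N * hat N x)"
    unfolding pl_def by (rule sum.mono_neutral_right[OF finite_nodes sub]) (auto simp: coef_def)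
  also have "\<dots> = (\<Sum>N\<in>?A. coef N * hat N x) + (\<Sum>N\<in>?B. coef N * hat N x)"
    by (rule sum.union_disjoint[OF fin]) auto
  also have "\<dots> = interpolation \<Omega> \<T> \<Gamma> v x"
    unfolding interpolation_def
  proof (intro arg_cong2[where f = "(+)"] sum.cong refl)
    fix N assume N: "N \<in> ?A"
    then have "N \<in> nodes \<T>" using sub by blast
    then show "coef N * hat N x = 1 / real (card (interface_elements_at \<T> \<Gamma> N)) *
        (\<Sum>T\<in>interface_elements_at \<T> \<Gamma> N.
           LINT y:\<Gamma> \<inter> T|arc_length \<E>. dual_basis (arc_length \<E>) \<T> N (\<Gamma> \<inter> T) y * trace_on \<Omega> \<E> v y) * nodal_basis \<T> N x"
      using N by (simp add: coef_def tr_def nodal_basis_eq)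
  next
    fix N assume N: "N \<in> ?B"
    then have "N \<in> nodes \<T>" using sub by blast
    then show "coef N * hat N x = 1 / real (card (elements_at \<T> N)) *
        (\<Sum>T\<in>elements_at \<T> N. LINT y:T|lebesgue. dual_basis lebesgue \<T> N T y * v y) * nodal_basis \<T> N x"
      using N by (simp add: coef_def nodal_basis_eq)
  qed
  finally show "interpolation \<Omega> \<T> \<Gamma> v x = pl coef x" by simp
qed

text \<open>Bounds at points are available for \<open>tg\<close>; since \<open>tr\<close> agrees
  with it almost everywhere on each edge, they integrate to a bound for \<open>tr\<close> over at
  most three edges of length at most \<open>H\<close>. The function \<open>f\<close> will be a
  constant or the interpolant.\<close>

lemma arc_deviation:
  assumes f[measurable]: "f \<in> borel_measurable borel" and T: "T \<in> \<T>" and b0: "b \<ge> 0"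
    and b: "\<And>E x. E \<in> \<E> \<Longrightarrow> E \<subseteq> T \<Longrightarrow> x \<in> E \<Longrightarrow> (tg x - f x)\<^sup>2 \<le> b"
  shows "(sq_int (arc_length \<E>) (\<Gamma> \<inter> T) (\<lambda>x. norm (tr x - f x))) \<le> ennreal (3 * (H * b))"
proof -
  define t0 where "t0 = (\<lambda>x. indicator \<Gamma> x * tr x)"
  have [measurable]: "t0 \<in> borel_measurable borel" unfolding t0_def by (rule trace_borel(2)[OF tr_trace])
  have "(sq_int (arc_length \<E>) (\<Gamma> \<inter> T) (\<lambda>x. norm (tr x - f x))) = (sq_int (arc_length \<E>) (\<Gamma> \<inter> T) (\<lambda>x. t0 x - f x))"
    by (intro nn_integral_cong) (auto simp: t0_def indicator_def)
  also have "\<dots> \<le> 3 * ennreal (H * b)"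
  proof (rule arc_triangle_le[OF T])
    fix E assume E: "E \<in> \<E>" "E \<subseteq> T"
    obtain L: "0 \<le> diameter E" "diameter E \<le> H" using edge_repr[OF E(1)] diameter_pos[OF E(1)] by (metis less_imp_le)
    show "(sq_int lborel ({0..diameter E}) (\<lambda>t. t0 (arc_param E t) - f (arc_param E t))) \<le> ennreal (H * b)"
    proof (rule nn_integral_Icc_bound[OF _ L b0])
      show "AE t in lborel. t \<in> {0..diameter E} \<longrightarrow> ennreal ((t0 (arc_param E t) - f (arc_param E t))\<^sup>2) \<le> ennreal b"
        using tr_eq_tg[OF E(1)]
      proof eventually_elim
        case (elim t)
        show ?case
        proof
          assume t: "t \<in> {0..diameter E}"
          have i: "arc_param E t \<in> E" by (rule arc_in[OF E(1) t])
          then have "t0 (arc_param E t) = tg (arc_param E t)" using elim t \<E>_subset[OF E(1)] by (auto simp: t0_def)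
          then show "ennreal ((t0 (arc_param E t) - f (arc_param E t))\<^sup>2) \<le> ennreal b" using b[OF E i] by (simp add: ennreal_leI)
        qed
      qed
    qed
  qed measurable
  also have "\<dots> = ennreal (3 * (H * b))" using b0 params by (simp add: ennreal_mult)
  finally show ?thesis .
qed

lemma tr_L2: "T \<in> \<T> \<Longrightarrow> tr \<in> L2 (arc_length \<E>) (\<Gamma> \<inter> T)"
proof (rule L2_subset)
  have "tr \<in> L2 (arc_length \<E>) (\<Union>\<E>)" using tr_trace by (simp add: is_trace_def)
  then show "tr \<in> L2 (arc_length \<E>) \<Gamma>" unfolding interface[symmetric] .
qed (use borel_interface borel_mem in auto)

lemma pl_sq_interface:
  assumes T: "T \<in> \<T>" and E: "E \<in> \<E>" "E \<subseteq> T" and N: "N \<in> nodes \<T>" "N \<in> E"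
  shows "ennreal (\<rho> / 18 * (c N)\<^sup>2) \<le> (sq_int (arc_length \<E>) (\<Gamma> \<inter> T) (\<lambda>x. pl c x))"
proof -
  note [measurable] = pl_measurable
  obtain M where M: "E = closed_segment N M" "N \<noteq> M" "\<rho> \<le> dist N M" using node_edge_endpoint[OF edges_\<E>[OF E(1)] N] by metis
  have "ennreal (\<rho> / 18 * (c N)\<^sup>2) = ennreal \<rho> * ennreal (1 / 18 * (c N)\<^sup>2)" using params by (subst ennreal_mult[symmetric]) auto
  also have "\<dots> \<le> ennreal (dist N M) * (sq_int lborel {0..1} (\<lambda>t. pl c (N + t *\<^sub>R (M - N))))"
    using M(3) by (intro mult_mono pl_sq_edge[OF edges_\<E>[OF E(1)] M(1,2) N(1)] ennreal_leI) auto
  also have "\<dots> = (sq_int lborel ({0..diameter E}) (\<lambda>t. pl c (arc_param E t)))"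
    by (rule arc_integral[OF M(1,2), symmetric, where F = "\<lambda>x. ennreal ((pl c x)\<^sup>2)"]) measurable
  also have "\<dots> \<le> (sq_int (arc_length \<E>) (\<Gamma> \<inter> T) (\<lambda>x. pl c x))"
    using E \<E>_subset[OF E(1)] borel_interface borel_mem[OF T] by (intro arc_edge_le) auto
  finally show ?thesis .
qed

end

section \<open>Coefficients compared with the mean and with the continuous trace\<close>

context mesh_element
begin

text \<open>The interface may contain several edges of \<open>T'\<close>, and \<open>x\<close> need
  not lie on an edge through \<open>N\<close>. Two edges of a triangle share a point, which serves
  as the intermediate point.\<close>

lemma tg_element:
  assumes N: "N \<in> T" "N \<in> E0" and T': "T' \<in> \<T>" and E0: "E0 \<in> \<E>" "E0 \<subseteq> T'" and E: "E \<in> \<E>" "E \<subseteq> T'" and x: "x \<in> E"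
  shows "(tg x - tg N)\<^sup>2 \<le> 4 * (H * GU)"
proof -
  interpret T': triangle T' using tri[OF T'] .
  obtain p where p: "p \<in> E" "p \<in> E0"
    by (rule T'.edges_meet[OF edge_subset_edge[OF edges_\<E>[OF E(1)] T' E(2)] edge_subset_edge[OF edges_\<E>[OF E0(1)] T' E0(2)]])
  have sub: "T' \<subseteq> patch \<T> T" using patch_sub[OF T' N(1)] N(2) E0(2) by blast
  have "(tg x - tg p)\<^sup>2 \<le> H * GU" "(tg p - tg N)\<^sup>2 \<le> H * GU"
    using tg_edge[OF E(1) _ x p(1)] tg_edge[OF E0(1) _ p(2) N(2)] E(2) E0(2) sub by auto
  then show ?thesis using real_sq_triangle[of "tg x" "tg N" "tg p"] by linarith
qed

lemma interface_coefficient: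
  assumes N: "N \<in> nodes \<T>" "N \<in> T" and T': "T' \<in> interface_elements_at \<T> \<Gamma> N"
  shows "((LINT y:\<Gamma> \<inter> T'|arc_length \<E>. dual_basis (arc_length \<E>) \<T> N (\<Gamma> \<inter> T') y * tr y) - tg N)\<^sup>2 \<le> K5 * H * GU"
proof -
  obtain E where T'm: "T' \<in> \<T>" "N \<in> T'" and E: "E \<in> \<E>" "N \<in> E" "E \<subseteq> T'"
    using T' by (auto simp: interface_elements_at_def elements_at_def)
  let ?s = "\<Gamma> \<inter> T'"
  have "((LINT y:?s|arc_length \<E>. dual_basis (arc_length \<E>) \<T> N ?s y * tr y) - tg N)\<^sup>2 \<le> 1 / (\<rho> / 18) * (LINT y:?s|arc_length \<E>. (tr y - tg N)\<^sup>2)"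
  proof (rule dual_basis_props[OF N(1) fmeasurable_arc])
    show "?s \<in> sets borel" using borel_interface borel_mem[OF T'm(1)] by simp
    show "?s \<subseteq> \<Union>\<T>" using T'm by blast
    show "hat N \<in> borel_measurable (arc_length \<E>)" for N using hat_measurable by simp
    show "0 < \<rho> / 18" using params by simp
    show "ennreal (\<rho> / 18 * (c N)\<^sup>2) \<le> (sq_int (arc_length \<E>) ?s (\<lambda>x. pl c x))" for c
      by (rule pl_sq_interface[OF T'm(1) E(1,3) N(1) E(2)])
    show "tr \<in> L2 (arc_length \<E>) ?s" by (rule tr_L2[OF T'm(1)])
  qed
  also have "\<dots> \<le> 1 / (\<rho> / 18) * (3 * (H * (4 * (H * GU))))"
  proof (rule mult_left_mono)
    have "(L2_norm (arc_length \<E>) ?s (\<lambda>y. tr y - tg N))\<^sup>2 \<le> 3 * (H * (4 * (H * GU)))"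
    proof (rule L2_norm_le_nn_integral)
      show "(sq_int (arc_length \<E>) ?s (\<lambda>y. norm (tr y - tg N))) \<le> ennreal (3 * (H * (4 * (H * GU))))"
        using params GU_nonneg by (intro arc_deviation T'm tg_element[OF N(2) E(2) T'm(1) E(1,3)]) auto
    qed (use params GU_nonneg in auto)
    then show "(LINT y:?s|arc_length \<E>. (tr y - tg N)\<^sup>2) \<le> 3 * (H * (4 * (H * GU)))" by (simp add: L2_norm_sq)
  qed (use params in auto)
  also have "\<dots> = 216 * (H / \<rho>) * H * GU" using params by (simp add: field_simps)
  also have "\<dots> = K5 * H * GU" by (simp add: H_div K5_def)
  finally show ?thesis .
qed

lemma element_coefficient:
  assumes N: "N \<in> nodes \<T>" "N \<in> T" and T': "T' \<in> elements_at \<T> N"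
  shows "((LINT y:T'|lebesgue. dual_basis lebesgue \<T> N T' y * v y) - m)\<^sup>2 \<le> K4 * DU"
proof -
  have T'm: "T' \<in> \<T>" "N \<in> T'" using T' by (auto simp: elements_at_def)
  let ?A = "measure lebesgue T'"
  have "((LINT y:T'|lebesgue. dual_basis lebesgue \<T> N T' y * v y) - m)\<^sup>2 \<le> 1 / (?A / 34) * (LINT y:T'|lebesgue. (v y - m)\<^sup>2)"
  proof (rule dual_basis_props[OF N(1) measure_tri(3)[OF T'm(1)]])
    show "T' \<subseteq> \<Union>\<T>" using T'm by blast
    show "hat N \<in> borel_measurable lebesgue" for N using hat_measurable by (intro measurable_completion) simp
    show "0 < ?A / 34" using area(3)[OF T'm(1)] by simp
    show "ennreal (?A / 34 * (c N)\<^sup>2) \<le> (sq_int lebesgue T' (\<lambda>x. pl c x))" for c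
      using pl_sq_triangle[OF T'm(1) N(1) T'm(2)] by (simp add: nn_integral_completion)
    show "v \<in> L2 lebesgue T'" by (rule v_element(1)[OF T'm(1)])
  qed
  then have "?A * ((LINT y:T'|lebesgue. dual_basis lebesgue \<T> N T' y * v y) - m)\<^sup>2 \<le> 34 * (LINT y:T'|lebesgue. (v y - m)\<^sup>2)"
    using area(3)[OF T'm(1)] by (simp add: field_simps)
  also have "\<dots> \<le> (34 * K1) * H\<^sup>2 * DU" using element_deviation[OF N T'm] by simp
  finally have "((LINT y:T'|lebesgue. dual_basis lebesgue \<T> N T' y * v y) - m)\<^sup>2 \<le> 4 * \<gamma>\<^sup>2 * (34 * K1) / 3 * DU"
    by (rule div_area) (use T'm K_pos DU_nonneg in auto)
  then show ?thesis by (simp add: K4_def ac_simps)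
qed

lemma finite_elements: "finite (elements_at \<T> N)" "finite (interface_elements_at \<T> \<Gamma> N)"
  using finite_mesh by (auto simp: elements_at_def interface_elements_at_def)

text \<open>That the bound contains no bulk term is what the estimates along the interface rest on.
  At a fixed node both quantities are zero, the coefficient by definition and the trace by
  \<open>v_trace_zero\<close>; at a free node the local coefficients are averaged.\<close>

lemma coef_tg:
  assumes N: "N \<in> nodes \<T>" "N \<in> T" and E: "E \<in> \<E>" "N \<in> E"
  shows "(coef N - tg N)\<^sup>2 \<le> K5 * H * GU"
proof (cases "N \<in> frontier \<Omega>")
  case True
  then have "coef N = 0" by (simp add: coef_def free_nodes_def)
  moreover have "tg N = 0" by (rule v_trace_zero[OF tg_props(1,2,3) N(1) True E])
  ultimately show ?thesis using K_pos params GU_nonneg by simp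
next
  case False
  then have free: "N \<in> free_nodes \<Omega> \<T>" using N by (simp add: free_nodes_def)
  obtain T' where T': "T' \<in> \<T>" "E edge_of T'" using edges_\<E>[OF E(1)] by (auto simp: edges_def)
  have "E \<subseteq> T'" using T'(2) edge_of_imp_subset by blast
  then have "T' \<in> interface_elements_at \<T> \<Gamma> N" using T' E by (auto simp: interface_elements_at_def elements_at_def)
  then have ne: "interface_elements_at \<T> \<Gamma> N \<noteq> {}" by blast
  show ?thesis
    using avg_sq_le[OF finite_elements(2) ne interface_coefficient[OF N]] free ne by (simp add: coef_def)
qed

text \<open>Three kinds of nodes need three comparisons: a fixed node the bound for the mean itself,
  a free node off the interface the dual functions on elements, and a free node on it the continuous
  trace as intermediate value.\<close>

lemma coef_mean:
  assumes N: "N \<in> nodes \<T>" "N \<in> T"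
  shows "(coef N - m)\<^sup>2 \<le> K6 * (DU + GU)"
proof -
  let ?R = "\<gamma> * diameter (closure \<Omega>)"
  have R: "0 \<le> ?R" "H \<le> ?R" using H_le params by auto
  have K6: "K4 * DU \<le> K6 * (DU + GU)" "K2 * DU \<le> K6 * (DU + GU)" "2 * (K5 * H * GU) + 2 * (K3 * DU + 2 * H * GU) \<le> K6 * (DU + GU)"
  proof -
    note p = K_pos DU_nonneg GU_nonneg
    have q: "0 \<le> (2 * K5 + 4) * ?R" using p R by (intro mult_nonneg_nonneg[of "2 * K5 + 4"]) auto
    have e: "K6 * (DU + GU) = K4 * DU + K2 * DU + 2 * K3 * DU + (2 * K5 + 4) * ?R * DU + (K4 + K2 + 2 * K3) * GU + (2 * K5 + 4) * ?R * GU"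
      unfolding K6_def by (simp add: algebra_simps)
    have pos: "0 \<le> K4 * DU" "0 \<le> K2 * DU" "0 \<le> 2 * K3 * DU" "0 \<le> (2 * K5 + 4) * ?R * DU" "0 \<le> (K4 + K2 + 2 * K3) * GU" "0 \<le> (2 * K5 + 4) * ?R * GU"
      using p mult_nonneg_nonneg[OF q p(7)] mult_nonneg_nonneg[OF q p(8)] by auto
    have "(2 * K5 + 4) * H * GU \<le> (2 * K5 + 4) * ?R * GU" using p R by (intro mult_right_mono mult_left_mono) auto
    moreover have "2 * (K5 * H * GU) + 2 * (K3 * DU + 2 * H * GU) = 2 * K3 * DU + (2 * K5 + 4) * H * GU" by (simp add: algebra_simps)
    ultimately show "K4 * DU \<le> K6 * (DU + GU)" "K2 * DU \<le> K6 * (DU + GU)" "2 * (K5 * H * GU) + 2 * (K3 * DU + 2 * H * GU) \<le> K6 * (DU + GU)"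
      unfolding e using pos by linarith+
  qed
  show ?thesis
  proof (cases "N \<in> frontier \<Omega>")
    case True
    then have "coef N = 0" by (simp add: coef_def free_nodes_def)
    then show ?thesis using mean_frontier[OF N True] K6(2) by simp
  next
    case False
    then have free: "N \<in> free_nodes \<Omega> \<T>" using N by (simp add: free_nodes_def)
    show ?thesis
    proof (cases "interface_elements_at \<T> \<Gamma> N = {}")
      case True
      have ne: "elements_at \<T> N \<noteq> {}" using T N by (auto simp: elements_at_def)
      have "(coef N - m)\<^sup>2 \<le> K4 * DU"
        using avg_sq_le[OF finite_elements(1) ne element_coefficient[OF N]] free True by (simp add: coef_def)
      then show ?thesis using K6(1) by simp
    next
      case False
      then obtain E where E: "E \<in> \<E>" "N \<in> E" by (auto simp: interface_elements_at_def)
      show ?thesis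
        by (rule order_trans[OF order_trans[OF real_sq_triangle[of "coef N" m "tg N"]] K6(3)])
          (intro add_mono mult_left_mono coef_tg[OF N E] tg_mean[OF E(1) N(1) E(2) N(2)], simp_all)
    qed
  qed
qed

end

subsection \<open>Error and stability estimates\<close>

lemma sq_convex_le:
  fixes x :: real
  assumes "0 \<le> s" "s \<le> 1" "(x - a)\<^sup>2 \<le> B" "(x - b)\<^sup>2 \<le> B"
  shows "(x - ((1 - s) * a + s * b))\<^sup>2 \<le> B"
proof -
  have "convex_on UNIV (\<lambda>y::real. y\<^sup>2)" by (rule convex_power2)
  then have "((1 - s) *\<^sub>R (x - a) + s *\<^sub>R (x - b))\<^sup>2 \<le> (1 - s) * (x - a)\<^sup>2 + s * (x - b)\<^sup>2"
    using assms(1,2) by (intro convex_onD) auto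
  also have "\<dots> \<le> (1 - s) * B + s * B" using assms by (intro add_mono mult_left_mono) auto
  also have "(1 - s) *\<^sub>R (x - a) + s *\<^sub>R (x - b) = x - ((1 - s) * a + s * b)" by (simp add: algebra_simps)
  finally show ?thesis by (simp add: algebra_simps)
qed

lemma sq_le_sqrt_mult:
  fixes a :: real
  assumes "a\<^sup>2 \<le> K * (h\<^sup>2 * (d\<^sup>2 + g\<^sup>2))" "0 \<le> K" "0 \<le> h" "0 \<le> d" "0 \<le> g"
  shows "a \<le> sqrt K * (h * (d + g))"
proof (rule power2_le_imp_le)
  have "d\<^sup>2 + g\<^sup>2 \<le> (d + g)\<^sup>2" using mult_nonneg_nonneg[OF assms(4,5)] by (simp add: power2_sum)
  then have "K * (h\<^sup>2 * (d\<^sup>2 + g\<^sup>2)) \<le> K * (h\<^sup>2 * (d + g)\<^sup>2)" using assms by (intro mult_left_mono) auto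
  then show "a\<^sup>2 \<le> (sqrt K * (h * (d + g)))\<^sup>2" using assms by (simp add: power_mult_distrib)
qed (use assms in auto)

section \<open>Gradients of piecewise linear functions\<close>

context mesh
begin

lemma pl_deviation:
  assumes T: "T \<in> \<T>" "x \<in> T" and c: "\<And>p. p \<in> vertices T \<Longrightarrow> (c p - a)\<^sup>2 \<le> B"
  shows "(pl c x - a)\<^sup>2 \<le> B"
proof -
  interpret triangle T using tri[OF T(1)] .
  obtain q where "q \<in> vertices T" using card3 by fastforce
  then have B: "B \<ge> 0" using c zero_le_power2 order_trans by blast
  have p: "\<bar>c p - a\<bar> \<le> sqrt B" if "p \<in> vertices T" for p using real_sqrt_le_mono[OF c[OF that]] by simp
  have "pl c x - a = (\<Sum>p\<in>vertices T. c p * bary T p x) - a * (\<Sum>p\<in>vertices T. bary T p x)"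
    by (simp add: pl_def sum_hat[OF T] bary_sums)
  also have "\<dots> = (\<Sum>p\<in>vertices T. (c p - a) * bary T p x)"
    by (simp add: sum_distrib_left sum_subtractf left_diff_distrib)
  finally have "\<bar>pl c x - a\<bar> \<le> (\<Sum>p\<in>vertices T. \<bar>(c p - a) * bary T p x\<bar>)" by simp
  also have "\<dots> \<le> (\<Sum>p\<in>vertices T. sqrt B * bary T p x)"
  proof (rule sum_mono)
    fix q assume q: "q \<in> vertices T"
    then have "bary T q x \<ge> 0" using mem_iff_bary T(2) by blast
    then show "\<bar>(c q - a) * bary T q x\<bar> \<le> sqrt B * bary T q x" using p[OF q] by (simp add: abs_mult mult_right_mono)
  qed
  also have "\<dots> = sqrt B" by (simp add: bary_sums flip: sum_distrib_left)
  finally have "\<bar>pl c x - a\<bar>\<^sup>2 \<le> (sqrt B)\<^sup>2" by (intro power_mono) auto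
  then show ?thesis using B by simp
qed

lemma pl_segment:
  assumes T: "T \<in> \<T>" and ab: "a \<in> nodes \<T>" "b \<in> nodes \<T>" "a \<in> T" "b \<in> T" and s: "0 \<le> s" "s \<le> 1"
  shows "pl c ((1 - s) *\<^sub>R a + s *\<^sub>R b) = (1 - s) * c a + s * c b"
proof -
  have x: "(1 - s) *\<^sub>R a + s *\<^sub>R b \<in> T" using convexD_alt[OF convex_mem[OF T] ab(3,4) s] .
  have "pl c ((1 - s) *\<^sub>R a + s *\<^sub>R b) = (1 - s) * pl c a + s * pl c b"
    unfolding pl_affine[OF T x] pl_affine[OF T ab(3)] pl_affine[OF T ab(4)] by (simp add: algebra_simps)
  then show ?thesis by (simp add: pl_node ab)
qed

definition slope :: "(pt \<Rightarrow> real) \<Rightarrow> pt set \<Rightarrow> pt" where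
  "slope c T = (\<Sum>N\<in>vertices T. c N *\<^sub>R bgrad T N)"

text \<open>Zero on element boundaries, a null set. The interiors of the elements are disjoint, so
  at most one summand is nonzero at any point.\<close>

definition pgrad :: "(pt \<Rightarrow> real) \<Rightarrow> pt \<Rightarrow> pt" where
  "pgrad c x = (\<Sum>T\<in>\<T>. indicator (interior T) x *\<^sub>R slope c T)"

lemma pgrad_interior:
  assumes "T \<in> \<T>" "x \<in> interior T"
  shows "pgrad c x = slope c T"
proof -
  have "pgrad c x = (\<Sum>T'\<in>\<T>. if T' = T then slope c T else 0)"
    unfolding pgrad_def using interior_disjoint[OF assms(1)] assms(2) by (intro sum.cong refl) (auto simp: indicator_def)
  then show ?thesis using assms(1) finite_mesh by simp
qed

lemma dom_lmeasurable: "\<Omega> \<in> lmeasurable"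
  using open_dom bounded_dom by (rule lmeasurable_open[rotated])

lemma pgrad_weak_gradient: "pgrad c \<in> L2 lebesgue \<Omega>" "weak_gradient \<Omega> (pl c) (pgrad c)"
proof -
  have "pgrad c \<in> borel_measurable borel"
    unfolding pgrad_def by (intro borel_measurable_sum borel_measurable_scaleR borel_measurable_indicator) auto
  then have "pgrad c \<in> borel_measurable lebesgue" by (intro measurable_completion) simp
  then have m: "set_borel_measurable lebesgue \<Omega> (pgrad c)"
    unfolding set_borel_measurable_def using open_dom by (intro borel_measurable_scaleR borel_measurable_indicator) auto
  have "norm (pgrad c x) \<le> (\<Sum>T\<in>\<T>. norm (slope c T))" for x
    unfolding pgrad_def by (intro order_trans[OF norm_sum sum_mono]) (simp add: indicator_def)
  with m show g: "pgrad c \<in> L2 lebesgue \<Omega>" by (intro L2_bounded[OF dom_lmeasurable]) auto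
  have "pl c \<in> borel_measurable lebesgue" using pl_measurable by (intro measurable_completion) simp
  then have "set_borel_measurable lebesgue \<Omega> (pl c)"
    unfolding set_borel_measurable_def using open_dom by (intro borel_measurable_scaleR borel_measurable_indicator) auto
  then have u: "pl c \<in> L2 lebesgue \<Omega>" using pl_bounded by (intro L2_bounded[OF dom_lmeasurable]) auto
  show "weak_gradient \<Omega> (pl c) (pgrad c)"
    by (rule weak_gradient_piecewise_affine[OF open_dom u g finite_mesh compact_mem _ dom_subset])
      (simp_all add: negligible_convex_frontier convex_mem pl_affine pgrad_interior flip: slope_def)
qed

text \<open>The gradients of the barycentric coordinates add up to zero, so \<open>a\<close> may be
  subtracted from the coefficients; three summands of norm at most \<open>sqrt B / \<rho>\<close>
  remain.\<close>

lemma norm_slope_le: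
  assumes T: "T \<in> \<T>" and c: "\<And>p. p \<in> vertices T \<Longrightarrow> (c p - a)\<^sup>2 \<le> B"
  shows "(norm (slope c T))\<^sup>2 \<le> 9 * B / \<rho>\<^sup>2"
proof -
  interpret triangle T using tri[OF T(1)] .
  obtain q where "q \<in> vertices T" using card3 by fastforce
  then have B: "B \<ge> 0" using c zero_le_power2 order_trans by blast
  have p: "\<bar>c p - a\<bar> \<le> sqrt B" if "p \<in> vertices T" for p using real_sqrt_le_mono[OF c[OF that]] by simp
  have "slope c T = (\<Sum>N\<in>vertices T. c N *\<^sub>R bgrad T N) - a *\<^sub>R (\<Sum>N\<in>vertices T. bgrad T N)"
    by (simp add: slope_def sum_bgrad)
  also have "\<dots> = (\<Sum>N\<in>vertices T. (c N - a) *\<^sub>R bgrad T N)"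
    by (simp add: scaleR_sum_right sum_subtractf scaleR_left_diff_distrib)
  finally have eq: "slope c T = (\<Sum>N\<in>vertices T. (c N - a) *\<^sub>R bgrad T N)" .
  have "norm (slope c T) \<le> (\<Sum>N\<in>vertices T. norm ((c N - a) *\<^sub>R bgrad T N))" unfolding eq by (rule norm_sum)
  also have "\<dots> \<le> (\<Sum>N\<in>vertices T. sqrt B * (1 / \<rho>))"
    unfolding norm_scaleR using p B params by (intro sum_mono mult_mono norm_bgrad[OF T]) auto
  also have "\<dots> = 3 * sqrt B / \<rho>" by (simp add: card3)
  finally have "(norm (slope c T))\<^sup>2 \<le> (3 * sqrt B / \<rho>)\<^sup>2" by (intro power_mono) auto
  then show ?thesis using B by (simp add: power_divide power_mult_distrib)
qed

text \<open>One square root for each of the four norms to be bounded. The domain enters only through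
  its diameter in \<open>K6\<close>.\<close>

definition Cint :: real where
  "Cint = sqrt (2 * K1 + 8 * K6) + sqrt (6 + 6 * K5) + sqrt (144 * \<gamma>\<^sup>2 * K6) + sqrt (18 * \<gamma> * (2 * K5 + 1))"

end

context mesh_function
begin

lemma pl_edge_gradient:
  assumes E: "E \<in> \<E>" "E \<subseteq> T" and T: "T \<in> \<T>"
  shows "(\<lambda>_. slope c T \<bullet> tangent E) \<in> L2 lebesgue {0<..<diameter E}"
    "set_borel_measurable lebesgue {0<..<diameter E} (\<lambda>t. pl c (arc_param E t))"
    "weak_gradient {0<..<diameter E} (\<lambda>t. pl c (arc_param E t)) (\<lambda>_. slope c T \<bullet> tangent E)"
proof -
  let ?I = "{0<..<diameter E}" and ?s = "slope c T \<bullet> tangent E"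
  have I: "?I \<in> lmeasurable" by simp
  have "set_borel_measurable lebesgue ?I (\<lambda>_. ?s)"
    unfolding set_borel_measurable_def by (intro borel_measurable_scaleR borel_measurable_indicator) auto
  then show g: "(\<lambda>_. ?s) \<in> L2 lebesgue ?I"
    by (rule L2_bounded[OF I, of _ "\<bar>?s\<bar>"]) simp
  have "(\<lambda>t. pl c (arc_param E t)) \<in> borel_measurable borel"
    by (rule measurable_compose[OF arc_measurable pl_measurable])
  then have "(\<lambda>t. pl c (arc_param E t)) \<in> borel_measurable lebesgue" by (intro measurable_completion) simp
  then show m: "set_borel_measurable lebesgue ?I (\<lambda>t. pl c (arc_param E t))"
    unfolding set_borel_measurable_def by (intro borel_measurable_scaleR borel_measurable_indicator) auto
  have u: "(\<lambda>t. pl c (arc_param E t)) \<in> L2 lebesgue ?I"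
    using pl_bounded by (intro L2_bounded[OF I m]) auto
  obtain b where b: "\<And>x. x \<in> T \<Longrightarrow> pl c x = slope c T \<bullet> x + b"
    using pl_affine[OF T] unfolding slope_def by blast
  show "weak_gradient ?I (\<lambda>t. pl c (arc_param E t)) (\<lambda>_. ?s)"
  proof (rule weak_gradient_piecewise_affine[OF _ u g, of "{{0..diameter E}}" "\<lambda>_. ?s" "\<lambda>_. slope c T \<bullet> fst (endpoints E) + b"])
    fix S and t :: real assume "S \<in> {{0..diameter E}}" "t \<in> S"
    then have "arc_param E t \<in> T" using arc_in[OF E(1), of t] E(2) by blast
    then show "pl c (arc_param E t) = ?s \<bullet> t + (slope c T \<bullet> fst (endpoints E) + b)"
      using b by (simp add: arc_param_def inner_add_right)
  next
    show "negligible (frontier S)" if "S \<in> {{0..diameter E}}" for S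
      using that by (intro negligible_convex_frontier) auto
  qed auto
qed

lemma pl_tgrad: "tgrad_spec (pl c) (tangential_grad \<E> (pl c))"
proof (rule tgrad_exists)
  fix E assume E: "E \<in> \<E>"
  then obtain T where T: "T \<in> \<T>" "E edge_of T" using edges_\<E> by (auto simp: edges_def)
  note P = pl_edge_gradient[OF E edge_of_imp_subset[OF T(2)] T(1), of c]
  show "\<exists>h\<in>L2 lebesgue {0<..<diameter E}. weak_gradient {0<..<diameter E} (\<lambda>t. pl c (arc_param E t)) h" using P by blast
  show "set_borel_measurable lebesgue {0<..<diameter E} (\<lambda>t. pl c (arc_param E t))" by (rule P(2))
qed

text \<open>On an edge a piecewise linear function is affine in arc length, with slope equal to the
  difference of the nodal values over the length, up to a sign from the orientation. Uniqueness of
  weak derivatives carries this over to the chosen tangential gradient.\<close>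

lemma pl_tgrad_edge:
  assumes E: "E \<in> \<E>" "E = closed_segment a b" "a \<noteq> b" and T: "E \<subseteq> T" "T \<in> \<T>" and ab: "a \<in> nodes \<T>" "b \<in> nodes \<T>"
  shows "AE t in lborel. t \<in> {0..diameter E} \<longrightarrow> (norm (tangential_grad \<E> (pl c) (arc_param E t)))\<^sup>2 = (c a - c b)\<^sup>2 / (diameter E)\<^sup>2"
proof -
  let ?L = "diameter E" and ?G = "tangential_grad \<E> (pl c)" and ?s = "slope c T \<bullet> tangent E"
  let ?p = "fst (endpoints E)" and ?q = "snd (endpoints E)"
  have L: "?L > 0" by (rule diameter_pos[OF E(1)])
  have p0: "arc_param E 0 = ?p" "arc_param E ?L = ?q"
    using arc_param_scaled[OF E(2,3), of 1] by (auto simp: arc_param_def)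
  have pq: "endpoints E = (a, b) \<or> endpoints E = (b, a)" by (rule endpoints_segment(2)[OF E(2)])
  obtain d where d: "\<And>x. x \<in> T \<Longrightarrow> pl c x = slope c T \<bullet> x + d"
    using pl_affine[OF T(2)] unfolding slope_def by blast
  have "?p \<in> T" "?q \<in> T" using arc_in[OF E(1), of 0] arc_in[OF E(1), of ?L] p0 L T(1) by auto
  then have "pl c ?q - pl c ?p = slope c T \<bullet> (?q - ?p)" using d by (simp add: inner_diff_right)
  also have "?q - ?p = ?L *\<^sub>R tangent E" using p0 by (simp add: arc_param_def) (metis add_diff_cancel_left')
  finally have "pl c ?q - pl c ?p = ?L * ?s" by simp
  moreover have "(c a - c b)\<^sup>2 = (pl c ?q - pl c ?p)\<^sup>2"
    using pq by (auto simp: pl_node[OF ab(1)] pl_node[OF ab(2)] power2_commute)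
  ultimately have "(c a - c b)\<^sup>2 = (?L * ?s)\<^sup>2" by simp
  then have s: "?s\<^sup>2 = (c a - c b)\<^sup>2 / ?L\<^sup>2" using L by (simp add: power_mult_distrib)
  note P = pl_edge_gradient[OF E(1) T, of c]
  have "AE t in lebesgue. t \<in> {0<..<?L} \<longrightarrow> ?G (arc_param E t) \<bullet> tangent E = ?s"
    by (rule weak_gradient_unique[OF _ tgrad_L2_edge(1)[OF pl_tgrad E(1)] P(1) _ P(3)])
      (use pl_tgrad[of c] E(1) in \<open>auto simp: tgrad_spec_def\<close>)
  then have "AE t in lborel. t \<in> {0<..<?L} \<longrightarrow> ?G (arc_param E t) \<bullet> tangent E = ?s"
    by (simp only: AE_completion_iff)
  moreover have "AE t in lborel. t \<noteq> 0" "AE t in lborel. t \<noteq> ?L" by (rule AE_lborel_singleton)+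
  ultimately show ?thesis
  proof eventually_elim
    case (elim t)
    show ?case
    proof
      assume "t \<in> {0..?L}"
      then have t: "t \<in> {0<..<?L}" using elim by auto
      then have "?G (arc_param E t) = ?s *\<^sub>R tangent E"
        using elim pl_tgrad[of c] E(1) unfolding tgrad_spec_def by metis
      then show "(norm (?G (arc_param E t)))\<^sup>2 = (c a - c b)\<^sup>2 / ?L\<^sup>2"
        using norm_tangent[OF E(1)] s by simp
    qed
  qed
qed

end

section \<open>Bounds for the four norms on an element\<close>

context mesh_element
begin

lemma vertex_coef: "p \<in> vertices T \<Longrightarrow> (coef p - m)\<^sup>2 \<le> K6 * (DU + GU)"
  using vertices_iff[OF T] by (intro coef_mean) auto

text \<open>The mean is the intermediate value: \<open>2 * K1\<close> comes from v - m, and 8 is 2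
  times the 4 in the bound 4 H^2 for the area, over which the deviation of the interpolant from
  \<open>m\<close> is integrated.\<close>

lemma error_element:
  "(L2_norm lebesgue T (\<lambda>x. v x - pl coef x))\<^sup>2 \<le> (2 * K1 + 8 * K6) * (H\<^sup>2 * (DU + GU))"
proof -
  interpret triangle T using tri[OF T] .
  obtain N where N: "N \<in> vertices T" using card3 by fastforce
  then have N': "N \<in> nodes \<T>" "N \<in> T" using vertices_iff[OF T] by auto
  note [measurable] = v0(1) pl_measurable borel_mem[OF T]
  let ?A = "measure lebesgue T" and ?B = "K6 * (DU + GU)" and ?Q = "LINT z:T|lebesgue. (v z - m)\<^sup>2"
  have B: "?B \<ge> 0" using K_pos DU_nonneg GU_nonneg by simp
  have Q: "0 \<le> ?Q" unfolding set_lebesgue_integral_def by (intro integral_nonneg_AE AE_I2) simp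
  have "(L2_norm lebesgue T (\<lambda>x. v x - pl coef x))\<^sup>2 \<le> 2 * ?Q + 2 * ?B * ?A"
  proof (rule L2_norm_le_nn_integral)
    have "(sq_int lebesgue T (\<lambda>x. norm (v x - pl coef x))) = (sq_int lborel T (\<lambda>x. v0 x - pl coef x))"
      unfolding nn_integral_completion[of lborel, symmetric]
      using v_element(2)[OF T] by (intro nn_integral_cong_AE) (auto elim!: eventually_mono simp: indicator_def)
    also have "\<dots> \<le> (\<integral>\<^sup>+x. 2 * (ennreal ((v0 x - m)\<^sup>2) * indicator T x) + ennreal (2 * ?B) * indicator T x \<partial>lborel)"
    proof (rule nn_integral_mono)
      fix x
      show "ennreal ((v0 x - pl coef x)\<^sup>2) * indicator T x \<le> 2 * (ennreal ((v0 x - m)\<^sup>2) * indicator T x) + ennreal (2 * ?B) * indicator T x"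
      proof (cases "x \<in> T")
        case True
        have "(pl coef x - m)\<^sup>2 \<le> ?B" by (rule pl_deviation[OF T True vertex_coef])
        then have "(v0 x - pl coef x)\<^sup>2 \<le> 2 * (v0 x - m)\<^sup>2 + 2 * ?B"
          using real_sq_triangle[of "v0 x" "pl coef x" m] power2_commute[of m "pl coef x"] by linarith
        then have "ennreal ((v0 x - pl coef x)\<^sup>2) \<le> ennreal (2 * (v0 x - m)\<^sup>2 + 2 * ?B)" by (rule ennreal_leI)
        also have "\<dots> = 2 * ennreal ((v0 x - m)\<^sup>2) + ennreal (2 * ?B)" using B by (subst ennreal_plus) (auto simp: ennreal_mult)
        finally show ?thesis using True by simp
      qed simp
    qed
    also have "\<dots> = 2 * (sq_int lborel T (\<lambda>x. v0 x - m)) + ennreal (2 * ?B) * emeasure lborel T"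
      by (subst nn_integral_add, measurable) (simp add: nn_integral_cmult)
    also have "\<dots> = ennreal (2 * ?Q) + ennreal (2 * ?B) * ennreal ?A" using Q by (simp add: nn_integral_v0[OF T] emeasure_tri[OF T] ennreal_mult)
    also have "\<dots> = ennreal (2 * ?Q + 2 * ?B * ?A)" using B Q by (subst ennreal_mult[symmetric]) auto
    finally show "(sq_int lebesgue T (\<lambda>x. norm (v x - pl coef x))) \<le> ennreal (2 * ?Q + 2 * ?B * ?A)" .
    show "0 \<le> 2 * ?Q + 2 * ?B * ?A" using mult_nonneg_nonneg[OF B measure_nonneg[of lebesgue T]] Q by simp
  qed
  also have "\<dots> \<le> 2 * (K1 * H\<^sup>2 * DU) + 2 * ?B * (4 * H\<^sup>2)"
    using element_deviation[OF N' T N'(2)] area(2)[OF T] B by (intro add_mono mult_left_mono) auto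
  also have "\<dots> \<le> 2 * (K1 * H\<^sup>2 * (DU + GU)) + 2 * ?B * (4 * H\<^sup>2)"
    using K_pos GU_nonneg by (intro add_right_mono mult_left_mono) auto
  finally show ?thesis by (simp add: algebra_simps)
qed

text \<open>The coefficients at the endpoints differ from the trace at \<open>x\<close> by an amount
  whose square is of order H GU, and so does their convex combination. Integration over up to three
  edges of length at most \<open>H\<close> supplies the second factor H.\<close>

lemma error_interface:
  "(L2_norm (arc_length \<E>) (\<Gamma> \<inter> T) (\<lambda>x. tr x - pl coef x))\<^sup>2 \<le> (6 + 6 * K5) * (H\<^sup>2 * GU)"
proof -
  have b0: "0 \<le> (2 + 2 * K5) * (H * GU)" using K_pos params GU_nonneg by auto
  have "(tg x - pl coef x)\<^sup>2 \<le> (2 + 2 * K5) * (H * GU)" if E: "E \<in> \<E>" "E \<subseteq> T" "x \<in> E" for E x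
  proof -
    obtain a b where ab: "E = closed_segment a b" "a \<in> nodes \<T>" "b \<in> nodes \<T>" using edge_repr[OF E(1)] by metis
    then have abE: "a \<in> E" "b \<in> E" by auto
    obtain s where s: "0 \<le> s" "s \<le> 1" "x = (1 - s) *\<^sub>R a + s *\<^sub>R b" using E(3) unfolding ab(1) in_segment(1) by blast
    have sub: "E \<subseteq> patch \<T> T" using edge_patch[OF E(1) abE(1)] abE E(2) by blast
    have q: "(tg x - coef q)\<^sup>2 \<le> (2 + 2 * K5) * (H * GU)" if "q \<in> E" "q \<in> nodes \<T>" for q
      using real_sq_triangle[of "tg x" "coef q" "tg q"] tg_edge[OF E(1) sub E(3) that(1)] coef_tg[OF that(2) _ E(1) that(1)] that E(2)
      by (auto simp: power2_commute algebra_simps)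
    have "pl coef x = (1 - s) * coef a + s * coef b"
      unfolding s(3) using abE E(2) by (intro pl_segment[OF T ab(2,3) _ _ s(1,2)]) auto
    then show ?thesis using sq_convex_le[OF s(1,2) q[OF abE(1) ab(2)] q[OF abE(2) ab(3)]] by simp
  qed
  then have "(L2_norm (arc_length \<E>) (\<Gamma> \<inter> T) (\<lambda>x. tr x - pl coef x))\<^sup>2 \<le> 3 * (H * ((2 + 2 * K5) * (H * GU)))"
    using b0 params by (intro L2_norm_le_nn_integral arc_deviation[OF pl_measurable T b0]) auto
  then show ?thesis by (simp add: power2_eq_square algebra_simps)
qed

text \<open>The slope is a sum of deviations of the coefficients from \<open>m\<close> over \<rho>.
  Against the area bound 4 H^2 the factor 1 / \<rho>^2 leaves 4 \<gamma>^2, and 144 = 9 * 4 *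
  4.\<close>

lemma stability_element:
  "(L2_norm lebesgue T (grad \<Omega> (pl coef)))\<^sup>2 \<le> (144 * \<gamma>\<^sup>2 * K6) * (DU + GU)"
proof -
  let ?B = "K6 * (DU + GU)"
  have B: "?B \<ge> 0" using K_pos DU_nonneg GU_nonneg by simp
  let ?s = "9 * ?B / \<rho>\<^sup>2"
  have s: "?s \<ge> 0" using B by simp
  have sl: "(norm (slope coef T))\<^sup>2 \<le> ?s" by (rule norm_slope_le[OF T vertex_coef])
  have "(L2_norm lebesgue T (grad \<Omega> (pl coef)))\<^sup>2 \<le> ?s * (4 * H\<^sup>2)"
  proof (rule L2_norm_le_nn_integral)
    have "AE x in lebesgue. x \<notin> frontier T"
      using negligible_convex_frontier[OF convex_mem[OF T]] by (intro AE_not_in) (simp add: negligible_iff_null_sets)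
    moreover have "AE x in lebesgue. x \<in> T \<longrightarrow> x \<in> \<Omega>" using T by (intro AE_dom) auto
    moreover note grad_eq_AE[OF open_dom pgrad_weak_gradient[of coef]]
    ultimately have "AE x in lebesgue. x \<in> T \<longrightarrow> grad \<Omega> (pl coef) x = slope coef T"
    proof eventually_elim
      case (elim x)
      show ?case
      proof
        assume x: "x \<in> T"
        then have "x \<in> interior T" using elim(1) closure_subset by (auto simp: frontier_def)
        then show "grad \<Omega> (pl coef) x = slope coef T" using elim x pgrad_interior[OF T] by auto
      qed
    qed
    then have "(sq_int lebesgue T (\<lambda>x. norm (grad \<Omega> (pl coef) x))) \<le> (\<integral>\<^sup>+x. ennreal ?s * indicator T x \<partial>lebesgue)"
      using sl by (intro nn_integral_mono_AE) (auto elim!: eventually_mono simp: indicator_def intro!: ennreal_leI)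
    also have "\<dots> = ennreal ?s * emeasure lborel T" using borel_mem[OF T] by (subst nn_integral_cmult_indicator) auto
    also have "\<dots> \<le> ennreal ?s * ennreal (4 * H\<^sup>2)" by (intro mult_left_mono emeasure_tri_le T) simp
    also have "\<dots> = ennreal (?s * (4 * H\<^sup>2))" by (rule ennreal_mult[symmetric, OF s]) simp
    finally show "(sq_int lebesgue T (\<lambda>x. norm (grad \<Omega> (pl coef) x))) \<le> ennreal (?s * (4 * H\<^sup>2))" .
    show "0 \<le> ?s * (4 * H\<^sup>2)" using s by (intro mult_nonneg_nonneg) auto
  qed
  also have "\<dots> = 36 * ?B * (H\<^sup>2 / \<rho>\<^sup>2)" by simp
  also have "\<dots> = (144 * \<gamma>\<^sup>2 * K6) * (DU + GU)" unfolding H_div(1) by simp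
  finally show ?thesis .
qed

text \<open>Two coefficients on an edge are compared in three steps, through the traces at both
  ends. The squared difference, of order H GU, is divided by the squared length and integrated over
  the edge, which leaves at most H / \<rho> = 2 \<gamma>.\<close>

lemma stability_interface:
  "(L2_norm (arc_length \<E>) (\<Gamma> \<inter> T) (tangential_grad \<E> (pl coef)))\<^sup>2 \<le> (18 * \<gamma> * (2 * K5 + 1)) * GU"
proof -
  let ?G = "tangential_grad \<E> (pl coef)" and ?b = "6 * \<gamma> * (2 * K5 + 1) * GU"
  have b: "?b \<ge> 0" using K_pos params GU_nonneg by auto
  define G1 where "G1 = (\<lambda>x. indicator \<Gamma> x *\<^sub>R ?G x)"
  have "?G \<in> L2 (arc_length \<E>) \<Gamma>" using pl_tgrad by (simp add: tgrad_spec_def)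
  then have [measurable]: "G1 \<in> borel_measurable borel" using L2_measurable by (fastforce simp: G1_def set_borel_measurable_def)
  have "(L2_norm (arc_length \<E>) (\<Gamma> \<inter> T) ?G)\<^sup>2 \<le> 3 * ?b"
  proof (rule L2_norm_le_nn_integral)
    have "(sq_int (arc_length \<E>) (\<Gamma> \<inter> T) (\<lambda>x. norm (?G x))) = (sq_int (arc_length \<E>) (\<Gamma> \<inter> T) (\<lambda>x. norm (G1 x)))"
      by (intro nn_integral_cong) (auto simp: G1_def indicator_def)
    also have "\<dots> \<le> 3 * ennreal ?b"
    proof (rule arc_triangle_le[OF T])
      fix E assume E: "E \<in> \<E>" "E \<subseteq> T"
      obtain a c where ab: "E = closed_segment a c" "a \<noteq> c" "a \<in> nodes \<T>" "c \<in> nodes \<T>" "\<rho> \<le> diameter E" using edge_repr[OF E(1)] by metis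
      then have abE: "a \<in> E" "c \<in> E" "a \<in> T" "c \<in> T" using E(2) by auto
      have sub: "E \<subseteq> patch \<T> T" using edge_patch[OF E(1) abE(1,3)] by blast
      let ?L = "diameter E" and ?d = "(coef a - coef c)\<^sup>2"
      have L: "0 < ?L" by (rule diameter_pos[OF E(1)])
      have "(coef a - coef c)\<^sup>2 \<le> 3 * ((coef a - tg a)\<^sup>2 + (tg a - tg c)\<^sup>2 + (tg c - coef c)\<^sup>2)"
        using zero_le_power2[of "(coef a - tg a) - (tg a - tg c)"] zero_le_power2[of "(tg a - tg c) - (tg c - coef c)"]
          zero_le_power2[of "(coef a - tg a) - (tg c - coef c)"] by (simp add: power2_eq_square algebra_simps)
      also have "\<dots> \<le> 3 * (K5 * H * GU + H * GU + K5 * H * GU)"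
        using coef_tg[OF ab(3) abE(3) E(1) abE(1)] tg_edge[OF E(1) sub abE(1,2)] coef_tg[OF ab(4) abE(4) E(1) abE(2)]
        by (intro mult_left_mono add_mono) (auto simp: power2_commute)
      finally have d: "?d \<le> 3 * (2 * K5 + 1) * (H * GU)" by (simp add: algebra_simps)
      have "(sq_int lborel {0..?L} (\<lambda>t. norm (G1 (arc_param E t)))) \<le> ennreal (?L * (?d / ?L\<^sup>2))"
      proof (rule nn_integral_Icc_bound)
        show "AE t in lborel. t \<in> {0..?L} \<longrightarrow> ennreal ((norm (G1 (arc_param E t)))\<^sup>2) \<le> ennreal (?d / ?L\<^sup>2)"
          using pl_tgrad_edge[OF E(1) ab(1,2) E(2) T ab(3,4), of coef]
        proof eventually_elim
          case (elim t)
          then show ?case using arc_in[OF E(1), of t] \<E>_subset[OF E(1)] by (auto simp: G1_def indicator_def)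
        qed
      qed (use L in auto)
      also have "\<dots> \<le> ennreal ?b"
      proof (rule ennreal_leI)
        have "?L * (?d / ?L\<^sup>2) = ?d / ?L" using L by (simp add: power2_eq_square)
        also have "\<dots> \<le> (3 * (2 * K5 + 1) * (H * GU)) / \<rho>"
          using d ab(5) params(3) L by (intro frac_le) (auto intro: order_trans[OF zero_le_power2])
        also have "\<dots> = 3 * (2 * K5 + 1) * GU * (H / \<rho>)" by simp
        also have "\<dots> = ?b" unfolding H_div(2) by (simp add: ac_simps)
        finally show "?L * (?d / ?L\<^sup>2) \<le> ?b" .
      qed
      finally show "(sq_int lborel {0..?L} (\<lambda>t. norm (G1 (arc_param E t)))) \<le> ennreal ?b" .
    qed measurable
    also have "\<dots> = ennreal (3 * ?b)" using b by (subst ennreal_mult) auto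
    finally show "(sq_int (arc_length \<E>) (\<Gamma> \<inter> T) (\<lambda>x. norm (?G x))) \<le> ennreal (3 * ?b)" .
    show "0 \<le> 3 * ?b" using b by linarith
  qed
  also have "3 * ?b = (18 * \<gamma> * (2 * K5 + 1)) * GU" by (simp add: algebra_simps)
  finally show ?thesis .
qed

lemma interpolation_estimates:
  defines "d \<equiv> L2_norm lebesgue (patch \<T> T) (grad \<Omega> v)" and "g \<equiv> L2_norm (arc_length \<E>) (patch \<T> T \<inter> \<Gamma>) (tangential_grad \<E> tr)"
  shows "L2_norm lebesgue T (\<lambda>x. v x - interpolation \<Omega> \<T> \<Gamma> v x) + L2_norm (arc_length \<E>) (\<Gamma> \<inter> T) (\<lambda>x. tr x - interpolation \<Omega> \<T> \<Gamma> v x) \<le> Cint * H * (d + g)"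
    "L2_norm lebesgue T (grad \<Omega> (interpolation \<Omega> \<T> \<Gamma> v)) + L2_norm (arc_length \<E>) (\<Gamma> \<inter> T) (tangential_grad \<E> (interpolation \<Omega> \<T> \<Gamma> v)) \<le> Cint * (d + g)"
proof -
  have dg: "DU = d\<^sup>2" "GU = g\<^sup>2" "0 \<le> d" "0 \<le> g" by (simp_all add: DU_def GU_def d_def g_def L2_norm_nonneg)
  have c: "0 \<le> 2 * K1 + 8 * K6" "0 \<le> 6 + 6 * K5" "0 \<le> 144 * \<gamma>\<^sup>2 * K6" "0 \<le> 18 * \<gamma> * (2 * K5 + 1)"
    using K_pos params by auto
  have le: "X * (h * GU) \<le> X * (h * (DU + GU))" if "0 \<le> X" "0 \<le> h" for X h
    using that DU_nonneg by (intro mult_left_mono) auto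
  have H: "0 \<le> H" "0 \<le> H\<^sup>2" "0 \<le> (1::real)\<^sup>2" using params by auto
  have 1: "L2_norm lebesgue T (\<lambda>x. v x - pl coef x) \<le> sqrt (2 * K1 + 8 * K6) * (H * (d + g))"
    by (rule sq_le_sqrt_mult[OF _ c(1) H(1) dg(3,4)]) (use error_element in \<open>simp add: dg\<close>)
  have 2: "L2_norm (arc_length \<E>) (\<Gamma> \<inter> T) (\<lambda>x. tr x - pl coef x) \<le> sqrt (6 + 6 * K5) * (H * (d + g))"
    by (rule sq_le_sqrt_mult[OF _ c(2) H(1) dg(3,4)]) (use order_trans[OF error_interface le[OF c(2) H(2)]] in \<open>simp add: dg\<close>)
  have 3: "L2_norm lebesgue T (grad \<Omega> (pl coef)) \<le> sqrt (144 * \<gamma>\<^sup>2 * K6) * (1 * (d + g))"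
    by (rule sq_le_sqrt_mult[OF _ c(3) _ dg(3,4)]) (use stability_element in \<open>simp_all add: dg\<close>)
  have 4: "L2_norm (arc_length \<E>) (\<Gamma> \<inter> T) (tangential_grad \<E> (pl coef)) \<le> sqrt (18 * \<gamma> * (2 * K5 + 1)) * (1 * (d + g))"
  proof (rule sq_le_sqrt_mult[OF _ c(4) _ dg(3,4)])
    have "(L2_norm (arc_length \<E>) (\<Gamma> \<inter> T) (tangential_grad \<E> (pl coef)))\<^sup>2 \<le> 18 * \<gamma> * (2 * K5 + 1) * (1 * GU)"
      using stability_interface by (simp only: mult_1)
    also have "\<dots> \<le> 18 * \<gamma> * (2 * K5 + 1) * (1 * (DU + GU))" by (rule le[OF c(4) zero_le_one])
    finally show "(L2_norm (arc_length \<E>) (\<Gamma> \<inter> T) (tangential_grad \<E> (pl coef)))\<^sup>2 \<le> 18 * \<gamma> * (2 * K5 + 1) * (1\<^sup>2 * (d\<^sup>2 + g\<^sup>2))"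
      by (simp only: power_one dg)
  qed simp
  note sq = real_sqrt_ge_zero[OF c(1)] real_sqrt_ge_zero[OF c(2)] real_sqrt_ge_zero[OF c(3)] real_sqrt_ge_zero[OF c(4)]
  have dgH: "0 \<le> H * (d + g)" "0 \<le> d + g" using H(1) dg(3,4) by auto
  have "Cint * (H * (d + g)) \<ge> (sqrt (2 * K1 + 8 * K6) + sqrt (6 + 6 * K5)) * (H * (d + g))"
    unfolding Cint_def using sq dgH by (intro mult_right_mono) auto
  then show "L2_norm lebesgue T (\<lambda>x. v x - interpolation \<Omega> \<T> \<Gamma> v x) + L2_norm (arc_length \<E>) (\<Gamma> \<inter> T) (\<lambda>x. tr x - interpolation \<Omega> \<T> \<Gamma> v x) \<le> Cint * H * (d + g)"
    unfolding interpolation_eq using 1 2 by (simp add: distrib_right mult.assoc)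
  have "Cint * (d + g) \<ge> (sqrt (144 * \<gamma>\<^sup>2 * K6) + sqrt (18 * \<gamma> * (2 * K5 + 1))) * (d + g)"
    unfolding Cint_def using sq dgH by (intro mult_right_mono) auto
  then show "L2_norm lebesgue T (grad \<Omega> (interpolation \<Omega> \<T> \<Gamma> v)) + L2_norm (arc_length \<E>) (\<Gamma> \<inter> T) (tangential_grad \<E> (interpolation \<Omega> \<T> \<Gamma> v)) \<le> Cint * (d + g)"
    unfolding interpolation_eq using 3 4 by (simp add: distrib_right)
qed

end

theorem lemma1:
  fixes \<Omega> \<Gamma> :: "(real ^ 2) set" and \<gamma> :: real
  assumes "polygonal_domain \<Omega>"
  shows "\<exists>C. \<forall>H \<T>. conforming_triangulation \<Omega> \<T> \<longrightarrow> quasi_uniform \<gamma> H \<T> \<longrightarrow>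
      \<Gamma> = \<Union>(interface_edges \<T> \<Gamma>) \<longrightarrow>
      (\<forall>v\<in>V_space \<Omega> (interface_edges \<T> \<Gamma>). \<forall>T\<in>\<T>.
        let ds = arc_length (interface_edges \<T> \<Gamma>);
            tr = trace_on \<Omega> (interface_edges \<T> \<Gamma>);
            tgrad = tangential_grad (interface_edges \<T> \<Gamma>);
            Iv = interpolation \<Omega> \<T> \<Gamma> v;
            U = patch \<T> T
        in L2_norm lebesgue T (\<lambda>x. v x - Iv x) + L2_norm ds (\<Gamma> \<inter> T) (\<lambda>x. tr v x - Iv x)
             \<le> C * H * (L2_norm lebesgue U (grad \<Omega> v) + L2_norm ds (U \<inter> \<Gamma>) (tgrad (tr v))) \<and>
           L2_norm lebesgue T (grad \<Omega> Iv) + L2_norm ds (\<Gamma> \<inter> T) (tgrad Iv)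
             \<le> C * (L2_norm lebesgue U (grad \<Omega> v) + L2_norm ds (U \<inter> \<Gamma>) (tgrad (tr v))))"
\<comment> \<open>The constant is exported from the locale \<open>mesh\<close> with only \<Omega>
  and \<gamma> as arguments, so it can be fixed before \<open>H\<close>, the triangulation and
  \<open>v\<close>.\<close>
proof (intro exI[of _ "mesh.Cint \<Omega> \<gamma>"] allI impI ballI)
  fix H \<T> v T
  assume "conforming_triangulation \<Omega> \<T>" "quasi_uniform \<gamma> H \<T>" "\<Gamma> = \<Union>(interface_edges \<T> \<Gamma>)"
    and "v \<in> V_space \<Omega> (interface_edges \<T> \<Gamma>)" "T \<in> \<T>"
  then interpret mesh_element \<Omega> \<T> \<gamma> H \<Gamma> v T
    using assms by unfold_locales
  show "let ds = arc_length \<E>; tr = trace_on \<Omega> \<E>; tgrad = tangential_grad \<E>; Iv = interpolation \<Omega> \<T> \<Gamma> v; U = patch \<T> T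
        in L2_norm lebesgue T (\<lambda>x. v x - Iv x) + L2_norm ds (\<Gamma> \<inter> T) (\<lambda>x. tr v x - Iv x)
             \<le> Cint * H * (L2_norm lebesgue U (grad \<Omega> v) + L2_norm ds (U \<inter> \<Gamma>) (tgrad (tr v))) \<and>
           L2_norm lebesgue T (grad \<Omega> Iv) + L2_norm ds (\<Gamma> \<inter> T) (tgrad Iv)
             \<le> Cint * (L2_norm lebesgue U (grad \<Omega> v) + L2_norm ds (U \<inter> \<Gamma>) (tgrad (tr v)))"
    using interpolation_estimates unfolding Let_def tr_def by blast
qed

end
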